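(* Let $(S,\sigma)$ be a smooth real affine surface with an effective $\mathbb{S}^{1}$-action $\mu:\mathbb{G}_{m,\mathbb{C}}\times S\rightarrow S$ determined by a regular real DPD-pair $(D,h)$ on a smooth real affine curve $(C,\tau)$. Let $\pi:(S,\sigma)\rightarrow(C,\tau)$ be the corresponding real quotient morphism and let $c$ be a real point of $(C,\tau)$. Then exactly one of the following three possibilities occurs: a) $D(c)\in\mathbb{Z}$ and $\mathrm{ord}_{c}(h)=2D(c)$. In this case, there exists a real affine open neighborhood $(U,\tau|_{U})$ of $c$ such that $\pi|_{\pi^{-1}(U)}:(\pi^{-1}(U),\sigma|_{\pi^{-1}(U)})\rightarrow(U,\tau|_{U})$ is an $\mathbb{S}^{1}$-torsor. The fiber $(\pi^{-1}(c),\sigma|_{\pi^{-1}(c)})$ is an $\mathbb{S}^{1}$-torsor over the real point $c$ (that is, over $\mathrm{Spec}(\mathbb{R})$) which is either isomorphic to the trivial $\mathbb{S}^1$-torsor $\mathbb{S}^{1}$ if $\pi^{-1}(c)$ contains a real point of $(S,\sigma)$, or to the nontrivial $\mathbb{S}^{1}$-torsor $\hat{\mathbb{S}}^{1}$ otherwise. b) $D(c)\in\frac{1}{2}\mathbb{Z}\setminus\mathbb{Z}$ and $\mathrm{ord}_{c}(h)=2D(c)$. In this case, $(\pi^{-1}(c),\sigma|_{\pi^{-1}(c)})$ is a multiple fiber of multiplicity $2$, whose reduction is an exceptional $\mathbb{S}^{1}$-orbit, isomorphic to $\mathbb{S}^{1}$ on which $\mathbb{S}^{1}$ acts with stabilizer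 $\mu_{2}$. c) $D(c)\in\mathbb{Z}$ and $\mathrm{ord}_{c}(h)=2D(c)+1$. In this case, the fiber $\pi^{-1}(c)$ is reduced, consisting of the closures of two principal $\mathbb{G}_{m,\mathbb{C}}$-orbits $O^{+}$ and $O^{-}$ exchanged by the real structure $\sigma$, whose closures $\overline{O}^{\pm}$ in $S$ are affine lines intersecting transversally at an $\mathbb{S}^{1}$-fixed real point $p$ of $(S,\sigma)$. Furthermore, in cases b) and c), for every real affine open neighborhood $(U,\tau|_{U})$ of $c\in C$, the restriction \[ \pi|_{\pi^{-1}(U\setminus\{c\})}:(\pi^{-1}(U\setminus\{c\}),\sigma|_{\pi^{-1}(U\setminus\{c\})})\rightarrow(U\setminus\{c\},\tau|_{U\setminus\{c\}}) \] is a nontrivial $\mathbb{S}^{1}$-torsor.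
   Context: A real algebraic variety is viewed as a pair $(V,\sigma)$, with $V$ a (quasi-projective, integral) complex variety and $\sigma$ a real structure, i.e. an involution of $V$ as an $\mathbb{R}$-scheme lifting complex conjugation. Real morphisms and real rational functions are those commuting with the real structures; real points are the $\sigma$-fixed closed points; real open/closed subsets are $\sigma$-invariant ones. The circle $\mathbb{S}^1$ is the real algebraic group $(\mathbb{G}_{m,\mathbb{C}},\sigma_0)$, with $\mathbb{G}_{m,\mathbb{C}}=\mathrm{Spec}(\mathbb{C}[t^{\pm1}])$ and $\sigma_0$ the composition of $t\mapsto t^{-1}$ with complex conjugation. An $\mathbb{S}^1$-action on $(V,\sigma)$ is an action $\mu:\mathbb{G}_{m,\mathbb{C}}\times V\to V$ with $\sigma\circ\mu=\mu\circ(\sigma_0\times\sigma)$. An $\mathbb{S}^1$-torsor over $(C,\tau)$ is a real variety $\rho:(P,\sigma)\to(C,\tau)$ with an $\mathbb{S}^1$-action for which $\rho:P\to C$ is a (Zariski locally trivial) $\mathbb{G}_{m,\mathbb{C}}$-torsor; it is trivial if it is equivariantly isomorphic over $(C,\tau)$ to $(C,\tau)\times\mathbb{S}^1$ with $\mathbb{S}^1$ acting by translations on the second factor. $\hat{\mathbb{S}}^1$ denotes $\mathrm{Spec}(\mathbb{C}[u^{\pm1}])$ with real structure the composition of $u\mapsto -u^{-1}$ with complex conjugation and action $t\cdot u=tu$; its real locus is empty. "$\mathbb{S}^1$ on which $\mathbb{S}^1$ acts with stabilizer $\mu_2$" means $\mathrm{Spec}(\mathbb{C}[w^{\pm1}])$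 with real structure the composition of $w\mapsto w^{-1}$ with complex conjugation and action $t\cdot w=t^2w$. A $\mathbb{G}_{m,\mathbb{C}}$-orbit $Z$ in $S$ is principal if $Z$ with the induced action is the trivial $\mathbb{G}_{m,\mathbb{C}}$-torsor, and exceptional otherwise. If $Z$ is irreducible and $\sigma$-invariant, $(Z,\sigma|_Z)$ is called a principal, resp. exceptional, $\mathbb{S}^1$-orbit accordingly. A Weil $\mathbb{Q}$-divisor on a smooth real affine curve $(C=\mathrm{Spec}(A_0),\tau)$ is a formal sum $D=\sum_{c}D(c)\{c\}$ over closed points of the complex curve $C$, with $D(c)\in\mathbb{Q}$ almost all zero; $\tau^*D=\sum_cD(\tau(c))\{c\}$; $\Gamma(C,\mathcal{O}_C(D))$ is the set of rational functions $f$ on $C$ that are zero or satisfy $\mathrm{div}(f)+D\ge0$. A real DPD-pair on $(C,\tau)$ is a pair $(D,h)$ with $D$ a Weil $\mathbb{Q}$-divisor and $h$ a nonzero real ($\tau^*h=h$) rational function such that $D+\tau^*D\le\mathrm{div}(h)$ coefficientwise. Rational numbers $p_1/q_1,p_2/q_2$ in lowest terms form a regular pair if $|p_1q_2-p_2q_1|=1$. $(D,h)$ is regular if for every $c\in C$ with $D(c)+D(\tau(c))<\mathrm{ord}_c(h)$, the numbers $D(c)$ and $D(\tau(c))-\mathrm{ord}_c(h)$ form a regular pair. The surface determined by $(D,h)$: with $D_+=D$ and $D_-=\tau^*D-\mathrm{div}(h)$, it is $S=\mathrm{Spec}\big(\bigoplus_{m<0}\Gamma(C,\mathcal{O}_C(-mD_-))\oplus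 A_0\oplus\bigoplus_{m>0}\Gamma(C,\mathcal{O}_C(mD_+))\big)$ (product induced from $\mathrm{Frac}(A_0)$), with $\mathbb{G}_{m,\mathbb{C}}$-action given by the grading (degree $m$ elements have weight $m$) and real structure $\sigma^*(g)=h^m\tau^*g$ for $g$ of degree $m$. The real quotient morphism $\pi:(S,\sigma)\to(C,\tau)$ is induced by the inclusion of the degree $0$ part $A_0$.
   Formalization: In "Furthermore", the torsor claim is proved for those U with D(x) integral and D(x)+D(τ(x))=ord_x(h) at all x in U\{c} (such U exist; it fails otherwise); nontriviality is proved for every U. Regularity is assumed only up to the sign of D(τ(c))-ord_c(h). *)

theory Defs
  imports Complex_Main "HOL-Algebra.Algebra" "HOL-Computational_Algebra.Polynomial"
begin

text \<open>
  All varieties occurring here are affine, and are given by their coordinate rings: a complex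
  algebra \<open>R\<close> stands for \<open>Spec R\<close>, morphisms are given by their comorphisms (in the opposite
  direction), and closed points are maximal ideals. A real affine variety is a pair consisting of
  a complex algebra and the comorphism of its real structure, a conjugate-linear ring involution.
\<close>

section \<open>Affine schemes over the complex numbers\<close>

record 'a calg = "'a ring" +
  cst :: "complex \<Rightarrow> 'a"

text \<open>
  An algebra together with the comorphism of an action of the multiplicative group with coordinate
  \<open>t\<close>: the image of \<open>a\<close> in \<open>R[t, 1/t]\<close> is the sum over \<open>m\<close> of \<open>wt a m * t^m\<close>.
\<close>

record 'a gmalg = "'a calg" +
  wt :: "'a \<Rightarrow> int \<Rightarrow> 'a"

definition mk_calg :: "'a ring \<Rightarrow> (complex \<Rightarrow> 'a) \<Rightarrow> 'a calg" where
  "mk_calg R k = ring.extend R (calg.fields k)"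

definition mk_gmalg :: "'a calg \<Rightarrow> ('a \<Rightarrow> int \<Rightarrow> 'a) \<Rightarrow> 'a gmalg" where
  "mk_gmalg R w = calg.extend R (gmalg.fields w)"

definition coord :: "'a::comm_ring_1 set \<Rightarrow> (complex \<Rightarrow> 'a) \<Rightarrow> 'a calg" where
  "coord A k = mk_calg \<lparr>carrier = A, monoid.mult = (*), one = 1, ring.zero = 0, add = (+)\<rparr> k"

definition point :: "complex calg" where
  "point = coord UNIV id"

definition affine_line :: "complex poly calg" where
  "affine_line = coord UNIV (\<lambda>z. [:z:])"

definition closed_points :: "('a, 'm) ring_scheme \<Rightarrow> 'a set set" where
  "closed_points R = {x. maximalideal x R}"

definition spec_map :: "('a, 'm) ring_scheme \<Rightarrow> ('a \<Rightarrow> 'b) \<Rightarrow> 'b set \<Rightarrow> 'a set" where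
  "spec_map R \<phi> y = {a \<in> carrier R. \<phi> a \<in> y}"

definition zclosure :: "('a, 'm) ring_scheme \<Rightarrow> 'a set set \<Rightarrow> 'a set set" where
  "zclosure R Z = {y \<in> closed_points R. \<Inter>Z \<subseteq> y}"

definition zariski_open :: "('a, 'm) ring_scheme \<Rightarrow> 'a set set \<Rightarrow> bool" where
  "zariski_open R U \<longleftrightarrow> (\<exists>I \<subseteq> carrier R. U = {x \<in> closed_points R. \<not> I \<subseteq> x})"

definition radical_ideal :: "('a, 'm) ring_scheme \<Rightarrow> 'a set \<Rightarrow> 'a set" where
  "radical_ideal R J = {a \<in> carrier R. \<exists>n::nat. a [^]\<^bsub>R\<^esub> n \<in> J}"

definition ideal_power :: "('a, 'm) ring_scheme \<Rightarrow> 'a set \<Rightarrow> nat \<Rightarrow> 'a set" where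
  "ideal_power R I n = (ideal_prod R I ^^ n) (carrier R)"

text \<open>The ideals \<open>I\<close> and \<open>J\<close> generate the same ideal of the local ring at the prime \<open>x\<close>.\<close>

definition locally_equal :: "('a, 'm) ring_scheme \<Rightarrow> 'a set \<Rightarrow> 'a set \<Rightarrow> 'a set \<Rightarrow> bool" where
  "locally_equal R x I J \<longleftrightarrow>
     (\<forall>a\<in>I. \<exists>s\<in>carrier R - x. s \<otimes>\<^bsub>R\<^esub> a \<in> J) \<and> (\<forall>a\<in>J. \<exists>s\<in>carrier R - x. s \<otimes>\<^bsub>R\<^esub> a \<in> I)"

definition calg_hom :: "('a, 'm) calg_scheme \<Rightarrow> ('b, 'n) calg_scheme \<Rightarrow> ('a \<Rightarrow> 'b) \<Rightarrow> bool" where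
  "calg_hom R S \<phi> \<longleftrightarrow> \<phi> \<in> ring_hom R S \<and> (\<forall>z. \<phi> (cst R z) = cst S z)"

definition calg_iso :: "('a, 'm) calg_scheme \<Rightarrow> ('b, 'n) calg_scheme \<Rightarrow> ('a \<Rightarrow> 'b) \<Rightarrow> bool" where
  "calg_iso R S \<phi> \<longleftrightarrow> calg_hom R S \<phi> \<and> \<phi> \<in> ring_iso R S"


section \<open>Smooth affine varieties\<close>

definition prime_chain :: "('a, 'm) ring_scheme \<Rightarrow> nat \<Rightarrow> (nat \<Rightarrow> 'a set) \<Rightarrow> bool" where
  "prime_chain R n P \<longleftrightarrow> (\<forall>i\<le>n. primeideal (P i) R) \<and> (\<forall>i<n. P i \<subset> P (Suc i))"

definition krull_dim :: "('a, 'm) ring_scheme \<Rightarrow> nat \<Rightarrow> bool" where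
  "krull_dim R d \<longleftrightarrow> (\<exists>P. prime_chain R d P) \<and> \<not> (\<exists>P. prime_chain R (Suc d) P)"

text \<open>
  The complex vector space \<open>x/x^2\<close> has a basis with \<open>d\<close> elements; over the complex numbers a
  variety is smooth at \<open>x\<close> if this is so for its dimension \<open>d\<close>.
\<close>

definition cotangent_dim :: "('a, 'm) calg_scheme \<Rightarrow> 'a set \<Rightarrow> nat \<Rightarrow> bool" where
  "cotangent_dim R x d \<longleftrightarrow>
     (\<exists>v. (\<forall>i<d. v i \<in> x) \<and>
       (\<forall>a\<in>x. \<exists>!k. (\<forall>i\<ge>d. k i = 0) \<and>
          a \<ominus>\<^bsub>R\<^esub> finsum R (\<lambda>i. cst R (k i) \<otimes>\<^bsub>R\<^esub> v i) {..<d} \<in> ideal_prod R x x))"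

definition affine_variety :: "('a, 'm) calg_scheme \<Rightarrow> bool" where
  "affine_variety R \<longleftrightarrow> domain R \<and> calg_hom point R (cst R) \<and>
     (\<exists>F. finite F \<and> F \<subseteq> carrier R \<and> generate_ring R (range (cst R) \<union> F) = carrier R)"

definition smooth_affine_variety :: "('a, 'm) calg_scheme \<Rightarrow> nat \<Rightarrow> bool" where
  "smooth_affine_variety R d \<longleftrightarrow>
     affine_variety R \<and> krull_dim R d \<and> (\<forall>x\<in>closed_points R. cotangent_dim R x d)"

definition real_structure :: "('a, 'm) calg_scheme \<Rightarrow> ('a \<Rightarrow> 'a) \<Rightarrow> bool" where
  "real_structure R \<sigma> \<longleftrightarrow> \<sigma> \<in> ring_hom R R \<and> (\<forall>a\<in>carrier R. \<sigma> (\<sigma> a) = a) \<and>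
     (\<forall>z. \<sigma> (cst R z) = cst R (cnj z))"


section \<open>Laurent polynomials, quotients and localizations\<close>

definition laurent :: "('a, 'm) ring_scheme \<Rightarrow> (int \<Rightarrow> 'a) ring" where
  "laurent R =
     \<lparr>carrier = {f. (\<forall>m. f m \<in> carrier R) \<and> finite {m. f m \<noteq> \<zero>\<^bsub>R\<^esub>}},
      monoid.mult = (\<lambda>f g m. finsum R (\<lambda>i. f i \<otimes>\<^bsub>R\<^esub> g (m - i)) {i. f i \<noteq> \<zero>\<^bsub>R\<^esub>}),
      one = (\<lambda>m. if m = 0 then \<one>\<^bsub>R\<^esub> else \<zero>\<^bsub>R\<^esub>),
      ring.zero = (\<lambda>m. \<zero>\<^bsub>R\<^esub>),
      add = (\<lambda>f g m. f m \<oplus>\<^bsub>R\<^esub> g m)\<rparr>"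

definition lmonom :: "('a, 'm) ring_scheme \<Rightarrow> int \<Rightarrow> 'a \<Rightarrow> int \<Rightarrow> 'a" where
  "lmonom R m a = (\<lambda>n. if n = m then a else \<zero>\<^bsub>R\<^esub>)"

text \<open>Quotient by an invariant ideal \<open>J\<close>, i.e. an invariant closed subscheme.\<close>

definition gm_quot :: "('a, 'm) gmalg_scheme \<Rightarrow> 'a set \<Rightarrow> 'a set gmalg" where
  "gm_quot R J = mk_gmalg (mk_calg (R Quot J) (\<lambda>z. J +>\<^bsub>R\<^esub> cst R z))
     (\<lambda>V m. \<Union>a\<in>V. J +>\<^bsub>R\<^esub> wt R a m)"

definition quot_conj :: "('a, 'm) ring_scheme \<Rightarrow> 'a set \<Rightarrow> ('a \<Rightarrow> 'a) \<Rightarrow> 'a set \<Rightarrow> 'a set" where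
  "quot_conj R J \<sigma> V = (\<Union>a\<in>V. J +>\<^bsub>R\<^esub> \<sigma> a)"

text \<open>Localization at a multiplicatively closed subset \<open>M\<close>; fractions are equivalence classes.\<close>

definition fraction :: "('a, 'm) ring_scheme \<Rightarrow> 'a set \<Rightarrow> 'a \<Rightarrow> 'a \<Rightarrow> ('a \<times> 'a) set" where
  "fraction R M a s = {(b, t). b \<in> carrier R \<and> t \<in> M \<and>
     (\<exists>u\<in>M. u \<otimes>\<^bsub>R\<^esub> (a \<otimes>\<^bsub>R\<^esub> t) = u \<otimes>\<^bsub>R\<^esub> (b \<otimes>\<^bsub>R\<^esub> s))}"

definition loc_calg :: "('a, 'm) calg_scheme \<Rightarrow> 'a set \<Rightarrow> ('a \<times> 'a) set calg" where
  "loc_calg R M = mk_calg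
     \<lparr>carrier = {fraction R M a s | a s. a \<in> carrier R \<and> s \<in> M},
      monoid.mult = (\<lambda>V W. \<Union>(a, s)\<in>V. \<Union>(b, t)\<in>W. fraction R M (a \<otimes>\<^bsub>R\<^esub> b) (s \<otimes>\<^bsub>R\<^esub> t)),
      one = fraction R M \<one>\<^bsub>R\<^esub> \<one>\<^bsub>R\<^esub>,
      ring.zero = fraction R M \<zero>\<^bsub>R\<^esub> \<one>\<^bsub>R\<^esub>,
      add = (\<lambda>V W. \<Union>(a, s)\<in>V. \<Union>(b, t)\<in>W.
               fraction R M ((a \<otimes>\<^bsub>R\<^esub> t) \<oplus>\<^bsub>R\<^esub> (b \<otimes>\<^bsub>R\<^esub> s)) (s \<otimes>\<^bsub>R\<^esub> t))\<rparr>
     (\<lambda>z. fraction R M (cst R z) \<one>\<^bsub>R\<^esub>)"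

text \<open>For the action to extend as below, the elements of \<open>M\<close> have to be invariant.\<close>

definition loc_gm :: "('a, 'm) gmalg_scheme \<Rightarrow> 'a set \<Rightarrow> ('a \<times> 'a) set gmalg" where
  "loc_gm R M = mk_gmalg (loc_calg R M) (\<lambda>V m. \<Union>(a, s)\<in>V. fraction R M (wt R a m) s)"


section \<open>Actions of the multiplicative group and of the circle\<close>

definition gm_action :: "('a, 'm) gmalg_scheme \<Rightarrow> bool" where
  "gm_action V \<longleftrightarrow> cring V \<and> calg_hom point V (cst V) \<and>
     wt V \<in> ring_hom V (laurent V) \<and> (\<forall>z. wt V (cst V z) = lmonom V 0 (cst V z)) \<and>
     (\<forall>a\<in>carrier V. finsum V (wt V a) {m. wt V a m \<noteq> \<zero>\<^bsub>V\<^esub>} = a) \<and>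
     (\<forall>a\<in>carrier V. \<forall>m. wt V (wt V a m) = lmonom V m (wt V a m))"

text \<open>
  The real structure of the circle is \<open>t \<mapsto> 1/t\<close> composed with conjugation; this is the source of
  the sign of the weight.
\<close>

definition S1_action :: "('a, 'm) gmalg_scheme \<Rightarrow> ('a \<Rightarrow> 'a) \<Rightarrow> bool" where
  "S1_action V \<sigma> \<longleftrightarrow> gm_action V \<and> real_structure V \<sigma> \<and>
     (\<forall>a\<in>carrier V. \<forall>m. wt V (\<sigma> a) m = \<sigma> (wt V a (- m)))"

definition translate :: "('a, 'm) gmalg_scheme \<Rightarrow> complex \<Rightarrow> 'a \<Rightarrow> 'a" where
  "translate V t a = finsum V (\<lambda>m. cst V (t powi m) \<otimes>\<^bsub>V\<^esub> wt V a m) {m. wt V a m \<noteq> \<zero>\<^bsub>V\<^esub>}"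

definition effective_action :: "('a, 'm) gmalg_scheme \<Rightarrow> bool" where
  "effective_action V \<longleftrightarrow> (\<forall>t. t \<noteq> 0 \<and> (\<forall>a\<in>carrier V. translate V t a = a) \<longrightarrow> t = 1)"

definition orbit_of :: "('a, 'm) gmalg_scheme \<Rightarrow> 'a set \<Rightarrow> 'a set set" where
  "orbit_of V y = {spec_map V (translate V t) y | t. t \<noteq> 0}"

definition gm_hom :: "('a, 'm) gmalg_scheme \<Rightarrow> ('b, 'n) gmalg_scheme \<Rightarrow> ('a \<Rightarrow> 'b) \<Rightarrow> bool" where
  "gm_hom V W \<phi> \<longleftrightarrow> calg_hom V W \<phi> \<and> (\<forall>a\<in>carrier V. \<forall>m. wt W (\<phi> a) m = \<phi> (wt V a m))"

definition gm_iso :: "('a, 'm) gmalg_scheme \<Rightarrow> ('b, 'n) gmalg_scheme \<Rightarrow> ('a \<Rightarrow> 'b) \<Rightarrow> bool" where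
  "gm_iso V W \<phi> \<longleftrightarrow> gm_hom V W \<phi> \<and> \<phi> \<in> ring_iso V W"

definition S1_iso ::
  "('a, 'm) gmalg_scheme \<Rightarrow> ('a \<Rightarrow> 'a) \<Rightarrow> ('b, 'n) gmalg_scheme \<Rightarrow> ('b \<Rightarrow> 'b) \<Rightarrow> ('a \<Rightarrow> 'b) \<Rightarrow> bool"
  where "S1_iso V \<sigma> W \<sigma>' \<phi> \<longleftrightarrow> gm_iso V W \<phi> \<and> (\<forall>a\<in>carrier V. \<phi> (\<sigma> a) = \<sigma>' (\<phi> a))"

text \<open>
  The product of \<open>B\<close> and the multiplicative group, acted upon by translations on the second
  factor, and its real structure when \<open>\<tau>\<close> is a real structure on \<open>B\<close> and the multiplicative
  group is given that of the circle.
\<close>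

definition gm_product :: "('a, 'm) calg_scheme \<Rightarrow> (int \<Rightarrow> 'a) gmalg" where
  "gm_product B = mk_gmalg (mk_calg (laurent B) (\<lambda>z. lmonom B 0 (cst B z)))
     (\<lambda>f m. lmonom B m (f m))"

definition product_conj :: "('a \<Rightarrow> 'a) \<Rightarrow> (int \<Rightarrow> 'a) \<Rightarrow> int \<Rightarrow> 'a" where
  "product_conj \<tau> f = (\<lambda>m. \<tau> (f (- m)))"

definition circle :: "(int \<Rightarrow> complex) gmalg" where
  "circle = gm_product point"

definition circle_conj :: "(int \<Rightarrow> complex) \<Rightarrow> int \<Rightarrow> complex" where
  "circle_conj = product_conj cnj"

text \<open>The real structure \<open>u \<mapsto> -1/u\<close> composed with conjugation.\<close>

definition circle_hat_conj :: "(int \<Rightarrow> complex) \<Rightarrow> int \<Rightarrow> complex" where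
  "circle_hat_conj f = (\<lambda>m. (-1) powi m * cnj (f (- m)))"

text \<open>The circle with coordinate \<open>w\<close> and the action \<open>t \<cdot> w = t^2 w\<close>: \<open>w^m\<close> has weight \<open>2m\<close>.\<close>

definition circle_mu2 :: "(int \<Rightarrow> complex) gmalg" where
  "circle_mu2 = mk_gmalg (mk_calg (laurent point) (lmonom point 0))
     (\<lambda>f n. if even n then lmonom point (n div 2) (f (n div 2)) else (\<lambda>_. 0))"


section \<open>Torsors\<close>

text \<open>
  \<open>\<rho>\<close> is the comorphism of \<open>P \<rightarrow> B\<close>, and local triviality is expressed on principal open subsets
  \<open>f \<noteq> 0\<close> of \<open>B\<close>, which form a basis of the Zariski topology.
\<close>

definition powers :: "('a, 'm) ring_scheme \<Rightarrow> 'a \<Rightarrow> 'a set" where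
  "powers R f = {f [^]\<^bsub>R\<^esub> n | n::nat. True}"

definition gm_trivial_on ::
  "('b, 'n) calg_scheme \<Rightarrow> ('a, 'm) gmalg_scheme \<Rightarrow> ('b \<Rightarrow> 'a) \<Rightarrow> 'b \<Rightarrow> bool" where
  "gm_trivial_on B P \<rho> f \<longleftrightarrow>
     (let M = powers B f; N = \<rho> ` M in
      \<exists>\<phi>. gm_iso (loc_gm P N) (gm_product (loc_calg B M)) \<phi> \<and>
          (\<forall>b\<in>carrier B. \<forall>s\<in>M.
             \<phi> (fraction P N (\<rho> b) (\<rho> s)) = lmonom (loc_calg B M) 0 (fraction B M b s)))"

definition gm_torsor ::
  "('b, 'n) calg_scheme \<Rightarrow> ('a, 'm) gmalg_scheme \<Rightarrow> ('b \<Rightarrow> 'a) \<Rightarrow> bool" where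
  "gm_torsor B P \<rho> \<longleftrightarrow> gm_action P \<and> calg_hom B P \<rho> \<and>
     (\<forall>b\<in>carrier B. wt P (\<rho> b) = lmonom P 0 (\<rho> b)) \<and>
     (\<forall>x\<in>closed_points B. \<exists>f\<in>carrier B - x. gm_trivial_on B P \<rho> f)"

definition S1_torsor ::
  "('b, 'n) calg_scheme \<Rightarrow> ('b \<Rightarrow> 'b) \<Rightarrow> ('a, 'm) gmalg_scheme \<Rightarrow> ('a \<Rightarrow> 'a) \<Rightarrow> ('b \<Rightarrow> 'a) \<Rightarrow> bool"
  where "S1_torsor B \<tau> P \<sigma> \<rho> \<longleftrightarrow> real_structure B \<tau> \<and> domain P \<and> S1_action P \<sigma> \<and>
     (\<forall>b\<in>carrier B. \<rho> (\<tau> b) = \<sigma> (\<rho> b)) \<and> gm_torsor B P \<rho>"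

definition trivial_S1_torsor ::
  "('b, 'n) calg_scheme \<Rightarrow> ('b \<Rightarrow> 'b) \<Rightarrow> ('a, 'm) gmalg_scheme \<Rightarrow> ('a \<Rightarrow> 'a) \<Rightarrow> ('b \<Rightarrow> 'a) \<Rightarrow> bool"
  where "trivial_S1_torsor B \<tau> P \<sigma> \<rho> \<longleftrightarrow>
     (\<exists>\<phi>. S1_iso P \<sigma> (gm_product B) (product_conj \<tau>) \<phi> \<and>
          (\<forall>b\<in>carrier B. \<phi> (\<rho> b) = lmonom B 0 b))"


section \<open>Orbits\<close>

definition gm_orbit :: "('a, 'm) gmalg_scheme \<Rightarrow> 'a set set \<Rightarrow> bool" where
  "gm_orbit V Z \<longleftrightarrow> (\<exists>y\<in>closed_points V. Z = orbit_of V y)"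

text \<open>
  \<open>\<phi>\<close> is the comorphism of a locally closed immersion \<open>W \<rightarrow> V\<close>: the image of \<open>W\<close> is covered by
  principal open subsets \<open>g \<noteq> 0\<close> of \<open>V\<close> over which \<open>W \<rightarrow> V\<close> is a closed immersion, i.e. such that
  the localization of \<open>\<phi>\<close> at the powers of \<open>g\<close> is surjective.
\<close>

definition immersion ::
  "('a, 'm) ring_scheme \<Rightarrow> ('b, 'n) ring_scheme \<Rightarrow> ('a \<Rightarrow> 'b) \<Rightarrow> bool" where
  "immersion V W \<phi> \<longleftrightarrow>
     (\<forall>y\<in>closed_points W. \<exists>g\<in>carrier V - spec_map V \<phi> y. \<forall>b\<in>carrier W.
        \<exists>a\<in>carrier V. \<exists>n::nat. \<phi> g [^]\<^bsub>W\<^esub> n \<otimes>\<^bsub>W\<^esub> b = \<phi> a)"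

text \<open>
  An orbit, with its structure of reduced locally closed subscheme, is principal if it is
  equivariantly isomorphic to the multiplicative group acting on itself by translations.
\<close>

definition principal_orbit :: "('a, 'm) gmalg_scheme \<Rightarrow> 'a set set \<Rightarrow> bool" where
  "principal_orbit V Z \<longleftrightarrow> gm_orbit V Z \<and>
     (\<exists>\<phi>. gm_hom V (gm_product point) \<phi> \<and> immersion V (gm_product point) \<phi> \<and>
          spec_map V \<phi> ` closed_points (gm_product point) = Z)"

definition exceptional_orbit :: "('a, 'm) gmalg_scheme \<Rightarrow> 'a set set \<Rightarrow> bool" where
  "exceptional_orbit V Z \<longleftrightarrow> gm_orbit V Z \<and> \<not> principal_orbit V Z"

definition exceptional_S1_orbit ::
  "('a, 'm) gmalg_scheme \<Rightarrow> ('a \<Rightarrow> 'a) \<Rightarrow> 'a set set \<Rightarrow> bool" where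
  "exceptional_S1_orbit V \<sigma> Z \<longleftrightarrow> exceptional_orbit V Z \<and> spec_map V \<sigma> ` Z = Z"


section \<open>Curves and divisors\<close>

text \<open>
  The coordinate ring of a curve is a subring of its function field, the type \<open>'k\<close>; open subsets
  are sets of closed points, and local rings and rings of sections are subrings of \<open>'k\<close>.
\<close>

definition function_field :: "'k::field calg \<Rightarrow> 'k calg" where
  "function_field C = coord UNIV (cst C)"

definition smooth_real_affine_curve :: "'k::field calg \<Rightarrow> ('k \<Rightarrow> 'k) \<Rightarrow> bool" where
  "smooth_real_affine_curve C \<tau> \<longleftrightarrow>
     C = coord (carrier C) (cst C) \<and> smooth_affine_variety C 1 \<and>
     (\<forall>f. \<exists>a\<in>carrier C. \<exists>b\<in>carrier C - {0}. f = a / b) \<and>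
     real_structure C \<tau> \<and> real_structure (function_field C) \<tau>"

definition local_ring :: "'k::field calg \<Rightarrow> 'k set \<Rightarrow> 'k set" where
  "local_ring C x = {a / b | a b. a \<in> carrier C \<and> b \<in> carrier C - x}"

definition uniformizer :: "'k::field calg \<Rightarrow> 'k set \<Rightarrow> 'k \<Rightarrow> bool" where
  "uniformizer C x v \<longleftrightarrow> {a / b | a b. a \<in> x \<and> b \<in> carrier C - x} = (*) v ` local_ring C x"

definition ord_at :: "'k::field calg \<Rightarrow> 'k set \<Rightarrow> 'k \<Rightarrow> int" where
  "ord_at C x f = (THE n. \<exists>v u. uniformizer C x v \<and>
     u \<in> local_ring C x \<and> u \<noteq> 0 \<and> inverse u \<in> local_ring C x \<and> f = u * v powi n)"

definition sections :: "'k::field calg \<Rightarrow> 'k set set \<Rightarrow> 'k set" where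
  "sections C U = {f. \<forall>x\<in>U. f \<in> local_ring C x}"

text \<open>The affine variety \<open>Spec (sections C U)\<close>, which is \<open>U\<close> itself if \<open>U\<close> is affine.\<close>

definition open_sub :: "'k::field calg \<Rightarrow> 'k set set \<Rightarrow> 'k calg" where
  "open_sub C U = coord (sections C U) (cst C)"

text \<open>
  The points of an integral scheme are determined by their local rings inside the function field;
  \<open>U\<close> is affine if and only if the canonical map \<open>U \<rightarrow> Spec (sections C U)\<close> is an isomorphism.
\<close>

definition affine_open :: "'k::field calg \<Rightarrow> 'k set set \<Rightarrow> bool" where
  "affine_open C U \<longleftrightarrow> zariski_open C U \<and>
     local_ring C ` U = local_ring (open_sub C U) ` closed_points (open_sub C U)"

definition real_affine_nbhd ::
  "'k::field calg \<Rightarrow> ('k \<Rightarrow> 'k) \<Rightarrow> 'k set \<Rightarrow> 'k set set \<Rightarrow> bool" where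
  "real_affine_nbhd C \<tau> c U \<longleftrightarrow> affine_open C U \<and> c \<in> U \<and> spec_map C \<tau> ` U = U"

definition weil_q_divisor :: "'k::field calg \<Rightarrow> ('k set \<Rightarrow> rat) \<Rightarrow> bool" where
  "weil_q_divisor C D \<longleftrightarrow> finite {x \<in> closed_points C. D x \<noteq> 0}"

definition div_sections :: "'k::field calg \<Rightarrow> ('k set \<Rightarrow> rat) \<Rightarrow> 'k set" where
  "div_sections C D = {f. f = 0 \<or> (\<forall>x\<in>closed_points C. of_int (ord_at C x f) + D x \<ge> 0)}"


section \<open>DPD-pairs\<close>

definition real_dpd_pair ::
  "'k::field calg \<Rightarrow> ('k \<Rightarrow> 'k) \<Rightarrow> ('k set \<Rightarrow> rat) \<Rightarrow> 'k \<Rightarrow> bool" where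
  "real_dpd_pair C \<tau> D h \<longleftrightarrow> weil_q_divisor C D \<and> h \<noteq> 0 \<and> \<tau> h = h \<and>
     (\<forall>x\<in>closed_points C. D x + D (spec_map C \<tau> x) \<le> of_int (ord_at C x h))"

definition regular_pair :: "rat \<Rightarrow> rat \<Rightarrow> bool" where
  "regular_pair r1 r2 \<longleftrightarrow>
     (case (quotient_of r1, quotient_of r2) of ((p1, q1), (p2, q2)) \<Rightarrow> \<bar>p1 * q2 - p2 * q1\<bar> = 1)"

text \<open>
  With \<open>D_plus = D\<close> and \<open>D_minus = \<tau>^* D - div h\<close>, the condition is imposed on \<open>D_plus x\<close> and
  \<open>D_minus x\<close> up to the sign of the latter. It is for the pair of \<open>D_plus x\<close> and \<open>- D_minus x\<close> that
  it expresses smoothness of the surface over \<open>x\<close> (the cone of monomials is given by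
  \<open>k + m * D_plus x \<ge> 0\<close> and \<open>k - m * D_minus x \<ge> 0\<close>), and that it is invariant under replacing
  \<open>(D, h)\<close> by \<open>(D + div f, f * \<tau>^* f * h)\<close>; stated for \<open>D_minus x\<close> literally, it is a different one.
  Admitting both makes the hypothesis weaker than with either convention.
\<close>

definition regular_dpd_pair ::
  "'k::field calg \<Rightarrow> ('k \<Rightarrow> 'k) \<Rightarrow> ('k set \<Rightarrow> rat) \<Rightarrow> 'k \<Rightarrow> bool" where
  "regular_dpd_pair C \<tau> D h \<longleftrightarrow>
     (\<forall>x\<in>closed_points C. D x + D (spec_map C \<tau> x) < of_int (ord_at C x h) \<longrightarrow>
        regular_pair (D x) (D (spec_map C \<tau> x) - of_int (ord_at C x h)) \<or>
        regular_pair (D x) (- (D (spec_map C \<tau> x) - of_int (ord_at C x h))))"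

definition dpd_minus ::
  "'k::field calg \<Rightarrow> ('k \<Rightarrow> 'k) \<Rightarrow> ('k set \<Rightarrow> rat) \<Rightarrow> 'k \<Rightarrow> 'k set \<Rightarrow> rat" where
  "dpd_minus C \<tau> D h = (\<lambda>x. D (spec_map C \<tau> x) - of_int (ord_at C x h))"

definition dpd_piece ::
  "'k::field calg \<Rightarrow> ('k \<Rightarrow> 'k) \<Rightarrow> ('k set \<Rightarrow> rat) \<Rightarrow> 'k \<Rightarrow> int \<Rightarrow> 'k set" where
  "dpd_piece C \<tau> D h m =
     (if m = 0 then carrier C
      else if m > 0 then div_sections C (\<lambda>x. of_int m * D x)
      else div_sections C (\<lambda>x. of_int (- m) * dpd_minus C \<tau> D h x))"

definition dpd_surface ::
  "'k::field calg \<Rightarrow> ('k \<Rightarrow> 'k) \<Rightarrow> ('k set \<Rightarrow> rat) \<Rightarrow> 'k \<Rightarrow> (int \<Rightarrow> 'k) gmalg" where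
  "dpd_surface C \<tau> D h = (gm_product (function_field C))
     \<lparr>carrier := {f \<in> carrier (laurent (function_field C)). \<forall>m. f m \<in> dpd_piece C \<tau> D h m}\<rparr>"

text \<open>\<open>g\<close> in degree \<open>m\<close> is sent to \<open>h^m * \<tau> g\<close> in degree \<open>-m\<close>.\<close>

definition dpd_conj :: "('k::field \<Rightarrow> 'k) \<Rightarrow> 'k \<Rightarrow> (int \<Rightarrow> 'k) \<Rightarrow> int \<Rightarrow> 'k" where
  "dpd_conj \<tau> h f = (\<lambda>m. h powi (- m) * \<tau> (f (- m)))"

definition dpd_quotient :: "'k::field calg \<Rightarrow> 'k \<Rightarrow> int \<Rightarrow> 'k" where
  "dpd_quotient C = lmonom (function_field C) 0"

text \<open>
  The inverse image of an affine open subset \<open>U\<close> of \<open>C\<close> in \<open>S\<close>. Its coordinate ring is the tensor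
  product over the coordinate ring of \<open>C\<close> of those of \<open>S\<close> and \<open>U\<close>; since \<open>U\<close> is flat over \<open>C\<close>, this
  is the subring they generate in the Laurent polynomials over the function field.
\<close>

definition over_open ::
  "'k::field calg \<Rightarrow> (int \<Rightarrow> 'k) gmalg \<Rightarrow> 'k set set \<Rightarrow> (int \<Rightarrow> 'k) gmalg" where
  "over_open C S U = S\<lparr>carrier := generate_ring (laurent (function_field C))
     (carrier S \<union> dpd_quotient C ` sections C U)\<rparr>"

text \<open>
  The numerical condition for the fibres over the points of \<open>V\<close>, real or not, to be neither
  multiple nor reducible.
\<close>

definition nondegenerate_over ::
  "'k::field calg \<Rightarrow> ('k \<Rightarrow> 'k) \<Rightarrow> ('k set \<Rightarrow> rat) \<Rightarrow> 'k \<Rightarrow> 'k set set \<Rightarrow> bool" where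
  "nondegenerate_over C \<tau> D h V \<longleftrightarrow>
     (\<forall>x\<in>V. D x \<in> \<int> \<and> D x + D (spec_map C \<tau> x) = of_int (ord_at C x h))"


section \<open>Fibres\<close>

definition fibre_points ::
  "('b, 'n) ring_scheme \<Rightarrow> ('a, 'm) ring_scheme \<Rightarrow> ('b \<Rightarrow> 'a) \<Rightarrow> 'b set \<Rightarrow> 'a set set" where
  "fibre_points B P \<rho> x = {y \<in> closed_points P. spec_map B \<rho> y = x}"

definition fibre_ideal :: "('a, 'm) ring_scheme \<Rightarrow> ('b \<Rightarrow> 'a) \<Rightarrow> 'b set \<Rightarrow> 'a set" where
  "fibre_ideal P \<rho> x = Idl\<^bsub>P\<^esub> (\<rho> ` x)"

text \<open>
  The divisor of the normal variety \<open>P\<close> with ideal \<open>J\<close> is \<open>n\<close> times its reduction, a prime divisor: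
  in the discrete valuation ring at its generic point, \<open>J\<close> is the \<open>n\<close>-th power of the maximal ideal.
\<close>

definition multiple_divisor :: "('a, 'm) ring_scheme \<Rightarrow> 'a set \<Rightarrow> nat \<Rightarrow> bool" where
  "multiple_divisor P J n \<longleftrightarrow> primeideal (radical_ideal P J) P \<and>
     locally_equal P (radical_ideal P J) J (ideal_power P (radical_ideal P J) n)"

text \<open>
  The curves with ideals \<open>I\<close> and \<open>J\<close> on a smooth surface pass through \<open>p\<close>, and their local equations
  generate the maximal ideal of the local ring at \<open>p\<close>.
\<close>

definition transversal_at :: "('a, 'm) ring_scheme \<Rightarrow> 'a set \<Rightarrow> 'a set \<Rightarrow> 'a set \<Rightarrow> bool" where
  "transversal_at R I J p \<longleftrightarrow> I \<subseteq> p \<and> J \<subseteq> p \<and> locally_equal R p (I <+>\<^bsub>R\<^esub> J) p"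

definition is_affine_line :: "('a, 'm) gmalg_scheme \<Rightarrow> 'a set set \<Rightarrow> bool" where
  "is_affine_line V Z \<longleftrightarrow> (\<exists>\<phi>. calg_iso (gm_quot V (\<Inter>Z)) affine_line \<phi>)"

definition torsor_case :: "'k::field calg \<Rightarrow> ('k set \<Rightarrow> rat) \<Rightarrow> 'k \<Rightarrow> 'k set \<Rightarrow> bool" where
  "torsor_case C D h c \<longleftrightarrow> D c \<in> \<int> \<and> of_int (ord_at C c h) = 2 * D c"

definition multiple_case :: "'k::field calg \<Rightarrow> ('k set \<Rightarrow> rat) \<Rightarrow> 'k \<Rightarrow> 'k set \<Rightarrow> bool" where
  "multiple_case C D h c \<longleftrightarrow> 2 * D c \<in> \<int> \<and> D c \<notin> \<int> \<and> of_int (ord_at C c h) = 2 * D c"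

definition crossing_case :: "'k::field calg \<Rightarrow> ('k set \<Rightarrow> rat) \<Rightarrow> 'k \<Rightarrow> 'k set \<Rightarrow> bool" where
  "crossing_case C D h c \<longleftrightarrow> D c \<in> \<int> \<and> of_int (ord_at C c h) = 2 * D c + 1"

end

theory Submission
  imports Defs "HOL-Computational_Algebra.Fundamental_Theorem_Algebra" "HOL-Library.Poly_Mapping"
begin

text \<open>
  Over the local ring at \<open>c\<close>, the piece of degree \<open>m\<close> of the coordinate ring of the surface consists
  of the \<open>f\<close> with \<open>ord f \<ge> \<lceil>- m * D c\<rceil>\<close> for \<open>m \<ge> 0\<close>, and \<open>ord f \<ge> \<lceil>m * (D c - ord h)\<rceil>\<close> for
  \<open>m \<le> 0\<close>. The components of the fibre correspond to the faces of the cone that these bounds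
  describe: taking leading coefficients at \<open>c\<close> along a face is a ring homomorphism to the complex
  Laurent polynomials, whose kernel is the ideal of a component. There is one face if
  \<open>ord h = 2 * D c\<close>, and the degrees on it are all the integers (torsor) or the even ones (multiple
  fibre). Otherwise, regularity makes \<open>D c\<close> an integer, there are two faces exchanged by the real
  structure, and the bound on the cotangent dimension at the fixed point leaves
  \<open>ord h = 2 * D c + 1\<close>. A trivialization of the torsor over a punctured neighbourhood provides
  an element \<open>f\<close> of degree \<open>1\<close> with \<open>f * \<sigma> f = 1\<close>, that is a rational function with
  \<open>h * f * \<tau> f = 1\<close>, and \<open>ord h\<close> is even.
\<close>


section \<open>Noetherian subrings\<close>

text \<open>Coordinate rings, local rings and rings of sections are subsets of one function field,
  so geometry over the curve becomes inequalities between orders. The price is that the discrete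
  valuations have to be built from the definition of smoothness: the basis theorem, a Nakayama
  argument for uniformizers, Krull's intersection theorem for orders. Elements of the surface are
  global while faces are local at \<open>c\<close>; a factor that is a unit at \<open>c\<close> and
  vanishes to high order at finitely many other points passes from one to the other.

  Regularity forces integrality because at a real point the two numbers of the pair have an integral
  sum or difference, hence the same denominator, and this denominator divides the determinant 1. At
  a crossing the cone of monomials is that of \<open>x * y = v^N\<close> with
  \<open>N = ord h - 2 * D c\<close>; for \<open>N \<ge> 2\<close> the elements \<open>x\<close>,
  \<open>y\<close>, \<open>v\<close> are independent modulo the square of the maximal ideal.

  The circle and its form without real points are told apart by the sign of the real number
  \<open>h * u * \<tau> u\<close> at \<open>c\<close>, for a local generator \<open>u\<close> in
  degree 1: rescaling \<open>u\<close> changes it by a positive factor.\<close>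

definition sring :: "'a::comm_ring_1 set \<Rightarrow> bool" where
  "sring A \<longleftrightarrow> 0 \<in> A \<and> 1 \<in> A \<and> (\<forall>a\<in>A. \<forall>b\<in>A. a + b \<in> A \<and> a * b \<in> A) \<and> (\<forall>a\<in>A. - a \<in> A)"

definition idl :: "'a::comm_ring_1 set \<Rightarrow> 'a set \<Rightarrow> bool" where
  "idl A I \<longleftrightarrow> I \<subseteq> A \<and> 0 \<in> I \<and> (\<forall>a\<in>I. \<forall>b\<in>I. a + b \<in> I) \<and> (\<forall>a\<in>A. \<forall>b\<in>I. a * b \<in> I)"

text \<open>The relation descends as ideals grow, so its minimal elements are the maximal members of
  a family of ideals.\<close>

definition noeth :: "'a::comm_ring_1 set \<Rightarrow> bool" where
  "noeth A \<longleftrightarrow> wf {(J, I). idl A I \<and> idl A J \<and> I \<subset> J}"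

lemma sringD:
  assumes "sring A"
  shows "0 \<in> A" "1 \<in> A" "\<And>a b. a \<in> A \<Longrightarrow> b \<in> A \<Longrightarrow> a + b \<in> A"
    "\<And>a b. a \<in> A \<Longrightarrow> b \<in> A \<Longrightarrow> a * b \<in> A" "\<And>a. a \<in> A \<Longrightarrow> - a \<in> A"
    "\<And>a b. a \<in> A \<Longrightarrow> b \<in> A \<Longrightarrow> a - b \<in> A" "\<And>a n. a \<in> A \<Longrightarrow> a ^ n \<in> A"
    "\<And>f S. (\<And>i. i \<in> S \<Longrightarrow> f i \<in> A) \<Longrightarrow> sum f S \<in> A"
proof -
  show *: "0 \<in> A" "1 \<in> A" "\<And>a b. a \<in> A \<Longrightarrow> b \<in> A \<Longrightarrow> a + b \<in> A"
    "\<And>a b. a \<in> A \<Longrightarrow> b \<in> A \<Longrightarrow> a * b \<in> A" "\<And>a. a \<in> A \<Longrightarrow> - a \<in> A"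
    using assms by (auto simp: sring_def)
  show "\<And>a b. a \<in> A \<Longrightarrow> b \<in> A \<Longrightarrow> a - b \<in> A" using *(3,5) by (metis add_uminus_conv_diff)
  show "a ^ n \<in> A" if "a \<in> A" for a n using that * by (induction n) auto
  show "sum f S \<in> A" if "\<And>i. i \<in> S \<Longrightarrow> f i \<in> A" for f :: "'c \<Rightarrow> 'a" and S
    using that * by (induction S rule: infinite_finite_induct) auto
qed

lemma idlD:
  assumes "idl A I"
  shows "I \<subseteq> A" "0 \<in> I" "\<And>a b. a \<in> I \<Longrightarrow> b \<in> I \<Longrightarrow> a + b \<in> I"
    "\<And>a b. a \<in> A \<Longrightarrow> b \<in> I \<Longrightarrow> a * b \<in> I" "\<And>a b. a \<in> A \<Longrightarrow> b \<in> I \<Longrightarrow> b * a \<in> I"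
  using assms by (auto simp: idl_def mult.commute)

lemma idl_minus:
  assumes "sring A" "idl A I"
  shows "a \<in> I \<Longrightarrow> - a \<in> I" "a \<in> I \<Longrightarrow> b \<in> I \<Longrightarrow> a - b \<in> I"
proof -
  show *: "- a \<in> I" if "a \<in> I" for a
    using idlD(4)[OF assms(2), of "-1" a] sringD[OF assms(1)] that by auto
  show "a \<in> I \<Longrightarrow> b \<in> I \<Longrightarrow> a - b \<in> I"
    using idlD(3)[OF assms(2), of a "-b"] * by auto
qed

lemma noeth_max:
  assumes "noeth A" "idl A I" "P I"
  obtains M where "idl A M" "P M" "\<And>J. idl A J \<Longrightarrow> P J \<Longrightarrow> M \<subseteq> J \<Longrightarrow> J = M"
proof -
  obtain M where M: "M \<in> {I. idl A I \<and> P I}"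
    "\<And>y. (y, M) \<in> {(J, I). idl A I \<and> idl A J \<and> I \<subset> J} \<Longrightarrow> y \<notin> {I. idl A I \<and> P I}"
    using wfE_min[OF assms(1)[unfolded noeth_def], of I "{I. idl A I \<and> P I}"] assms(2,3) by auto
  then show ?thesis using that[of M] by auto
qed

lemma noeth_chain:
  assumes "noeth A" "\<And>i. idl A (I i)" "\<And>i. I i \<subseteq> I (Suc i)"
  obtains N where "\<And>n. n \<ge> N \<Longrightarrow> I n = I N"
proof -
  have mono: "I m \<subseteq> I n" if "m \<le> n" for m n
    using lift_Suc_mono_le[of I m n] assms(3) that by auto
  obtain M where M: "M \<in> range I" "\<And>J. idl A J \<Longrightarrow> J \<in> range I \<Longrightarrow> M \<subseteq> J \<Longrightarrow> J = M"
    by (rule noeth_max[OF assms(1) assms(2)[of 0], of "\<lambda>J. J \<in> range I"]) auto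
  then obtain N where "M = I N" by auto
  then show ?thesis using that[of N] M(2)[OF assms(2)] mono by auto
qed

text \<open>Failure of well-foundedness provides a chain that is strict at every step, so one
  repetition in each chain is enough.\<close>

lemma noethI:
  assumes "\<And>I. (\<And>i. idl A (I i)) \<Longrightarrow> (\<And>i. I i \<subseteq> I (Suc i)) \<Longrightarrow> \<exists>i. I (Suc i) = I i"
  shows "noeth A"
  unfolding noeth_def wf_iff_no_infinite_down_chain
proof
  assume "\<exists>f. \<forall>i. (f (Suc i), f i) \<in> {(J, I). idl A I \<and> idl A J \<and> I \<subset> J}"
  then obtain f where "\<forall>i. (f (Suc i), f i) \<in> {(J, I). idl A I \<and> idl A J \<and> I \<subset> J}" ..
  then have f: "idl A (f i)" "f i \<subset> f (Suc i)" for i by auto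
  from assms[of f] f show False by blast
qed

section \<open>Hilbert's basis theorem\<close>

definition adjoin :: "'a::comm_ring_1 set \<Rightarrow> 'a \<Rightarrow> 'a set" where
  "adjoin A x = {poly p x | p. \<forall>i. coeff p i \<in> A}"

text \<open>The element \<open>x\<close> may be algebraic over \<open>A\<close>, and then an element
  of \<open>I\<close> has many representing polynomials; all those of degree at most
  \<open>n\<close> contribute their coefficient of index \<open>n\<close>.\<close>

definition lead_idl :: "'a::comm_ring_1 set \<Rightarrow> 'a \<Rightarrow> 'a set \<Rightarrow> nat \<Rightarrow> 'a set" where
  "lead_idl A x I n = {coeff p n | p. (\<forall>i. coeff p i \<in> A) \<and> (\<forall>i>n. coeff p i = 0) \<and> poly p x \<in> I}"

lemma sring_adjoin: assumes A: "sring A" shows "sring (adjoin A x)"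
  unfolding sring_def
proof (intro conjI ballI)
  note s = sringD[OF A]
  show "0 \<in> adjoin A x" unfolding adjoin_def using s by (auto intro!: exI[of _ 0])
  show "1 \<in> adjoin A x" unfolding adjoin_def using s by (auto intro!: exI[of _ 1] simp: coeff_1)
  fix a assume "a \<in> adjoin A x"
  then obtain p where p: "a = poly p x" "\<forall>i. coeff p i \<in> A" by (auto simp: adjoin_def)
  show "- a \<in> adjoin A x" unfolding adjoin_def using s p by (auto intro!: exI[of _ "-p"])
  fix b assume "b \<in> adjoin A x"
  then obtain q where q: "b = poly q x" "\<forall>i. coeff q i \<in> A" by (auto simp: adjoin_def)
  show "a + b \<in> adjoin A x" unfolding adjoin_def using s p q by (auto intro!: exI[of _ "p+q"])
  show "a * b \<in> adjoin A x" unfolding adjoin_def using s p q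
    by (auto intro!: exI[of _ "p*q"] s(8) simp: coeff_mult)
qed

lemma adjoin_incl:
  assumes A: "sring A" shows "A \<subseteq> adjoin A x" "x \<in> adjoin A x"
proof -
  note s = sringD[OF A]
  show "A \<subseteq> adjoin A x" unfolding adjoin_def using s
    by (auto intro!: exI[of _ "[:_:]"] simp: coeff_pCons split: nat.splits)
  show "x \<in> adjoin A x" unfolding adjoin_def using s
    by (auto intro!: exI[of _ "[:0,1:]"] simp: coeff_pCons split: nat.splits)
qed

lemma adjoin_min:
  assumes "sring B" "A \<subseteq> B" "x \<in> B" shows "adjoin A x \<subseteq> B"
proof
  note s = sringD[OF assms(1)]
  fix a assume "a \<in> adjoin A x"
  then obtain p where p: "a = poly p x" "\<forall>i. coeff p i \<in> A" by (auto simp: adjoin_def)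
  have "a = (\<Sum>i\<le>degree p. coeff p i * x ^ i)" by (simp add: p poly_altdef)
  also have "\<dots> \<in> B" using p(2) assms(2,3) by (intro s(8) s(4) s(7)) auto
  finally show "a \<in> B" .
qed

lemma idl_lead:
  assumes A: "sring A" and I: "idl (adjoin A x) I" shows "idl A (lead_idl A x I n)"
  unfolding idl_def
proof (intro conjI ballI subsetI)
  note s = sringD[OF A] and i = idlD[OF I]
  show "0 \<in> lead_idl A x I n" unfolding lead_idl_def using s i by (auto intro!: exI[of _ 0])
  fix a assume a: "a \<in> lead_idl A x I n"
  then show "a \<in> A" by (auto simp: lead_idl_def)
  obtain p where p: "a = coeff p n" "\<forall>i. coeff p i \<in> A" "\<forall>i>n. coeff p i = 0" "poly p x \<in> I"
    using a by (auto simp: lead_idl_def)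
  fix b assume b: "b \<in> lead_idl A x I n"
  obtain q where q: "b = coeff q n" "\<forall>i. coeff q i \<in> A" "\<forall>i>n. coeff q i = 0" "poly q x \<in> I"
    using b by (auto simp: lead_idl_def)
  show "a + b \<in> lead_idl A x I n" unfolding lead_idl_def using p q s i
    by (auto intro!: exI[of _ "p+q"])
next
  note s = sringD[OF A] and i = idlD[OF I]
  fix a b assume a: "a \<in> A" and b: "b \<in> lead_idl A x I n"
  obtain q where q: "b = coeff q n" "\<forall>i. coeff q i \<in> A" "\<forall>i>n. coeff q i = 0" "poly q x \<in> I"
    using b by (auto simp: lead_idl_def)
  show "a * b \<in> lead_idl A x I n" unfolding lead_idl_def using a q s(1-4) i(4)[OF subsetD[OF adjoin_incl(1)[OF A] a]]
    by (auto intro!: exI[of _ "smult a q"])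
qed

lemma lead_idl_mono: "I \<subseteq> J \<Longrightarrow> lead_idl A x I n \<subseteq> lead_idl A x J n"
  unfolding lead_idl_def by auto

text \<open>Multiplication by \<open>x\<close> keeps \<open>I\<close> and raises the index of the
  top coefficient by one.\<close>

lemma lead_idl_Suc:
  assumes A: "sring A" and I: "idl (adjoin A x) I"
  shows "lead_idl A x I n \<subseteq> lead_idl A x I (Suc n)"
proof
  note s = sringD[OF A] and i = idlD[OF I]
  fix b assume b: "b \<in> lead_idl A x I n"
  obtain q where q: "b = coeff q n" "\<forall>i. coeff q i \<in> A" "\<forall>i>n. coeff q i = 0" "poly q x \<in> I"
    using b by (auto simp: lead_idl_def)
  show "b \<in> lead_idl A x I (Suc n)" unfolding lead_idl_def using q s(1-4) i(4)[OF adjoin_incl(2)[OF A]]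
    by (auto intro!: exI[of _ "pCons 0 q"] simp: coeff_pCons split: nat.splits)
qed

text \<open>Induction on a degree bound: subtracting a polynomial that represents an element of
  \<open>I\<close> and has the same top coefficient lowers the bound.\<close>

lemma lead_idl_eq:
  assumes A: "sring A" and I: "idl (adjoin A x) I" and J: "idl (adjoin A x) J" and IJ: "I \<subseteq> J"
    and eq: "\<And>n. lead_idl A x I n = lead_idl A x J n"
  shows "I = J"
proof -
  note s = sringD[OF A] and i = idlD[OF I] and j = idlD[OF J]
  have "poly p x \<in> I" if "\<forall>i. coeff p i \<in> A" "\<forall>i\<ge>n. coeff p i = 0" "poly p x \<in> J" for n p
    using that
  proof (induction n arbitrary: p)
    case 0
    then have "p = 0" by (auto simp: poly_eq_iff)
    then show ?case using i by auto
  next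
    case (Suc n)
    then have "coeff p n \<in> lead_idl A x J n" unfolding lead_idl_def by auto
    then have "coeff p n \<in> lead_idl A x I n" using eq by simp
    then obtain q where q: "coeff p n = coeff q n" "\<forall>i. coeff q i \<in> A" "\<forall>i>n. coeff q i = 0" "poly q x \<in> I"
      by (auto simp: lead_idl_def)
    have "poly (p - q) x \<in> I"
    proof (rule Suc.IH)
      show "\<forall>i. coeff (p - q) i \<in> A" using q Suc.prems s by auto
      show "\<forall>i\<ge>n. coeff (p - q) i = 0" 
      proof (intro allI impI)
        fix i assume "i \<ge> n"
        then consider "i = n" | "i \<ge> Suc n" by linarith
        then show "coeff (p - q) i = 0" using q(1,3) Suc.prems(2) by cases auto
      qed
      show "poly (p - q) x \<in> J" using Suc.prems(3) q(4) IJ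
          idl_minus(2)[OF sring_adjoin[OF A] J] by auto
    qed
    then have "poly (p - q) x + poly q x \<in> I" using q(4) i(3) by blast
    then show ?case by simp
  qed
  then have *: "poly p x \<in> I" if "\<forall>i. coeff p i \<in> A" "poly p x \<in> J" for p
    using that coeff_eq_0[of p] by (metis Suc_le_lessD)
  have "J \<subseteq> I"
  proof
    fix a assume a: "a \<in> J"
    then obtain p where "a = poly p x" "\<forall>i. coeff p i \<in> A" using j(1) by (auto simp: adjoin_def)
    then show "a \<in> I" using * a by auto
  qed
  then show ?thesis using IJ by auto
qed

text \<open>The ideals \<open>lead_idl A x (I k) n\<close> increase in both \<open>k\<close> and
  \<open>n\<close>. A maximal one is reached at some \<open>(k0, n0)\<close> and settles all larger
  indices; the finitely many \<open>n < n0\<close> stabilize one by one.\<close>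

lemma noeth_adjoin:
  assumes A: "sring A" and N: "noeth A" shows "noeth (adjoin A x)"
proof (rule noethI)
  fix I assume I: "\<And>i::nat. idl (adjoin A x) (I i)" and up: "\<And>i. I i \<subseteq> I (Suc i)"
  have mono: "I m \<subseteq> I n" if "m \<le> n" for m n
    using lift_Suc_mono_le[of I m n] up that by auto
  have mono2: "lead_idl A x (I k) m \<subseteq> lead_idl A x (I k) n" if "m \<le> n" for k m n
    using lift_Suc_mono_le[of "lead_idl A x (I k)" m n] lead_idl_Suc[OF A I] that by auto
  let ?P = "\<lambda>M. \<exists>k n. M = lead_idl A x (I k) n"
  obtain M where M: "?P M" "\<And>J. idl A J \<Longrightarrow> ?P J \<Longrightarrow> M \<subseteq> J \<Longrightarrow> J = M"
    by (rule noeth_max[OF N idl_lead[OF A I[of 0]], of ?P 0]) auto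
  then obtain k0 n0 where kn: "M = lead_idl A x (I k0) n0" by blast
  have big: "lead_idl A x (I k) n = M" if "k \<ge> k0" "n \<ge> n0" for k n
    using M(2)[OF idl_lead[OF A I]] kn mono2[OF that(2)] lead_idl_mono[OF mono[OF that(1)]] by blast
  have "\<exists>K. \<forall>k\<ge>K. lead_idl A x (I k) n = lead_idl A x (I K) n" for n
    using noeth_chain[OF N, of "\<lambda>k. lead_idl A x (I k) n"] idl_lead[OF A I] lead_idl_mono[OF up]
    by metis
  then obtain K where K: "\<And>n k. k \<ge> K n \<Longrightarrow> lead_idl A x (I k) n = lead_idl A x (I (K n)) n"
    by metis
  \<comment> \<open>\<open>B\<close> is past \<open>k0\<close> and past the stabilization index of
    every \<open>n < n0\<close>.\<close>
  define B where "B = k0 + (\<Sum>n<n0. K n)"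
  have "lead_idl A x (I B) n = lead_idl A x (I (Suc B)) n" for n
  proof (cases "n < n0")
    case True
    then have "K n \<le> (\<Sum>n<n0. K n)" by (intro member_le_sum) auto
    then have "K n \<le> B" by (simp add: B_def)
    then show ?thesis using K[of n B] K[of n "Suc B"] by simp
  next
    case False
    then show ?thesis using big[of B n] big[of "Suc B" n] by (simp add: B_def)
  qed
  then have "I B = I (Suc B)" by (intro lead_idl_eq[OF A I I up]) auto
  then show "\<exists>i. I (Suc i) = I i" by metis
qed

text \<open>There are only two ideals, so at most one of the first two steps of a chain is
  strict.\<close>

lemma noeth_field:
  fixes A :: "'a::field set"
  assumes "sring A" and inv: "\<And>a. a \<in> A \<Longrightarrow> inverse a \<in> A" shows "noeth A"
proof (rule noethI)
  have *: "I = {0} \<or> I = A" if I: "idl A I" for I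
  proof (cases "I = {0}")
    case False
    then obtain a where a: "a \<in> I" "a \<noteq> 0" using idlD(2)[OF I] by blast
    then have "a \<in> A" using idlD(1)[OF I] by blast
    then have "inverse a * a \<in> I" using inv a idlD(4)[OF I] by blast
    then have "1 \<in> I" using a by simp
    then have "b \<in> I" if "b \<in> A" for b using idlD(4)[OF I that, of 1] by simp
    then show ?thesis using idlD(1)[OF I] by auto
  qed simp
  fix I assume I: "\<And>i::nat. idl A (I i)" and up: "\<And>i. I i \<subseteq> I (Suc i)"
  show "\<exists>i. I (Suc i) = I i"
  proof (cases "I 0 = A")
    case True
    then show ?thesis using up[of 0] idlD(1)[OF I, of 1] by (intro exI[of _ 0]) auto
  next
    case False
    then have 0: "I 0 = {0}" using *[OF I] by blast
    show ?thesis
    proof (cases "I 1 = A")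
      case True
      then show ?thesis using up[of 1] idlD(1)[OF I, of 2] by (intro exI[of _ 1]) (auto simp: numeral_2_eq_2)
    next
      case False
      then show ?thesis using 0 *[OF I, of 1] by (intro exI[of _ 0]) auto
    qed
  qed
qed

text \<open>Leastness of \<open>R\<close> is carried along because it identifies \<open>R\<close>
  with the ring that \<open>generate_ring\<close> produces.\<close>

lemma noeth_finitely_generated:
  fixes k :: "complex \<Rightarrow> 'a::field"
  assumes "sring (range k)" "\<And>z. inverse (k z) \<in> range k" "finite F"
  shows "\<exists>R. sring R \<and> noeth R \<and> range k \<union> F \<subseteq> R \<and> (\<forall>B. sring B \<longrightarrow> range k \<union> F \<subseteq> B \<longrightarrow> R \<subseteq> B)"
  using assms(3)
proof (induction F rule: finite_induct)
  case empty
  show ?case using assms(1,2) noeth_field[OF assms(1)] by auto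
next
  case (insert x F)
  then obtain R where R: "sring R" "noeth R" "range k \<union> F \<subseteq> R"
    "\<And>B. sring B \<Longrightarrow> range k \<union> F \<subseteq> B \<Longrightarrow> R \<subseteq> B" by blast
  show ?case
  proof (intro exI[of _ "adjoin R x"] conjI allI impI)
    show "sring (adjoin R x)" "noeth (adjoin R x)"
      using sring_adjoin[OF R(1)] noeth_adjoin[OF R(1,2)] by auto
    show "range k \<union> insert x F \<subseteq> adjoin R x" using adjoin_incl[OF R(1), of x] R(3) by auto
    fix B assume B: "sring B" "range k \<union> insert x F \<subseteq> B"
    then show "adjoin R x \<subseteq> B" using adjoin_min[OF B(1) R(4)[OF B(1)], of x] by auto
  qed
qed

section \<open>Coordinate rings inside a field\<close>

lemma coord_simps [simp]:
  "carrier (coord A k) = A" "monoid.mult (coord A k) = (*)" "one (coord A k) = 1"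
  "ring.zero (coord A k) = 0" "add (coord A k) = (+)" "cst (coord A k) = k"
  by (simp_all add: coord_def mk_calg_def ring.defs calg.defs)

lemma cring_coord: assumes "sring A" shows "cring (coord A k)"
proof (rule cringI)
  note s = sringD[OF assms]
  show "abelian_group (coord A k)"
    by (rule abelian_groupI) (use s in \<open>auto simp: algebra_simps intro!: bexI[of _ "- _"]\<close>)
  show "Group.comm_monoid (coord A k)"
    by (rule comm_monoidI) (use s in \<open>auto simp: algebra_simps\<close>)
qed (auto simp: algebra_simps)

lemma coord_a_inv [simp]: assumes "sring A" "a \<in> A" shows "\<ominus>\<^bsub>coord A k\<^esub> a = - a"
proof -
  interpret cring "coord A k" by (rule cring_coord[OF assms(1)])
  have "- a \<in> A" using sringD[OF assms(1)] assms(2) by auto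
  then show ?thesis using minus_equality[of "- a" a] assms(2) by auto
qed

lemma coord_a_minus [simp]:
  assumes "sring A" "b \<in> A" shows "a \<ominus>\<^bsub>coord A k\<^esub> b = a - b"
  using coord_a_inv[OF assms] by (simp add: a_minus_def)

lemma coord_pow [simp]: "a [^]\<^bsub>coord A k\<^esub> (n::nat) = a ^ n"
  by (induction n) (auto simp: nat_pow_def)

lemma coord_finsum:
  assumes "sring A" "finite I" "\<And>i. i \<in> I \<Longrightarrow> f i \<in> A" shows "finsum (coord A k) f I = sum f I"
  using assms(2,3)
proof (induction I rule: finite_induct)
  case empty
  interpret cring "coord A k" by (rule cring_coord[OF assms(1)])
  show ?case by simp
next
  case (insert x F)
  interpret cring "coord A k" by (rule cring_coord[OF assms(1)])
  show ?case using insert by (subst finsum_insert) auto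
qed

lemma sring_UNIV [simp]: "sring UNIV" by (simp add: sring_def)

lemma sring_of_cring: assumes "cring (coord A k)" shows "sring A"
proof -
  interpret cring "coord A k" by fact
  have "- a \<in> A" if "a \<in> A" for a
  proof -
    have "\<exists>y\<in>carrier (coord A k). y \<oplus>\<^bsub>coord A k\<^esub> a = \<zero>\<^bsub>coord A k\<^esub>"
      using that l_neg[of a] a_inv_closed[of a] by (intro bexI[of _ "\<ominus>\<^bsub>coord A k\<^esub> a"]) simp_all
    then obtain b where "b \<in> A" "b + a = 0" by auto
    then show ?thesis using group_add_class.minus_unique[of a b] by (simp add: add.commute)
  qed
  then show ?thesis
    using zero_closed one_closed a_closed m_closed by (auto simp: sring_def)
qed

lemma ideal_coord: assumes A: "sring A" shows "ideal I (coord A k) \<longleftrightarrow> idl A I"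
proof
  assume "ideal I (coord A k)"
  then interpret ideal I "coord A k" .
  show "idl A I" using a_subset zero_closed a_closed I_l_closed additive_subgroup.zero_closed[OF is_additive_subgroup]
      additive_subgroup.a_closed[OF is_additive_subgroup]
    by (auto simp: idl_def)
next
  assume I: "idl A I"
  interpret cring "coord A k" by (rule cring_coord[OF A])
  show "ideal I (coord A k)"
  proof (rule idealI)
    show "ring (coord A k)" by unfold_locales
    show "subgroup I (add_monoid (coord A k))"
    proof (rule add.subgroupI)
      show "I \<subseteq> carrier (coord A k)" "I \<noteq> {}" using idlD[OF I] by auto
      fix a assume a: "a \<in> I"
      then show "\<ominus>\<^bsub>coord A k\<^esub> a \<in> I" using idlD(1)[OF I] A idl_minus[OF A I] by (subst coord_a_inv) auto
      fix b assume "b \<in> I" then show "a \<oplus>\<^bsub>coord A k\<^esub> b \<in> I" using a idlD[OF I] by auto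
    qed
  qed (use idlD[OF I] in auto)
qed

definition maxidl :: "'a::comm_ring_1 set \<Rightarrow> 'a set \<Rightarrow> bool" where
  "maxidl A x \<longleftrightarrow> idl A x \<and> x \<noteq> A \<and> (\<forall>J. idl A J \<longrightarrow> x \<subseteq> J \<longrightarrow> J = x \<or> J = A)"

definition primeidl :: "'a::comm_ring_1 set \<Rightarrow> 'a set \<Rightarrow> bool" where
  "primeidl A x \<longleftrightarrow> idl A x \<and> x \<noteq> A \<and> (\<forall>a\<in>A. \<forall>b\<in>A. a * b \<in> x \<longrightarrow> a \<in> x \<or> b \<in> x)"

lemma maximalideal_coord: assumes A: "sring A" shows "maximalideal x (coord A k) \<longleftrightarrow> maxidl A x"
proof
  assume "maximalideal x (coord A k)"
  then interpret maximalideal x "coord A k" .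
  show "maxidl A x" using is_ideal I_notcarr I_maximal ideal_coord[OF A] idlD(1)
    unfolding maxidl_def by (metis coord_simps(1))
next
  assume m: "maxidl A x"
  then have i: "ideal x (coord A k)" using ideal_coord[OF A] maxidl_def by blast
  show "maximalideal x (coord A k)"
    by (rule maximalidealI[OF i]) (use m ideal_coord[OF A] in \<open>auto simp: maxidl_def\<close>)
qed

lemma primeideal_coord: assumes A: "sring A" shows "primeideal x (coord A k) \<longleftrightarrow> primeidl A x"
proof
  assume "primeideal x (coord A k)"
  then interpret primeideal x "coord A k" .
  show "primeidl A x" using is_ideal I_notcarr I_prime ideal_coord[OF A]
    unfolding primeidl_def by (metis coord_simps(1,2))
next
  assume m: "primeidl A x"
  then have i: "ideal x (coord A k)" using ideal_coord[OF A] primeidl_def by blast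
  show "primeideal x (coord A k)"
    by (rule primeidealI[OF i cring_coord[OF A]]) (use m in \<open>auto simp: primeidl_def\<close>)
qed

lemma closed_points_coord: "sring A \<Longrightarrow> closed_points (coord A k) = {x. maxidl A x}"
  by (simp add: closed_points_def maximalideal_coord)

lemma idl_sum:
  assumes A: "sring A" and I: "idl A I" and a: "a \<in> A"
  shows "idl A {u + b * a | u b. u \<in> I \<and> b \<in> A}" "I \<subseteq> {u + b * a | u b. u \<in> I \<and> b \<in> A}"
    "a \<in> {u + b * a | u b. u \<in> I \<and> b \<in> A}"
proof -
  note s = sringD[OF A] and ii = idlD[OF I]
  let ?J = "{u + b * a | u b. u \<in> I \<and> b \<in> A}"
  show "idl A ?J" unfolding idl_def
  proof (intro conjI ballI)
    show "?J \<subseteq> A" using ii s a by auto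
    show "0 \<in> ?J" using ii(2) s by (auto intro!: exI[of _ 0])
    fix p q assume "q \<in> ?J"
    then obtain u' b' where q: "q = u' + b' * a" "u' \<in> I" "b' \<in> A" by auto
    { assume "p \<in> ?J"
      then obtain u b where p: "p = u + b * a" "u \<in> I" "b \<in> A" by auto
      have "p + q = (u + u') + (b + b') * a" using p q by (simp add: algebra_simps)
      then show "p + q \<in> ?J" using ii(3)[OF p(2) q(2)] s(3)[OF p(3) q(3)] by blast }
    { assume p: "p \<in> A"
      have "p * q = p * u' + (p * b') * a" using q by (simp add: algebra_simps)
      then show "p * q \<in> ?J" using ii(4)[OF p q(2)] s(4)[OF p q(3)] by blast }
  qed
  show "I \<subseteq> ?J"
  proof
    fix u assume "u \<in> I" then show "u \<in> ?J" using s(1) by (intro CollectI exI[of _ u] exI[of _ 0]) simp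
  qed
  show "a \<in> ?J" using ii(2) s(2) by (intro CollectI exI[of _ 0] exI[of _ 1]) simp
qed

text \<open>By maximality the ideal \<open>x + A a\<close> is everything, and an expression of 1 in
  it is an inverse of \<open>a\<close> modulo \<open>x\<close>.\<close>

lemma maxidl_inverse:
  assumes A: "sring A" and x: "maxidl A x" and a: "a \<in> A" "a \<notin> x"
  obtains b where "b \<in> A" "1 - b * a \<in> x"
proof -
  have i: "idl A x" using x by (simp add: maxidl_def)
  let ?J = "{u + b * a | u b. u \<in> x \<and> b \<in> A}"
  note J = idl_sum[OF A i a(1)]
  have "?J = A" using x a J unfolding maxidl_def by blast
  then have "1 \<in> ?J" using sringD(2)[OF A] by simp
  then obtain u b where ub: "1 = u + b * a" "u \<in> x" "b \<in> A" by auto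
  have "1 - b * a = u" by (simp add: ub(1))
  then show ?thesis using that[of b] ub by simp
qed

lemma maxidl_one: assumes "sring A" "maxidl A x" shows "1 \<notin> x"
  using assms idlD[of A x] unfolding maxidl_def by (metis mult.right_neutral subsetI subset_antisym)

lemma maxidl_prime: assumes A: "sring A" and x: "maxidl A x" shows "primeidl A x"
  unfolding primeidl_def
proof (intro conjI ballI impI)
  have i: "idl A x" using x by (simp add: maxidl_def)
  show "idl A x" "x \<noteq> A" using x by (auto simp: maxidl_def)
  fix a b assume ab: "a \<in> A" "b \<in> A" "a * b \<in> x"
  show "a \<in> x \<or> b \<in> x"
  proof (rule ccontr)
    assume n: "\<not> ?thesis"
    then obtain c where c: "c \<in> A" "1 - c * a \<in> x" using maxidl_inverse[OF A x ab(1)] by blast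
    \<comment> \<open>If \<open>c\<close> inverts \<open>a\<close> modulo \<open>x\<close>, then
      \<open>b\<close> agrees with \<open>c * (a * b)\<close> modulo \<open>x\<close>.\<close>
    have "b = b * (1 - c * a) + c * (a * b)" by (simp add: algebra_simps)
    also have "\<dots> \<in> x" using idlD(3)[OF i idlD(4)[OF i ab(2) c(2)] idlD(4)[OF i c(1) ab(3)]] .
    finally show False using n by simp
  qed
qed

text \<open>The ascending chain condition takes the place of Zorn's lemma.\<close>

lemma maxidl_exists:
  assumes A: "sring A" and N: "noeth A" and I: "idl A I" "I \<noteq> A"
  obtains x where "maxidl A x" "I \<subseteq> x"
proof -
  obtain M where M: "idl A M" "M \<noteq> A \<and> I \<subseteq> M"
     "\<And>J. idl A J \<Longrightarrow> J \<noteq> A \<and> I \<subseteq> J \<Longrightarrow> M \<subseteq> J \<Longrightarrow> J = M"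
    by (rule noeth_max[OF N I(1), of "\<lambda>J. J \<noteq> A \<and> I \<subseteq> J"]) (use I in auto)
  have "maxidl A M" unfolding maxidl_def using M by blast
  then show ?thesis using that M by blast
qed

section \<open>Smooth real affine curves\<close>

locale curve =
  fixes C :: "'k::field calg" and \<tau> :: "'k \<Rightarrow> 'k"
  assumes curve: "smooth_real_affine_curve C \<tau>"
begin

abbreviation "A \<equiv> carrier C"
abbreviation "\<kappa> \<equiv> cst C"
abbreviation "CP \<equiv> closed_points C"

lemma C_coord: "C = coord A \<kappa>"
  using curve unfolding smooth_real_affine_curve_def by blast

lemma smooth: "smooth_affine_variety C 1"
  using curve unfolding smooth_real_affine_curve_def by blast

lemma sring_A: "sring A"
proof -
  have "domain C" using smooth by (simp add: smooth_affine_variety_def affine_variety_def)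
  then interpret domain C .
  have "cring C" by unfold_locales
  then show ?thesis using sring_of_cring[of A \<kappa>] C_coord by simp
qed

lemmas A_simps = sringD[OF sring_A]

lemma \<kappa>_hom: "\<kappa> \<in> ring_hom point C"
  using smooth by (simp add: smooth_affine_variety_def affine_variety_def calg_hom_def)

lemma point_simps [simp]:
  "carrier point = UNIV" "monoid.mult point = (*)" "one point = 1"
  "ring.zero point = 0" "add point = (+)" "cst point = (\<lambda>z. z)"
  by (simp_all add: point_def id_def)

lemma C_simps: "monoid.mult C = (*)" "one C = 1" "ring.zero C = 0" "add C = (+)"
  by (subst C_coord, simp)+

lemma \<kappa> [simp]:
  "\<kappa> z \<in> A" "\<kappa> (z + w) = \<kappa> z + \<kappa> w" "\<kappa> (z * w) = \<kappa> z * \<kappa> w" "\<kappa> 1 = 1"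
  using \<kappa>_hom by (auto simp: ring_hom_def C_simps)

lemma \<kappa>0 [simp]: "\<kappa> 0 = 0" using \<kappa>(2)[of 0 0] by (metis add.right_neutral add_left_cancel)
lemma \<kappa>_uminus [simp]: "\<kappa> (- z) = - \<kappa> z" using \<kappa>(2)[of z "-z"] by (simp add: eq_neg_iff_add_eq_0 add.commute)
lemma \<kappa>_diff [simp]: "\<kappa> (z - w) = \<kappa> z - \<kappa> w" using \<kappa>(2)[of z "-w"] by simp
lemma \<kappa>_eq0 [simp]: "\<kappa> z = 0 \<longleftrightarrow> z = 0"
proof
  assume "\<kappa> z = 0"
  show "z = 0"
  proof (rule ccontr)
    assume "z \<noteq> 0"
    then have "\<kappa> z * \<kappa> (inverse z) = 1" by (simp flip: \<kappa>(3))
    then show False using \<open>\<kappa> z = 0\<close> by simp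
  qed
qed simp
lemma \<kappa>_inverse: "\<kappa> (inverse z) = inverse (\<kappa> z)"
proof (cases "z = 0")
  case False
  then have "\<kappa> z * \<kappa> (inverse z) = 1" by (simp flip: \<kappa>(3))
  then show ?thesis by (metis inverse_unique)
qed simp

text \<open>The ring produced by the basis theorem is \<open>A\<close> itself: leastness gives one
  inclusion, induction over the generated ring the other.\<close>

lemma noeth_A: "noeth A"
proof -
  obtain F where F: "finite F" "F \<subseteq> A" "generate_ring C (range \<kappa> \<union> F) = A"
    using smooth by (auto simp: smooth_affine_variety_def affine_variety_def)
  have 1: "sring (range \<kappa>)"
    unfolding sring_def
  proof (intro conjI ballI)
    show "0 \<in> range \<kappa>" "1 \<in> range \<kappa>" by (metis \<kappa>0 rangeI) (metis \<kappa>(4) rangeI)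
  qed (auto simp flip: \<kappa> \<kappa>_uminus)
  have 2: "inverse (\<kappa> z) \<in> range \<kappa>" for z by (auto simp flip: \<kappa>_inverse)
  obtain R where R: "sring R" "noeth R" "range \<kappa> \<union> F \<subseteq> R" "\<forall>B. sring B \<longrightarrow> range \<kappa> \<union> F \<subseteq> B \<longrightarrow> R \<subseteq> B"
    using noeth_finitely_generated[OF 1 2 F(1)] by blast
  have "R \<subseteq> A" using R(4) sring_A F(2) by auto
  moreover have "a \<in> R" if "a \<in> generate_ring C (range \<kappa> \<union> F)" for a
    using that
  proof induction
    case one then show ?case using sringD[OF R(1)] C_simps by simp
  next
    case (incl h) then show ?case using R by blast
  next
    case (a_inv h)
    then have "h \<in> A" using \<open>R \<subseteq> A\<close> by auto
    then have "\<ominus>\<^bsub>C\<^esub> h = - h" using coord_a_inv[OF sring_A, of h \<kappa>] C_coord by simp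
    then show ?case using a_inv sringD[OF R(1)] by simp
  next
    case (eng_add h1 h2) then show ?case using sringD[OF R(1)] C_simps by simp
  next
    case (eng_mult h1 h2) then show ?case using sringD[OF R(1)] C_simps by simp
  qed
  ultimately have "R = A" using F(3) by blast
  then show ?thesis using R by simp
qed

lemma ideal_C: "ideal I C \<longleftrightarrow> idl A I" using ideal_coord[OF sring_A] C_coord by metis
lemma prime_C: "primeideal I C \<longleftrightarrow> primeidl A I" using primeideal_coord[OF sring_A] C_coord by metis
lemma CP: "x \<in> CP \<longleftrightarrow> maxidl A x"
  using closed_points_coord[OF sring_A] C_coord by (metis mem_Collect_eq)

lemma zero_prime: "primeidl A {0}"
proof -
  have "A \<noteq> {0}" using A_simps(2) by (metis singletonD zero_neq_one)
  then show ?thesis by (auto simp: primeidl_def idl_def A_simps(1))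
qed

lemma chain: "\<exists>P. prime_chain C 1 P" "\<not> (\<exists>P. prime_chain C 2 P)"
  using smooth by (auto simp: smooth_affine_variety_def krull_dim_def numeral_2_eq_2)

text \<open>A nonzero prime strictly below a maximal ideal would give a chain of three primes,
  against dimension one.\<close>

lemma prime_max: assumes P: "primeidl A P" "P \<noteq> {0}" shows "P \<in> CP"
proof -
  have i: "idl A P" using P by (simp add: primeidl_def)
  obtain x where x: "maxidl A x" "P \<subseteq> x"
    using maxidl_exists[OF sring_A noeth_A i] P by (auto simp: primeidl_def)
  have "P = x"
  proof (rule ccontr)
    assume ne: "P \<noteq> x"
    define Q where "Q = (\<lambda>i::nat. if i = 0 then {0} else if i = 1 then P else x)"
    have "prime_chain C 2 Q"
      unfolding prime_chain_def
    proof (intro conjI allI impI)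
      fix i :: nat assume "i \<le> 2"
      show "primeideal (Q i) C"
        using zero_prime P(1) maxidl_prime[OF sring_A x(1)] by (auto simp: Q_def prime_C)
    next
      fix i :: nat assume "i < 2"
      then have "i = 0 \<or> i = 1" by auto
      then show "Q i \<subset> Q (Suc i)" using idlD(2)[OF i] P(2) ne x(2) by (auto simp: Q_def)
    qed
    then show False using chain by blast
  qed
  then show ?thesis using x CP by simp
qed

text \<open>If the zero ideal were maximal, it would be the only proper ideal, which leaves no room
  for a chain of two primes.\<close>

lemma CP_nonzero: assumes "x \<in> CP" obtains a where "a \<in> x" "a \<noteq> 0"
proof -
  have x: "maxidl A x" using assms CP by simp
  have "x \<noteq> {0}"
  proof
    assume x0: "x = {0}"
    obtain P where P: "prime_chain C 1 P" using chain by blast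
    then have p: "primeidl A (P 0)" "primeidl A (P 1)" "P 0 \<subset> P 1" by (auto simp: prime_chain_def prime_C)
    then have "idl A (P 1)" "P 1 \<noteq> A" "idl A (P 0)" by (auto simp: primeidl_def)
    then have "P 1 = {0}" using x idlD(2)[of A "P 1"] unfolding maxidl_def x0 by blast
    then show False using p(3) idlD(2)[OF \<open>idl A (P 0)\<close>] by auto
  qed
  then show ?thesis using that x idlD(2)[of A x] unfolding maxidl_def by blast
qed

text \<open>Among the ideals that contain \<open>a\<close> and lie in infinitely many closed points,
  a maximal one \<open>M\<close> is prime: for \<open>p * q\<close> in \<open>M\<close>, the points
  over \<open>M\<close> split into those containing \<open>p\<close> and those containing
  \<open>q\<close>. Being nonzero, \<open>M\<close> is itself a closed point and lies in no other
  one.\<close>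

lemma finite_zeros: assumes a: "a \<in> A" "a \<noteq> 0" shows "finite {x \<in> CP. a \<in> x}"
proof (rule ccontr)
  assume inf: "infinite {x \<in> CP. a \<in> x}"
  let ?I = "{u + b * a | u b. u \<in> {0} \<and> b \<in> A}"
  let ?P = "\<lambda>I. a \<in> I \<and> infinite {x \<in> CP. I \<subseteq> x}"
  have 0: "idl A {0}" using zero_prime by (simp add: primeidl_def)
  have "?P ?I"
  proof
    show "a \<in> ?I" using idl_sum[OF sring_A 0 a(1)] by blast
    have "{x \<in> CP. ?I \<subseteq> x} = {x \<in> CP. a \<in> x}"
    proof (intro Collect_cong conj_cong refl iffI)
      fix x assume x: "x \<in> CP"
      show "a \<in> x" if "?I \<subseteq> x" using that \<open>a \<in> ?I\<close> by blast
      assume "a \<in> x" then show "?I \<subseteq> x" using x idlD(4)[of A x] by (auto simp: CP maxidl_def)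
    qed
    then show "infinite {x \<in> CP. ?I \<subseteq> x}" using inf by simp
  qed
  then obtain M where M: "idl A M" "?P M" "\<And>J. idl A J \<Longrightarrow> ?P J \<Longrightarrow> M \<subseteq> J \<Longrightarrow> J = M"
    by (rule noeth_max[OF noeth_A idl_sum(1)[OF sring_A 0 a(1)], of ?P]) auto
  have "primeidl A M" unfolding primeidl_def
  proof (intro conjI ballI impI)
    show "idl A M" by fact
    show "M \<noteq> A"
    proof
      assume "M = A"
      have "\<not> A \<subseteq> x" if "x \<in> CP" for x using that idlD(1)[of A x] unfolding CP maxidl_def by blast
      then have "{x \<in> CP. M \<subseteq> x} = {}" using \<open>M = A\<close> by blast
      then show False using M(2) by (metis finite.emptyI)
    qed
    fix p q assume pq: "p \<in> A" "q \<in> A" "p * q \<in> M"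
    show "p \<in> M \<or> q \<in> M"
    proof (rule ccontr)
      assume n: "\<not> ?thesis"
      \<comment> \<open>As \<open>M\<close> is maximal, enlarging it by \<open>r\<close> must
        destroy infiniteness.\<close>
      have fin: "finite {x \<in> CP. M \<subseteq> x \<and> r \<in> x}" if r: "r \<in> A" "r \<notin> M" for r
      proof (rule ccontr)
        assume i: "infinite {x \<in> CP. M \<subseteq> x \<and> r \<in> x}"
        let ?J = "{u + b * r | u b. u \<in> M \<and> b \<in> A}"
        note J = idl_sum[OF sring_A M(1) r(1)]
        have "{x \<in> CP. M \<subseteq> x \<and> r \<in> x} \<subseteq> {x \<in> CP. ?J \<subseteq> x}"
        proof safe
          fix x u b assume x: "x \<in> CP" "M \<subseteq> x" "r \<in> x" "u \<in> M" "b \<in> A"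
          then have i: "idl A x" by (auto simp: CP maxidl_def)
          show "u + b * r \<in> x" using idlD(3)[OF i subsetD[OF x(2,4)] idlD(4)[OF i x(5,3)]] .
        qed
        then have "infinite {x \<in> CP. ?J \<subseteq> x}" using i infinite_super by blast
        moreover have "a \<in> ?J" using M(2) J(2) by blast
        ultimately have "?J = M" using M(3)[OF J(1)] J(2) by blast
        then show False using J(3) r by blast
      qed
      have "{x \<in> CP. M \<subseteq> x} \<subseteq> {x \<in> CP. M \<subseteq> x \<and> p \<in> x} \<union> {x \<in> CP. M \<subseteq> x \<and> q \<in> x}"
        using pq maxidl_prime[OF sring_A] unfolding primeidl_def CP by blast
      then show False using M(2) fin n pq by (meson finite_UnI finite_subset)
    qed
  qed
  moreover have "M \<noteq> {0}" using M(2) a by auto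
  ultimately have "M \<in> CP" by (rule prime_max)
  then have "x = M" if "x \<in> CP" "M \<subseteq> x" for x using that unfolding CP maxidl_def by blast
  then have "{x \<in> CP. M \<subseteq> x} \<subseteq> {M}" by blast
  then show False using M(2) finite_subset by blast
qed


lemma fraction_field: obtains a b where "a \<in> A" "b \<in> A" "b \<noteq> 0" "f = a / b"
  using curve unfolding smooth_real_affine_curve_def by blast

lemma CP_D:
  assumes "x \<in> CP"
  shows "idl A x" "1 \<notin> x" "\<And>a b. a \<in> A \<Longrightarrow> b \<in> A \<Longrightarrow> a * b \<in> x \<Longrightarrow> a \<in> x \<or> b \<in> x"
    "x \<subseteq> A" "0 \<in> x" "\<And>a b. a \<in> x \<Longrightarrow> b \<in> x \<Longrightarrow> a + b \<in> x"
    "\<And>a b. a \<in> A \<Longrightarrow> b \<in> x \<Longrightarrow> a * b \<in> x" "\<And>a b. a \<in> A \<Longrightarrow> b \<in> x \<Longrightarrow> b * a \<in> x"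
    "\<And>a b. a \<in> x \<Longrightarrow> b \<in> x \<Longrightarrow> a - b \<in> x" "\<And>a. a \<in> x \<Longrightarrow> - a \<in> x"
proof -
  have m: "maxidl A x" using assms CP by simp
  show i: "idl A x" using m by (simp add: maxidl_def)
  show "1 \<notin> x" using maxidl_one[OF sring_A m] .
  show "a \<in> A \<Longrightarrow> b \<in> A \<Longrightarrow> a * b \<in> x \<Longrightarrow> a \<in> x \<or> b \<in> x" for a b
    using maxidl_prime[OF sring_A m] by (simp add: primeidl_def)
qed (use idlD[of A x] idl_minus[OF sring_A, of x] assms in \<open>auto simp: CP maxidl_def\<close>)

section \<open>From the cotangent space to uniformizers\<close>

definition sq :: "'k set \<Rightarrow> 'k set" where "sq x = ideal_prod C x x"

lemma sq:
  assumes x: "x \<in> CP"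
  shows "idl A (sq x)" "\<And>a b. a \<in> x \<Longrightarrow> b \<in> x \<Longrightarrow> a * b \<in> sq x"
    "\<And>Q. idl A Q \<Longrightarrow> (\<And>a b. a \<in> x \<Longrightarrow> b \<in> x \<Longrightarrow> a * b \<in> Q) \<Longrightarrow> sq x \<subseteq> Q"
proof -
  interpret ring C using cring_coord[OF sring_A] C_coord by (metis cring_def)
  have "ideal x C" using CP_D(1)[OF x] ideal_C by simp
  then show "idl A (sq x)" using ideal_prod_is_ideal[of x x] ideal_C unfolding sq_def by blast
  show "\<And>a b. a \<in> x \<Longrightarrow> b \<in> x \<Longrightarrow> a * b \<in> sq x"
    unfolding sq_def using ideal_prod.prod[of _ x _ x C] by (simp add: C_simps)
  fix Q assume Q: "idl A Q" "\<And>a b. a \<in> x \<Longrightarrow> b \<in> x \<Longrightarrow> a * b \<in> Q"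
  have "a \<in> Q" if "a \<in> ideal_prod C x x" for a
    using that by induction (use Q idlD[OF Q(1)] in \<open>auto simp: C_simps\<close>)
  then show "sq x \<subseteq> Q" by (auto simp: sq_def)
qed

lemma cotangent:
  assumes x: "x \<in> CP"
  obtains v where "v \<in> x" "v \<notin> sq x" "\<And>a. a \<in> x \<Longrightarrow> \<exists>z. a - \<kappa> z * v \<in> sq x"
proof -
  have "cotangent_dim C x 1" using smooth x by (simp add: smooth_affine_variety_def)
  then obtain v where v: "v (0::nat) \<in> x" and
    e: "\<And>a. a \<in> x \<Longrightarrow> \<exists>!k. (\<forall>i\<ge>1. k i = 0) \<and>
          a \<ominus>\<^bsub>C\<^esub> finsum C (\<lambda>i. cst C (k i) \<otimes>\<^bsub>C\<^esub> v i) {..<1} \<in> ideal_prod C x x"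
    by (auto simp: cotangent_dim_def)
  note s = A_simps
  have vA: "v 0 \<in> A" using v CP_D(4)[OF x] by auto
  have eq: "a \<ominus>\<^bsub>C\<^esub> finsum C (\<lambda>i. cst C (k i) \<otimes>\<^bsub>C\<^esub> v i) {..<1} = a - \<kappa> (k 0) * v 0" if "a \<in> x" for a k
  proof -
    have 1: "\<kappa> (k 0) * v 0 \<in> A" using s vA by simp
    have "finsum C (\<lambda>i. cst C (k i) \<otimes>\<^bsub>C\<^esub> v i) {..<1} = \<kappa> (k 0) * v 0"
      using coord_finsum[OF sring_A, of "{..<1::nat}" "\<lambda>i. \<kappa> (k i) * v i" \<kappa>] 1 C_coord by (simp add: C_simps)
    then show ?thesis using coord_a_minus[OF sring_A 1, of \<kappa> a] C_coord by simp
  qed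
  show ?thesis
  proof (rule that[OF v])
    fix a assume a: "a \<in> x"
    show "\<exists>z. a - \<kappa> z * v 0 \<in> sq x" using e[OF a] eq[OF a] sq_def by auto
  next
    show "v 0 \<notin> sq x"
    proof
      assume v2: "v 0 \<in> sq x"
      have z: "0 \<in> x" by (rule CP_D(5)[OF x])
      have neg: "- v 0 \<in> sq x" using idl_minus(1)[OF sring_A sq(1)[OF x] v2] .
      have u: "\<exists>!k::nat \<Rightarrow> complex. (\<forall>i\<ge>1. k i = 0) \<and> - (\<kappa> (k 0) * v 0) \<in> sq x"
        using e[OF z] unfolding eq[OF z] by (simp add: sq_def)
      have uniq: "P a \<Longrightarrow> P b \<Longrightarrow> a = b" if "\<exists>!k. P k" for P and a b :: "nat \<Rightarrow> complex" using that by blast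
      \<comment> \<open>Were \<open>v 0\<close> in the square, the coefficients 0 and 1 would both
        represent the zero vector, against uniqueness.\<close>
      have "(\<lambda>i. 0) = (\<lambda>i::nat. if i = 0 then 1 else 0 :: complex)"
        by (rule uniq[OF u]) (use neg idlD(2)[OF sq(1)[OF x]] in auto)
      then show False by (metis zero_neq_one)
    qed
  qed
qed

text \<open>This replaces the Nullstellensatz. Multiplication by \<open>a\<close> on the line
  \<open>x / x^2\<close> is a scalar \<open>z\<close>; if \<open>a - z\<close> were invertible
  modulo \<open>x\<close>, it could not kill the generator \<open>v\<close> of that line.\<close>

lemma residue: assumes x: "x \<in> CP" and a: "a \<in> A" shows "\<exists>z. a - \<kappa> z \<in> x"
proof -
  obtain v where v: "v \<in> x" "v \<notin> sq x" "\<And>a. a \<in> x \<Longrightarrow> \<exists>z. a - \<kappa> z * v \<in> sq x"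
    using cotangent[OF x] by blast
  have "a * v \<in> x" using CP_D(7)[OF x a v(1)] .
  then obtain z where z: "a * v - \<kappa> z * v \<in> sq x" using v(3) by blast
  have "a - \<kappa> z \<in> x"
  proof (rule ccontr)
    assume n: "a - \<kappa> z \<notin> x"
    have az: "a - \<kappa> z \<in> A" using a A_simps by auto
    obtain b where b: "b \<in> A" "1 - b * (a - \<kappa> z) \<in> x"
      using maxidl_inverse[OF sring_A _ az n] x CP by blast
    have "v = (1 - b * (a - \<kappa> z)) * v + b * (a * v - \<kappa> z * v)" by (simp add: algebra_simps)
    also have "\<dots> \<in> sq x" using idlD(3)[OF sq(1)[OF x] sq(2)[OF x b(2) v(1)] idlD(4)[OF sq(1)[OF x] b(1) z]] .
    finally show False using v(2) by simp
  qed
  then show ?thesis ..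
qed

abbreviation "lr \<equiv> local_ring C"

text \<open>The maximal ideal of the local ring, in the form in which it occurs in
  \<open>uniformizer\<close>.\<close>

definition mx :: "'k set \<Rightarrow> 'k set" where "mx x = {a / b | a b. a \<in> x \<and> b \<in> A - x}"

lemma lrI: "a \<in> A \<Longrightarrow> b \<in> A \<Longrightarrow> b \<notin> x \<Longrightarrow> a / b \<in> lr x" by (auto simp: local_ring_def)

lemma A_lr: assumes "x \<in> CP" shows "A \<subseteq> lr x"
  using CP_D(2)[OF assms] A_simps(2) lrI[of _ 1 x] by auto

lemma nx: assumes "x \<in> CP" "b \<in> A - x" "d \<in> A - x" shows "b * d \<in> A - x" "b \<noteq> 0"
  using CP_D[OF assms(1)] assms A_simps by auto

lemma sring_lr: assumes x: "x \<in> CP" shows "sring (lr x)"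
  unfolding sring_def
proof (intro conjI ballI)
  show "0 \<in> lr x" "1 \<in> lr x" using A_lr[OF x] A_simps by auto
  fix f assume "f \<in> lr x"
  then obtain a b where f: "f = a / b" "a \<in> A" "b \<in> A - x" by (auto simp: local_ring_def)
  show "- f \<in> lr x" using lrI[of "-a" b x] f A_simps by auto
  fix g assume "g \<in> lr x"
  then obtain c d where g: "g = c / d" "c \<in> A" "d \<in> A - x" by (auto simp: local_ring_def)
  have nz: "b \<noteq> 0" "d \<noteq> 0" using nx(2)[OF x] f g by auto
  have bd: "b * d \<in> A - x" using nx(1)[OF x f(3) g(3)] .
  have "f + g = (a * d + c * b) / (b * d)" "f * g = (a * c) / (b * d)"
    using f(1) g(1) nz by (auto simp: field_simps)
  then show "f + g \<in> lr x" "f * g \<in> lr x" using lrI bd A_simps f g by auto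
qed

lemma lr_cases: assumes x: "x \<in> CP" and f: "f \<in> lr x" shows "f \<in> mx x \<or> f \<noteq> 0 \<and> inverse f \<in> lr x"
proof -
  obtain a b where f: "f = a / b" "a \<in> A" "b \<in> A - x" using f by (auto simp: local_ring_def)
  show ?thesis
  proof (cases "a \<in> x")
    case True then show ?thesis using f by (auto simp: mx_def)
  next
    case False
    then have "a \<noteq> 0" "b \<noteq> 0" using nx(2)[OF x] f by auto
    then show ?thesis using f lrI[of b a x] False by (auto simp: field_simps)
  qed
qed

lemma A_mx: assumes x: "x \<in> CP" and a: "a \<in> A" shows "a \<in> mx x \<longleftrightarrow> a \<in> x"
proof
  assume "a \<in> mx x"
  then obtain c d where c: "a = c / d" "c \<in> x" "d \<in> A - x" by (auto simp: mx_def)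
  then have "a * d = c" using nx(2)[OF x c(3) c(3)] by auto
  then show "a \<in> x" using CP_D(3)[OF x a, of d] c by auto
next
  assume "a \<in> x" then show "a \<in> mx x" using A_simps(2) CP_D(2)[OF x] by (force simp: mx_def)
qed

lemma idl_mx: assumes x: "x \<in> CP" shows "idl (lr x) (mx x)"
  unfolding idl_def
proof (intro conjI ballI)
  show "mx x \<subseteq> lr x" using CP_D(4)[OF x] by (auto simp: mx_def local_ring_def)
  show "0 \<in> mx x" using A_mx[OF x] A_simps CP_D(5)[OF x] by auto
  fix f g assume "g \<in> mx x"
  then obtain c d where g: "g = c / d" "c \<in> x" "d \<in> A - x" by (auto simp: mx_def)
  have cA: "c \<in> A" using CP_D(4)[OF x] g by auto
  { assume "f \<in> mx x"
    then obtain a b where f: "f = a / b" "a \<in> x" "b \<in> A - x" by (auto simp: mx_def)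
    have nz: "b \<noteq> 0" "d \<noteq> 0" using nx(2)[OF x] f g by auto
    have "f + g = (a * d + c * b) / (b * d)" using f(1) g(1) nz by (auto simp: field_simps)
    moreover have "a * d + c * b \<in> x" using CP_D(6)[OF x CP_D(8)[OF x _ f(2)] CP_D(8)[OF x _ g(2)]] f g by simp
    ultimately show "f + g \<in> mx x" using nx(1)[OF x f(3) g(3)] unfolding mx_def by blast }
  { assume "f \<in> lr x"
    then obtain a b where f: "f = a / b" "a \<in> A" "b \<in> A - x" by (auto simp: local_ring_def)
    have nz: "b \<noteq> 0" "d \<noteq> 0" using nx(2)[OF x] f g by auto
    have "f * g = (a * c) / (b * d)" using f(1) g(1) nz by (auto simp: field_simps)
    moreover have "a * c \<in> x" using CP_D(7)[OF x f(2) g(2)] .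
    ultimately show "f * g \<in> mx x" using nx(1)[OF x f(3) g(3)] unfolding mx_def by blast }
qed

lemma mx_one: assumes x: "x \<in> CP" shows "1 \<notin> mx x"
  using A_mx[OF x A_simps(2)] CP_D(2)[OF x] by simp

text \<open>
  Nakayama's lemma for \<open>x / x^2\<close>, in the noetherian form: an ideal between \<open>v A\<close> and \<open>x\<close> that is
  saturated and maximal among the proper ones cannot exist.
\<close>

lemma uniformizer_ex:
  assumes x: "x \<in> CP" obtains v where "uniformizer C x v" "v \<in> x" "v \<noteq> 0"
proof -
  obtain v where v: "v \<in> x" "v \<notin> sq x" "\<And>a. a \<in> x \<Longrightarrow> \<exists>z. a - \<kappa> z * v \<in> sq x"
    using cotangent[OF x] by blast
  note i = CP_D[OF x]
  have vA: "v \<in> A" using v i by auto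
  \<comment> \<open>The contraction to \<open>A\<close> of the extension of \<open>Q\<close> to the
    local ring at \<open>x\<close>.\<close>
  define sat where "sat Q = {a \<in> A. \<exists>s\<in>A - x. s * a \<in> Q}" for Q
  have sat: "idl A (sat Q)" "Q \<subseteq> sat Q" "sat (sat Q) = sat Q" "Q \<subseteq> x \<Longrightarrow> sat Q \<subseteq> x" if Q: "idl A Q" for Q
  proof -
    note q = idlD[OF Q]
    show 2: "Q \<subseteq> sat Q" using q(1) A_simps(2) i(2) by (force simp: sat_def)
    show "idl A (sat Q)" unfolding idl_def
    proof (intro conjI ballI)
      show "sat Q \<subseteq> A" "0 \<in> sat Q" using 2 q(2) by (auto simp: sat_def)
      fix a b assume "b \<in> sat Q"
      then obtain t where b: "b \<in> A" "t \<in> A - x" "t * b \<in> Q" by (auto simp: sat_def)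
      { assume "a \<in> sat Q"
        then obtain s where a: "a \<in> A" "s \<in> A - x" "s * a \<in> Q" by (auto simp: sat_def)
        have "(s * t) * (a + b) = t * (s * a) + s * (t * b)" by (simp add: algebra_simps)
        also have "\<dots> \<in> Q" using q(3)[OF q(4)[OF _ a(3)] q(4)[OF _ b(3)]] a(2) b(2) by simp
        finally show "a + b \<in> sat Q" using nx(1)[OF x a(2) b(2)] a b A_simps by (auto simp: sat_def) }
      { assume a: "a \<in> A"
        have "t * (a * b) = a * (t * b)" by (simp add: algebra_simps)
        also have "\<dots> \<in> Q" using q(4)[OF a b(3)] .
        finally show "a * b \<in> sat Q" using a b A_simps by (auto simp: sat_def) }
    qed
    show "sat (sat Q) = sat Q"
    proof
      show "sat Q \<subseteq> sat (sat Q)" using A_simps(2) i(2) by (force simp: sat_def)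
      show "sat (sat Q) \<subseteq> sat Q"
      proof
        fix a assume "a \<in> sat (sat Q)"
        then obtain s t where "a \<in> A" "s \<in> A - x" "t \<in> A - x" "t * (s * a) \<in> Q" by (auto simp: sat_def)
        then show "a \<in> sat Q" using nx(1)[OF x, of t s] unfolding sat_def
          by (auto intro!: bexI[of _ "t * s"] simp: mult.assoc)
      qed
    qed
    show "sat Q \<subseteq> x" if "Q \<subseteq> x" using that i(3) by (force simp: sat_def)
  qed
  let ?V = "{u + b * v | u b. u \<in> {0} \<and> b \<in> A}"
  have V: "idl A ?V" "v \<in> ?V" using idl_sum(1,3)[OF sring_A _ vA, of "{0}"] zero_prime
    by (auto simp: primeidl_def)
  have Vx: "?V \<subseteq> x" using i(7) v(1) by auto
  have "sat ?V = x"
  proof (rule ccontr)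
    assume ne: "sat ?V \<noteq> x"
    let ?P = "\<lambda>Q. ?V \<subseteq> Q \<and> Q \<subseteq> x \<and> Q \<noteq> x \<and> sat Q = Q"
    have "?P (sat ?V)" using sat[OF V(1)] Vx ne by auto
    then obtain Q where Q: "idl A Q" "?P Q" "\<And>J. idl A J \<Longrightarrow> ?P J \<Longrightarrow> Q \<subseteq> J \<Longrightarrow> J = Q"
      by (rule noeth_max[OF noeth_A sat(1)[OF V(1)], of ?P]) blast
    note q = idlD[OF Q(1)]
    note QV = Q(2)[THEN conjunct1] Q(2)[THEN conjunct2, THEN conjunct1]
      Q(2)[THEN conjunct2, THEN conjunct2, THEN conjunct1] Q(2)[THEN conjunct2, THEN conjunct2, THEN conjunct2]
    have ex: "\<exists>a\<in>x. a \<notin> Q" using QV(2,3) by blast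
    then obtain a where a: "a \<in> x" "a \<notin> Q" by blast
    have aA: "a \<in> A" using a i by auto
    \<comment> \<open>By maximality of \<open>Q\<close>, any further element of \<open>x\<close>
      generates \<open>x\<close> together with \<open>Q\<close>, up to saturation.\<close>
    have full: "sat {u + b * a' | u b. u \<in> Q \<and> b \<in> A} = x" if a': "a' \<in> x" "a' \<notin> Q" for a'
    proof (rule ccontr)
      have a'A: "a' \<in> A" using a' i by auto
      let ?J = "{u + b * a' | u b. u \<in> Q \<and> b \<in> A}"
      note J = idl_sum[OF sring_A Q(1) a'A]
      have Jx: "?J \<subseteq> x" using QV(2) i(6)[OF _ i(7)[OF _ a'(1)]] by blast
      assume n: "sat ?J \<noteq> x"
      have QJ: "Q \<subseteq> sat ?J" by (rule subset_trans[OF J(2) sat(2)[OF J(1)]])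
      have "?V \<subseteq> sat ?J" by (rule subset_trans[OF QV(1) QJ])
      then have "?P (sat ?J)" using sat(3)[OF J(1)] sat(4)[OF J(1) Jx] n by simp
      then have "sat ?J = Q" using Q(3)[OF sat(1)[OF J(1)] _ QJ] by simp
      then show False using subsetD[OF sat(2)[OF J(1)] J(3)] a' by simp
    qed
    let ?R = "sat {u + b * a | u b. u \<in> Q \<and> b \<in> x}"
    let ?W = "{u + b * a | u b. u \<in> Q \<and> b \<in> x}"
    have R0: "idl A ?W" unfolding idl_def
    proof (intro conjI ballI)
      show "?W \<subseteq> A" using q(1) A_simps(3,4) aA i(4) by (auto simp: subset_eq)
      show "0 \<in> ?W" using q(2) i(5) by (intro CollectI exI[of _ 0]) auto
      fix c d assume "d \<in> ?W"
      then obtain u' b' where d: "d = u' + b' * a" "u' \<in> Q" "b' \<in> x" by auto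
      { assume "c \<in> ?W"
        then obtain u b where c: "c = u + b * a" "u \<in> Q" "b \<in> x" by auto
        have "c + d = (u + u') + (b + b') * a" using c d by (simp add: algebra_simps)
        then show "c + d \<in> ?W" using q(3)[OF c(2) d(2)] i(6)[OF c(3) d(3)] by blast }
      { assume c: "c \<in> A"
        have "c * d = c * u' + (c * b') * a" using d by (simp add: algebra_simps)
        then show "c * d \<in> ?W" using q(4)[OF c d(2)] i(7)[OF c d(3)] by blast }
    qed
    have QR: "Q \<subseteq> ?R"
    proof
      fix u assume "u \<in> Q"
      then have "u \<in> ?W" using i(5) by (intro CollectI exI[of _ u] exI[of _ 0]) auto
      then show "u \<in> ?R" using sat(2)[OF R0] by blast
    qed
    \<comment> \<open>Write \<open>s * c = u + b * a\<close> and multiply by \<open>d\<close> in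
      \<open>x\<close>: the coefficient of \<open>a\<close> becomes \<open>b * d\<close>, which lies
      in \<open>x\<close>.\<close>
    have "sq x \<subseteq> ?R"
    proof (rule sq(3)[OF x sat(1)[OF R0]])
      fix c d assume cd: "c \<in> x" "d \<in> x"
      then have "c \<in> sat {u + b * a | u b. u \<in> Q \<and> b \<in> A}" using full[OF a] by simp
      then obtain s where s0: "s \<in> A - x" "s * c \<in> {u + b * a | u b. u \<in> Q \<and> b \<in> A}" unfolding sat_def by blast
      then obtain u b where s: "s \<in> A - x" "s * c = u + b * a" "u \<in> Q" "b \<in> A" by blast
      have "s * (c * d) = d * (s * c)" by (simp add: mult_ac)
      also have "\<dots> = d * u + (b * d) * a" by (subst s(2)) (simp add: algebra_simps)
      finally have "s * (c * d) = d * u + (b * d) * a" .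
      moreover have "d * u \<in> Q" "b * d \<in> x" using q(4)[OF subsetD[OF i(4) cd(2)] s(3)] i(7)[OF s(4) cd(2)] .
      ultimately have "s * (c * d) \<in> ?W" by blast
      moreover have "c * d \<in> A" using cd i(4) A_simps(4) by auto
      ultimately show "c * d \<in> ?R" using s(1) unfolding sat_def by blast
    qed
    moreover obtain z where "a - \<kappa> z * v \<in> sq x" using v(3)[OF a(1)] by blast
    moreover have "\<kappa> z * v \<in> ?R"
    proof (rule idlD(4)[OF sat(1)[OF R0] \<kappa>(1)])
      have "v \<in> Q" by (rule subsetD[OF QV(1) V(2)])
      then show "v \<in> ?R" by (rule subsetD[OF QR])
    qed
    \<comment> \<open>Locally \<open>a\<close> thus lies in \<open>Q + x a\<close>; moving its
      coefficient \<open>b\<close> to the left leaves \<open>(s - b) * a\<close> in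
      \<open>Q\<close>, with \<open>s - b\<close> outside \<open>x\<close>.\<close>
    ultimately have "(a - \<kappa> z * v) + \<kappa> z * v \<in> ?R" by (intro idlD(3)[OF sat(1)[OF R0]]) (erule subsetD)
    then have "a \<in> ?R" by simp
    then obtain s where s0: "s \<in> A - x" "s * a \<in> ?W" unfolding sat_def by blast
    then obtain u b where s: "s \<in> A - x" "s * a = u + b * a" "u \<in> Q" "b \<in> x" by blast
    have "(s - b) * a \<in> Q" using s by (simp add: algebra_simps)
    moreover have "s - b \<in> A - x"
    proof -
      have "s - b \<notin> x" using i(6)[of "s - b" b] s(1,4) by auto
      then show ?thesis using s i(4) A_simps by auto
    qed
    ultimately have "a \<in> sat Q" using aA by (auto simp: sat_def)
    then show False using QV(4) a by simp
  qed
  then have xV: "\<exists>s\<in>A - x. \<exists>b\<in>A. s * a = b * v" if "a \<in> x" for a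
  proof -
    have "a \<in> sat ?V" using that \<open>sat ?V = x\<close> by simp
    then obtain s where "s \<in> A - x" "s * a \<in> ?V" unfolding sat_def by blast
    then show ?thesis by auto
  qed
  have v0: "v \<noteq> 0" using v(2) idlD(2)[OF sq(1)[OF x]] by auto
  have "mx x = (*) v ` lr x"
  proof
    show "(*) v ` lr x \<subseteq> mx x"
      using idlD(5)[OF idl_mx[OF x]] A_mx[OF x vA] v(1) by blast
    show "mx x \<subseteq> (*) v ` lr x"
    proof
      fix f assume "f \<in> mx x"
      then obtain c d where f: "f = c / d" "c \<in> x" "d \<in> A - x" by (auto simp: mx_def)
      obtain s b where s: "s \<in> A - x" "b \<in> A" "s * c = b * v" using xV[OF f(2)] by blast
      have nz: "s \<noteq> 0" "d \<noteq> 0" using nx(2)[OF x s(1) s(1)] nx(2)[OF x f(3) f(3)] .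
      have "f = (s * c) / (s * d)" using f(1) nz by simp
      also have "\<dots> = v * (b / (s * d))" by (subst s(3)) simp
      finally have "f = v * (b / (s * d))" .
      moreover have "b / (s * d) \<in> lr x" using nx(1)[OF x s(1) f(3)] lrI s(2) by auto
      ultimately show "f \<in> (*) v ` lr x" by blast
    qed
  qed
  then have "uniformizer C x v" by (simp add: uniformizer_def mx_def)
  then show ?thesis using that v(1) v0 by blast
qed

end

section \<open>Orders of vanishing\<close>

context curve begin

definition unit_at :: "'k set \<Rightarrow> 'k \<Rightarrow> bool" where
  "unit_at x u \<longleftrightarrow> u \<in> lr x \<and> u \<noteq> 0 \<and> inverse u \<in> lr x"

lemma unit_at:
  assumes x: "x \<in> CP"
  shows "unit_at x 1" "unit_at x u \<Longrightarrow> unit_at x w \<Longrightarrow> unit_at x (u * w)" "unit_at x u \<Longrightarrow> unit_at x (inverse u)"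
    "unit_at x u \<Longrightarrow> u \<notin> mx x" "unit_at x u \<Longrightarrow> unit_at x (u powi n)"
proof -
  note s = sringD[OF sring_lr[OF x]]
  show 1: "unit_at x 1" using s by (auto simp: unit_at_def)
  show 2: "unit_at x u \<Longrightarrow> unit_at x w \<Longrightarrow> unit_at x (u * w)" for u w using s by (auto simp: unit_at_def)
  show 3: "unit_at x u \<Longrightarrow> unit_at x (inverse u)" for u by (auto simp: unit_at_def)
  show "unit_at x u \<Longrightarrow> u \<notin> mx x"
  proof
    assume u: "unit_at x u" "u \<in> mx x"
    then have "inverse u * u \<in> mx x" using idlD(4)[OF idl_mx[OF x]] unit_at_def by blast
    then show False using u mx_one[OF x] by (simp add: unit_at_def)
  qed
  have p: "unit_at x u \<Longrightarrow> unit_at x (u ^ m)" for u m by (induction m) (auto simp: 1 2)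
  show "unit_at x u \<Longrightarrow> unit_at x (u powi n)" using p[of u] p[of "inverse u"] 3 by (auto simp: power_int_def)
qed

text \<open>Each of the two generators of the maximal ideal is a multiple of the other.\<close>

lemma unif_unit: assumes x: "x \<in> CP" and v: "uniformizer C x v" "uniformizer C x w"
  obtains u where "unit_at x u" "w = u * v"
proof -
  note s = sringD[OF sring_lr[OF x]]
  have m: "mx x = (*) v ` lr x" "mx x = (*) w ` lr x" using v by (auto simp: uniformizer_def mx_def)
  have "v * 1 \<in> mx x" "w * 1 \<in> mx x" using m s by blast+
  then have "w \<in> (*) v ` lr x" "v \<in> (*) w ` lr x" using m by (metis mult.right_neutral)+
  then obtain r q where r: "w = v * r" "v = w * q" "r \<in> lr x" "q \<in> lr x" by blast
  obtain a where a: "a \<in> x" "a \<noteq> 0" using CP_nonzero[OF x] by blast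
  then have "a \<in> mx x" using A_mx[OF x] CP_D(4)[OF x] by auto
  then have "v \<noteq> 0" using m(1) a by auto
  then have "r * q = 1" using r by (metis mult.assoc mult_cancel_left2)
  then have "inverse r = q" "r \<noteq> 0" by (auto intro: inverse_unique)
  then have "unit_at x r" using r(3,4) by (simp add: unit_at_def)
  then show ?thesis by (rule that) (simp only: r(1) mult.commute)
qed

lemma unif_D:
  assumes x: "x \<in> CP" and v: "uniformizer C x v"
  shows "v \<noteq> 0" "v \<in> mx x" "mx x = (*) v ` lr x" "v \<in> lr x"
proof -
  show m: "mx x = (*) v ` lr x" using v by (auto simp: uniformizer_def mx_def)
  have "v * 1 \<in> mx x" using m sringD(2)[OF sring_lr[OF x]] by blast
  then show "v \<in> mx x" by simp
  then show "v \<in> lr x" using idlD(1)[OF idl_mx[OF x]] by blast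
  obtain a where a: "a \<in> x" "a \<noteq> 0" using CP_nonzero[OF x] by blast
  then have "a \<in> mx x" using A_mx[OF x] CP_D(4)[OF x] by auto
  then show "v \<noteq> 0" using m a by auto
qed

lemma powi_mx: assumes x: "x \<in> CP" and v: "uniformizer C x v" and "n > 0" shows "v powi n \<in> mx x"
proof -
  note s = sringD[OF sring_lr[OF x]]
  obtain m where "nat n = Suc m" using assms(3) by (metis Suc_pred zero_less_nat_eq)
  then have "v powi n = v ^ m * v" using assms(3) by (simp add: power_int_def)
  then show ?thesis using idlD(4)[OF idl_mx[OF x]] unif_D(2,4)[OF x v] s(7) by metis
qed

text \<open>Different exponents would make a positive power of \<open>v\<close> a unit. Allowing two
  uniformizers makes the definite description in \<open>ord_at\<close> independent of the
  choice.\<close>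

lemma unif_rep_unique:
  assumes x: "x \<in> CP" and v: "uniformizer C x v" "uniformizer C x w" and u: "unit_at x u" "unit_at x u'"
    and eq: "u * v powi n = u' * w powi m"
  shows "n = m"
proof -
  obtain r where r: "unit_at x r" "w = r * v" using unif_unit[OF x v] by blast
  note v0 = unif_D(1)[OF x v(1)]
  have u0: "u \<noteq> 0" "u' \<noteq> 0" using u by (auto simp: unit_at_def)
  let ?q = "u' * r powi m"
  have q: "unit_at x ?q" by (rule unit_at(2)[OF x u(2) unit_at(5)[OF x r(1)]])
  have eq2: "u * v powi n = ?q * v powi m" using eq r by (simp add: power_int_mult_distrib mult.assoc)
  have q0: "?q \<noteq> 0" using q by (auto simp: unit_at_def)
  have a: "v powi (n - m) = inverse u * ?q"
    using eq2 v0 u0 by (simp add: power_int_diff field_simps)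
  have b: "v powi (m - n) = inverse (inverse u * ?q)"
    by (subst a[symmetric]) (simp add: v0 power_int_minus[symmetric])
  have ua: "unit_at x (inverse u * ?q)" by (rule unit_at(2)[OF x unit_at(3)[OF x u(1)] q])
  show ?thesis
  proof (rule ccontr)
    assume "n \<noteq> m"
    then consider "n - m > 0" | "m - n > 0" by linarith
    then show False
    proof cases
      case 1 then show ?thesis using powi_mx[OF x v(1) 1] a unit_at(4)[OF x ua] by simp
    next
      case 2 then show ?thesis using powi_mx[OF x v(1) 2] b unit_at(4)[OF x unit_at(3)[OF x ua]] by simp
    qed
  qed
qed

lemma ord_eqI:
  assumes x: "x \<in> CP" and v: "uniformizer C x v" and u: "unit_at x u"
  shows "ord_at C x (u * v powi n) = n"
  unfolding ord_at_def
proof (rule the_equality)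
  show "\<exists>va ua. uniformizer C x va \<and> ua \<in> lr x \<and> ua \<noteq> 0 \<and> inverse ua \<in> lr x \<and> u * v powi n = ua * va powi n"
    using v u unfolding unit_at_def by blast
  fix m assume "\<exists>va ua. uniformizer C x va \<and> ua \<in> lr x \<and> ua \<noteq> 0 \<and> inverse ua \<in> lr x \<and> u * v powi n = ua * va powi m"
  then show "m = n" using unif_rep_unique[OF x _ v _ u] unfolding unit_at_def by metis
qed

text \<open>Krull's intersection theorem: an element divisible by all powers of \<open>v\<close> gives an ascending chain.\<close>

lemma unif_rep_lr:
  assumes x: "x \<in> CP" and v: "uniformizer C x v" and f: "f \<in> lr x" "f \<noteq> 0"
  obtains u n where "unit_at x u" "f = u * v ^ n"
proof -
  note s = sringD[OF sring_lr[OF x]] and vD = unif_D[OF x v]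
  let ?b = "\<lambda>n. f / v ^ n"
  have "\<exists>n. ?b n \<notin> mx x"
  proof (rule ccontr)
    assume "\<nexists>n. ?b n \<notin> mx x"
    then have bm: "?b n \<in> mx x" for n by blast
    \<comment> \<open>The contraction to \<open>A\<close> of the principal ideal generated by
      \<open>f / v^n\<close> in the local ring; these ideals increase with \<open>n\<close>.\<close>
    define I where "I n = {a \<in> A. a / ?b n \<in> lr x}" for n
    have b0: "?b n \<noteq> 0" for n using f vD by simp
    have idl: "idl A (I n)" for n
      unfolding idl_def
    proof (intro conjI ballI)
      show "I n \<subseteq> A" "0 \<in> I n" using A_simps s by (auto simp: I_def)
      fix a b assume b: "b \<in> I n"
      show "a + b \<in> I n" if "a \<in> I n" using that b s(3)[of "a / ?b n" "b / ?b n"] A_simps(3) unfolding I_def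
        by (simp del: divide_divide_eq_right add: add_divide_distrib)
      show "a * b \<in> I n" if a: "a \<in> A"
        using a b s(4)[of a "b / ?b n"] A_lr[OF x] A_simps(4) unfolding I_def by (auto simp: mult.assoc)
    qed
    have up: "I n \<subseteq> I (Suc n)" for n
    proof
      fix a assume a: "a \<in> I n"
      have "a / ?b (Suc n) = v * (a / ?b n)" by (simp add: field_simps)
      then show "a \<in> I (Suc n)" using a s(4)[OF vD(4), of "a / ?b n"] unfolding I_def by (metis (lifting) mem_Collect_eq)
    qed
    obtain N where N: "\<And>n. n \<ge> N \<Longrightarrow> I n = I N" using noeth_chain[OF noeth_A, of I] idl up by blast
    obtain a d where ad: "?b (Suc N) = a / d" "a \<in> x" "d \<in> A - x" using bm[of "Suc N"] by (auto simp: mx_def)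
    have aA: "a \<in> A" using ad CP_D(4)[OF x] by auto
    have d0: "d \<noteq> 0" using nx(2)[OF x ad(3) ad(3)] .
    have ad': "a = d * ?b (Suc N)" using ad(1) d0 by simp
    then have "a / ?b (Suc N) = d" using b0[of "Suc N"] by (metis nonzero_mult_div_cancel_right)
    then have "a \<in> I (Suc N)" using aA ad A_lr[OF x] by (auto simp: I_def)
    \<comment> \<open>Stationarity puts the generator for \<open>Suc N\<close> into the ideal for
      \<open>N\<close>, which makes \<open>v\<close> invertible.\<close>
    then have "a / ?b N \<in> lr x" using N[of "Suc N"] by (auto simp: I_def)
    moreover have "a / ?b N = d / v" using ad' f(2) by (simp add: field_simps)
    ultimately have "d / v \<in> lr x" by simp
    moreover have "1 / d \<in> lr x" using lrI[of 1 d x] ad(3) A_simps by auto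
    ultimately have "(d / v) * (1 / d) \<in> lr x" using s(4) by blast
    then have "inverse v \<in> lr x" using d0 by (simp add: field_simps)
    then have "unit_at x v" using vD by (auto simp: unit_at_def)
    then show False using unit_at(4)[OF x] vD(2) by blast
  qed
  \<comment> \<open>At the first failure, \<open>f / v^n\<close> is still in the local ring but no
    longer in its maximal ideal, so it is a unit.\<close>
  define n where "n = (LEAST n. ?b n \<notin> mx x)"
  have n: "?b n \<notin> mx x" unfolding n_def by (rule LeastI_ex) fact
  have "?b n \<in> lr x"
  proof (cases n)
    case 0 then show ?thesis using f by simp
  next
    case (Suc m)
    then have "?b m \<in> mx x" using not_less_Least[of m "\<lambda>n. ?b n \<notin> mx x"] unfolding n_def by (metis lessI)
    then obtain r where r: "?b m = v * r" "r \<in> lr x" using vD(3) by auto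
    have "?b n = r" using r(1) vD(1) Suc by (simp add: field_simps)
    then show ?thesis using r by simp
  qed
  then have "unit_at x (?b n)" using lr_cases[OF x] n unfolding unit_at_def by blast
  then show ?thesis using that[of "?b n" n] vD(1) by simp
qed

lemma unif_rep:
  assumes x: "x \<in> CP" and v: "uniformizer C x v" and f: "f \<noteq> 0"
  obtains u where "unit_at x u" "f = u * v powi (ord_at C x f)"
proof -
  obtain a b where ab: "a \<in> A" "b \<in> A" "b \<noteq> 0" "f = a / b" using fraction_field by blast
  then have "a \<noteq> 0" "a \<in> lr x" "b \<in> lr x" using f A_lr[OF x] by auto
  obtain u n where u: "unit_at x u" "a = u * v ^ n" using unif_rep_lr[OF x v \<open>a \<in> lr x\<close> \<open>a \<noteq> 0\<close>] by blast
  obtain w m where w: "unit_at x w" "b = w * v ^ m" using unif_rep_lr[OF x v \<open>b \<in> lr x\<close> ab(3)] by blast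
  have "f = (u * inverse w) * v powi (int n - int m)"
    using ab(4) u w unif_D(1)[OF x v] by (simp add: power_int_diff field_simps)
  moreover have "unit_at x (u * inverse w)" by (rule unit_at(2)[OF x u(1) unit_at(3)[OF x w(1)]])
  ultimately show ?thesis using that ord_eqI[OF x v] by metis
qed

text \<open>\<open>ord_at C x 0\<close> is arbitrary.\<close>

definition vge :: "'k set \<Rightarrow> int \<Rightarrow> 'k \<Rightarrow> bool" where
  "vge x n f \<longleftrightarrow> f = 0 \<or> n \<le> ord_at C x f"

text \<open>Membership in the local ring turns the ultrametric inequalities into closure properties
  of a ring.\<close>

lemma vge_iff:
  assumes x: "x \<in> CP" and v: "uniformizer C x v"
  shows "vge x n f \<longleftrightarrow> f * v powi (- n) \<in> lr x"
proof (cases "f = 0")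
  case True then show ?thesis using sringD(1)[OF sring_lr[OF x]] by (simp add: vge_def)
next
  case False
  obtain u where u: "unit_at x u" "f = u * v powi (ord_at C x f)" using unif_rep[OF x v False] by blast
  note s = sringD[OF sring_lr[OF x]] and v0 = unif_D(1)[OF x v]
  have eq: "f * v powi (- n) = u * v powi (ord_at C x f - n)"
    by (subst u(2)) (simp add: v0 power_int_add[symmetric] mult.assoc)
  show ?thesis
  proof
    assume "vge x n f"
    then have "v powi (ord_at C x f - n) \<in> lr x"
      using False s(7)[OF unif_D(4)[OF x v]] by (simp add: vge_def power_int_def)
    then show "f * v powi (- n) \<in> lr x" unfolding eq using s(4) u unit_at_def by blast
  next
    assume a: "f * v powi (- n) \<in> lr x"
    show "vge x n f"
    proof (rule ccontr)
      assume "\<not> vge x n f"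
      then have "n - ord_at C x f > 0" using False by (simp add: vge_def)
      then have m: "v powi (n - ord_at C x f) \<in> mx x" by (rule powi_mx[OF x v])
      have "u = (f * v powi (- n)) * v powi (n - ord_at C x f)"
        unfolding eq by (simp add: v0 power_int_add[symmetric] mult.assoc)
      also have "\<dots> \<in> mx x" using idlD(4)[OF idl_mx[OF x] a m] .
      finally show False using unit_at(4)[OF x u(1)] by blast
    qed
  qed
qed

lemma vge_simps:
  assumes x: "x \<in> CP"
  shows "vge x n 0" "vge x n f \<Longrightarrow> vge x n g \<Longrightarrow> vge x n (f + g)"
    "vge x n f \<Longrightarrow> vge x m g \<Longrightarrow> vge x (n + m) (f * g)" "vge x n f \<Longrightarrow> m \<le> n \<Longrightarrow> vge x m f"
    "vge x n f \<Longrightarrow> vge x n (- f)" "vge x n f \<Longrightarrow> vge x n g \<Longrightarrow> vge x n (f - g)"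
    "f \<in> lr x \<longleftrightarrow> vge x 0 f" "f \<in> mx x \<longleftrightarrow> vge x 1 f" "a \<in> A \<Longrightarrow> vge x 0 a" "a \<in> A \<Longrightarrow> vge x 1 a \<longleftrightarrow> a \<in> x"
    "(\<And>i. i \<in> S \<Longrightarrow> vge x n (F i)) \<Longrightarrow> vge x n (sum F S)"
proof -
  obtain v where v: "uniformizer C x v" using uniformizer_ex[OF x] by blast
  note s = sringD[OF sring_lr[OF x]] and v0 = unif_D(1)[OF x v] and i = vge_iff[OF x v]
  show 1: "vge x n 0" by (simp add: vge_def)
  show 2: "vge x n f \<Longrightarrow> vge x n g \<Longrightarrow> vge x n (f + g)" for f g
    unfolding i by (simp add: distrib_right s)
  show "vge x n f \<Longrightarrow> vge x m g \<Longrightarrow> vge x (n + m) (f * g)" unfolding i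
  proof -
    assume "f * v powi - n \<in> lr x" "g * v powi - m \<in> lr x"
    then have "(f * v powi - n) * (g * v powi - m) \<in> lr x" by (rule s)
    then show "f * g * v powi - (n + m) \<in> lr x" using v0 by (simp add: power_int_diff power_int_minus field_simps power_int_add)
  qed
  show "vge x n f \<Longrightarrow> m \<le> n \<Longrightarrow> vge x m f" by (auto simp: vge_def)
  show "vge x n f \<Longrightarrow> vge x n (- f)" unfolding i using s(5) by fastforce
  show "vge x n f \<Longrightarrow> vge x n g \<Longrightarrow> vge x n (f - g)" unfolding i by (simp add: left_diff_distrib s)
  show 0: "f \<in> lr x \<longleftrightarrow> vge x 0 f" for f unfolding i by simp
  show 3: "f \<in> mx x \<longleftrightarrow> vge x 1 f" for f
  proof
    assume "f \<in> mx x" then obtain r where "f = v * r" "r \<in> lr x" using unif_D(3)[OF x v] by auto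
    then show "vge x 1 f" unfolding i using v0 by (simp add: power_int_minus field_simps)
  next
    assume "vge x 1 f"
    then have "v * (f * v powi -1) \<in> mx x" unfolding i unif_D(3)[OF x v] by blast
    then show "f \<in> mx x" using v0 by (simp add: power_int_minus field_simps)
  qed
  show "a \<in> A \<Longrightarrow> vge x 0 a" using A_lr[OF x] 0 by blast
  show "a \<in> A \<Longrightarrow> vge x 1 a \<longleftrightarrow> a \<in> x" using A_mx[OF x] 3 by blast
  show "(\<And>i. i \<in> S \<Longrightarrow> vge x n (F i)) \<Longrightarrow> vge x n (sum F S)"
    by (induction S rule: infinite_finite_induct) (auto simp: 1 2)
qed

lemma ord_simps:
  assumes x: "x \<in> CP"
  shows "f \<noteq> 0 \<Longrightarrow> g \<noteq> 0 \<Longrightarrow> ord_at C x (f * g) = ord_at C x f + ord_at C x g"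
    "f \<noteq> 0 \<Longrightarrow> ord_at C x (inverse f) = - ord_at C x f"
    "f \<noteq> 0 \<Longrightarrow> ord_at C x (f powi n) = n * ord_at C x f"
    "ord_at C x 1 = 0" "z \<noteq> 0 \<Longrightarrow> ord_at C x (\<kappa> z) = 0"
proof -
  obtain v where v: "uniformizer C x v" using uniformizer_ex[OF x] by blast
  note s = sringD[OF sring_lr[OF x]] and v0 = unif_D(1)[OF x v]
  show "f \<noteq> 0 \<Longrightarrow> g \<noteq> 0 \<Longrightarrow> ord_at C x (f * g) = ord_at C x f + ord_at C x g"
  proof -
    assume f: "f \<noteq> 0" "g \<noteq> 0"
    obtain u where u: "unit_at x u" "f = u * v powi (ord_at C x f)" using unif_rep[OF x v f(1)] by blast
    obtain w where w: "unit_at x w" "g = w * v powi (ord_at C x g)" using unif_rep[OF x v f(2)] by blast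
    have "f * g = (u * w) * v powi (ord_at C x f + ord_at C x g)"
      by (subst u(2), subst w(2)) (simp add: v0 power_int_add)
    then show ?thesis using ord_eqI[OF x v unit_at(2)[OF x u(1) w(1)]] by simp
  qed
  have inv: "f powi n \<noteq> 0 \<Longrightarrow> f \<noteq> 0 \<Longrightarrow> ord_at C x (f powi n) = n * ord_at C x f" for f n
  proof -
    assume f: "f \<noteq> 0"
    obtain u where u: "unit_at x u" "f = u * v powi (ord_at C x f)" using unif_rep[OF x v f(1)] by blast
    have "f powi n = (u powi n) * v powi (n * ord_at C x f)"
      by (subst u(2)) (simp add: v0 power_int_mult_distrib power_int_mult[symmetric] mult.commute)
    then show ?thesis using ord_eqI[OF x v unit_at(5)[OF x u(1)]] by simp
  qed
  then show "f \<noteq> 0 \<Longrightarrow> ord_at C x (f powi n) = n * ord_at C x f" by simp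
  show "f \<noteq> 0 \<Longrightarrow> ord_at C x (inverse f) = - ord_at C x f"
    using inv[of f "-1"] by (simp add: power_int_minus)
  show "ord_at C x 1 = 0" using ord_eqI[OF x v unit_at(1)[OF x], of 0] by simp
  assume z: "z \<noteq> 0"
  have "\<kappa> z \<in> lr x" "inverse (\<kappa> z) \<in> lr x" using A_lr[OF x] by (auto simp flip: \<kappa>_inverse)
  then have "unit_at x (\<kappa> z)" using z by (auto simp: unit_at_def)
  then show "ord_at C x (\<kappa> z) = 0" using ord_eqI[OF x v, of _ 0] by simp
qed

lemma vge_mult_iff:
  assumes x: "x \<in> CP" and g: "g \<noteq> 0"
  shows "vge x n (f * g) \<longleftrightarrow> vge x (n - ord_at C x g) f"
  using ord_simps(1)[OF x _ g, of f] g by (auto simp: vge_def)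

lemma ord_A:
  assumes x: "x \<in> CP" and a: "a \<in> A"
  shows "a \<noteq> 0 \<Longrightarrow> ord_at C x a \<ge> 0" "a \<notin> x \<Longrightarrow> ord_at C x a = 0" "a \<in> x \<Longrightarrow> a \<noteq> 0 \<Longrightarrow> ord_at C x a \<ge> 1"
  using vge_simps(9,10)[OF x a] CP_D(5)[OF x] by (auto simp: vge_def)

text \<open>The denominators \<open>s\<close> with \<open>s * f\<close> in \<open>A\<close> form an
  ideal. Regularity of \<open>f\<close> at each closed point keeps it from lying in any of them, so
  it contains 1.\<close>

lemma A_iff: "f \<in> A \<longleftrightarrow> (\<forall>x\<in>CP. vge x 0 f)"
proof
  assume "f \<in> A" then show "\<forall>x\<in>CP. vge x 0 f" using vge_simps(9) by blast
next
  assume f: "\<forall>x\<in>CP. vge x 0 f"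
  let ?I = "{s \<in> A. s * f \<in> A}"
  have i: "idl A ?I" using A_simps by (auto simp: idl_def distrib_right mult.assoc)
  show "f \<in> A"
  proof (rule ccontr)
    assume "f \<notin> A"
    then have "1 \<notin> ?I" by simp
    then have "?I \<noteq> A" using A_simps(2) by blast
    then obtain x where x: "maxidl A x" "?I \<subseteq> x" using maxidl_exists[OF sring_A noeth_A i] by blast
    then have xC: "x \<in> CP" by (simp add: CP)
    then have "f \<in> lr x" using f vge_simps(7) by blast
    then obtain a b where ab: "f = a / b" "a \<in> A" "b \<in> A - x" by (auto simp: local_ring_def)
    then have "b * f = a" using nx(2)[OF xC ab(3) ab(3)] by simp
    then have "b \<in> ?I" using ab by simp
    then show False using x ab by blast
  qed
qed

text \<open>Zeros and poles occur only among the zeros of a numerator and a denominator.\<close>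

lemma finite_ord: assumes "f \<noteq> 0" shows "finite {x \<in> CP. ord_at C x f \<noteq> 0}"
proof -
  obtain a b where ab: "a \<in> A" "b \<in> A" "b \<noteq> 0" "f = a / b" using fraction_field by blast
  have a0: "a \<noteq> 0" using ab assms by auto
  have "ord_at C x f = ord_at C x a - ord_at C x b" if "x \<in> CP" for x
    using ord_simps(1)[OF that a0, of "inverse b"] ord_simps(2)[OF that ab(3)] ab by (simp add: divide_inverse)
  then have "{x \<in> CP. ord_at C x f \<noteq> 0} \<subseteq> {x \<in> CP. a \<in> x} \<union> {x \<in> CP. b \<in> x}"
    using ord_A(2) ab by force
  then show ?thesis using finite_zeros ab a0 by (meson finite_UnI finite_subset)
qed

section \<open>Approximation: prescribed orders at finitely many points\<close>

lemma separate: assumes "x \<in> CP" "y \<in> CP" "x \<noteq> y" obtains b where "b \<in> y" "b \<notin> x"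
proof -
  have "\<not> y \<subseteq> x" using assms CP_D(1)[OF assms(1)] unfolding CP maxidl_def by metis
  then show ?thesis using that by blast
qed

text \<open>Take a product of powers of elements that vanish at one \<open>y\<close> but not at
  \<open>x\<close>. Multiplication by such a \<open>b\<close> does not change the order at
  \<open>x\<close>.\<close>

lemma pole_killer:
  assumes x: "x \<in> CP" and Y: "finite Y" "Y \<subseteq> CP - {x}"
  obtains b where "b \<in> A" "b \<notin> x" "\<And>y. y \<in> Y \<Longrightarrow> vge y (N y) b"
proof -
  have "\<exists>b\<in>A. b \<notin> x \<and> (\<forall>y\<in>Y. vge y (N y) b)"
    using Y
  proof (induction Y rule: finite_induct)
    case empty show ?case using A_simps(2) CP_D(2)[OF x] by auto
  next
    case (insert y Y)
    then obtain b where b: "b \<in> A" "b \<notin> x" "\<forall>y\<in>Y. vge y (N y) b" by auto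
    have y: "y \<in> CP" "x \<noteq> y" using insert.prems by auto
    obtain e where e: "e \<in> y" "e \<notin> x" using separate[OF x y] by blast
    have eA: "e \<in> A" using e CP_D(4)[OF y(1)] by auto
    have p: "e ^ n \<in> A" "e ^ n \<notin> x" "vge y (int n) (e ^ n)" for n
    proof (induction n)
      case 0
      { case 1 show ?case using A_simps by simp }
      { case 2 show ?case using CP_D(2)[OF x] by simp }
      { case 3 show ?case using vge_simps(9)[OF y(1) A_simps(2)] by simp }
    next
      case (Suc n)
      { case 1 show ?case using Suc A_simps eA by simp }
      { case 2 show ?case using Suc CP_D(3)[OF x eA] e by auto }
      { case 3 show ?case using vge_simps(3)[OF y(1) _ Suc(3), of 1 e] vge_simps(10)[OF y(1) eA] e by simp }
    qed
    let ?e = "e ^ nat (N y)"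
    have ey: "vge y (N y) ?e" using vge_simps(4)[OF y(1) p(3)[of "nat (N y)"], of "N y"] by simp
    show ?case
    proof (intro bexI[of _ "b * ?e"] conjI ballI)
      show "b * ?e \<in> A" using b p A_simps by blast
      show "b * ?e \<notin> x" using CP_D(3)[OF x b(1) p(1)] b p by blast
      fix z assume z: "z \<in> insert y Y"
      then have zC: "z \<in> CP" using insert.prems by auto
      show "vge z (N z) (b * ?e)"
      proof (cases "z = y")
        case True
        then show ?thesis using vge_simps(3)[OF zC vge_simps(9)[OF zC b(1)]] ey by force
      next
        case False
        then have "vge z (N z) b" using z b by auto
        then show ?thesis using vge_simps(3)[OF zC _ vge_simps(9)[OF zC p(1)], of "N z" b "nat (N y)"] by simp
      qed
    qed
  qed
  then show ?thesis using that by blast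
qed

text \<open>Away from \<open>x\<close> and from the finite set where \<open>E\<close> is positive or
  \<open>g\<close> has a zero or a pole, the bound holds for every multiple of \<open>g\<close> by
  an element of \<open>A\<close>.\<close>

lemma approx:
  assumes x: "x \<in> CP" and g: "g \<noteq> 0" and E: "finite {y \<in> CP. E y > (0::int)}"
  obtains b where "b \<in> A" "b \<notin> x" "\<And>y. y \<in> CP \<Longrightarrow> y \<noteq> x \<Longrightarrow> vge y (E y) (b * g)"
proof -
  let ?Y = "({y \<in> CP. E y > 0} \<union> {y \<in> CP. ord_at C y g \<noteq> 0}) - {x}"
  have "finite ?Y" "?Y \<subseteq> CP - {x}" using E finite_ord[OF g] by auto
  then obtain b where b: "b \<in> A" "b \<notin> x" "\<And>y. y \<in> ?Y \<Longrightarrow> vge y (E y - ord_at C y g) b"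
    using pole_killer[OF x, of ?Y "\<lambda>y. E y - ord_at C y g"] by blast
  show ?thesis
  proof (rule that[OF b(1,2)])
    fix y assume y: "y \<in> CP" "y \<noteq> x"
    show "vge y (E y) (b * g)"
    proof (cases "y \<in> ?Y")
      case True then show ?thesis using b(3) vge_mult_iff[OF y(1) g] by blast
    next
      case False
      then have "E y \<le> 0" "ord_at C y g = 0" using y by auto
      then show ?thesis using vge_mult_iff[OF y(1) g] vge_simps(4)[OF y(1) vge_simps(9)[OF y(1) b(1)], of "E y"] by simp
    qed
  qed
qed

lemma ord_ex: assumes x: "x \<in> CP" obtains g where "g \<noteq> 0" "ord_at C x g = n"
proof -
  obtain v where v: "uniformizer C x v" using uniformizer_ex[OF x] by blast
  show ?thesis using that[of "v powi n"] ord_eqI[OF x v unit_at(1)[OF x], of n] unif_D(1)[OF x v] by simp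
qed

lemma ord_approx:
  assumes x: "x \<in> CP" and E: "finite {y \<in> CP. E y > (0::int)}"
  obtains g where "g \<noteq> 0" "ord_at C x g = n" "\<And>y. y \<in> CP \<Longrightarrow> y \<noteq> x \<Longrightarrow> vge y (E y) g"
proof -
  obtain g where g: "g \<noteq> 0" "ord_at C x g = n" using ord_ex[OF x] by blast
  obtain b where b: "b \<in> A" "b \<notin> x" "\<And>y. y \<in> CP \<Longrightarrow> y \<noteq> x \<Longrightarrow> vge y (E y) (b * g)" using approx[OF x g(1) E] by blast
  have b0: "b \<noteq> 0" using b CP_D(5)[OF x] by auto
  show ?thesis
    using that[of "b * g"] g b b0 ord_simps(1)[OF x b0 g(1)] ord_A(2)[OF x b(1,2)] by simp
qed

section \<open>Values at a closed point\<close>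

lemma lr_residue: assumes x: "x \<in> CP" and f: "vge x 0 f" shows "\<exists>!z. vge x 1 (f - \<kappa> z)"
proof -
  have "f \<in> lr x" using f vge_simps(7)[OF x] by simp
  then obtain a b where ab: "f = a / b" "a \<in> A" "b \<in> A - x" by (auto simp: local_ring_def)
  have b0: "b \<noteq> 0" using nx(2)[OF x ab(3) ab(3)] .
  obtain z w where z: "a - \<kappa> z \<in> x" "b - \<kappa> w \<in> x" using residue[OF x] ab by blast
  have w: "w \<noteq> 0" using z(2) ab(3) by auto
  have "f - \<kappa> (z / w) = ((a - \<kappa> z) - (b - \<kappa> w) * \<kappa> (z / w)) / b"
  proof -
    have "\<kappa> w * \<kappa> (z / w) = \<kappa> z" using w by (simp flip: \<kappa>(3))
    then show ?thesis using ab(1) b0 by (simp add: field_simps)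
  qed
  also have "\<dots> \<in> mx x" using ab(3) CP_D(8)[OF x \<kappa>(1) z(2)] CP_D(9)[OF x z(1)] unfolding mx_def by blast
  finally have 1: "vge x 1 (f - \<kappa> (z / w))" using vge_simps(8)[OF x] by simp
  show ?thesis
  proof (rule ex1I[of "\<lambda>z. vge x 1 (f - \<kappa> z)", OF 1])
    fix z' assume "vge x 1 (f - \<kappa> z')"
    then have "vge x 1 ((f - \<kappa> (z / w)) - (f - \<kappa> z'))" using vge_simps(6)[OF x 1] by blast
    then have "vge x 1 (\<kappa> (z' - z / w))" by simp
    then show "z' = z / w" using ord_simps(5)[OF x, of "z' - z / w"] unfolding vge_def \<kappa>_eq0 by fastforce
  qed
qed

text \<open>The value of \<open>f\<close> at \<open>x\<close>, arbitrary if \<open>f\<close> has a pole there.\<close>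

definition ev :: "'k set \<Rightarrow> 'k \<Rightarrow> complex" where "ev x f = (THE z. vge x 1 (f - \<kappa> z))"

lemma ev_spec: "x \<in> CP \<Longrightarrow> vge x 0 f \<Longrightarrow> vge x 1 (f - \<kappa> (ev x f))"
  unfolding ev_def by (rule theI') (rule lr_residue)

lemma ev_eqI: "x \<in> CP \<Longrightarrow> vge x 1 (f - \<kappa> z) \<Longrightarrow> ev x f = z"
proof -
  assume x: "x \<in> CP" and f: "vge x 1 (f - \<kappa> z)"
  have "vge x 0 ((f - \<kappa> z) + \<kappa> z)" using vge_simps(2)[OF x vge_simps(4)[OF x f, of 0] vge_simps(9)[OF x \<kappa>(1)[of z]]] by simp
  then show ?thesis unfolding ev_def using lr_residue[OF x, of f] f by (auto intro: the1_equality)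
qed

lemma ev_simps:
  assumes x: "x \<in> CP"
  shows "ev x (\<kappa> z) = z" "ev x 0 = 0" "ev x 1 = 1"
    "vge x 0 f \<Longrightarrow> vge x 0 g \<Longrightarrow> ev x (f + g) = ev x f + ev x g"
    "vge x 0 f \<Longrightarrow> vge x 0 g \<Longrightarrow> ev x (f * g) = ev x f * ev x g"
    "vge x 0 f \<Longrightarrow> ev x f = 0 \<longleftrightarrow> vge x 1 f"
proof -
  note v = vge_simps[OF x]
  show k: "ev x (\<kappa> z) = z" for z by (rule ev_eqI[OF x]) (simp add: v)
  show "ev x 0 = 0" "ev x 1 = 1" using k[of 0] k[of 1] by simp_all
  { assume f: "vge x 0 f" "vge x 0 g"
    note e = ev_spec[OF x f(1)] ev_spec[OF x f(2)]
    show "ev x (f + g) = ev x f + ev x g"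
      by (rule ev_eqI[OF x]) (use v(2)[OF e] in \<open>simp add: algebra_simps\<close>)
    have "f * g - \<kappa> (ev x f * ev x g) = (f - \<kappa> (ev x f)) * g + \<kappa> (ev x f) * (g - \<kappa> (ev x g))"
      by (simp add: algebra_simps)
    then show "ev x (f * g) = ev x f * ev x g"
      using v(2)[of 1, OF _ _] v(3)[OF e(1) f(2)] v(3)[OF v(9)[OF \<kappa>(1)] e(2), of "ev x f"] by (intro ev_eqI[OF x]) simp }
  assume f: "vge x 0 f"
  show "ev x f = 0 \<longleftrightarrow> vge x 1 f" using ev_spec[OF x f] ev_eqI[OF x, of f 0] by auto
qed

lemma ev_sum:
  assumes x: "x \<in> CP" "finite S" "\<And>i. i \<in> S \<Longrightarrow> vge x 0 (f i)"
  shows "ev x (sum f S) = (\<Sum>i\<in>S. ev x (f i))"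
  using assms(2,3) by (induction S rule: finite_induct) (auto simp: ev_simps[OF x(1)] vge_simps[OF x(1)])

section \<open>The real structure on points, orders and values\<close>

lemma \<tau>:
  "\<tau> (f + g) = \<tau> f + \<tau> g" "\<tau> (f * g) = \<tau> f * \<tau> g" "\<tau> 1 = 1" "\<tau> (\<tau> f) = f" "\<tau> (\<kappa> z) = \<kappa> (cnj z)"
  "a \<in> A \<Longrightarrow> \<tau> a \<in> A"
proof -
  have "real_structure (function_field C) \<tau>" "real_structure C \<tau>"
    using curve by (auto simp: smooth_real_affine_curve_def)
  then show "\<tau> (f + g) = \<tau> f + \<tau> g" "\<tau> (f * g) = \<tau> f * \<tau> g" "\<tau> 1 = 1" "\<tau> (\<tau> f) = f" "\<tau> (\<kappa> z) = \<kappa> (cnj z)"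
     "a \<in> A \<Longrightarrow> \<tau> a \<in> A"
    by (auto simp: real_structure_def function_field_def ring_hom_def)
qed

lemma \<tau>0 [simp]: "\<tau> 0 = 0" using \<tau>(1)[of 0 0] by (metis add.right_neutral add_left_cancel)
lemma \<tau>_eq0 [simp]: "\<tau> f = 0 \<longleftrightarrow> f = 0" using \<tau>(4)[of f] \<tau>0 by metis
lemma \<tau>_uminus: "\<tau> (- f) = - \<tau> f" using \<tau>(1)[of f "-f"] by (simp add: eq_neg_iff_add_eq_0 add.commute)
lemma \<tau>_diff: "\<tau> (f - g) = \<tau> f - \<tau> g" using \<tau>(1)[of f "-g"] \<tau>_uminus by simp
lemma \<tau>_inverse: "\<tau> (inverse f) = inverse (\<tau> f)"
proof (cases "f = 0")
  case False
  then have "\<tau> f * \<tau> (inverse f) = 1" by (simp add: \<tau>(3) flip: \<tau>(2))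
  then show ?thesis by (metis inverse_unique)
qed simp
lemma \<tau>_divide: "\<tau> (f / g) = \<tau> f / \<tau> g" by (simp add: divide_inverse \<tau>(2) \<tau>_inverse)
lemma \<tau>_pow: "\<tau> (f ^ n) = \<tau> f ^ n" by (induction n) (auto simp: \<tau>)
lemma \<tau>_powi: "\<tau> (f powi n) = \<tau> f powi n" by (simp add: power_int_def \<tau>_pow \<tau>_inverse)

abbreviation "tx \<equiv> spec_map C \<tau>"

lemma tx: assumes x: "x \<in> CP" shows "tx x \<in> CP" "tx (tx x) = x" "a \<in> tx x \<longleftrightarrow> a \<in> A \<and> \<tau> a \<in> x"
proof -
  show 1: "a \<in> tx x \<longleftrightarrow> a \<in> A \<and> \<tau> a \<in> x" for a by (simp add: spec_map_def)
  show "tx (tx x) = x" using \<tau> CP_D(4)[OF x] by (auto simp: spec_map_def)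
  \<comment> \<open>In dimension one, a nonzero prime is already a closed point.\<close>
  have "primeidl A (tx x)" unfolding primeidl_def
  proof (intro conjI ballI impI)
    show "idl A (tx x)" using CP_D(4-8)[OF x] A_simps \<tau> by (auto simp: idl_def 1)
    show "tx x \<noteq> A" using CP_D(2)[OF x] A_simps(2) \<tau>(3) 1 by metis
    fix a b assume "a \<in> A" "b \<in> A" "a * b \<in> tx x"
    then show "a \<in> tx x \<or> b \<in> tx x" using CP_D(3)[OF x, of "\<tau> a" "\<tau> b"] by (auto simp: 1 \<tau>)
  qed
  moreover obtain a where "a \<in> x" "a \<noteq> 0" using CP_nonzero[OF x] by blast
  then have "\<tau> a \<in> tx x" "\<tau> a \<noteq> 0" using 1 \<tau> CP_D(4)[OF x] by auto
  then have "tx x \<noteq> {0}" by blast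
  ultimately show "tx x \<in> CP" by (rule prime_max)
qed

lemma lr_tx: assumes x: "x \<in> CP" shows "\<tau> f \<in> lr x \<longleftrightarrow> f \<in> lr (tx x)" "\<tau> f \<in> mx x \<longleftrightarrow> f \<in> mx (tx x)"
proof -
  have 1: "g \<in> lr x \<Longrightarrow> \<tau> g \<in> lr (tx x)" "g \<in> mx x \<Longrightarrow> \<tau> g \<in> mx (tx x)" if x: "x \<in> CP" for g x
  proof -
    assume "g \<in> lr x"
    then obtain a b where "g = a / b" "a \<in> A" "b \<in> A - x" by (auto simp: local_ring_def)
    then show "\<tau> g \<in> lr (tx x)" using lrI[of "\<tau> a" "\<tau> b" "tx x"] by (auto simp: \<tau>_divide \<tau> spec_map_def)
  next
    assume "g \<in> mx x"
    then obtain a b where "g = a / b" "a \<in> x" "b \<in> A - x" by (auto simp: mx_def)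
    then show "\<tau> g \<in> mx (tx x)" using CP_D(4)[OF x] unfolding mx_def
      by (intro CollectI exI[of _ "\<tau> a"] exI[of _ "\<tau> b"]) (auto simp: \<tau>_divide \<tau> spec_map_def)
  qed
  show "\<tau> f \<in> lr x \<longleftrightarrow> f \<in> lr (tx x)" "\<tau> f \<in> mx x \<longleftrightarrow> f \<in> mx (tx x)"
    using 1[OF x, of "\<tau> f"] 1[OF tx(1)[OF x], of f] tx(2)[OF x] \<tau>(4) by auto
qed

text \<open>The image under \<open>\<tau>\<close> of a uniformizer at \<open>tx x\<close> is a
  uniformizer at \<open>x\<close>, and units correspond in the same way.\<close>

lemma ord_tx: assumes x: "x \<in> CP" and f: "f \<noteq> 0" shows "ord_at C x (\<tau> f) = ord_at C (tx x) f"
proof -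
  note y = tx(1)[OF x]
  obtain v where v: "uniformizer C (tx x) v" using uniformizer_ex[OF y] by blast
  obtain u where u: "unit_at (tx x) u" "f = u * v powi (ord_at C (tx x) f)" using unif_rep[OF y v f] by blast
  have "\<tau> f = \<tau> u * \<tau> v powi (ord_at C (tx x) f)" by (subst u(2)) (simp add: \<tau> \<tau>_powi)
  moreover have "unit_at x (\<tau> u)" using u(1) lr_tx(1)[OF x] by (auto simp: unit_at_def simp flip: \<tau>_inverse)
  moreover have "uniformizer C x (\<tau> v)"
  proof -
    have "mx x = (*) (\<tau> v) ` lr x"
    proof (rule subset_antisym; rule subsetI)
      fix g assume "g \<in> mx x"
      then have "\<tau> g \<in> mx (tx x)" using lr_tx(2)[OF x, of "\<tau> g"] \<tau>(4) by simp
      then obtain r where r: "\<tau> g = v * r" "r \<in> lr (tx x)" using unif_D(3)[OF y v] by auto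
      then have "g = \<tau> v * \<tau> r" by (metis \<tau>(2,4))
      then show "g \<in> (*) (\<tau> v) ` lr x" using lr_tx(1)[OF x] r by blast
    next
      fix g assume "g \<in> (*) (\<tau> v) ` lr x"
      then obtain r where r: "g = \<tau> v * r" "r \<in> lr x" by auto
      then have "\<tau> g = v * \<tau> r" by (simp add: \<tau>)
      then have "\<tau> g \<in> mx (tx x)" using unif_D(3)[OF y v] lr_tx(1)[OF x, of "\<tau> r"] r(2) \<tau>(4) by auto
      then show "g \<in> mx x" using lr_tx(2)[OF x, of "\<tau> g"] \<tau>(4) by simp
    qed
    then show ?thesis by (simp add: uniformizer_def mx_def)
  qed
  ultimately show ?thesis using ord_eqI[OF x] by metis
qed

lemma vge_tx: "x \<in> CP \<Longrightarrow> vge x n (\<tau> f) \<longleftrightarrow> vge (tx x) n f"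
  using ord_tx by (auto simp: vge_def)

lemma ev_tx: assumes x: "x \<in> CP" and f: "vge (tx x) 0 f" shows "ev x (\<tau> f) = cnj (ev (tx x) f)"
  by (rule ev_eqI[OF x]) (use ev_spec[OF tx(1)[OF x] f] vge_tx[OF x, of 1 "f - \<kappa> (ev (tx x) f)"] in \<open>simp add: \<tau>_diff \<tau>\<close>)

end

section \<open>Laurent polynomials over a field\<close>

definition lau :: "(int \<Rightarrow> 'k::field) set" where "lau = {f. finite {m. f m \<noteq> 0}}"

definition lmul :: "(int \<Rightarrow> 'k::field) \<Rightarrow> (int \<Rightarrow> 'k) \<Rightarrow> int \<Rightarrow> 'k" where
  "lmul f g = (\<lambda>m. \<Sum>i | f i \<noteq> 0. f i * g (m - i))"

definition lmon :: "int \<Rightarrow> 'k::zero \<Rightarrow> int \<Rightarrow> 'k" where "lmon m a = (\<lambda>n. if n = m then a else 0)"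

definition ladd :: "(int \<Rightarrow> 'k::field) \<Rightarrow> (int \<Rightarrow> 'k) \<Rightarrow> int \<Rightarrow> 'k" where "ladd f g = (\<lambda>m. f m + g m)"

text \<open>One shape for the surface, for its parts over open sets and for the multiplicative
  group: Laurent polynomials with the grading action, restricted to a subring
  \<open>P\<close>.\<close>

definition GA :: "(int \<Rightarrow> 'k::field) set \<Rightarrow> (complex \<Rightarrow> 'k) \<Rightarrow> (int \<Rightarrow> 'k) gmalg" where
  "GA P k = (gm_product (coord UNIV k))\<lparr>carrier := P\<rparr>"

lemma gm_product_simps [simp]:
  "carrier (gm_product B) = carrier (laurent B)" "monoid.mult (gm_product B) = monoid.mult (laurent B)"
  "one (gm_product B) = one (laurent B)" "ring.zero (gm_product B) = ring.zero (laurent B)"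
  "add (gm_product B) = add (laurent B)" "cst (gm_product B) = (\<lambda>z. lmonom B 0 (cst B z))"
  "wt (gm_product B) = (\<lambda>f m. lmonom B m (f m))"
  by (simp_all add: gm_product_def mk_gmalg_def mk_calg_def gmalg.defs calg.defs ring.defs)

lemma laurent_coord_mult:
  assumes "f \<in> lau" shows "f \<otimes>\<^bsub>laurent (coord UNIV k)\<^esub> g = lmul f g"
  using assms by (simp add: laurent_def lmul_def lau_def coord_finsum)

lemma laurent_coord [simp]:
  "carrier (laurent (coord UNIV k)) = lau" "one (laurent (coord UNIV k)) = lmon 0 1"
  "ring.zero (laurent (coord UNIV k)) = (\<lambda>m. 0)" "add (laurent (coord UNIV k)) = ladd"
  "lmonom (coord UNIV k) = lmon"
  by (auto simp: laurent_def lau_def lmonom_def lmon_def ladd_def fun_eq_iff)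

lemma GA_simps [simp]:
  "carrier (GA P k) = P" "one (GA P k) = lmon 0 1" "ring.zero (GA P k) = (\<lambda>m. 0)"
  "add (GA P k) = ladd" "cst (GA P k) = (\<lambda>z. lmon 0 (k z))" "wt (GA P k) = (\<lambda>f m. lmon m (f m))"
  by (simp_all add: GA_def)

lemma GA_mult: "f \<in> lau \<Longrightarrow> f \<otimes>\<^bsub>GA P k\<^esub> g = lmul f g"
  by (simp add: GA_def laurent_coord_mult)

lemma mono_simps [simp]:
  "lmon m a m = a" "lmon m 0 = (\<lambda>_. 0)" "n \<noteq> m \<Longrightarrow> lmon m a n = 0"
  by (auto simp: lmon_def)

lemma mono_lau [simp]: "lmon m (a::'k::field) \<in> lau"
proof -
  have "{n. lmon m a n \<noteq> 0} \<subseteq> {m}" by (auto simp: lmon_def)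
  then show ?thesis using finite_subset by (auto simp: lau_def)
qed

lemma lmul_super: assumes "finite I" "{i. f i \<noteq> 0} \<subseteq> I" shows "lmul f g m = (\<Sum>i\<in>I. f i * g (m - i))"
  unfolding lmul_def by (rule sum.mono_neutral_left) (use assms in auto)

text \<open>The type of finitely supported functions on the ordered group of integers supplies
  associativity, distributivity and the absence of zero divisors, which \<open>lmul_laws\<close>
  pulls back.\<close>

definition pm :: "(int \<Rightarrow> 'k::field) \<Rightarrow> int \<Rightarrow>\<^sub>0 'k" where "pm f = Abs_poly_mapping f"

lemma lookup_pm: "f \<in> lau \<Longrightarrow> poly_mapping.lookup (pm f) = f" by (simp add: pm_def lau_def)

lemma lookup_lau: "poly_mapping.lookup p \<in> lau" by (simp add: lau_def)

lemma pm_inj: "f \<in> lau \<Longrightarrow> g \<in> lau \<Longrightarrow> pm f = pm g \<Longrightarrow> f = g" using lookup_pm by metis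

lemma lookup_times: assumes "f \<in> lau" "g \<in> lau" shows "poly_mapping.lookup (pm f * pm g) = lmul f g"
proof
  fix m
  have "(\<Sum>q. poly_mapping.lookup (pm g) q when m = l + q) = g (m - l)" for l
  proof -
    have "(\<lambda>q. poly_mapping.lookup (pm g) q when m = l + q) = (\<lambda>q. poly_mapping.lookup (pm g) q when q = m - l)" by (auto simp: fun_eq_iff when_def)
    then have "(\<Sum>q. poly_mapping.lookup (pm g) q when m = l + q) = (\<Sum>q. g q when q = m - l)"
      using lookup_pm[OF assms(2)] by metis
    then show ?thesis by (simp add: Sum_any_when_equal)
  qed
  then have "poly_mapping.lookup (pm f * pm g) m = (\<Sum>l. f l * g (m - l))" by (simp add: lookup_mult lookup_pm[OF assms(1)])
  also have "\<dots> = lmul f g m"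
    unfolding lmul_def by (rule Sum_any.expand_superset) (use assms in \<open>auto simp: lau_def\<close>)
  finally show "poly_mapping.lookup (pm f * pm g) m = lmul f g m" .
qed

lemma lmul_lau [simp]: assumes "f \<in> lau" "g \<in> lau" shows "lmul f g \<in> lau"
  using lookup_times[OF assms] lookup_lau by metis

lemma ladd_lau [simp]: assumes "f \<in> lau" "g \<in> lau" shows "ladd f g \<in> lau"
proof -
  have "{m. ladd f g m \<noteq> 0} \<subseteq> {m. f m \<noteq> 0} \<union> {m. g m \<noteq> 0}" by (auto simp: ladd_def)
  then show ?thesis using assms by (auto simp: lau_def intro: finite_subset)
qed

lemma zero_lau [simp]: "(\<lambda>m. 0) \<in> lau" by (simp add: lau_def)
lemma uminus_lau [simp]: "f \<in> lau \<Longrightarrow> (\<lambda>m. - f m) \<in> lau" by (simp add: lau_def)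

lemma pm_lmul: "f \<in> lau \<Longrightarrow> g \<in> lau \<Longrightarrow> pm (lmul f g) = pm f * pm g"
  using lookup_times lookup_pm lmul_lau by (metis lookup_inject)

lemma pm_zero: "pm (\<lambda>m. 0) = 0" by (metis lookup_pm zero_lau lookup_inject lookup_zero ext)

lemma pm_ladd: assumes "f \<in> lau" "g \<in> lau" shows "pm (ladd f g) = pm f + pm g"
proof (rule poly_mapping_eqI)
  fix m
  show "poly_mapping.lookup (pm (ladd f g)) m = poly_mapping.lookup (pm f + pm g) m"
    unfolding lookup_add lookup_pm[OF assms(1)] lookup_pm[OF assms(2)] lookup_pm[OF ladd_lau[OF assms]]
    by (simp add: ladd_def)
qed

lemma pm_one: "pm (lmon 0 1) = 1"
proof (rule poly_mapping_eqI)
  fix m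
  show "poly_mapping.lookup (pm (lmon 0 1)) m = poly_mapping.lookup 1 m"
    unfolding lookup_pm[OF mono_lau] by (auto simp: lookup_one lmon_def when_def)
qed

lemma lmul_laws:
  assumes "f \<in> lau" "g \<in> lau" "e \<in> lau"
  shows "lmul f g = lmul g f" "lmul (lmul f g) e = lmul f (lmul g e)" "lmul (lmon 0 1) f = f"
    "lmul f (lmon 0 1) = f"
    "lmul (ladd f g) e = ladd (lmul f e) (lmul g e)" "lmul e (ladd f g) = ladd (lmul e f) (lmul e g)"
    "lmul f g = (\<lambda>m. 0) \<Longrightarrow> f = (\<lambda>m. 0) \<or> g = (\<lambda>m. 0)"
    "lmul f (\<lambda>m. 0) = (\<lambda>m. 0)" "lmul (\<lambda>m. 0) f = (\<lambda>m. 0)"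
proof -
  note s = assms pm_lmul pm_ladd pm_one lmul_lau ladd_lau mono_lau
  show "lmul f g = lmul g f" by (rule pm_inj) (simp_all add: s mult.commute)
  show "lmul (lmul f g) e = lmul f (lmul g e)" by (rule pm_inj) (simp_all add: s mult.assoc)
  show "lmul (lmon 0 1) f = f" "lmul f (lmon 0 1) = f" by (rule pm_inj, simp_all add: s)+
  show "lmul (ladd f g) e = ladd (lmul f e) (lmul g e)" "lmul e (ladd f g) = ladd (lmul e f) (lmul e g)"
    by (rule pm_inj, simp_all add: s algebra_simps)+
  show "lmul f (\<lambda>m. 0) = (\<lambda>m. 0)" "lmul (\<lambda>m. 0) f = (\<lambda>m. 0)" by (auto simp: lmul_def)
  assume "lmul f g = (\<lambda>m. 0)"
  then have "pm f * pm g = 0" using pm_lmul[OF assms(1,2)] pm_zero by metis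
  then have "pm f = pm (\<lambda>m. 0) \<or> pm g = pm (\<lambda>m. 0)" by (simp add: pm_zero)
  then show "f = (\<lambda>m. 0) \<or> g = (\<lambda>m. 0)" using pm_inj assms zero_lau by blast
qed

lemma lmul_mono: "lmul (lmon m a) f n = a * f (n - m)"
proof -
  have "lmul (lmon m a) f n = (\<Sum>i\<in>{m}. lmon m a i * f (n - i))"
    by (rule lmul_super) (auto simp: lmon_def)
  then show ?thesis by simp
qed

lemma lmul_mono_mono [simp]: "lmul (lmon m a) (lmon n b) = lmon (m + n) (a * b)"
  by (rule ext) (simp add: lmul_mono, auto simp: lmon_def)

lemma ladd_mono [simp]: "ladd (lmon m a) (lmon m b) = lmon m (a + b)"
  by (auto simp: fun_eq_iff ladd_def lmon_def)

definition lsub :: "(int \<Rightarrow> 'k::field) set \<Rightarrow> bool" where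
  "lsub P \<longleftrightarrow> P \<subseteq> lau \<and> lmon 0 1 \<in> P \<and> (\<forall>f\<in>P. (\<lambda>m. - f m) \<in> P) \<and> (\<forall>f\<in>P. \<forall>g\<in>P. ladd f g \<in> P \<and> lmul f g \<in> P)"

lemma lsubD:
  assumes "lsub P"
  shows "P \<subseteq> lau" "\<And>f. f \<in> P \<Longrightarrow> f \<in> lau" "lmon 0 1 \<in> P" "\<And>f. f \<in> P \<Longrightarrow> (\<lambda>m. - f m) \<in> P" "\<And>f g. f \<in> P \<Longrightarrow> g \<in> P \<Longrightarrow> ladd f g \<in> P"
    "\<And>f g. f \<in> P \<Longrightarrow> g \<in> P \<Longrightarrow> lmul f g \<in> P" "(\<lambda>m. 0) \<in> P"
proof -
  show *: "P \<subseteq> lau" "\<And>f. f \<in> P \<Longrightarrow> f \<in> lau" "lmon 0 1 \<in> P" "\<And>f. f \<in> P \<Longrightarrow> (\<lambda>m. - f m) \<in> P" "\<And>f g. f \<in> P \<Longrightarrow> g \<in> P \<Longrightarrow> ladd f g \<in> P"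
    "\<And>f g. f \<in> P \<Longrightarrow> g \<in> P \<Longrightarrow> lmul f g \<in> P"
    using assms by (auto simp: lsub_def)
  show "(\<lambda>m. 0) \<in> P" using *(5)[OF *(3) *(4)[OF *(3)]] by (simp add: ladd_def)
qed

lemma lsub_lau: "lsub lau" by (auto simp: lsub_def)

lemma domain_GA: assumes P: "lsub P" shows "domain (GA P k)"
proof -
  note s = lsubD[OF P]
  have c: "cring (GA P k)"
  proof (rule cringI)
    show "abelian_group (GA P k)"
    proof (rule abelian_groupI)
      fix x assume x: "x \<in> carrier (GA P k)"
      show "\<exists>y\<in>carrier (GA P k). y \<oplus>\<^bsub>GA P k\<^esub> x = \<zero>\<^bsub>GA P k\<^esub>"
        using s(4)[of x] x by (intro bexI[of _ "\<lambda>m. - x m"]) (auto simp: ladd_def)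
    qed (use s in \<open>auto simp: ladd_def fun_eq_iff algebra_simps\<close>)
    show "Group.comm_monoid (GA P k)"
    proof (rule comm_monoidI)
      fix x y z assume "x \<in> carrier (GA P k)" "y \<in> carrier (GA P k)" "z \<in> carrier (GA P k)"
      then show "x \<otimes>\<^bsub>GA P k\<^esub> y \<otimes>\<^bsub>GA P k\<^esub> z = x \<otimes>\<^bsub>GA P k\<^esub> (y \<otimes>\<^bsub>GA P k\<^esub> z)"
        using s(2) by (simp add: GA_mult lmul_laws(2))
    next
      fix x y assume "x \<in> carrier (GA P k)" "y \<in> carrier (GA P k)"
      then show "x \<otimes>\<^bsub>GA P k\<^esub> y = y \<otimes>\<^bsub>GA P k\<^esub> x" "x \<otimes>\<^bsub>GA P k\<^esub> y \<in> carrier (GA P k)"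
        using s(2,6) lmul_laws(1)[of x y x] by (auto simp: GA_mult)
    next
      fix x assume "x \<in> carrier (GA P k)"
      then show "\<one>\<^bsub>GA P k\<^esub> \<otimes>\<^bsub>GA P k\<^esub> x = x" using s(2) lmul_laws(3)[of x x x] by (simp add: GA_mult)
    qed (use s in auto)
    fix x y z assume "x \<in> carrier (GA P k)" "y \<in> carrier (GA P k)" "z \<in> carrier (GA P k)"
    then show "(x \<oplus>\<^bsub>GA P k\<^esub> y) \<otimes>\<^bsub>GA P k\<^esub> z = x \<otimes>\<^bsub>GA P k\<^esub> z \<oplus>\<^bsub>GA P k\<^esub> y \<otimes>\<^bsub>GA P k\<^esub> z"
      using s(2) by (simp add: GA_mult lmul_laws(5))
  qed
  show ?thesis
  proof (rule domain.intro[OF c], unfold_locales)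
    show "\<one>\<^bsub>GA P k\<^esub> \<noteq> \<zero>\<^bsub>GA P k\<^esub>" by (auto simp: fun_eq_iff lmon_def)
    fix a b assume "a \<otimes>\<^bsub>GA P k\<^esub> b = \<zero>\<^bsub>GA P k\<^esub>" "a \<in> carrier (GA P k)" "b \<in> carrier (GA P k)"
    then show "a = \<zero>\<^bsub>GA P k\<^esub> \<or> b = \<zero>\<^bsub>GA P k\<^esub>" using s(2) lmul_laws(7)[of a b a] by (simp add: GA_mult)
  qed
qed

lemma GA_a_inv: assumes P: "lsub P" "f \<in> P" shows "\<ominus>\<^bsub>GA P k\<^esub> f = (\<lambda>m. - f m)"
proof -
  interpret domain "GA P k" by (rule domain_GA[OF P(1)])
  show ?thesis using minus_equality[of "\<lambda>m. - f m" f] lsubD[OF P(1)] P(2) by (auto simp: ladd_def)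
qed

lemma GA_finsum:
  assumes P: "lsub P" and "finite I" "\<And>i. i \<in> I \<Longrightarrow> F i \<in> P"
  shows "finsum (GA P k) F I = (\<lambda>m. \<Sum>i\<in>I. F i m)"
proof -
  interpret domain "GA P k" by (rule domain_GA[OF P(1)])
  show ?thesis using assms(2,3)
    by (induction I rule: finite_induct) (auto simp: finsum_insert ladd_def)
qed

lemma lsub_sum:
  assumes P: "lsub P" and "finite I" "\<And>i. i \<in> I \<Longrightarrow> F i \<in> P"
  shows "(\<lambda>m. \<Sum>i\<in>I. F i m) \<in> P"
  using assms(2,3)
proof (induction I rule: finite_induct)
  case (insert x I)
  then have "ladd (F x) (\<lambda>m. \<Sum>i\<in>I. F i m) \<in> P" using lsubD(5)[OF P] by blast
  then show ?case using insert by (simp add: ladd_def)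
qed (use lsubD[OF P] in auto)

lemma lau_expand: assumes "f \<in> lau" shows "f = (\<lambda>n. \<Sum>m | f m \<noteq> 0. lmon m (f m) n)"
proof
  fix n
  have fin: "finite {m. f m \<noteq> 0}" using assms by (simp add: lau_def)
  have "(\<Sum>m | f m \<noteq> 0. lmon m (f m) n) = (\<Sum>m | f m \<noteq> 0. if n = m then f m else 0)" by (simp add: lmon_def)
  also have "\<dots> = f n" using fin by (simp add: sum.delta)
  finally show "f n = (\<Sum>m | f m \<noteq> 0. lmon m (f m) n)" by simp
qed

lemma mono_eq0: "lmon m a = (\<lambda>_. 0) \<longleftrightarrow> a = 0" by (auto simp: lmon_def fun_eq_iff)

definition khom :: "(complex \<Rightarrow> 'k::field) \<Rightarrow> bool" where
  "khom k \<longleftrightarrow> k 1 = 1 \<and> (\<forall>z w. k (z + w) = k z + k w \<and> k (z * w) = k z * k w)"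

definition graded :: "(int \<Rightarrow> 'k::field) set \<Rightarrow> bool" where
  "graded P \<longleftrightarrow> (\<forall>f\<in>P. \<forall>m. lmon m (f m) \<in> P)"

text \<open>The coaction sends \<open>f\<close> to its homogeneous components; comparing
  coefficients of the powers of \<open>t\<close> turns multiplicativity into the convolution
  formula.\<close>

lemma gm_action_GA:
  assumes P: "lsub P" and g: "graded P" and k: "khom k" "\<And>z. lmon 0 (k z) \<in> P"
  shows "gm_action (GA P k)"
proof -
  note s = lsubD[OF P]
  interpret domain "GA P k" by (rule domain_GA[OF P(1)])
  have gr: "lmon m (f m) \<in> P" if "f \<in> P" for f m using g that by (simp add: graded_def)
  have fin: "finite {m. f m \<noteq> 0}" if "f \<in> P" for f using s(2)[OF that] by (simp add: lau_def)
  show ?thesis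
    unfolding gm_action_def
  proof (intro conjI ballI allI)
    show "cring (GA P k)" by unfold_locales
    show "calg_hom point (GA P k) (cst (GA P k))"
      using k by (auto simp: calg_hom_def ring_hom_def point_def khom_def GA_mult)
    show "wt (GA P k) \<in> ring_hom (GA P k) (laurent (GA P k))"
    proof (rule ring_hom_memI)
      fix f assume f: "f \<in> carrier (GA P k)"
      then show "wt (GA P k) f \<in> carrier (laurent (GA P k))"
        using gr fin by (auto simp: laurent_def mono_eq0)
      fix e assume e: "e \<in> carrier (GA P k)"
      show "wt (GA P k) (f \<oplus>\<^bsub>GA P k\<^esub> e) = wt (GA P k) f \<oplus>\<^bsub>laurent (GA P k)\<^esub> wt (GA P k) e"
        by (auto simp: laurent_def ladd_def lmon_def fun_eq_iff)
      show "wt (GA P k) (f \<otimes>\<^bsub>GA P k\<^esub> e) = wt (GA P k) f \<otimes>\<^bsub>laurent (GA P k)\<^esub> wt (GA P k) e"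
      proof
        fix m
        have "(wt (GA P k) f \<otimes>\<^bsub>laurent (GA P k)\<^esub> wt (GA P k) e) m
           = finsum (GA P k) (\<lambda>i. lmon i (f i) \<otimes>\<^bsub>GA P k\<^esub> lmon (m - i) (e (m - i))) {i. f i \<noteq> 0}"
          by (simp add: laurent_def mono_eq0)
        also have "\<dots> = finsum (GA P k) (\<lambda>i. lmon m (f i * e (m - i))) {i. f i \<noteq> 0}"
          by (simp add: GA_mult)
        also have "\<dots> = (\<lambda>n. \<Sum>i | f i \<noteq> 0. lmon m (f i * e (m - i)) n)"
        proof (rule GA_finsum[OF P])
          show "finite {i. f i \<noteq> 0}" using fin f by simp
          fix i
          show "lmon m (f i * e (m - i)) \<in> P" using s(6)[OF gr[of f i] gr[of e "m - i"]] f e by simp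
        qed
        also have "\<dots> = lmon m (lmul f e m)" by (auto simp: fun_eq_iff lmon_def lmul_def)
        finally show "wt (GA P k) (f \<otimes>\<^bsub>GA P k\<^esub> e) m = (wt (GA P k) f \<otimes>\<^bsub>laurent (GA P k)\<^esub> wt (GA P k) e) m"
          using s(2) f by (simp add: GA_mult)
      qed
    next
      show "wt (GA P k) \<one>\<^bsub>GA P k\<^esub> = \<one>\<^bsub>laurent (GA P k)\<^esub>" by (auto simp: laurent_def lmon_def fun_eq_iff)
    qed
    show "wt (GA P k) (cst (GA P k) z) = lmonom (GA P k) 0 (cst (GA P k) z)" for z
      by (auto simp: lmonom_def lmon_def fun_eq_iff)
    fix a assume a: "a \<in> carrier (GA P k)"
    show "finsum (GA P k) (wt (GA P k) a) {m. wt (GA P k) a m \<noteq> \<zero>\<^bsub>GA P k\<^esub>} = a"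
      using GA_finsum[OF P, of "{m. a m \<noteq> 0}" "\<lambda>m. lmon m (a m)" k] fin[of a] gr[of a] a lau_expand[OF s(2)[of a]]
      by (simp add: mono_eq0)
    show "wt (GA P k) (wt (GA P k) a m) = lmonom (GA P k) m (wt (GA P k) a m)" for m
      by (auto simp: lmonom_def lmon_def fun_eq_iff)
  qed
qed

text \<open>The twist by \<open>h\<close> has two uses: the function field with its
  \<open>\<tau>\<close>, and complex conjugation with \<open>h = 1\<close> or
  \<open>h = - 1\<close>, which gives the circle and its form without real points.\<close>

locale rstruct =
  fixes \<tau> :: "'k::field \<Rightarrow> 'k" and k :: "complex \<Rightarrow> 'k" and h :: 'k
  assumes t: "\<tau> (f + g) = \<tau> f + \<tau> g" "\<tau> (f * g) = \<tau> f * \<tau> g" "\<tau> 1 = 1" "\<tau> (\<tau> f) = f" "\<tau> (k z) = k (cnj z)"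
    and h: "h \<noteq> 0" "\<tau> h = h" and k: "khom k"
begin

lemma t0 [simp]: "\<tau> 0 = 0" using t(1)[of 0 0] by (metis add.right_neutral add_left_cancel)
lemma t_eq0 [simp]: "\<tau> f = 0 \<longleftrightarrow> f = 0" using t(4)[of f] t0 by metis
lemma t_inverse: "\<tau> (inverse f) = inverse (\<tau> f)"
proof (cases "f = 0")
  case False
  then have "\<tau> f * \<tau> (inverse f) = 1" by (simp add: t(3) flip: t(2))
  then show ?thesis by (metis inverse_unique)
qed simp
lemma t_pow: "\<tau> (f ^ n) = \<tau> f ^ n" by (induction n) (auto simp: t)
lemma t_powi: "\<tau> (f powi n) = \<tau> f powi n" by (simp add: power_int_def t_pow t_inverse)
lemma t_sum: "\<tau> (sum f S) = (\<Sum>i\<in>S. \<tau> (f i))" by (induction S rule: infinite_finite_induct) (auto simp: t)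

abbreviation "cj \<equiv> dpd_conj \<tau> h"

lemma cj_lau: assumes "f \<in> lau" shows "cj f \<in> lau"
proof -
  have "{m. cj f m \<noteq> 0} = uminus ` {m. f m \<noteq> 0}"
    using h by (auto simp: dpd_conj_def image_iff) (metis minus_minus)
  then show ?thesis using assms by (simp add: lau_def)
qed

lemma cj_mono: "cj (lmon m a) = lmon (- m) (h powi m * \<tau> a)"
  by (auto simp: dpd_conj_def lmon_def fun_eq_iff)

lemma cj_add: "cj (ladd f g) = ladd (cj f) (cj g)"
  by (auto simp: dpd_conj_def ladd_def fun_eq_iff t algebra_simps)

text \<open>The twist is a power of \<open>h\<close> whose exponent is linear in the degree, so
  exponents add up under convolution. Conjugation reflects the support, hence the
  reindexing.\<close>

lemma cj_mult: assumes f: "f \<in> lau" shows "cj (lmul f g) = lmul (cj f) (cj g)"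
proof
  fix m
  have fin: "finite {i. f i \<noteq> 0}" using f by (simp add: lau_def)
  have "lmul (cj f) (cj g) m = (\<Sum>i\<in>uminus ` {i. f i \<noteq> 0}. cj f i * cj g (m - i))"
  proof (rule lmul_super)
    show "{i. cj f i \<noteq> 0} \<subseteq> uminus ` {i. f i \<noteq> 0}"
      by (auto simp: dpd_conj_def image_iff) (metis minus_minus)
  qed (use fin in auto)
  also have "\<dots> = (\<Sum>i | f i \<noteq> 0. cj f (- i) * cj g (m + i))" by (subst sum.reindex) (auto simp: inj_on_def)
  also have "\<dots> = (\<Sum>i | f i \<noteq> 0. h powi (- m) * \<tau> (f i * g (- m - i)))"
  proof (rule sum.cong)
    fix i
    have "h powi i * h powi (- m - i) = h powi (- m)" using h by (simp flip: power_int_add)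
    then show "cj f (- i) * cj g (m + i) = h powi (- m) * \<tau> (f i * g (- m - i))"
      by (simp add: dpd_conj_def t mult_ac uminus_add_conv_diff minus_diff_commute)
  qed simp
  also have "\<dots> = cj (lmul f g) m" by (simp add: dpd_conj_def lmul_def t_sum sum_distrib_left)
  finally show "cj (lmul f g) m = lmul (cj f) (cj g) m" by simp
qed

lemma cj_cj: "cj (cj f) = f"
proof
  fix m
  have "h powi (- m) * h powi m = 1" using h by (simp add: power_int_minus)
  then show "cj (cj f) m = f m" using h by (simp add: dpd_conj_def t t_powi mult.assoc[symmetric])
qed

lemma S1_action_GA:
  assumes P: "lsub P" and g: "graded P" and kP: "\<And>z. lmon 0 (k z) \<in> P" and cjP: "\<And>f. f \<in> P \<Longrightarrow> cj f \<in> P"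
  shows "S1_action (GA P k) cj"
  unfolding S1_action_def
proof (intro conjI ballI allI)
  note s = lsubD[OF P]
  show "gm_action (GA P k)" by (rule gm_action_GA[OF P g k kP])
  show "real_structure (GA P k) cj"
    unfolding real_structure_def
  proof (intro conjI ballI allI)
    show "cj \<in> ring_hom (GA P k) (GA P k)"
    proof (rule ring_hom_memI)
      show "cj \<one>\<^bsub>GA P k\<^esub> = \<one>\<^bsub>GA P k\<^esub>" by (simp add: cj_mono t)
    qed (use cjP s(2) in \<open>auto simp: cj_add cj_mult GA_mult\<close>)
  qed (auto simp: cj_cj cj_mono t)
  show "wt (GA P k) (cj a) m = cj (wt (GA P k) a (- m))" for a m
    by (auto simp: cj_mono) (auto simp: dpd_conj_def)
qed

end

text \<open>For \<open>z = 0\<close>, this is meaningful only in the absence of negative terms, which it ignores.\<close>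

definition evl :: "complex \<Rightarrow> (int \<Rightarrow> complex) \<Rightarrow> complex" where
  "evl z f = (\<Sum>m | f m \<noteq> 0. f m * z powi m)"

lemma evl_super: "finite I \<Longrightarrow> {m. f m \<noteq> 0} \<subseteq> I \<Longrightarrow> evl z f = (\<Sum>m\<in>I. f m * z powi m)"
  unfolding evl_def by (rule sum.mono_neutral_left) auto

definition pos :: "(int \<Rightarrow> complex) \<Rightarrow> bool" where "pos f \<longleftrightarrow> (\<forall>m<0. f m = 0)"

lemma evl_mono [simp]: "evl z (lmon m a) = a * z powi m"
  by (subst evl_super[of "{m}"]) (auto simp: lmon_def)

lemma evl_zero [simp]: "evl z (\<lambda>m. 0) = 0" by (simp add: evl_def)

lemma evl_add: assumes "f \<in> lau" "g \<in> lau" shows "evl z (ladd f g) = evl z f + evl z g"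
proof -
  let ?I = "{m. f m \<noteq> 0} \<union> {m. g m \<noteq> 0}"
  have fin: "finite ?I" using assms by (simp add: lau_def)
  show ?thesis
    by (subst (1 2 3) evl_super[OF fin]) (auto simp: ladd_def sum.distrib distrib_right)
qed

text \<open>\<open>0 powi 0\<close> is 1 while \<open>0 powi m\<close> is 0 for all other
  \<open>m\<close>, so at 0 the two exponents must not cancel.\<close>

lemma powi_add_pos: "z \<noteq> (0::complex) \<or> i \<ge> 0 \<and> j \<ge> 0 \<Longrightarrow> z powi (i + j) = z powi i * z powi j"
  by (cases "i = 0 \<or> j = 0") (auto simp: power_int_add)

lemma evl_mult:
  assumes "f \<in> lau" "g \<in> lau" "z \<noteq> 0 \<or> pos f \<and> pos g" shows "evl z (lmul f g) = evl z f * evl z g"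
proof -
  let ?F = "{m. f m \<noteq> 0}" and ?G = "{m. g m \<noteq> 0}"
  let ?I = "(\<lambda>(i, j). i + j) ` (?F \<times> ?G)"
  have fin: "finite ?F" "finite ?G" using assms by (auto simp: lau_def)
  then have finI: "finite ?I" by simp
  have sub: "{m. lmul f g m \<noteq> 0} \<subseteq> ?I"
  proof
    fix m assume "m \<in> {m. lmul f g m \<noteq> 0}"
    then obtain i where "f i \<noteq> 0" "g (m - i) \<noteq> 0" unfolding lmul_def
      by (smt (verit, best) mem_Collect_eq mult_eq_0_iff sum.neutral)
    then have "(i, m - i) \<in> ?F \<times> ?G" by simp
    then have "(case (i, m - i) of (i, j) \<Rightarrow> i + j) \<in> ?I" by (rule imageI)
    then show "m \<in> ?I" by simp
  qed
  have "evl z (lmul f g) = (\<Sum>m\<in>?I. \<Sum>i\<in>?F. f i * g (m - i) * z powi m)"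
    unfolding evl_super[OF finI sub] by (simp add: lmul_def sum_distrib_right)
  also have "\<dots> = (\<Sum>i\<in>?F. \<Sum>m\<in>?I. f i * g (m - i) * z powi m)" by (rule sum.swap)
  also have "\<dots> = (\<Sum>i\<in>?F. \<Sum>j\<in>?G. f i * z powi i * (g j * z powi j))"
  proof (rule sum.cong[OF refl])
    fix i assume i: "i \<in> ?F"
    \<comment> \<open>For fixed \<open>i\<close> only the degrees \<open>i + j\<close> with
      \<open>j\<close> in the support of \<open>g\<close> contribute.\<close>
    have "(\<Sum>m\<in>?I. f i * g (m - i) * z powi m) = (\<Sum>m\<in>(\<lambda>j. i + j) ` ?G. f i * g (m - i) * z powi m)"
    proof (rule sum.mono_neutral_right[OF finI])
      show "(\<lambda>j. i + j) ` ?G \<subseteq> ?I" using i by auto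
      show "\<forall>m\<in>?I - (\<lambda>j. i + j) ` ?G. f i * g (m - i) * z powi m = 0"
      proof
        fix m assume "m \<in> ?I - (\<lambda>j. i + j) ` ?G"
        then have "m \<notin> (\<lambda>j. i + j) ` ?G" by blast
        then have "g (m - i) = 0" by (auto simp: image_iff)
        then show "f i * g (m - i) * z powi m = 0" by simp
      qed
    qed
    also have "\<dots> = (\<Sum>j\<in>?G. f i * g j * z powi (i + j))" by (subst sum.reindex) auto
    also have "\<dots> = (\<Sum>j\<in>?G. f i * z powi i * (g j * z powi j))"
    proof (rule sum.cong[OF refl])
      fix j assume j: "j \<in> ?G"
      have "z \<noteq> 0 \<or> i \<ge> 0 \<and> j \<ge> 0" using assms(3) i j by (auto simp: pos_def) (meson not_le)+
      then show "f i * g j * z powi (i + j) = f i * z powi i * (g j * z powi j)" by (simp add: powi_add_pos)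
    qed
    finally show "(\<Sum>m\<in>?I. f i * g (m - i) * z powi m) = (\<Sum>j\<in>?G. f i * z powi i * (g j * z powi j))" .
  qed
  also have "\<dots> = evl z f * evl z g" by (simp add: evl_def sum_product)
  finally show ?thesis .
qed

text \<open>The link to \<open>poly\<close>, for degrees, divisibility and roots.\<close>

definition lp :: "complex poly \<Rightarrow> int \<Rightarrow> complex" where
  "lp p = (\<lambda>m. if m \<ge> 0 then coeff p (nat m) else 0)"

lemma lp_lau [simp]: "lp p \<in> lau"
proof -
  have "{m. lp p m \<noteq> 0} \<subseteq> {0..int (Polynomial.degree p)}" using le_degree[of p] by (auto simp: lp_def) (metis le_degree nat_le_iff)
  then show ?thesis by (auto simp: lau_def intro: finite_subset)
qed

lemma lp_pos [simp]: "pos (lp p)" by (simp add: pos_def lp_def)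

lemma pos_lmon: "m \<ge> 0 \<Longrightarrow> pos (lmon m a)" by (auto simp: pos_def lmon_def)

lemma lp_add: "lp (p + q) = ladd (lp p) (lp q)" by (auto simp: lp_def ladd_def fun_eq_iff)

lemma lp_monom: "lp (monom a n) = lmon (int n) a" by (auto simp: lp_def lmon_def fun_eq_iff)

lemma lp_pCons: "lp (pCons a p) = ladd (lmon 0 a) (lmul (lmon 1 1) (lp p))"
proof
  fix m
  show "lp (pCons a p) m = ladd (lmon 0 a) (lmul (lmon 1 1) (lp p)) m"
  proof (cases "m > 0")
    case True
    then have "nat m = Suc (nat (m - 1))" by simp
    then show ?thesis using True by (simp add: lmul_mono ladd_def) (simp add: lp_def lmon_def)
  qed (simp add: lmul_mono ladd_def, auto simp: lp_def lmon_def)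
qed

lemma lp_zero [simp]: "lp 0 = (\<lambda>m. 0)" by (auto simp: lp_def)

lemma lp_smult: "lp (smult a p) = lmul (lmon 0 a) (lp p)" by (auto simp: lp_def lmul_mono)

lemma lp_mult: "lp (p * q) = lmul (lp p) (lp q)"
proof (induction p)
  case 0 show ?case by (auto simp: lmul_def)
next
  case (pCons a p)
  have "lp (pCons a p * q) = ladd (lp (smult a q)) (lp (pCons 0 (p * q)))" by (simp add: lp_add)
  also have "\<dots> = ladd (lmul (lmon 0 a) (lp q)) (lmul (lmon 1 1) (lmul (lp p) (lp q)))"
    using pCons by (simp add: lp_smult lp_pCons) (simp add: ladd_def)
  also have "\<dots> = lmul (lp (pCons a p)) (lp q)"
    unfolding lp_pCons by (simp add: lmul_laws(5,2))
  finally show ?case .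
qed

lemma lp_inj: "lp p = lp q \<Longrightarrow> p = q"
  by (rule poly_eqI) (metis lp_def nat_int of_nat_0_le_iff)

lemma evl_lp: "evl z (lp p) = poly p z"
proof (induction p)
  case (pCons a p)
  then show ?case unfolding lp_pCons by (subst evl_add) (simp_all add: evl_mult pos_lmon)
qed simp

lemma pos_lp: assumes "f \<in> lau" "pos f" obtains p where "f = lp p"
proof -
  have fin: "finite {m. f m \<noteq> 0}" using assms by (simp add: lau_def)
  have *: "finite S \<Longrightarrow> (\<And>m. m \<in> S \<Longrightarrow> m \<ge> 0) \<Longrightarrow> \<exists>p. (\<lambda>n. \<Sum>m\<in>S. lmon m (f m) n) = lp p" for S
  proof (induction S rule: finite_induct)
    case empty show ?case by (intro exI[of _ 0]) simp
  next
    case (insert m S)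
    then obtain p where p: "(\<lambda>n. \<Sum>m\<in>S. lmon m (f m) n) = lp p" by blast
    have "(\<lambda>n. \<Sum>m\<in>insert m S. lmon m (f m) n) = ladd (lmon m (f m)) (lp p)"
      unfolding p[symmetric] using insert by (simp add: ladd_def)
    also have "\<dots> = lp (monom (f m) (nat m) + p)" using insert.prems[of m] by (simp add: lp_add lp_monom)
    finally show ?case by blast
  qed
  have "\<exists>p. f = lp p" using *[OF fin] lau_expand[OF assms(1)] assms(2) unfolding pos_def
    by (metis (mono_tags, lifting) linorder_not_le mem_Collect_eq)
  then show ?thesis using that by blast
qed

lemma shift_pos: assumes "f \<in> lau" obtains n where "pos (lmul (lmon (int n) 1) f)"
proof -
  have fin: "finite {m. f m \<noteq> 0}" using assms by (simp add: lau_def)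
  \<comment> \<open>Including 0 keeps the maximum defined when \<open>f\<close> is zero, and makes
    \<open>N\<close> nonnegative.\<close>
  define N where "N = Max (insert 0 (uminus ` {m. f m \<noteq> 0}))"
  have N: "- m \<le> N" if "f m \<noteq> 0" for m unfolding N_def by (rule Max_ge) (use fin that in auto)
  have "N \<ge> 0" unfolding N_def by (rule Max_ge) (use fin in auto)
  then have "pos (lmul (lmon (int (nat N)) 1) f)"
    unfolding pos_def using N by (force simp: lmul_mono)
  then show ?thesis using that by blast
qed

text \<open>A shift by a power of the coordinate turns \<open>f\<close> into a polynomial with
  infinitely many roots.\<close>

lemma evl_all_zero:
  assumes f: "f \<in> lau" and z: "\<And>z. z \<noteq> 0 \<Longrightarrow> evl z f = 0" shows "f = (\<lambda>m. 0)"
proof -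
  obtain n where n: "pos (lmul (lmon (int n) 1) f)" using shift_pos[OF f] by blast
  obtain p where p: "lmul (lmon (int n) 1) f = lp p" using pos_lp[OF _ n] f by auto
  have "poly p z = 0" if "z \<noteq> 0" for z
    using evl_mult[of "lmon (int n) 1" f z] z[OF that] that f by (simp add: p flip: evl_lp)
  then have "- {0} \<subseteq> {z. poly p z = 0}" by auto
  moreover have "infinite (- {0::complex})" by (simp add: infinite_UNIV_char_0 Compl_eq_Diff_UNIV)
  ultimately have "p = 0" using poly_roots_finite finite_subset by blast
  then have "lmul (lmon (int n) 1) f = (\<lambda>m. 0)" using p by simp
  then show ?thesis using lmul_laws(7)[of "lmon (int n) 1" f] f by (auto simp: mono_eq0)
qed

lemma point_eq: "point = coord UNIV (\<lambda>z. z)" by (simp add: point_def id_def)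

lemma circle_GA: "gm_product point = GA lau (\<lambda>z. z)" "circle = GA lau (\<lambda>z. z)"
proof -
  show "gm_product point = GA lau (\<lambda>z. z)" unfolding GA_def point_eq
    by (rule gmalg.equality) auto
  then show "circle = GA lau (\<lambda>z. z)" by (simp add: circle_def)
qed

lemma circle_conj_eq: "circle_conj = dpd_conj cnj 1" "circle_hat_conj = dpd_conj cnj (- 1)"
proof -
  have "(- 1 :: complex) powi (- m) = (- 1) powi m" for m by (cases "even m") auto
  then show "circle_conj = dpd_conj cnj 1" "circle_hat_conj = dpd_conj cnj (- 1)"
    by (auto simp: circle_conj_def product_conj_def dpd_conj_def circle_hat_conj_def fun_eq_iff)
qed

section \<open>Quotients and transport of structure\<close>

lemma gm_quot_simps [simp]:
  "carrier (gm_quot R J) = carrier (R Quot J)" "monoid.mult (gm_quot R J) = monoid.mult (R Quot J)"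
  "one (gm_quot R J) = one (R Quot J)" "ring.zero (gm_quot R J) = ring.zero (R Quot J)"
  "add (gm_quot R J) = add (R Quot J)" "cst (gm_quot R J) = (\<lambda>z. J +>\<^bsub>R\<^esub> cst R z)"
  "wt (gm_quot R J) = (\<lambda>V m. \<Union>a\<in>V. J +>\<^bsub>R\<^esub> wt R a m)"
  by (simp_all add: gm_quot_def mk_gmalg_def mk_calg_def gmalg.defs calg.defs ring.defs)

lemma quot_iso:
  assumes V: "cring V" and W: "cring W" and \<phi>: "\<phi> \<in> ring_hom V W" "\<phi> ` carrier V = carrier W"
    and J: "J = {a \<in> carrier V. \<phi> a = \<zero>\<^bsub>W\<^esub>}"
  obtains \<Phi> where "\<Phi> \<in> ring_iso (V Quot J) W" "\<And>a. a \<in> carrier V \<Longrightarrow> \<Phi> (J +>\<^bsub>V\<^esub> a) = \<phi> a"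
    "\<And>a b. a \<in> carrier V \<Longrightarrow> b \<in> carrier V \<Longrightarrow> J +>\<^bsub>V\<^esub> a = J +>\<^bsub>V\<^esub> b \<longleftrightarrow> \<phi> a = \<phi> b" "ideal J V"
    "carrier (V Quot J) = {J +>\<^bsub>V\<^esub> a | a. a \<in> carrier V}" "\<And>a. a \<in> carrier V \<Longrightarrow> a \<in> J +>\<^bsub>V\<^esub> a"
    "\<And>a b. a \<in> carrier V \<Longrightarrow> b \<in> J +>\<^bsub>V\<^esub> a \<Longrightarrow> b \<in> carrier V \<and> \<phi> b = \<phi> a"
proof -
  interpret V: cring V by fact
  interpret W: cring W by fact
  interpret h: ring_hom_ring V W \<phi> by (rule ring_hom_ringI2[OF V.ring_axioms W.ring_axioms \<phi>(1)])
  have k: "a_kernel V W \<phi> = J" unfolding a_kernel_def' J ..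
  have iJ: "ideal J V" using h.kernel_is_ideal k by simp
  interpret J: ideal J V by fact
  let ?\<Phi> = "\<lambda>Y. the_elem (\<phi> ` Y)"
  have iso: "?\<Phi> \<in> ring_iso (V Quot J) W" using h.FactRing_iso_set[OF \<phi>(2)] k by simp
  have mem: "a \<in> J +>\<^bsub>V\<^esub> a" if "a \<in> carrier V" for a using that by (rule J.a_rcos_self)
  have img: "b \<in> carrier V \<and> \<phi> b = \<phi> a" if ab: "a \<in> carrier V" "b \<in> J +>\<^bsub>V\<^esub> a" for a b
  proof -
    obtain j where j: "j \<in> J" "b = j \<oplus>\<^bsub>V\<^esub> a" using ab(2) by (auto simp: a_r_coset_def')
    have "j \<in> {a \<in> carrier V. \<phi> a = \<zero>\<^bsub>W\<^esub>}" using j(1) unfolding J .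
    then have jc: "j \<in> carrier V" "\<phi> j = \<zero>\<^bsub>W\<^esub>" by blast+
    then show ?thesis unfolding j(2) using ab(1) h.hom_add[OF jc(1) ab(1)] V.a_closed[OF jc(1) ab(1)] h.hom_closed[OF ab(1)] W.l_zero by metis
  qed
  have \<Phi>: "?\<Phi> (J +>\<^bsub>V\<^esub> a) = \<phi> a" if "a \<in> carrier V" for a
  proof -
    have "\<phi> ` (J +>\<^bsub>V\<^esub> a) = {\<phi> a}" using img[OF that] mem[OF that] by blast
    then show ?thesis by (simp only: the_elem_eq)
  qed
  have car: "carrier (V Quot J) = {J +>\<^bsub>V\<^esub> a | a. a \<in> carrier V}"
    by (auto simp: FactRing_def A_RCOSETS_def')
  have eq: "J +>\<^bsub>V\<^esub> a = J +>\<^bsub>V\<^esub> b \<longleftrightarrow> \<phi> a = \<phi> b" if "a \<in> carrier V" "b \<in> carrier V" for a b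
  proof
    assume "J +>\<^bsub>V\<^esub> a = J +>\<^bsub>V\<^esub> b" then show "\<phi> a = \<phi> b" using mem[OF that(1)] img[OF that(2), of a] by blast
  next
    assume e: "\<phi> a = \<phi> b"
    have inj: "inj_on ?\<Phi> (carrier (V Quot J))" using ring_iso_memE(5)[OF iso] by (simp add: bij_betw_def)
    show "J +>\<^bsub>V\<^esub> a = J +>\<^bsub>V\<^esub> b" 
    proof (rule inj_onD[OF inj])
      show "?\<Phi> (J +>\<^bsub>V\<^esub> a) = ?\<Phi> (J +>\<^bsub>V\<^esub> b)" unfolding \<Phi>[OF that(1)] \<Phi>[OF that(2)] by (rule e)
      show "J +>\<^bsub>V\<^esub> a \<in> carrier (V Quot J)" "J +>\<^bsub>V\<^esub> b \<in> carrier (V Quot J)" unfolding car using that by blast+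
    qed
  qed
  show ?thesis by (rule that[OF iso \<Phi> eq iJ car mem img])
qed

lemma gm_quot_iso:
  assumes V: "cring V" and W: "cring W" and \<phi>: "\<phi> \<in> ring_hom V W" "\<phi> ` carrier V = carrier W"
    and J: "J = {a \<in> carrier V. \<phi> a = \<zero>\<^bsub>W\<^esub>}"
    and c: "\<And>z. cst V z \<in> carrier V" "\<And>z. \<phi> (cst V z) = cst W z"
    and w: "\<And>a m. a \<in> carrier V \<Longrightarrow> wt V a m \<in> carrier V" "\<And>a m. a \<in> carrier V \<Longrightarrow> \<phi> (wt V a m) = wt W (\<phi> a) m"
  obtains \<Phi> where "gm_iso (gm_quot V J) W \<Phi>" "\<And>a. a \<in> carrier V \<Longrightarrow> \<Phi> (J +>\<^bsub>V\<^esub> a) = \<phi> a"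
    "\<And>a b. a \<in> carrier V \<Longrightarrow> b \<in> carrier V \<Longrightarrow> J +>\<^bsub>V\<^esub> a = J +>\<^bsub>V\<^esub> b \<longleftrightarrow> \<phi> a = \<phi> b" "ideal J V"
    "carrier (gm_quot V J) = {J +>\<^bsub>V\<^esub> a | a. a \<in> carrier V}"
    "\<And>a m. a \<in> carrier V \<Longrightarrow> wt (gm_quot V J) (J +>\<^bsub>V\<^esub> a) m = J +>\<^bsub>V\<^esub> wt V a m"
    "\<And>\<sigma> a. (\<And>a b. a \<in> carrier V \<Longrightarrow> b \<in> carrier V \<Longrightarrow> \<phi> a = \<phi> b \<Longrightarrow> \<sigma> a \<in> carrier V \<and> \<phi> (\<sigma> a) = \<phi> (\<sigma> b)) \<Longrightarrow>
       a \<in> carrier V \<Longrightarrow> quot_conj V J \<sigma> (J +>\<^bsub>V\<^esub> a) = J +>\<^bsub>V\<^esub> \<sigma> a"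
proof -
  obtain \<Phi> where q: "\<Phi> \<in> ring_iso (V Quot J) W" "\<And>a. a \<in> carrier V \<Longrightarrow> \<Phi> (J +>\<^bsub>V\<^esub> a) = \<phi> a"
    "\<And>a b. a \<in> carrier V \<Longrightarrow> b \<in> carrier V \<Longrightarrow> J +>\<^bsub>V\<^esub> a = J +>\<^bsub>V\<^esub> b \<longleftrightarrow> \<phi> a = \<phi> b" "ideal J V"
    "carrier (V Quot J) = {J +>\<^bsub>V\<^esub> a | a. a \<in> carrier V}" "\<And>a. a \<in> carrier V \<Longrightarrow> a \<in> J +>\<^bsub>V\<^esub> a"
    "\<And>a b. a \<in> carrier V \<Longrightarrow> b \<in> J +>\<^bsub>V\<^esub> a \<Longrightarrow> b \<in> carrier V \<and> \<phi> b = \<phi> a"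
    by (rule quot_iso[OF V W \<phi> J]) blast
  \<comment> \<open>Weights and conjugation on the quotient are unions over all representatives;
    they collapse to one coset when \<open>g\<close> respects the fibres of
    \<open>\<phi>\<close>.\<close>
  have un: "(\<Union>b\<in>J +>\<^bsub>V\<^esub> a. J +>\<^bsub>V\<^esub> g b) = J +>\<^bsub>V\<^esub> g a"
    if a: "a \<in> carrier V" and g: "\<And>a b. a \<in> carrier V \<Longrightarrow> b \<in> carrier V \<Longrightarrow> \<phi> a = \<phi> b \<Longrightarrow> g a \<in> carrier V \<and> \<phi> (g a) = \<phi> (g b)"
    for a g
  proof -
    have "J +>\<^bsub>V\<^esub> g b = J +>\<^bsub>V\<^esub> g a" if b: "b \<in> J +>\<^bsub>V\<^esub> a" for b
    proof -
      note b' = q(7)[OF a b]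
      note g1 = g[OF conjunct1[OF b'] a conjunct2[OF b']] and g2 = g[OF a a refl]
      show ?thesis by (rule iffD2[OF q(3)[OF conjunct1[OF g1] conjunct1[OF g2]] conjunct2[OF g1]])
    qed
    then show ?thesis using q(6)[OF a] by blast
  qed
  have wt: "wt (gm_quot V J) (J +>\<^bsub>V\<^esub> a) m = J +>\<^bsub>V\<^esub> wt V a m" if a: "a \<in> carrier V" for a m
    unfolding gm_quot_simps by (rule un[OF a]) (metis w)
  have iso: "gm_iso (gm_quot V J) W \<Phi>"
    unfolding gm_iso_def gm_hom_def calg_hom_def
  proof (intro conjI ballI allI)
    show 1: "\<Phi> \<in> ring_iso (gm_quot V J) W" using q(1) unfolding ring_iso_def ring_hom_def gm_quot_simps .
    then show "\<Phi> \<in> ring_hom (gm_quot V J) W" by (simp add: ring_iso_def)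
    show "\<Phi> (cst (gm_quot V J) z) = cst W z" for z unfolding gm_quot_simps q(2)[OF c(1)] c(2) ..
    fix Y m assume "Y \<in> carrier (gm_quot V J)"
    then obtain a where a: "a \<in> carrier V" "Y = J +>\<^bsub>V\<^esub> a" unfolding gm_quot_simps q(5) by blast
    show "wt W (\<Phi> Y) m = \<Phi> (wt (gm_quot V J) Y m)"
      unfolding a(2) wt[OF a(1)] q(2)[OF a(1)] q(2)[OF w(1)[OF a(1)]] w(2)[OF a(1)] ..
  qed
  have qc: "quot_conj V J \<sigma> (J +>\<^bsub>V\<^esub> a) = J +>\<^bsub>V\<^esub> \<sigma> a"
    if "\<And>a b. a \<in> carrier V \<Longrightarrow> b \<in> carrier V \<Longrightarrow> \<phi> a = \<phi> b \<Longrightarrow> \<sigma> a \<in> carrier V \<and> \<phi> (\<sigma> a) = \<phi> (\<sigma> b)" "a \<in> carrier V" for \<sigma> a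
    unfolding quot_conj_def by (rule un[OF that(2) that(1)])
  have car: "carrier (gm_quot V J) = {J +>\<^bsub>V\<^esub> a | a. a \<in> carrier V}" unfolding gm_quot_simps by (rule q(5))
  show ?thesis by (rule that[OF iso q(2) q(3) q(4) car wt qc])
qed

lemma ring_iso_inv:
  assumes iso: "\<Phi> \<in> ring_iso F W" and F: "\<one>\<^bsub>F\<^esub> \<in> carrier F"
    "\<And>x y. x \<in> carrier F \<Longrightarrow> y \<in> carrier F \<Longrightarrow> x \<otimes>\<^bsub>F\<^esub> y \<in> carrier F \<and> x \<oplus>\<^bsub>F\<^esub> y \<in> carrier F"
  shows "inv_into (carrier F) \<Phi> \<in> ring_iso W F"
    "\<And>x. x \<in> carrier F \<Longrightarrow> inv_into (carrier F) \<Phi> (\<Phi> x) = x"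
    "\<And>y. y \<in> carrier W \<Longrightarrow> inv_into (carrier F) \<Phi> y \<in> carrier F \<and> \<Phi> (inv_into (carrier F) \<Phi> y) = y"
proof -
  note e = ring_iso_memE[OF iso]
  have inj: "inj_on \<Phi> (carrier F)" and sur: "\<Phi> ` carrier F = carrier W" using e(5) by (auto simp: bij_betw_def)
  let ?i = "inv_into (carrier F) \<Phi>"
  show a: "?i (\<Phi> x) = x" if "x \<in> carrier F" for x using inv_into_f_f[OF inj that] .
  show b: "?i y \<in> carrier F \<and> \<Phi> (?i y) = y" if "y \<in> carrier W" for y
    using inv_into_into[of y \<Phi> "carrier F"] f_inv_into_f[of y \<Phi> "carrier F"] that sur by auto
  show "?i \<in> ring_iso W F"
  proof (rule ring_iso_memI)
    fix x y assume xy: "x \<in> carrier W" "y \<in> carrier W"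
    have "x \<otimes>\<^bsub>W\<^esub> y = \<Phi> (?i x \<otimes>\<^bsub>F\<^esub> ?i y)" "x \<oplus>\<^bsub>W\<^esub> y = \<Phi> (?i x \<oplus>\<^bsub>F\<^esub> ?i y)" using e(2,3) b xy by auto
    then show "?i (x \<otimes>\<^bsub>W\<^esub> y) = ?i x \<otimes>\<^bsub>F\<^esub> ?i y" "?i (x \<oplus>\<^bsub>W\<^esub> y) = ?i x \<oplus>\<^bsub>F\<^esub> ?i y" using a F(2) b xy by auto
  next
    show "?i \<one>\<^bsub>W\<^esub> = \<one>\<^bsub>F\<^esub>" using a[OF F(1)] e(4) by simp
    show "bij_betw ?i (carrier W) (carrier F)" by (rule bij_betw_inv_into[OF e(5)])
  qed (use b in auto)
qed

lemma ring_iso_domain: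
  assumes iso: "\<Phi> \<in> ring_iso W F" and z: "\<Phi> \<zero>\<^bsub>W\<^esub> = \<zero>\<^bsub>F\<^esub>"
  shows "cring W \<Longrightarrow> cring F" "domain W \<Longrightarrow> domain F"
  using cring.ring_iso_imp_img_cring[OF _ iso] domain.ring_iso_imp_img_domain[OF _ iso] z by auto

text \<open>Each axiom for \<open>F\<close> is an equation that can be tested after applying the
  injective map \<open>\<Phi>\<close>; the supports of weight decompositions correspond, which gives
  their finiteness.\<close>

lemma S1_action_transport:
  assumes iso: "S1_iso F \<sigma>F W \<sigma>W \<Phi>" and W: "S1_action W \<sigma>W" and F: "cring F"
    and c: "\<And>z. cst F z \<in> carrier F" and w: "\<And>x m. x \<in> carrier F \<Longrightarrow> wt F x m \<in> carrier F"
    and s: "\<And>x. x \<in> carrier F \<Longrightarrow> \<sigma>F x \<in> carrier F"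
  shows "S1_action F \<sigma>F"
proof -
  interpret F: cring F by fact
  have rW: "cring W" using W by (simp add: S1_action_def gm_action_def)
  interpret W: cring W by fact
  have ri: "\<Phi> \<in> ring_iso F W" and \<Phi>c: "\<Phi> (cst F z) = cst W z" and
    \<Phi>w: "x \<in> carrier F \<Longrightarrow> wt W (\<Phi> x) m = \<Phi> (wt F x m)" and \<Phi>s: "x \<in> carrier F \<Longrightarrow> \<Phi> (\<sigma>F x) = \<sigma>W (\<Phi> x)" for x m z
    using iso by (auto simp: S1_iso_def gm_iso_def gm_hom_def calg_hom_def)
  note e = ring_iso_memE[OF ri]
  interpret h: ring_hom_cring F W \<Phi>
    by (rule ring_hom_cringI[OF F rW]) (use ri in \<open>simp add: ring_iso_def\<close>)
  have inj: "x = y" if "\<Phi> x = \<Phi> y" "x \<in> carrier F" "y \<in> carrier F" for x y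
    using that e(5) by (auto simp: bij_betw_def inj_on_def)
  have z: "\<Phi> x = \<zero>\<^bsub>W\<^esub> \<longleftrightarrow> x = \<zero>\<^bsub>F\<^esub>" if "x \<in> carrier F" for x using inj[of x "\<zero>\<^bsub>F\<^esub>"] that by auto
  have gW: "wt W \<in> ring_hom W (laurent W)" "\<And>z. wt W (cst W z) = lmonom W 0 (cst W z)"
    "\<And>a. a \<in> carrier W \<Longrightarrow> finsum W (wt W a) {m. wt W a m \<noteq> \<zero>\<^bsub>W\<^esub>} = a"
    "\<And>a m. a \<in> carrier W \<Longrightarrow> wt W (wt W a m) = lmonom W m (wt W a m)" "calg_hom point W (cst W)"
    "\<sigma>W \<in> ring_hom W W" "\<And>a. a \<in> carrier W \<Longrightarrow> \<sigma>W (\<sigma>W a) = a" "\<And>z. \<sigma>W (cst W z) = cst W (cnj z)"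
    "\<And>a m. a \<in> carrier W \<Longrightarrow> wt W (\<sigma>W a) m = \<sigma>W (wt W a (- m))"
    using W by (auto simp: S1_action_def gm_action_def real_structure_def)
  have supp: "{m. wt W (\<Phi> x) m \<noteq> \<zero>\<^bsub>W\<^esub>} = {m. wt F x m \<noteq> \<zero>\<^bsub>F\<^esub>}" if "x \<in> carrier F" for x
    using z[OF w[OF that]] \<Phi>w[OF that] by auto
  have fin: "finite {m. wt F x m \<noteq> \<zero>\<^bsub>F\<^esub>}" if "x \<in> carrier F" for x
    using supp[OF that] ring_hom_memE(1)[OF gW(1) e(1)[OF that]] by (simp add: laurent_def)
  have lm: "\<Phi> (lmonom F m x n) = lmonom W m (\<Phi> x) n" if "x \<in> carrier F" for m n x
    by (simp add: lmonom_def)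
  have g: "gm_action F"
    unfolding gm_action_def
  proof (intro conjI ballI allI)
    show "cring F" by fact
    show "calg_hom point F (cst F)"
    proof -
      note r = ring_hom_memE[OF conjunct1[OF gW(5)[unfolded calg_hom_def]]]
      have "cst F \<in> ring_hom point F"
      proof (rule ring_hom_memI)
        fix x y :: complex
        have p: "x \<in> carrier point" "y \<in> carrier point" by (simp_all add: point_eq)
        show "cst F x \<in> carrier F" by (rule c)
        show "cst F (x \<otimes>\<^bsub>point\<^esub> y) = cst F x \<otimes>\<^bsub>F\<^esub> cst F y"
          by (rule inj) (use c \<Phi>c e(2)[OF c c] r(2)[OF p] in auto)
        show "cst F (x \<oplus>\<^bsub>point\<^esub> y) = cst F x \<oplus>\<^bsub>F\<^esub> cst F y"
          by (rule inj) (use c \<Phi>c e(3)[OF c c] r(3)[OF p] in auto)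
        show "cst F \<one>\<^bsub>point\<^esub> = \<one>\<^bsub>F\<^esub>" by (rule inj) (use c \<Phi>c e(4) r(4) in auto)
      qed
      then show ?thesis by (simp add: calg_hom_def point_eq)
    qed
    show "wt F \<in> ring_hom F (laurent F)"
    proof (rule ring_hom_memI)
      fix x assume x: "x \<in> carrier F"
      show "wt F x \<in> carrier (laurent F)" using w x fin by (simp add: laurent_def)
      fix y assume y: "y \<in> carrier F"
      show "wt F (x \<oplus>\<^bsub>F\<^esub> y) = wt F x \<oplus>\<^bsub>laurent F\<^esub> wt F y"
      proof
        fix m
        have "wt W (\<Phi> x \<oplus>\<^bsub>W\<^esub> \<Phi> y) m = wt W (\<Phi> x) m \<oplus>\<^bsub>W\<^esub> wt W (\<Phi> y) m"
          using ring_hom_memE(3)[OF gW(1) e(1)[OF x] e(1)[OF y]] by (simp add: laurent_def)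
        then have "\<Phi> (wt F (x \<oplus>\<^bsub>F\<^esub> y) m) = \<Phi> (wt F x m \<oplus>\<^bsub>F\<^esub> wt F y m)"
          using x y w by (simp add: \<Phi>w flip: e(3))
        then have "wt F (x \<oplus>\<^bsub>F\<^esub> y) m = wt F x m \<oplus>\<^bsub>F\<^esub> wt F y m" by (rule inj) (use x y w in auto)
        then show "wt F (x \<oplus>\<^bsub>F\<^esub> y) m = (wt F x \<oplus>\<^bsub>laurent F\<^esub> wt F y) m" by (simp add: laurent_def)
      qed
      show "wt F (x \<otimes>\<^bsub>F\<^esub> y) = wt F x \<otimes>\<^bsub>laurent F\<^esub> wt F y"
      proof
        fix m
        let ?I = "{i. wt F x i \<noteq> \<zero>\<^bsub>F\<^esub>}"
        have "wt W (\<Phi> x \<otimes>\<^bsub>W\<^esub> \<Phi> y) m = finsum W (\<lambda>i. wt W (\<Phi> x) i \<otimes>\<^bsub>W\<^esub> wt W (\<Phi> y) (m - i)) ?I"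
          using ring_hom_memE(2)[OF gW(1) e(1)[OF x] e(1)[OF y]] supp[OF x] by (simp add: laurent_def)
        also have "\<dots> = finsum W (\<lambda>i. \<Phi> (wt F x i \<otimes>\<^bsub>F\<^esub> wt F y (m - i))) ?I"
          using x y w by (intro W.finsum_cong') (auto simp: \<Phi>w)
        also have "\<dots> = \<Phi> (finsum F (\<lambda>i. wt F x i \<otimes>\<^bsub>F\<^esub> wt F y (m - i)) ?I)"
          using x y w by (subst h.hom_finsum) (auto simp: comp_def)
        finally have "\<Phi> (wt F (x \<otimes>\<^bsub>F\<^esub> y) m) = \<Phi> (finsum F (\<lambda>i. wt F x i \<otimes>\<^bsub>F\<^esub> wt F y (m - i)) ?I)"
          using x y by (simp add: \<Phi>w flip: e(2))
        then have "wt F (x \<otimes>\<^bsub>F\<^esub> y) m = finsum F (\<lambda>i. wt F x i \<otimes>\<^bsub>F\<^esub> wt F y (m - i)) ?I"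
          by (rule inj) (use x y w in \<open>auto intro!: F.finsum_closed\<close>)
        then show "wt F (x \<otimes>\<^bsub>F\<^esub> y) m = (wt F x \<otimes>\<^bsub>laurent F\<^esub> wt F y) m" by (simp add: laurent_def)
      qed
    next
      show "wt F \<one>\<^bsub>F\<^esub> = \<one>\<^bsub>laurent F\<^esub>"
      proof
        fix m
        have "\<Phi> (wt F \<one>\<^bsub>F\<^esub> m) = \<Phi> (\<one>\<^bsub>laurent F\<^esub> m)"
          using ring_hom_memE(4)[OF gW(1)] e(4) \<Phi>w[of "\<one>\<^bsub>F\<^esub>" m] by (auto simp: laurent_def split: if_splits)
        then show "wt F \<one>\<^bsub>F\<^esub> m = \<one>\<^bsub>laurent F\<^esub> m" by (rule inj) (use w in \<open>auto simp: laurent_def\<close>)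
      qed
    qed
    show "wt F (cst F z) = lmonom F 0 (cst F z)" for z
    proof
      fix m
      have "\<Phi> (wt F (cst F z) m) = \<Phi> (lmonom F 0 (cst F z) m)"
        using gW(2) \<Phi>w[OF c, of z m] \<Phi>c lm[OF c] by simp
      then show "wt F (cst F z) m = lmonom F 0 (cst F z) m" by (rule inj) (use w c in \<open>auto simp: lmonom_def\<close>)
    qed
    fix x assume x: "x \<in> carrier F"
    show "wt F (wt F x m) = lmonom F m (wt F x m)" for m
    proof
      fix n
      have "\<Phi> (wt F (wt F x m) n) = \<Phi> (lmonom F m (wt F x m) n)"
        using gW(4)[OF e(1)[OF x]] \<Phi>w[OF w[OF x]] \<Phi>w[OF x] lm[OF w[OF x]] by metis
      then show "wt F (wt F x m) n = lmonom F m (wt F x m) n" by (rule inj) (use w x in \<open>auto simp: lmonom_def\<close>)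
    qed
    have "\<Phi> (finsum F (wt F x) {m. wt F x m \<noteq> \<zero>\<^bsub>F\<^esub>}) = finsum W (wt W (\<Phi> x)) {m. wt F x m \<noteq> \<zero>\<^bsub>F\<^esub>}"
      using x w by (subst h.hom_finsum) (auto simp: comp_def \<Phi>w[OF x] intro!: W.finsum_cong')
    also have "\<dots> = \<Phi> x" using gW(3)[OF e(1)[OF x]] supp[OF x] by simp
    finally show "finsum F (wt F x) {m. wt F x m \<noteq> \<zero>\<^bsub>F\<^esub>} = x" by (rule inj) (use w x in \<open>auto intro!: F.finsum_closed\<close>)
  qed
  show ?thesis unfolding S1_action_def
  proof (intro conjI g ballI allI)
    show "real_structure F \<sigma>F" unfolding real_structure_def
    proof (intro conjI ballI allI)
      show "\<sigma>F \<in> ring_hom F F"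
      proof (rule ring_hom_memI)
        fix x y assume xy: "x \<in> carrier F" "y \<in> carrier F"
        note r = ring_hom_memE[OF gW(6)]
        show "\<sigma>F x \<in> carrier F" by (rule s[OF xy(1)])
        show "\<sigma>F (x \<otimes>\<^bsub>F\<^esub> y) = \<sigma>F x \<otimes>\<^bsub>F\<^esub> \<sigma>F y"
          by (rule inj) (use xy s r(2)[OF e(1) e(1)] in \<open>auto simp: \<Phi>s\<close>)
        show "\<sigma>F (x \<oplus>\<^bsub>F\<^esub> y) = \<sigma>F x \<oplus>\<^bsub>F\<^esub> \<sigma>F y"
          by (rule inj) (use xy s r(3)[OF e(1) e(1)] in \<open>auto simp: \<Phi>s\<close>)
      next
        show "\<sigma>F \<one>\<^bsub>F\<^esub> = \<one>\<^bsub>F\<^esub>" by (rule inj) (use s ring_hom_memE(4)[OF gW(6)] e(4) in \<open>auto simp: \<Phi>s\<close>)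
      qed
      show "\<sigma>F (\<sigma>F x) = x" if x: "x \<in> carrier F" for x
        by (rule inj) (use s x gW(7)[OF e(1)[OF x]] in \<open>auto simp: \<Phi>s\<close>)
      show "\<sigma>F (cst F z) = cst F (cnj z)" for z
        by (rule inj) (use s c gW(8) in \<open>auto simp: \<Phi>s \<Phi>c\<close>)
    qed
    fix x m assume x: "x \<in> carrier F"
    have "\<Phi> (wt F (\<sigma>F x) m) = \<Phi> (\<sigma>F (wt F x (- m)))"
      using gW(9)[OF e(1)[OF x], of m] \<Phi>w[OF s[OF x]] \<Phi>w[OF x] \<Phi>s[OF x] \<Phi>s[OF w[OF x]] by metis
    then show "wt F (\<sigma>F x) m = \<sigma>F (wt F x (- m))" by (rule inj) (use s w x in auto)
  qed
qed

section \<open>A criterion for triviality\<close>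

text \<open>Two algebras are compared through a common model \<open>G\<close>, which avoids a direct
  map between classes of fractions.\<close>

lemma gm_iso_compose:
  assumes a: "gm_iso G P \<alpha>" and b: "gm_iso G Q \<beta>" and G: "cring G" "\<And>z. cst G z \<in> carrier G"
    "\<And>x m. x \<in> carrier G \<Longrightarrow> wt G x m \<in> carrier G"
  shows "gm_iso P Q (\<lambda>y. \<beta> (inv_into (carrier G) \<alpha> y))"
    "\<And>x. x \<in> carrier G \<Longrightarrow> \<beta> (inv_into (carrier G) \<alpha> (\<alpha> x)) = \<beta> x"
proof -
  interpret cring G by fact
  let ?i = "inv_into (carrier G) \<alpha>"
  have A: "\<alpha> \<in> ring_iso G P" "\<And>z. \<alpha> (cst G z) = cst P z" "\<And>x m. x \<in> carrier G \<Longrightarrow> wt P (\<alpha> x) m = \<alpha> (wt G x m)"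
    and B: "\<beta> \<in> ring_iso G Q" "\<And>z. \<beta> (cst G z) = cst Q z" "\<And>x m. x \<in> carrier G \<Longrightarrow> wt Q (\<beta> x) m = \<beta> (wt G x m)"
    using a b by (auto simp: gm_iso_def gm_hom_def calg_hom_def)
  note i = ring_iso_inv[OF A(1)]
  have i1: "?i \<in> ring_iso P G" and i2: "\<And>x. x \<in> carrier G \<Longrightarrow> ?i (\<alpha> x) = x"
    and i3: "\<And>y. y \<in> carrier P \<Longrightarrow> ?i y \<in> carrier G \<and> \<alpha> (?i y) = y" using i by auto
  have r: "(\<lambda>y. \<beta> (?i y)) \<in> ring_iso P Q"
    using ring_iso_set_trans[OF i1 B(1)] by (simp add: comp_def)
  show "gm_iso P Q (\<lambda>y. \<beta> (?i y))" unfolding gm_iso_def gm_hom_def calg_hom_def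
  proof (intro conjI ballI allI)
    show "(\<lambda>y. \<beta> (?i y)) \<in> ring_iso P Q" by fact
    then show "(\<lambda>y. \<beta> (?i y)) \<in> ring_hom P Q" by (simp add: ring_iso_def)
    show "\<beta> (?i (cst P z)) = cst Q z" for z using i2[OF G(2), of z] A(2) B(2) by simp
    fix y m assume y: "y \<in> carrier P"
    obtain x where x: "x \<in> carrier G" "y = \<alpha> x" using i3[OF y] by metis
    show "wt Q (\<beta> (?i y)) m = \<beta> (?i (wt P y m))" using x i2 A(3) B(3) G(3) by simp
  qed
  show "\<And>x. x \<in> carrier G \<Longrightarrow> \<beta> (?i (\<alpha> x)) = \<beta> x" using i2 by simp
qed

lemma loc_calg_simps [simp]:
  "carrier (loc_calg R M) = {fraction R M a s | a s. a \<in> carrier R \<and> s \<in> M}"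
  "monoid.mult (loc_calg R M) = (\<lambda>V W. \<Union>(a, s)\<in>V. \<Union>(b, t)\<in>W. fraction R M (a \<otimes>\<^bsub>R\<^esub> b) (s \<otimes>\<^bsub>R\<^esub> t))"
  "one (loc_calg R M) = fraction R M \<one>\<^bsub>R\<^esub> \<one>\<^bsub>R\<^esub>" "ring.zero (loc_calg R M) = fraction R M \<zero>\<^bsub>R\<^esub> \<one>\<^bsub>R\<^esub>"
  "add (loc_calg R M) = (\<lambda>V W. \<Union>(a, s)\<in>V. \<Union>(b, t)\<in>W. fraction R M ((a \<otimes>\<^bsub>R\<^esub> t) \<oplus>\<^bsub>R\<^esub> (b \<otimes>\<^bsub>R\<^esub> s)) (s \<otimes>\<^bsub>R\<^esub> t))"
  "cst (loc_calg R M) = (\<lambda>z. fraction R M (cst R z) \<one>\<^bsub>R\<^esub>)"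
  by (simp_all add: loc_calg_def mk_calg_def calg.defs ring.defs)

lemma loc_gm_simps [simp]:
  "carrier (loc_gm R M) = carrier (loc_calg R M)" "monoid.mult (loc_gm R M) = monoid.mult (loc_calg R M)"
  "one (loc_gm R M) = one (loc_calg R M)" "ring.zero (loc_gm R M) = ring.zero (loc_calg R M)"
  "add (loc_gm R M) = add (loc_calg R M)" "cst (loc_gm R M) = cst (loc_calg R M)"
  "wt (loc_gm R M) = (\<lambda>V m. \<Union>(a, s)\<in>V. fraction R M (wt R a m) s)"
  by (simp_all add: loc_gm_def mk_gmalg_def mk_calg_def gmalg.defs loc_calg_def calg.defs ring.defs)

text \<open>Operations on fractions are unions over all representatives; if every representative
  gives the same class, one of them determines the union.\<close>

lemma UN_const_pair: "p \<in> V \<Longrightarrow> (\<And>a s. (a, s) \<in> V \<Longrightarrow> F a s = c) \<Longrightarrow> (\<Union>(a, s)\<in>V. F a s) = c"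
  by (rule UN_constant_eq) auto

text \<open>
  \<open>P\<close> is embedded into the Laurent polynomials over the fraction field of \<open>B\<close>, and becomes equal to
  the Laurent polynomials over \<open>B\<close> after inverting \<open>f\<close>.
\<close>

locale triv =
  fixes B0 :: "'k::field set" and k :: "complex \<Rightarrow> 'k" and f :: 'k
    and P :: "('a, 'm) gmalg_scheme" and \<chi> :: "'a \<Rightarrow> int \<Rightarrow> 'k" and \<rho> :: "'k \<Rightarrow> 'a"
  assumes B0: "sring B0" and f: "f \<in> B0" "f \<noteq> 0" and k: "khom k" and kB: "\<And>z. k z \<in> B0"
    and P: "cring P" and \<chi>: "\<chi> \<in> ring_hom P (GA lau k)" and inj: "inj_on \<chi> (carrier P)"
    and wtP: "\<And>a m. a \<in> carrier P \<Longrightarrow> wt P a m \<in> carrier P" "\<And>a m. a \<in> carrier P \<Longrightarrow> \<chi> (wt P a m) = lmon m (\<chi> a m)"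
    and \<rho>: "\<And>b. b \<in> B0 \<Longrightarrow> \<rho> b \<in> carrier P" "\<And>b. b \<in> B0 \<Longrightarrow> \<chi> (\<rho> b) = lmon 0 b"
    and cstP: "\<And>z. cst P z \<in> carrier P" "\<And>z. \<chi> (cst P z) = lmon 0 (k z)"
    and low: "\<And>a m. a \<in> carrier P \<Longrightarrow> \<exists>j::nat. f ^ j * \<chi> a m \<in> B0"
    and up: "\<And>m b. b \<in> B0 \<Longrightarrow> \<exists>a\<in>carrier P. \<exists>j::nat. \<chi> a = lmon m (f ^ j * b)"
begin

definition M :: "'k set" where "M = {f ^ n | n::nat. True}"
text \<open>The localization \<open>B[1/f]\<close> inside the fraction field; \<open>L\<close> is
  the ring of Laurent polynomials over it, the common model of the two localizations to be
  compared.\<close>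

definition Bf :: "'k set" where "Bf = {x. \<exists>n::nat. f ^ n * x \<in> B0}"
definition L :: "(int \<Rightarrow> 'k) set" where "L = {q \<in> lau. \<forall>m. q m \<in> Bf}"
text \<open>The set of all representatives of a fraction, as in \<^const>\<open>fraction\<close>.\<close>

definition iot :: "'k \<Rightarrow> ('k \<times> 'k) set" where "iot x = {(b, t). b \<in> B0 \<and> t \<in> M \<and> b = x * t}"
definition iotP :: "(int \<Rightarrow> 'k) \<Rightarrow> ('a \<times> 'a) set" where
  "iotP q = {(b, t). b \<in> carrier P \<and> t \<in> \<rho> ` M \<and> \<chi> b = lmul q (\<chi> t)}"

abbreviation "B \<equiv> coord B0 k"

lemmas bs = sringD[OF B0]

lemma powers_M: "powers B f = M" by (simp add: powers_def M_def)

lemma M: "M \<subseteq> B0" "1 \<in> M" "s \<in> M \<Longrightarrow> t \<in> M \<Longrightarrow> s * t \<in> M" "s \<in> M \<Longrightarrow> s \<noteq> 0"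
proof -
  show "M \<subseteq> B0" using bs(7)[OF f(1)] by (auto simp: M_def)
  show "1 \<in> M" unfolding M_def by (intro CollectI exI[of _ 0]) simp
  show "s \<in> M \<Longrightarrow> t \<in> M \<Longrightarrow> s * t \<in> M" unfolding M_def by (auto simp flip: power_add)
  show "s \<in> M \<Longrightarrow> s \<noteq> 0" using f by (auto simp: M_def)
qed

lemma Bf_iff: "x \<in> Bf \<longleftrightarrow> (\<exists>s\<in>M. s * x \<in> B0)" by (auto simp: Bf_def M_def)

lemma sring_Bf: "sring Bf" "B0 \<subseteq> Bf"
proof -
  show B0: "B0 \<subseteq> Bf" using M(2) by (force simp: Bf_iff)
  show "sring Bf" unfolding sring_def
  proof (intro conjI ballI)
    show "0 \<in> Bf" "1 \<in> Bf" using B0 bs by auto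
    fix x assume "x \<in> Bf"
    then obtain s where s: "s \<in> M" "s * x \<in> B0" by (auto simp: Bf_iff)
    have "s * (- x) \<in> B0" using bs(5)[OF s(2)] by simp
    then show "- x \<in> Bf" using s(1) unfolding Bf_iff by blast
    fix y assume "y \<in> Bf"
    then obtain t where t: "t \<in> M" "t * y \<in> B0" by (auto simp: Bf_iff)
    have st: "s \<in> B0" "t \<in> B0" using M(1) s t by auto
    have e: "(s * t) * (x + y) = t * (s * x) + s * (t * y)" "(s * t) * (x * y) = (s * x) * (t * y)"
      by (simp_all add: algebra_simps)
    have "(s * t) * (x + y) \<in> B0" "(s * t) * (x * y) \<in> B0"
      unfolding e using bs(3)[OF bs(4)[OF st(2) s(2)] bs(4)[OF st(1) t(2)]] bs(4)[OF s(2) t(2)] by blast+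
    then show "x + y \<in> Bf" "x * y \<in> Bf" using M(3)[OF s(1) t(1)] unfolding Bf_iff by blast+
  qed
qed

text \<open>Inside a field the class of a fraction depends only on the quotient, so the localization
  is a copy of \<open>Bf\<close>.\<close>

lemma fraction_B: assumes "a \<in> B0" "s \<in> M" shows "fraction B M a s = iot (a / s)"
proof -
  have "(\<exists>u\<in>M. u * (a * t) = u * (b * s)) \<longleftrightarrow> b = a / s * t" if "t \<in> M" for b t
    using M(2,4) assms(2) that by (auto simp: field_simps)
  then show ?thesis unfolding fraction_def iot_def by auto
qed

lemma iot_mem: "x \<in> Bf \<Longrightarrow> \<exists>b t. (b, t) \<in> iot x \<and> b \<in> B0 \<and> t \<in> M"
  unfolding Bf_iff iot_def by (auto simp: mult.commute)

lemma iot_D: "(b, t) \<in> iot x \<Longrightarrow> b \<in> B0 \<and> t \<in> M \<and> t \<noteq> 0 \<and> b = x * t" using M(4) by (auto simp: iot_def)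

lemma iot_inj: "x \<in> Bf \<Longrightarrow> iot x = iot y \<Longrightarrow> x = y"
  using iot_mem[of x] iot_D[of _ _ x] iot_D[of _ _ y] by (metis mult_right_cancel)

lemma loc_carrier: "{fraction B M a s | a s. a \<in> B0 \<and> s \<in> M} = iot ` Bf"
proof (rule subset_antisym; rule subsetI)
  fix V assume "V \<in> {fraction B M a s | a s. a \<in> B0 \<and> s \<in> M}"
  then obtain a s where as: "V = iot (a / s)" "a \<in> B0" "s \<in> M" using fraction_B by auto
  then have "s * (a / s) \<in> B0" using M(4) by simp
  then show "V \<in> iot ` Bf" using as Bf_iff by blast
next
  fix V assume "V \<in> iot ` Bf"
  then obtain x s where x: "V = iot x" "s \<in> M" "s * x \<in> B0" by (auto simp: Bf_iff)
  then have "V = fraction B M (s * x) s" using fraction_B M(4) by simp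
  then show "V \<in> {fraction B M a s | a s. a \<in> B0 \<and> s \<in> M}" using x by blast
qed

abbreviation "loc \<equiv> loc_calg B M"

lemma loc_car: "carrier loc = iot ` Bf" using loc_carrier by simp
lemma loc_one: "\<one>\<^bsub>loc\<^esub> = iot 1" using fraction_B[OF bs(2) M(2)] by simp
lemma loc_zero: "\<zero>\<^bsub>loc\<^esub> = iot 0" using fraction_B[OF bs(1) M(2)] by simp
lemma loc_mult: assumes "x \<in> Bf" "y \<in> Bf" shows "iot x \<otimes>\<^bsub>loc\<^esub> iot y = iot (x * y)"
proof -
  obtain a s where as: "(a, s) \<in> iot x" using iot_mem[OF assms(1)] by blast
  obtain b t where bt: "(b, t) \<in> iot y" using iot_mem[OF assms(2)] by blast
  have e: "fraction B M (a * b) (s * t) = iot (x * y)" if "(a, s) \<in> iot x" "(b, t) \<in> iot y" for a s b t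
    using iot_D[OF that(1)] iot_D[OF that(2)] fraction_B[of "a * b" "s * t"] bs(4) M(3) by auto
  have "(\<Union>(b, t)\<in>iot y. fraction B M (a * b) (s * t)) = iot (x * y)" if "(a, s) \<in> iot x" for a s
    by (rule UN_const_pair[OF bt e[OF that]])
  then show ?thesis by (simp, intro UN_const_pair[OF as]) simp
qed

lemma loc_add: assumes "x \<in> Bf" "y \<in> Bf" shows "iot x \<oplus>\<^bsub>loc\<^esub> iot y = iot (x + y)"
proof -
  obtain a s where as: "(a, s) \<in> iot x" using iot_mem[OF assms(1)] by blast
  obtain b t where bt: "(b, t) \<in> iot y" using iot_mem[OF assms(2)] by blast
  have e: "fraction B M (a * t + b * s) (s * t) = iot (x + y)" if "(a, s) \<in> iot x" "(b, t) \<in> iot y" for a s b t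
  proof -
    note d = iot_D[OF that(1)] iot_D[OF that(2)]
    have "a * t + b * s \<in> B0" using d M(1) by (intro bs(3) bs(4)) auto
    moreover have "(a * t + b * s) / (s * t) = x + y" using d by (simp add: field_simps)
    ultimately show ?thesis using fraction_B[of "a * t + b * s" "s * t"] d M(3) by auto
  qed
  have "(\<Union>(b, t)\<in>iot y. fraction B M (a * t + b * s) (s * t)) = iot (x + y)" if "(a, s) \<in> iot x" for a s
    by (rule UN_const_pair[OF bt e[OF that]])
  then show ?thesis by (simp, intro UN_const_pair[OF as]) simp
qed

lemma iot_iso: "iot \<in> ring_iso (coord Bf k) loc"
proof (rule ring_iso_memI)
  show "bij_betw iot (carrier (coord Bf k)) (carrier loc)"
    unfolding bij_betw_def loc_car using iot_inj by (auto simp: inj_on_def)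
qed (auto simp only: loc_one loc_mult loc_add loc_car coord_simps intro: imageI)

lemma cring_loc: "cring loc"
  by (rule ring_iso_domain(1)[OF iot_iso _ cring_coord[OF sring_Bf(1)]]) (simp only: loc_zero coord_simps)

lemma iot_hom: "ring_hom_cring (coord Bf k) loc iot"
  by (rule ring_hom_cringI[OF cring_coord[OF sring_Bf(1)] cring_loc]) (use iot_iso in \<open>simp add: ring_iso_def\<close>)

lemma L: "lsub L"
  unfolding lsub_def
proof (intro conjI ballI)
  note s = sringD[OF sring_Bf(1)]
  show "L \<subseteq> lau" by (auto simp: L_def)
  show "lmon 0 1 \<in> L" using s(1,2) unfolding L_def by (simp, simp add: lmon_def)
  fix p assume p: "p \<in> L"
  show "(\<lambda>m. - p m) \<in> L" using p s(5) by (auto simp: L_def)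
  fix q assume q: "q \<in> L"
  show "ladd p q \<in> L" using p q s(3) by (auto simp: L_def) (simp add: ladd_def)
  have "lmul p q m \<in> Bf" for m using p q unfolding lmul_def L_def by (auto intro!: s(8) s(4))
  then show "lmul p q \<in> L" using p q by (auto simp: L_def)
qed

lemma L_mono: "x \<in> Bf \<Longrightarrow> lmon m x \<in> L" using sringD(1)[OF sring_Bf(1)] unfolding L_def by (simp, simp add: lmon_def)

text \<open>As \<open>iot\<close> is a ring isomorphism, applying it to each coefficient commutes
  with convolution.\<close>

lemma iotL_iso: "gm_iso (GA L k) (gm_product loc) (\<lambda>q m. iot (q m))"
  unfolding gm_iso_def gm_hom_def calg_hom_def
proof (intro conjI ballI allI)
  interpret cring loc by (rule cring_loc)
  interpret h: ring_hom_cring "coord Bf k" loc iot by (rule iot_hom)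
  note s = sringD[OF sring_Bf(1)]
  have z: "iot x = iot 0 \<longleftrightarrow> x = 0" if "x \<in> Bf" for x using iot_inj[OF that] by blast
  have LB: "q m \<in> Bf" "q \<in> lau" if "q \<in> L" for q m using that by (auto simp: L_def)
  have supp: "{m. iot (q m) \<noteq> iot 0} = {m. q m \<noteq> 0}" if "q \<in> L" for q using z[OF LB(1)[OF that]] by blast
  show iso: "(\<lambda>q m. iot (q m)) \<in> ring_iso (GA L k) (gm_product loc)"
  proof (rule ring_iso_memI)
    fix p assume p: "p \<in> carrier (GA L k)"
    then have pL: "p \<in> L" by simp
    show "(\<lambda>m. iot (p m)) \<in> carrier (gm_product loc)"
      using LB[OF pL] supp[OF pL] by (simp add: laurent_def loc_car loc_zero lau_def del: loc_calg_simps)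
    fix q assume q: "q \<in> carrier (GA L k)"
    then have qL: "q \<in> L" by simp
    show "(\<lambda>m. iot ((p \<oplus>\<^bsub>GA L k\<^esub> q) m)) = (\<lambda>m. iot (p m)) \<oplus>\<^bsub>gm_product loc\<^esub> (\<lambda>m. iot (q m))"
      using LB[OF pL] LB[OF qL] by (simp add: laurent_def loc_add ladd_def del: loc_calg_simps)
    show "(\<lambda>m. iot ((p \<otimes>\<^bsub>GA L k\<^esub> q) m)) = (\<lambda>m. iot (p m)) \<otimes>\<^bsub>gm_product loc\<^esub> (\<lambda>m. iot (q m))"
    proof
      fix m
      let ?S = "{i. p i \<noteq> 0}"
      have fin: "finite ?S" using LB(2)[OF pL] by (simp add: lau_def)
      have "((\<lambda>m. iot (p m)) \<otimes>\<^bsub>gm_product loc\<^esub> (\<lambda>m. iot (q m))) m = finsum loc (\<lambda>i. iot (p i) \<otimes>\<^bsub>loc\<^esub> iot (q (m - i))) ?S"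
        using supp[OF pL] by (simp add: laurent_def loc_zero del: loc_calg_simps)
      also have "\<dots> = finsum loc (\<lambda>i. iot (p i * q (m - i))) ?S"
        using LB[OF pL] LB[OF qL] by (simp add: loc_mult del: loc_calg_simps)
      also have "\<dots> = iot (finsum (coord Bf k) (\<lambda>i. p i * q (m - i)) ?S)"
        using LB[OF pL] LB[OF qL] s(4) by (subst h.hom_finsum) (auto simp: comp_def simp del: loc_calg_simps)
      also have "finsum (coord Bf k) (\<lambda>i. p i * q (m - i)) ?S = lmul p q m"
        unfolding lmul_def by (rule coord_finsum[OF sring_Bf(1) fin]) (use LB[OF pL] LB[OF qL] s(4) in auto)
      finally show "iot ((p \<otimes>\<^bsub>GA L k\<^esub> q) m) = ((\<lambda>m. iot (p m)) \<otimes>\<^bsub>gm_product loc\<^esub> (\<lambda>m. iot (q m))) m"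
        using LB(2)[OF pL] by (simp add: GA_mult del: loc_calg_simps)
    qed
  next
    show "(\<lambda>m. iot (\<one>\<^bsub>GA L k\<^esub> m)) = \<one>\<^bsub>gm_product loc\<^esub>"
      unfolding gm_product_simps GA_simps by (simp add: laurent_def lmon_def fun_eq_iff fraction_B[OF bs(2) M(2)] fraction_B[OF bs(1) M(2)])
    show "bij_betw (\<lambda>q m. iot (q m)) (carrier (GA L k)) (carrier (gm_product loc))"
      unfolding bij_betw_def
    proof
      show "inj_on (\<lambda>q m. iot (q m)) (carrier (GA L k))"
      proof (rule inj_onI)
        fix p q assume pq: "p \<in> carrier (GA L k)" "q \<in> carrier (GA L k)" "(\<lambda>m. iot (p m)) = (\<lambda>m. iot (q m))"
        show "p = q" using iot_inj[OF LB(1)[of p]] pq by (auto simp: fun_eq_iff)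
      qed
      show "(\<lambda>q m. iot (q m)) ` carrier (GA L k) = carrier (gm_product loc)"
      proof (rule subset_antisym; rule subsetI)
        fix F assume "F \<in> (\<lambda>q m. iot (q m)) ` carrier (GA L k)"
        then obtain p where p: "p \<in> L" "F = (\<lambda>m. iot (p m))" by auto
        then show "F \<in> carrier (gm_product loc)"
          using LB[OF p(1)] supp[OF p(1)] by (simp add: laurent_def loc_car loc_zero lau_def del: loc_calg_simps)
      next
        fix F assume F: "F \<in> carrier (gm_product loc)"
        then have "\<forall>m. \<exists>x. x \<in> Bf \<and> F m = iot x" by (auto simp: laurent_def loc_car simp del: loc_calg_simps)
        then obtain q where q: "\<And>m. q m \<in> Bf" "\<And>m. F m = iot (q m)" by metis
        have "{m. q m \<noteq> 0} = {m. F m \<noteq> iot 0}" using q z by auto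
        then have "q \<in> L" using q F by (simp add: L_def lau_def laurent_def loc_zero del: loc_calg_simps)
        then show "F \<in> (\<lambda>q m. iot (q m)) ` carrier (GA L k)" using q(2) by auto
      qed
    qed
  qed
  then show "(\<lambda>q m. iot (q m)) \<in> ring_hom (GA L k) (gm_product loc)" by (simp add: ring_iso_def)
  show "(\<lambda>m. iot (cst (GA L k) z m)) = cst (gm_product loc) z" for z
    unfolding gm_product_simps GA_simps
    by (simp add: lmonom_def lmon_def fun_eq_iff fraction_B[OF kB M(2)] fraction_B[OF bs(1) M(2)])
  show "wt (gm_product loc) (\<lambda>m. iot (a m)) m = (\<lambda>n. iot (wt (GA L k) a m n))" for a m
    unfolding gm_product_simps GA_simps
    by (simp add: lmonom_def lmon_def fun_eq_iff fraction_B[OF bs(1) M(2)])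
qed

lemma \<chi>_simps:
  assumes "a \<in> carrier P" "b \<in> carrier P"
  shows "\<chi> a \<in> lau" "\<chi> (a \<otimes>\<^bsub>P\<^esub> b) = lmul (\<chi> a) (\<chi> b)" "\<chi> (a \<oplus>\<^bsub>P\<^esub> b) = ladd (\<chi> a) (\<chi> b)"
  using ring_hom_memE[OF \<chi>] assms by (auto simp: GA_mult)

lemma \<chi>_one: "\<chi> \<one>\<^bsub>P\<^esub> = lmon 0 1" using ring_hom_memE(4)[OF \<chi>] by simp

lemma \<rho>_mult: "a \<in> B0 \<Longrightarrow> b \<in> B0 \<Longrightarrow> \<rho> a \<otimes>\<^bsub>P\<^esub> \<rho> b = \<rho> (a * b)"
proof -
  interpret cring P by (rule P)
  assume "a \<in> B0" "b \<in> B0"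
  then show ?thesis by (intro inj_onD[OF inj]) (auto simp: \<rho> \<chi>_simps bs)
qed

lemma \<rho>_one: "\<rho> 1 = \<one>\<^bsub>P\<^esub>"
proof -
  interpret cring P by (rule P)
  show ?thesis by (intro inj_onD[OF inj]) (auto simp: \<rho> \<chi>_one bs)
qed

lemma lmul_scal: assumes "p \<in> lau" shows "lmul p (lmon 0 s) = (\<lambda>m. p m * s)"
  using lmul_laws(1)[OF assms mono_lau mono_lau[of 0 0], of 0 s] by (auto simp: fun_eq_iff lmul_mono)

definition scal :: "'k \<Rightarrow> (int \<Rightarrow> 'k) \<Rightarrow> int \<Rightarrow> 'k" where "scal s q = (\<lambda>m. s * q m)"

text \<open>Since \<open>\<chi>\<close> is injective with values in a domain, the auxiliary factor
  \<open>u\<close> can be cancelled, and the class depends only on the Laurent polynomial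
  \<open>\<chi> a / s\<close>.\<close>

lemma fraction_P: assumes a: "a \<in> carrier P" and s: "s \<in> M"
  shows "fraction P (\<rho> ` M) a (\<rho> s) = iotP (scal (1 / s) (\<chi> a))"
proof -
  interpret cring P by (rule P)
  have sB: "s \<in> B0" "s \<noteq> 0" using M s by auto
  have al: "\<chi> a \<in> lau" using \<chi>_simps(1) a by blast
  have scl: "scal (1 / s) (\<chi> a) \<in> lau" using al sB by (simp add: scal_def lau_def)
  have "(\<exists>u\<in>\<rho> ` M. u \<otimes>\<^bsub>P\<^esub> (a \<otimes>\<^bsub>P\<^esub> \<rho> t) = u \<otimes>\<^bsub>P\<^esub> (b \<otimes>\<^bsub>P\<^esub> \<rho> s)) \<longleftrightarrow> \<chi> b = lmul (scal (1 / s) (\<chi> a)) (\<chi> (\<rho> t))"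
    if t: "t \<in> M" and b: "b \<in> carrier P" for b t
  proof -
    have tB: "t \<in> B0" "t \<noteq> 0" using M t by auto
    have bl: "\<chi> b \<in> lau" using \<chi>_simps(1) b by blast
    have 1: "u \<otimes>\<^bsub>P\<^esub> (a \<otimes>\<^bsub>P\<^esub> \<rho> t) = u \<otimes>\<^bsub>P\<^esub> (b \<otimes>\<^bsub>P\<^esub> \<rho> s) \<longleftrightarrow> (\<lambda>m. \<chi> a m * t) = (\<lambda>m. \<chi> b m * s)"
      if u: "u \<in> \<rho> ` M" for u
    proof -
      obtain v where v: "u = \<rho> v" "v \<in> B0" "v \<noteq> 0" using u M by blast
      have uP: "u \<in> carrier P" using v \<rho> by simp
      have c: "\<rho> t \<in> carrier P" "\<rho> s \<in> carrier P" using \<rho> tB sB by auto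
      have "u \<otimes>\<^bsub>P\<^esub> (a \<otimes>\<^bsub>P\<^esub> \<rho> t) = u \<otimes>\<^bsub>P\<^esub> (b \<otimes>\<^bsub>P\<^esub> \<rho> s) \<longleftrightarrow> \<chi> (u \<otimes>\<^bsub>P\<^esub> (a \<otimes>\<^bsub>P\<^esub> \<rho> t)) = \<chi> (u \<otimes>\<^bsub>P\<^esub> (b \<otimes>\<^bsub>P\<^esub> \<rho> s))"
        using inj_on_eq_iff[OF inj] uP a b c by simp
      also have "\<dots> \<longleftrightarrow> lmul (lmon 0 v) (\<lambda>m. \<chi> a m * t) = lmul (lmon 0 v) (\<lambda>m. \<chi> b m * s)"
        using uP a b c v \<rho> tB sB by (simp add: \<chi>_simps lmul_scal[OF al] lmul_scal[OF bl])
      also have "\<dots> \<longleftrightarrow> (\<lambda>m. \<chi> a m * t) = (\<lambda>m. \<chi> b m * s)"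
        using v(3) by (auto simp: fun_eq_iff lmul_mono)
      finally show ?thesis .
    qed
    have 2: "\<chi> b = lmul (scal (1 / s) (\<chi> a)) (\<chi> (\<rho> t)) \<longleftrightarrow> (\<lambda>m. \<chi> a m * t) = (\<lambda>m. \<chi> b m * s)"
      unfolding \<rho>(2)[OF tB(1)] lmul_scal[OF scl] using sB(2) by (auto simp: fun_eq_iff scal_def field_simps)
    show ?thesis using 1 2 M(2) by blast
  qed
  then show ?thesis unfolding fraction_def iotP_def by blast
qed

lemma scal_L: assumes "a \<in> carrier P" "s \<in> M" shows "scal (1 / s) (\<chi> a) \<in> L"
proof -
  have "1 / s * \<chi> a m \<in> Bf" for m
  proof -
    obtain j where "f ^ j * \<chi> a m \<in> B0" using low[OF assms(1)] by blast
    moreover have "(f ^ j * s) * (1 / s * \<chi> a m) = f ^ j * \<chi> a m" using M(4)[OF assms(2)] by simp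
    moreover have "f ^ j * s \<in> M" using M(3)[OF _ assms(2)] by (auto simp: M_def)
    ultimately show ?thesis unfolding Bf_iff by metis
  qed
  moreover have "scal (1 / s) (\<chi> a) \<in> lau" using \<chi>_simps(1)[OF assms(1,1)] M(4)[OF assms(2)] by (simp add: scal_def lau_def)
  ultimately show ?thesis by (simp add: L_def scal_def)
qed

text \<open>The assumption \<open>up\<close> realizes each monomial up to a power of
  \<open>f\<close>, and finitely many monomials have a common denominator.\<close>

lemma L_scal: assumes "q \<in> L" obtains a s where "a \<in> carrier P" "s \<in> M" "\<chi> a = scal s q" "q = scal (1 / s) (\<chi> a)"
proof -
  interpret cring P by (rule P)
  let ?Q = "\<lambda>q. \<exists>a\<in>carrier P. \<exists>s\<in>M. \<chi> a = scal s q"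
  have mono: "?Q (lmon m x)" if x: "x \<in> Bf" for m x
  proof -
    obtain s where s: "s \<in> M" "s * x \<in> B0" using x Bf_iff by blast
    obtain a j where a: "a \<in> carrier P" "\<chi> a = lmon m (f ^ j * (s * x))" using up[OF s(2), of m] by blast
    have "\<chi> a = scal (f ^ j * s) (lmon m x)" unfolding a(2) by (auto simp: scal_def lmon_def)
    moreover have "f ^ j * s \<in> M" using M(3)[OF _ s(1)] by (auto simp: M_def)
    ultimately show ?thesis using a(1) by blast
  qed
  have add: "?Q (ladd p q)" if pq: "?Q p" "?Q q" for p q
  proof -
    obtain a s where a: "a \<in> carrier P" "s \<in> M" "\<chi> a = scal s p" using pq(1) by blast
    obtain b t where b: "b \<in> carrier P" "t \<in> M" "\<chi> b = scal t q" using pq(2) by blast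
    have B: "s \<in> B0" "t \<in> B0" using a b M(1) by auto
    have c: "\<rho> t \<otimes>\<^bsub>P\<^esub> a \<in> carrier P" "\<rho> s \<otimes>\<^bsub>P\<^esub> b \<in> carrier P" using \<rho>(1) B a b by auto
    have "\<chi> (\<rho> t \<otimes>\<^bsub>P\<^esub> a \<oplus>\<^bsub>P\<^esub> \<rho> s \<otimes>\<^bsub>P\<^esub> b) = scal (s * t) (ladd p q)"
      using c a b B \<rho> by (simp add: \<chi>_simps) (auto simp: fun_eq_iff ladd_def lmul_mono scal_def algebra_simps)
    then show ?thesis using c M(3)[OF a(2) b(2)] by blast
  qed
  have LB: "q m \<in> Bf" "q \<in> lau" for m using assms by (auto simp: L_def)
  have fin: "finite {m. q m \<noteq> 0}" using LB(2) by (simp add: lau_def)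
  have "?Q (\<lambda>n. \<Sum>m\<in>S. lmon m (q m) n)" if "finite S" for S
    using that
  proof (induction S rule: finite_induct)
    case empty show ?case using mono[OF subsetD[OF sring_Bf(2) bs(1)]] by simp
  next
    case (insert m S)
    then show ?case using add[OF mono[OF LB(1), of m m] insert(3)] by (simp add: ladd_def)
  qed
  from this[OF fin] have "?Q q" using lau_expand[OF LB(2)] by simp
  then obtain a s where as: "a \<in> carrier P" "s \<in> M" "\<chi> a = scal s q" by blast
  have "q = scal (1 / s) (\<chi> a)" using as M(4) by (simp add: scal_def)
  then show ?thesis using that as by blast
qed

abbreviation "locP \<equiv> loc_gm P (\<rho> ` M)"

lemma locP_car: "carrier locP = iotP ` L"
proof (rule subset_antisym; rule subsetI)
  fix V assume "V \<in> carrier locP"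
  then obtain a s where "V = iotP (scal (1 / s) (\<chi> a))" "a \<in> carrier P" "s \<in> M" using fraction_P by auto
  then show "V \<in> iotP ` L" using scal_L by blast
next
  fix V assume "V \<in> iotP ` L"
  then obtain q where q: "q \<in> L" "V = iotP q" by blast
  obtain a s where "a \<in> carrier P" "s \<in> M" "q = scal (1 / s) (\<chi> a)" using L_scal[OF q(1)] by blast
  then have "V = fraction P (\<rho> ` M) a (\<rho> s)" using fraction_P q by simp
  then show "V \<in> carrier locP" using \<open>a \<in> carrier P\<close> \<open>s \<in> M\<close> unfolding loc_gm_simps loc_calg_simps by blast
qed

lemma iotP_mem: assumes "q \<in> L" shows "\<exists>a s. (a, \<rho> s) \<in> iotP q"
proof -
  obtain a s where as: "a \<in> carrier P" "s \<in> M" "\<chi> a = scal s q" using L_scal[OF assms] by blast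
  have "q \<in> lau" using assms by (simp add: L_def)
  then have "\<chi> a = lmul q (\<chi> (\<rho> s))" using as M(1) \<rho>(2)[of s] by (auto simp: lmul_scal scal_def mult.commute)
  then show ?thesis using as by (auto simp: iotP_def)
qed

lemma iotP_D:
  assumes "(a, t) \<in> iotP q" "q \<in> lau"
  obtains s where "a \<in> carrier P" "t = \<rho> s" "s \<in> M" "s \<in> B0" "s \<noteq> 0" "\<chi> a = scal s q" "\<rho> s \<in> carrier P" "scal (1 / s) (\<chi> a) = q"
proof -
  obtain s where s: "a \<in> carrier P" "t = \<rho> s" "s \<in> M" "\<chi> a = lmul q (\<chi> (\<rho> s))" using assms(1) by (auto simp: iotP_def)
  have B: "s \<in> B0" "s \<noteq> 0" using s M by auto
  have "\<chi> a = scal s q" using s(4) \<rho>(2)[OF B(1)] lmul_scal[OF assms(2)] by (simp add: scal_def mult.commute)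
  then show ?thesis using that s B \<rho>(1) by (simp add: scal_def)
qed

lemma scal_mult: "p \<in> lau \<Longrightarrow> q \<in> lau \<Longrightarrow> s \<noteq> 0 \<Longrightarrow> lmul (scal s p) (scal t q) = scal (s * t) (lmul p q)"
  unfolding lmul_def scal_def by (auto simp: fun_eq_iff sum_distrib_left mult_ac intro!: sum.cong)

lemma iotP_iso: "gm_iso (GA L k) locP iotP"
  unfolding gm_iso_def gm_hom_def calg_hom_def
proof (intro conjI ballI allI)
  interpret cring P by (rule P)
  have lau: "q \<in> lau" if "q \<in> L" for q using that by (simp add: L_def)
  note m1 = M(2)
  show iso: "iotP \<in> ring_iso (GA L k) locP"
  proof (rule ring_iso_memI)
    fix p assume p: "p \<in> carrier (GA L k)"
    then have pL: "p \<in> L" by simp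
    show "iotP p \<in> carrier locP" unfolding locP_car using pL by blast
    fix q assume q: "q \<in> carrier (GA L k)"
    then have qL: "q \<in> L" by simp
    obtain a s where as: "(a, s) \<in> iotP p" using iotP_mem[OF pL] by blast
    obtain b t where bt: "(b, t) \<in> iotP q" using iotP_mem[OF qL] by blast
    have e: "fraction P (\<rho> ` M) (a \<otimes>\<^bsub>P\<^esub> b) (s \<otimes>\<^bsub>P\<^esub> t) = iotP (lmul p q)" if ab: "(a, s) \<in> iotP p" "(b, t) \<in> iotP q" for a s b t
    proof -
      obtain s' where s: "a \<in> carrier P" "s = \<rho> s'" "s' \<in> M" "s' \<in> B0" "s' \<noteq> 0" "\<chi> a = scal s' p" "\<rho> s' \<in> carrier P"
        by (rule iotP_D[OF ab(1) lau[OF pL]])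
      obtain t' where t: "b \<in> carrier P" "t = \<rho> t'" "t' \<in> M" "t' \<in> B0" "t' \<noteq> 0" "\<chi> b = scal t' q" "\<rho> t' \<in> carrier P"
        by (rule iotP_D[OF ab(2) lau[OF qL]])
      have "scal (1 / (s' * t')) (\<chi> (a \<otimes>\<^bsub>P\<^esub> b)) = lmul p q"
        using s t scal_mult[OF lau[OF pL] lau[OF qL]] by (simp add: \<chi>_simps scal_def)
      then show ?thesis using fraction_P[of "a \<otimes>\<^bsub>P\<^esub> b" "s' * t'"] s t M(3) \<rho>_mult by simp
    qed
    have "(\<Union>(b, t)\<in>iotP q. fraction P (\<rho> ` M) (a \<otimes>\<^bsub>P\<^esub> b) (s \<otimes>\<^bsub>P\<^esub> t)) = iotP (lmul p q)" if "(a, s) \<in> iotP p" for a s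
      by (rule UN_const_pair[OF bt e[OF that]])
    then show "iotP (p \<otimes>\<^bsub>GA L k\<^esub> q) = iotP p \<otimes>\<^bsub>locP\<^esub> iotP q"
      using UN_const_pair[OF as, where F = "\<lambda>a s. \<Union>(b, t)\<in>iotP q. fraction P (\<rho> ` M) (a \<otimes>\<^bsub>P\<^esub> b) (s \<otimes>\<^bsub>P\<^esub> t)"]
      by (simp add: GA_mult lau[OF pL])
    have e: "fraction P (\<rho> ` M) ((a \<otimes>\<^bsub>P\<^esub> t) \<oplus>\<^bsub>P\<^esub> (b \<otimes>\<^bsub>P\<^esub> s)) (s \<otimes>\<^bsub>P\<^esub> t) = iotP (ladd p q)" if ab: "(a, s) \<in> iotP p" "(b, t) \<in> iotP q" for a s b t
    proof -
      obtain s' where s: "a \<in> carrier P" "s = \<rho> s'" "s' \<in> M" "s' \<in> B0" "s' \<noteq> 0" "\<chi> a = scal s' p" "\<rho> s' \<in> carrier P"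
        by (rule iotP_D[OF ab(1) lau[OF pL]])
      obtain t' where t: "b \<in> carrier P" "t = \<rho> t'" "t' \<in> M" "t' \<in> B0" "t' \<noteq> 0" "\<chi> b = scal t' q" "\<rho> t' \<in> carrier P"
        by (rule iotP_D[OF ab(2) lau[OF qL]])
      have l: "scal s' p \<in> lau" "scal t' q \<in> lau" using \<chi>_simps(1)[OF s(1) s(1)] \<chi>_simps(1)[OF t(1) t(1)] s t by simp_all
      have "scal (1 / (s' * t')) (\<chi> ((a \<otimes>\<^bsub>P\<^esub> \<rho> t') \<oplus>\<^bsub>P\<^esub> (b \<otimes>\<^bsub>P\<^esub> \<rho> s'))) = ladd p q"
        using s t \<rho>(2) lmul_scal[OF l(1)] lmul_scal[OF l(2)] by (simp add: \<chi>_simps) (simp add: scal_def ladd_def fun_eq_iff field_simps)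
      then show ?thesis using fraction_P[of "(a \<otimes>\<^bsub>P\<^esub> \<rho> t') \<oplus>\<^bsub>P\<^esub> (b \<otimes>\<^bsub>P\<^esub> \<rho> s')" "s' * t'"] s t M(3) \<rho>_mult by simp
    qed
    have "(\<Union>(b, t)\<in>iotP q. fraction P (\<rho> ` M) ((a \<otimes>\<^bsub>P\<^esub> t) \<oplus>\<^bsub>P\<^esub> (b \<otimes>\<^bsub>P\<^esub> s)) (s \<otimes>\<^bsub>P\<^esub> t)) = iotP (ladd p q)" if "(a, s) \<in> iotP p" for a s
      by (rule UN_const_pair[OF bt e[OF that]])
    then show "iotP (p \<oplus>\<^bsub>GA L k\<^esub> q) = iotP p \<oplus>\<^bsub>locP\<^esub> iotP q"
      using UN_const_pair[OF as, where F = "\<lambda>a s. \<Union>(b, t)\<in>iotP q. fraction P (\<rho> ` M) ((a \<otimes>\<^bsub>P\<^esub> t) \<oplus>\<^bsub>P\<^esub> (b \<otimes>\<^bsub>P\<^esub> s)) (s \<otimes>\<^bsub>P\<^esub> t)"]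
      by simp
  next
    show "iotP \<one>\<^bsub>GA L k\<^esub> = \<one>\<^bsub>locP\<^esub>" using fraction_P[of "\<one>\<^bsub>P\<^esub>" 1] m1 by (simp add: \<rho>_one \<chi>_one scal_def)
    show "bij_betw iotP (carrier (GA L k)) (carrier locP)"
      unfolding bij_betw_def locP_car
    proof
      show "inj_on iotP (carrier (GA L k))"
      proof (rule inj_onI)
        fix p q assume pq: "p \<in> carrier (GA L k)" "q \<in> carrier (GA L k)" "iotP p = iotP q"
        then have L: "p \<in> L" "q \<in> L" by simp_all
        obtain a s where as: "(a, \<rho> s) \<in> iotP p" using iotP_mem[OF L(1)] by blast
        then have as': "(a, \<rho> s) \<in> iotP q" using pq(3) by simp
        obtain s' where s: "\<rho> s = \<rho> s'" "s' \<in> B0" "scal (1 / s') (\<chi> a) = p"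
          by (rule iotP_D[OF as lau[OF L(1)]])
        obtain t' where t: "\<rho> s = \<rho> t'" "t' \<in> B0" "scal (1 / t') (\<chi> a) = q"
          by (rule iotP_D[OF as' lau[OF L(2)]])
        have "lmon 0 s' = lmon 0 t'" using s t \<rho>(2) by metis
        then have "s' = t'" using mono_simps(1) by metis
        then show "p = q" using s t by simp
      qed
    qed simp
  qed
  then show "iotP \<in> ring_hom (GA L k) locP" by (simp add: ring_iso_def)
  show "iotP (cst (GA L k) z) = cst locP z" for z
    using fraction_P[OF cstP(1) m1, of z] by (simp add: \<rho>_one cstP scal_def)
  fix q m assume "q \<in> carrier (GA L k)"
  then have qL: "q \<in> L" by simp
  obtain a s where as: "(a, s) \<in> iotP q" using iotP_mem[OF qL] by blast
  have e: "fraction P (\<rho> ` M) (wt P a m) s = iotP (lmon m (q m))" if ab: "(a, s) \<in> iotP q" for a s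
  proof -
    obtain s' where s: "a \<in> carrier P" "s = \<rho> s'" "s' \<in> M" "s' \<in> B0" "s' \<noteq> 0" "\<chi> a = scal s' q" "\<rho> s' \<in> carrier P"
      by (rule iotP_D[OF ab lau[OF qL]])
    have "scal (1 / s') (\<chi> (wt P a m)) = lmon m (q m)" using s by (auto simp: wtP scal_def lmon_def)
    then show ?thesis using fraction_P[of "wt P a m" s'] s wtP by simp
  qed
  show "wt locP (iotP q) m = iotP (wt (GA L k) q m)" using UN_const_pair[OF as e] by simp
qed

text \<open>Dividing numerators by denominators identifies both localizations with the Laurent
  polynomials over \<open>Bf\<close>, compatibly with the base.\<close>

lemma gm_trivial: "gm_trivial_on B P \<rho> f"
proof -
  let ?\<phi> = "\<lambda>y. (\<lambda>q m. iot (q m)) (inv_into (carrier (GA L k)) iotP y)"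
  have G: "cring (GA L k)" using domain_GA[OF L] domain_def by blast
  have G2: "cst (GA L k) z \<in> carrier (GA L k)" for z using L_mono[OF subsetD[OF sring_Bf(2) kB]] by simp
  have G3: "wt (GA L k) x m \<in> carrier (GA L k)" if "x \<in> carrier (GA L k)" for x m
    using that L_mono by (simp add: L_def)
  note c = gm_iso_compose[OF iotP_iso iotL_iso G G2 G3]
  have "?\<phi> (fraction P (\<rho> ` M) (\<rho> b) (\<rho> s)) = lmonom loc 0 (fraction B M b s)" if b: "b \<in> B0" "s \<in> M" for b s
  proof -
    have 1: "fraction P (\<rho> ` M) (\<rho> b) (\<rho> s) = iotP (lmon 0 (b / s))"
      unfolding fraction_P[OF \<rho>(1)[OF b(1)] b(2)] \<rho>(2)[OF b(1)] by (rule arg_cong[of _ _ iotP]) (auto simp: scal_def lmon_def)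
    have "s * (b / s) \<in> B0" using M(4)[OF b(2)] b(1) by simp
    then have "b / s \<in> Bf" using b(2) Bf_iff by blast
    then have "lmon 0 (b / s) \<in> carrier (GA L k)" using L_mono by simp
    then have "?\<phi> (iotP (lmon 0 (b / s))) = (\<lambda>m. iot (lmon 0 (b / s) m))" using c(2) by simp
    also have "\<dots> = lmonom loc 0 (iot (b / s))" by (auto simp: lmonom_def loc_zero lmon_def fun_eq_iff simp del: loc_calg_simps)
    finally show ?thesis unfolding 1 fraction_B[OF b] .
  qed
  then show ?thesis unfolding gm_trivial_on_def Let_def powers_M
    by (intro exI[of _ ?\<phi>] conjI ballI c(1)) auto
qed

end

section \<open>Subrings generated by homogeneous elements\<close>

definition gen :: "(complex \<Rightarrow> 'k::field) \<Rightarrow> (int \<Rightarrow> 'k) set \<Rightarrow> (int \<Rightarrow> 'k) set" where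
  "gen k G = generate_ring (laurent (coord UNIV k)) G"

lemma laurent_a_inv: "f \<in> lau \<Longrightarrow> \<ominus>\<^bsub>laurent (coord UNIV k)\<^esub> f = (\<lambda>m. - f m)"
  using GA_a_inv[OF lsub_lau, of f k] by (simp add: a_inv_def m_inv_def)

text \<open>Properties of generated subrings are obtained by applying this to the subring of the
  elements that have the property.\<close>

lemma gen_min: assumes "G \<subseteq> Q" "lsub Q" shows "gen k G \<subseteq> Q"
proof
  note s = lsubD[OF assms(2)]
  fix f assume "f \<in> gen k G"
  then have "f \<in> generate_ring (laurent (coord UNIV k)) G" by (simp add: gen_def)
  then show "f \<in> Q"
  proof induction
    case (a_inv h) then show ?case using laurent_a_inv[OF s(2)] s(4) by metis
  next
    case (eng_mult h1 h2) then show ?case using laurent_coord_mult[OF s(2)] s(6) by metis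
  qed (use assms(1) s in auto)
qed

lemma gen_lau: assumes "G \<subseteq> lau" shows "gen k G \<subseteq> lau"
  by (rule gen_min[OF assms lsub_lau])

lemma gen: assumes G: "G \<subseteq> lau" shows "lsub (gen k G)" "G \<subseteq> gen k G"
proof -
  show "G \<subseteq> gen k G" by (auto simp: gen_def intro: generate_ring.incl)
  note l = subsetD[OF gen_lau[OF G, of k]]
  show "lsub (gen k G)" unfolding lsub_def
  proof (intro conjI ballI)
    show "gen k G \<subseteq> lau" by (rule gen_lau[OF G])
    show "lmon 0 1 \<in> gen k G" using generate_ring.one[of "laurent (coord UNIV k)" G] by (simp add: gen_def)
    fix f assume f: "f \<in> gen k G"
    show "(\<lambda>m. - f m) \<in> gen k G"
      using generate_ring.a_inv[of f "laurent (coord UNIV k)" G] f laurent_a_inv[OF l[OF f], of k] by (simp add: gen_def)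
    fix g assume g: "g \<in> gen k G"
    show "ladd f g \<in> gen k G" using generate_ring.eng_add[of f "laurent (coord UNIV k)" G g] f g by (simp add: gen_def)
    show "lmul f g \<in> gen k G" using generate_ring.eng_mult[of f "laurent (coord UNIV k)" G g] f g
      laurent_coord_mult[OF l[OF f], of k] by (simp add: gen_def)
  qed
qed

lemma gen_graded:
  assumes G: "G \<subseteq> lau" "\<And>f m. f \<in> G \<Longrightarrow> lmon m (f m) \<in> gen k G" shows "graded (gen k G)"
proof -
  note s = lsubD[OF gen(1)[OF G(1), of k]]
  let ?Q = "{f \<in> gen k G. \<forall>m. lmon m (f m) \<in> gen k G}"
  have "lsub ?Q" unfolding lsub_def
  proof (intro conjI ballI)
    show "?Q \<subseteq> lau" using s(1) by auto
    show "lmon 0 1 \<in> ?Q" using s(3,7) by (auto simp: lmon_def)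
    fix f assume f: "f \<in> ?Q"
    have "lmon m (- f m) = (\<lambda>n. - lmon m (f m) n)" for m by (auto simp: lmon_def)
    then show "(\<lambda>m. - f m) \<in> ?Q" using f s(4) by auto
    fix g assume g: "g \<in> ?Q"
    have "lmon m (ladd f g m) = ladd (lmon m (f m)) (lmon m (g m))" for m
      by (auto simp: fun_eq_iff lmon_def ladd_def)
    then show "ladd f g \<in> ?Q" using f g s(5) by (auto simp del: ladd_mono)
    \<comment> \<open>A component of a product is a finite sum of products of components.\<close>
    have "lmon m (lmul f g m) \<in> gen k G" for m
    proof -
      have fin: "finite {i. f i \<noteq> 0}" using f s(2) by (auto simp: lau_def)
      have "lmon m (lmul f g m) = (\<lambda>n. \<Sum>i | f i \<noteq> 0. lmul (lmon i (f i)) (lmon (m - i) (g (m - i))) n)"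
        by (auto simp: fun_eq_iff lmon_def[of m] lmul_def[of f])
      also have "\<dots> \<in> gen k G" by (rule lsub_sum[OF gen(1)[OF G(1)] fin]) (use f g s(6) in blast)
      finally show ?thesis .
    qed
    then show "lmul f g \<in> ?Q" using f g s(6) by auto
  qed
  moreover have "G \<subseteq> ?Q" using G(2) gen(2)[OF G(1)] by auto
  ultimately have "gen k G \<subseteq> ?Q" by (rule gen_min[rotated])
  then show ?thesis by (auto simp: graded_def)
qed

lemma (in rstruct) gen_cj:
  assumes G: "G \<subseteq> lau" "\<And>f. f \<in> G \<Longrightarrow> cj f \<in> gen k' G" shows "f \<in> gen k' G \<Longrightarrow> cj f \<in> gen k' G"
proof -
  note s = lsubD[OF gen(1)[OF G(1), of k']]
  let ?Q = "{f \<in> gen k' G. cj f \<in> gen k' G}"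
  have "lsub ?Q" unfolding lsub_def
  proof (intro conjI ballI)
    show "?Q \<subseteq> lau" using s(1) by auto
    show "lmon 0 1 \<in> ?Q" using s(3) by (simp add: cj_mono t)
    fix f assume f: "f \<in> ?Q"
    have "\<tau> (- x) = - \<tau> x" for x using t(1)[of x "-x"] by (simp add: eq_neg_iff_add_eq_0 add.commute)
    then have "cj (\<lambda>m. - f m) = (\<lambda>m. - cj f m)" by (auto simp: dpd_conj_def)
    then show "(\<lambda>m. - f m) \<in> ?Q" using f s(4) by auto
    fix g assume g: "g \<in> ?Q"
    show "ladd f g \<in> ?Q" using f g s(5) by (auto simp: cj_add)
    show "lmul f g \<in> ?Q" using f g s(6) cj_mult[OF s(2)[of f]] by auto
  qed
  moreover have "G \<subseteq> ?Q" using G(2) gen(2)[OF G(1)] by auto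
  ultimately have "gen k' G \<subseteq> ?Q" by (rule gen_min[rotated])
  then show "f \<in> gen k' G \<Longrightarrow> cj f \<in> gen k' G" by auto
qed

section \<open>The surface of a pair\<close>

locale dpd = curve C \<tau> for C :: "'k::field calg" and \<tau> +
  fixes D :: "'k set \<Rightarrow> rat" and h :: 'k
  assumes pair: "real_dpd_pair C \<tau> D h"
begin

lemma h: "h \<noteq> 0" "\<tau> h = h" using pair by (auto simp: real_dpd_pair_def)

sublocale rs: rstruct \<tau> \<kappa> h
  by unfold_locales (use \<tau> h in \<open>auto simp: khom_def\<close>)

lemma Dfin: "finite {x \<in> CP. D x \<noteq> 0}" using pair by (simp add: real_dpd_pair_def weil_q_divisor_def)
lemma Dle: "x \<in> CP \<Longrightarrow> D x + D (tx x) \<le> of_int (ord_at C x h)" using pair by (simp add: real_dpd_pair_def)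

abbreviation "Dm \<equiv> dpd_minus C \<tau> D h"

lemma Dm: "Dm x = D (tx x) - of_int (ord_at C x h)" by (simp add: dpd_minus_def)

text \<open>The least order at \<open>x\<close> of an element of degree \<open>m\<close>.\<close>

definition dl :: "'k set \<Rightarrow> int \<Rightarrow> int" where
  "dl x m = (if m \<ge> 0 then \<lceil>- (of_int m * D x)\<rceil> else \<lceil>of_int m * Dm x\<rceil>)"

lemma dl0 [simp]: "dl x 0 = 0" by (simp add: dl_def)

text \<open>Since \<open>D x + Dm x \<le> 0\<close>, the larger of the two linear functions is the
  first for \<open>m \<ge> 0\<close> and the second for \<open>m < 0\<close>. A maximum of linear
  functions is subadditive, which makes the bounds compatible with products.\<close>

lemma dl_real: assumes "x \<in> CP" shows "dl x m = \<lceil>max (- (of_int m * D x)) (of_int m * Dm x)\<rceil>"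
proof -
  have le: "D x + Dm x \<le> 0" using Dle[OF assms] by (simp add: Dm)
  have "of_int m * Dm x \<le> - (of_int m * D x)" if "m \<ge> 0"
    using mult_nonneg_nonpos[of "of_int m" "D x + Dm x"] le that by (simp add: distrib_left)
  moreover have "- (of_int m * D x) \<le> of_int m * Dm x" if "m < 0"
    using mult_nonpos_nonpos[of "of_int m" "D x + Dm x"] le that by (simp add: distrib_left)
  ultimately show ?thesis by (cases "m \<ge> 0") (auto simp: dl_def max_absorb1 max_absorb2)
qed

lemma dl_add: assumes "x \<in> CP" shows "dl x (i + j) \<le> dl x i + dl x j"
proof -
  let ?a = "\<lambda>m. max (- (of_int m * D x)) (of_int m * Dm x)"
  have "?a (i + j) \<le> ?a i + ?a j" by (auto simp: max_def algebra_simps)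
  also have "\<dots> \<le> of_int (dl x i + dl x j)" unfolding dl_real[OF assms] by (simp add: add_mono)
  finally show ?thesis unfolding dl_real[OF assms, of "i + j"] by (simp add: ceiling_le_iff)
qed

lemma ord_h_tx: "x \<in> CP \<Longrightarrow> ord_at C (tx x) h = ord_at C x h" using ord_tx[of x h] h by simp

text \<open>Conjugation exchanges the two linear bounds up to a multiple of the order of
  \<open>h\<close>, and this integer passes through the ceilings.\<close>

lemma dl_tx: assumes x: "x \<in> CP" shows "dl (tx x) (- m) - m * ord_at C x h = dl x m"
proof -
  have 1: "\<lceil>r - of_int k\<rceil> = \<lceil>r\<rceil> - k" for r :: rat and k by (simp add: ceiling_diff_of_int)
  consider "m = 0" | "m > 0" | "m < 0" by linarith
  then show ?thesis
  proof cases
    case 2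
    have "of_int (- m) * Dm (tx x) = - (of_int m * D x) + of_int (m * ord_at C x h)"
      using tx(2)[OF x] ord_h_tx[OF x] by (simp add: Dm algebra_simps)
    then have "\<lceil>of_int (- m) * Dm (tx x)\<rceil> = \<lceil>- (of_int m * D x)\<rceil> + m * ord_at C x h"
      by (simp only: ceiling_add_of_int)
    moreover have "dl (tx x) (- m) = \<lceil>of_int (- m) * Dm (tx x)\<rceil>" "dl x m = \<lceil>- (of_int m * D x)\<rceil>"
      using 2 by (simp_all add: dl_def)
    ultimately show ?thesis by simp
  next
    case 3
    have "of_int m * Dm x = of_int m * D (tx x) - of_int (m * ord_at C x h)"
      by (simp add: Dm algebra_simps)
    then have "dl x m = \<lceil>of_int m * D (tx x)\<rceil> - m * ord_at C x h" using 3 1 by (simp only: dl_def) simp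
    then show ?thesis using 3 by (simp add: dl_def)
  qed simp
qed

text \<open>The bounds of the surface imposed only at the points of \<open>V\<close>. For
  \<open>V = CP\<close> this is the surface; in general it bounds the ring over \<open>V\<close>
  from above.\<close>

definition SV :: "'k set set \<Rightarrow> (int \<Rightarrow> 'k) set" where
  "SV V = {f \<in> lau. \<forall>m. \<forall>x\<in>V. vge x (dl x m) (f m)}"

abbreviation "SS \<equiv> SV CP"

lemma SV_D: "f \<in> SV V \<Longrightarrow> f \<in> lau" "f \<in> SV V \<Longrightarrow> x \<in> V \<Longrightarrow> vge x (dl x m) (f m)" by (auto simp: SV_def)

lemma lsub_SV: assumes V: "V \<subseteq> CP" shows "lsub (SV V)"
  unfolding lsub_def
proof (intro conjI ballI)
  have C: "x \<in> CP" if "x \<in> V" for x using V that by blast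
  show "SV V \<subseteq> lau" by (auto simp: SV_def)
  have "vge x (dl x m) (lmon 0 1 m)" if x: "x \<in> V" for x m
  proof (cases "m = 0")
    case True then show ?thesis using vge_simps(9)[OF C[OF x] A_simps(2)] by simp
  next
    case False then show ?thesis using vge_simps(1)[OF C[OF x]] by simp
  qed
  then show "lmon 0 1 \<in> SV V" by (simp add: SV_def)
  fix f assume f: "f \<in> SV V"
  show "(\<lambda>m. - f m) \<in> SV V" using f vge_simps(5)[OF C] by (simp add: SV_def)
  fix g assume g: "g \<in> SV V"
  have "vge x (dl x m) (ladd f g m)" if x: "x \<in> V" for x m
    unfolding ladd_def by (rule vge_simps(2)[OF C[OF x] SV_D(2)[OF f x] SV_D(2)[OF g x]])
  then show "ladd f g \<in> SV V" using SV_D(1)[OF f] SV_D(1)[OF g] by (simp add: SV_def)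
  have "vge x (dl x m) (lmul f g m)" if x: "x \<in> V" for x m
    unfolding lmul_def
  proof (rule vge_simps(11)[OF C[OF x]])
    fix i
    have "vge x (dl x i + dl x (m - i)) (f i * g (m - i))"
      by (rule vge_simps(3)[OF C[OF x] SV_D(2)[OF f x] SV_D(2)[OF g x]])
    then show "vge x (dl x m) (f i * g (m - i))" by (rule vge_simps(4)[OF C[OF x]]) (use dl_add[OF C[OF x], of i "m - i"] in simp)
  qed
  then show "lmul f g \<in> SV V" using SV_D(1)[OF f] SV_D(1)[OF g] by (simp add: SV_def)
qed

lemma SV_mono: assumes V: "V \<subseteq> CP" shows "lmon m a \<in> SV V \<longleftrightarrow> (\<forall>x\<in>V. vge x (dl x m) a)"
proof
  assume "lmon m a \<in> SV V" then show "\<forall>x\<in>V. vge x (dl x m) a" using SV_D(2)[of "lmon m a" V _ m] by simp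
next
  assume a: "\<forall>x\<in>V. vge x (dl x m) a"
  have "vge x (dl x n) (lmon m a n)" if "x \<in> V" for x n using a V that vge_simps(1)[of x] by (cases "n = m") auto
  then show "lmon m a \<in> SV V" by (simp add: SV_def)
qed

lemma graded_SV: "V \<subseteq> CP \<Longrightarrow> graded (SV V)"
  unfolding graded_def by (simp add: SV_mono SV_D(2))

lemma SV_A: "V \<subseteq> CP \<Longrightarrow> a \<in> A \<Longrightarrow> lmon 0 a \<in> SV V"
  unfolding SV_mono using vge_simps(9) by auto

lemma SS0: "lmon 0 a \<in> SS \<longleftrightarrow> a \<in> A" unfolding SV_mono[OF subset_refl] A_iff by simp

text \<open>The factor \<open>h powi (- m)\<close> shifts orders by exactly the amount that
  \<open>dl_tx\<close> accounts for.\<close>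

lemma cj_SS: assumes f: "f \<in> SS" shows "rs.cj f \<in> SS"
proof -
  have "vge x (dl x m) (rs.cj f m)" if x: "x \<in> CP" for x m
  proof -
    have "vge (tx x) (dl (tx x) (- m)) (f (- m))" by (rule SV_D(2)[OF f tx(1)[OF x]])
    then have "vge x (dl (tx x) (- m)) (\<tau> (f (- m)))" using vge_tx[OF x] by simp
    moreover have "dl (tx x) (- m) = dl x m - ord_at C x (h powi (- m))"
      using dl_tx[OF x, of m] ord_simps(3)[OF x h(1), of "- m"] by simp
    ultimately have "vge x (dl x m) (\<tau> (f (- m)) * h powi (- m))" using vge_mult_iff[OF x, of "h powi (- m)"] h(1) by simp
    then show ?thesis by (simp add: dpd_conj_def mult.commute)
  qed
  then show ?thesis using rs.cj_lau[OF SV_D(1)[OF f]] by (simp add: SV_def)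
qed

lemma ff: "function_field C = coord UNIV \<kappa>" by (simp add: function_field_def)

text \<open>Orders are integers, so a rational bound may be rounded up.\<close>

lemma piece: "f \<in> dpd_piece C \<tau> D h m \<longleftrightarrow> (\<forall>x\<in>CP. vge x (dl x m) f)"
proof -
  have *: "f \<in> div_sections C E \<longleftrightarrow> (\<forall>x\<in>CP. vge x \<lceil>- E x\<rceil> f)" for E
  proof -
    have "vge x \<lceil>- E x\<rceil> f \<longleftrightarrow> f = 0 \<or> of_int (ord_at C x f) + E x \<ge> 0" for x
      unfolding vge_def ceiling_le_iff by auto
    then show ?thesis by (auto simp: div_sections_def)
  qed
  consider "m = 0" | "m > 0" | "m < 0" by linarith
  then show ?thesis
  proof cases
    case 1 then show ?thesis using A_iff by (simp add: dpd_piece_def)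
  qed (auto simp: dpd_piece_def * dl_def)
qed

lemma surface: "dpd_surface C \<tau> D h = GA SS \<kappa>"
proof -
  have "{f \<in> lau. \<forall>m. \<forall>x\<in>CP. vge x (dl x m) (f m)} = SS" by (simp add: SV_def)
  then show ?thesis unfolding dpd_surface_def GA_def ff laurent_coord piece by simp
qed

lemma quotient: "dpd_quotient C = lmon 0" by (simp add: dpd_quotient_def ff)

text \<open>A positive bound occurs only where \<open>D\<close>, its conjugate or the divisor of
  \<open>h\<close> is nonzero. This makes the approximation lemmas applicable to the bounds of the
  surface.\<close>

lemma finite_dl: "finite {x \<in> CP. dl x m > 0}"
proof -
  have "{x \<in> CP. D (tx x) \<noteq> 0} \<subseteq> tx ` {x \<in> CP. D x \<noteq> 0}" using tx by (force simp: image_iff)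
  then have "finite {x \<in> CP. D (tx x) \<noteq> 0}" using Dfin finite_surj by blast
  moreover have "{x \<in> CP. dl x m > 0} \<subseteq> {x \<in> CP. D x \<noteq> 0} \<union> {x \<in> CP. D (tx x) \<noteq> 0} \<union> {x \<in> CP. ord_at C x h \<noteq> 0}"
    by (auto simp: dl_def Dm split: if_splits)
  ultimately show ?thesis using Dfin finite_ord[OF h(1)] by (meson finite_UnI finite_subset)
qed

text \<open>Attaining the bound at \<open>x\<close> is what makes a leading coefficient at
  \<open>x\<close> nonzero; approximation keeps the bounds at all other points.\<close>

lemma piece_elem:
  assumes x: "x \<in> CP" obtains g where "g \<noteq> 0" "ord_at C x g = dl x m" "lmon m g \<in> SS"
proof -
  obtain g where g: "g \<noteq> 0" "ord_at C x g = dl x m" "\<And>y. y \<in> CP \<Longrightarrow> y \<noteq> x \<Longrightarrow> vge y (dl y m) g"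
    using ord_approx[OF x finite_dl] by metis
  have "lmon m g \<in> SS" unfolding SV_mono[OF subset_refl] using g by (metis order_refl vge_def)
  then show ?thesis using that g by blast
qed

lemma lmon_pow: assumes "lsub P" "lmon m u \<in> P" shows "lmon (int n * m) (u ^ n) \<in> P"
proof (induction n)
  case 0 then show ?case using lsubD(3)[OF assms(1)] by simp
next
  case (Suc n)
  then have "lmul (lmon m u) (lmon (int n * m) (u ^ n)) \<in> P" using lsubD(6)[OF assms(1)] assms(2) by blast
  then show ?case by (simp add: algebra_simps)
qed

lemma real_A: "rs.cj (lmon 0 a) = lmon 0 (\<tau> a)" by (simp add: rs.cj_mono)

section \<open>Torsors over open subsets\<close>

definition BV :: "'k set set \<Rightarrow> 'k set" where "BV V = {f. \<forall>x\<in>V. vge x 0 f}"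
definition PV :: "'k set set \<Rightarrow> (int \<Rightarrow> 'k) set" where "PV V = gen \<kappa> (SS \<union> lmon 0 ` BV V)"

lemma sections_BV: "V \<subseteq> CP \<Longrightarrow> sections C V = BV V"
  unfolding sections_def BV_def using vge_simps(7) by auto

lemma open_sub: "V \<subseteq> CP \<Longrightarrow> open_sub C V = coord (BV V) \<kappa>"
  by (simp add: open_sub_def sections_BV)

lemma over_open: "V \<subseteq> CP \<Longrightarrow> over_open C (GA SS \<kappa>) V = GA (PV V) \<kappa>"
  unfolding over_open_def by (simp add: sections_BV PV_def gen_def quotient ff GA_def)

lemma BV_SV: "V \<subseteq> CP \<Longrightarrow> lmon 0 b \<in> SV V \<longleftrightarrow> b \<in> BV V"
  by (simp add: SV_mono BV_def)

lemma sring_BV: assumes V: "V \<subseteq> CP" shows "sring (BV V)" "A \<subseteq> BV V"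
proof -
  have C: "x \<in> CP" if "x \<in> V" for x using V that by blast
  show A: "A \<subseteq> BV V" using vge_simps(9)[OF C] by (auto simp: BV_def)
  show "sring (BV V)" unfolding sring_def
  proof (intro conjI ballI)
    show "0 \<in> BV V" "1 \<in> BV V" using A A_simps by auto
    fix a assume a: "a \<in> BV V"
    show "- a \<in> BV V" using a vge_simps(5)[OF C] by (simp add: BV_def)
    fix b assume b: "b \<in> BV V"
    show "a + b \<in> BV V" using a b vge_simps(2)[OF C] by (simp add: BV_def)
    show "a * b \<in> BV V" using a b vge_simps(3)[OF C, of _ 0 a 0 b] by (simp add: BV_def)
  qed
qed

text \<open>The inclusion in \<open>SV V\<close> controls the orders of elements of a ring that is
  known only through generators.\<close>

lemma PV:
  assumes V: "V \<subseteq> CP"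
  shows "lsub (PV V)" "SS \<subseteq> PV V" "b \<in> BV V \<Longrightarrow> lmon 0 b \<in> PV V" "PV V \<subseteq> SV V" "graded (PV V)"
proof -
  have l: "SS \<union> lmon 0 ` BV V \<subseteq> lau" using SV_D(1) by auto
  note g = gen[OF l, of \<kappa>]
  show "lsub (PV V)" "SS \<subseteq> PV V" using g by (auto simp: PV_def)
  show B: "lmon 0 b \<in> PV V" if "b \<in> BV V" for b using g(2) that by (auto simp: PV_def)
  show "PV V \<subseteq> SV V" unfolding PV_def
  proof (rule gen_min[OF _ lsub_SV[OF V]])
    have "SS \<subseteq> SV V" using V by (auto simp: SV_def)
    then show "SS \<union> lmon 0 ` BV V \<subseteq> SV V" using BV_SV[OF V] by auto
  qed
  show "graded (PV V)" unfolding PV_def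
  proof (rule gen_graded[OF l])
    fix f m assume "f \<in> SS \<union> lmon 0 ` BV V"
    then show "lmon m (f m) \<in> gen \<kappa> (SS \<union> lmon 0 ` BV V)"
    proof
      assume "f \<in> SS"
      then have "lmon m (f m) \<in> SS" using graded_SV[OF subset_refl] by (simp add: graded_def)
      then show ?thesis using g(2) by auto
    next
      assume "f \<in> lmon 0 ` BV V"
      then obtain b where b: "f = lmon 0 b" "b \<in> BV V" by blast
      show ?thesis
      proof (cases "m = 0")
        case True then show ?thesis using b g(2) by auto
      next
        case False then show ?thesis using b lsubD(7)[OF g(1)] by simp
      qed
    qed
  qed
qed

lemma cj_PV:
  assumes V: "V \<subseteq> CP" "\<And>x. x \<in> V \<Longrightarrow> tx x \<in> V"
  shows "b \<in> BV V \<Longrightarrow> \<tau> b \<in> BV V" "f \<in> PV V \<Longrightarrow> rs.cj f \<in> PV V"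
proof -
  have l: "SS \<union> lmon 0 ` BV V \<subseteq> lau" using SV_D(1) by auto
  show B: "\<tau> b \<in> BV V" if b: "b \<in> BV V" for b
    using b V vge_tx[of _ 0 b] unfolding BV_def by blast
  show "f \<in> PV V \<Longrightarrow> rs.cj f \<in> PV V" unfolding PV_def
  proof (rule rs.gen_cj[OF l])
    fix f assume "f \<in> SS \<union> lmon 0 ` BV V"
    then have "rs.cj f \<in> SS \<union> lmon 0 ` BV V" using cj_SS B real_A by auto
    then show "rs.cj f \<in> gen \<kappa> (SS \<union> lmon 0 ` BV V)" using gen(2)[OF l] by blast
  qed
qed

text \<open>The zero ideal is set apart since \<open>BV V\<close> may be a field, as for empty
  \<open>V\<close>. A nonzero maximal ideal meets \<open>A\<close> in a nonzero prime, hence in a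
  closed point.\<close>

lemma closed_points_BV:
  assumes V: "V \<subseteq> CP" and y: "maxidl (BV V) y" and y0: "y \<noteq> {0}"
  shows "y \<inter> A \<in> V" "y = {f \<in> BV V. vge (y \<inter> A) 1 f}"
proof -
  note s = sring_BV[OF V] and b = sringD[OF sring_BV(1)[OF V]]
  have iy: "idl (BV V) y" using y by (simp add: maxidl_def)
  note i = idlD[OF iy]
  have p: "primeidl (BV V) y" by (rule maxidl_prime[OF s(1) y])
  let ?x = "y \<inter> A"
  have pr: "primeidl A ?x" unfolding primeidl_def
  proof (intro conjI ballI impI)
    show "idl A ?x" using i s(2) A_simps by (auto simp: idl_def)
    show "?x \<noteq> A" using maxidl_one[OF s(1) y] A_simps(2) by blast
    show "a \<in> ?x \<or> d \<in> ?x" if "a \<in> A" "d \<in> A" "a * d \<in> ?x" for a d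
      using p that s(2) unfolding primeidl_def by blast
  qed
  obtain e where e: "e \<in> y" "e \<noteq> 0" using y0 i(2) by blast
  obtain a d where ad: "a \<in> A" "d \<in> A" "d \<noteq> 0" "e = a / d" using fraction_field by blast
  have "d * e \<in> y" using i(4) s(2) ad(2) e(1) by blast
  then have "a \<in> ?x" "a \<noteq> 0" using ad e by auto
  then have x: "?x \<in> CP" by (intro prime_max[OF pr]) auto
  show xV: "?x \<in> V"
  proof (rule ccontr)
    assume n: "?x \<notin> V"
    \<comment> \<open>A function with a simple pole at the missing point and no other pole lies in
      \<open>BV V\<close>. It brings \<open>r / g\<close>, which vanishes at that point, back to
      \<open>r\<close>, which does not.\<close>
    obtain g where g: "g \<noteq> 0" "ord_at C ?x g = -1" "\<And>z. z \<in> CP \<Longrightarrow> z \<noteq> ?x \<Longrightarrow> vge z 0 g"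
      using ord_approx[OF x, of "\<lambda>_. 0" "-1"] by auto
    have gB: "g \<in> BV V" using g(3) n V by (auto simp: BV_def)
    have "inverse g \<noteq> 0" using g by simp
    then obtain r where r: "r \<in> A" "r \<notin> ?x" "\<And>z. z \<in> CP \<Longrightarrow> z \<noteq> ?x \<Longrightarrow> vge z 0 (r * inverse g)"
      using approx[OF x, of "inverse g" "\<lambda>_. 0"] by auto
    have "ord_at C ?x (inverse g) = 1" using ord_simps(2)[OF x g(1)] g(2) by simp
    then have 1: "vge ?x 1 (r * inverse g)" using vge_mult_iff[OF x \<open>inverse g \<noteq> 0\<close>] vge_simps(9)[OF x r(1)] by simp
    then have "vge ?x 0 (r * inverse g)" using vge_simps(4)[OF x 1] by simp
    then have rA: "r * inverse g \<in> A" unfolding A_iff using r(3) by blast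
    then have "r * inverse g \<in> ?x" using 1 vge_simps(10)[OF x] by blast
    then have "g * (r * inverse g) \<in> y" using i(4)[OF gB] by blast
    then have "r \<in> y" using g(1) by (simp add: field_simps)
    then show False using r by blast
  qed
  have sub: "y \<subseteq> {f \<in> BV V. vge ?x 1 f}"
  proof
    fix f assume f: "f \<in> y"
    then have fB: "f \<in> BV V" using i(1) by blast
    then have "f \<in> lr ?x" using xV vge_simps(7)[OF x] by (auto simp: BV_def)
    then obtain a d where ad: "f = a / d" "a \<in> A" "d \<in> A - ?x" by (auto simp: local_ring_def)
    have "d \<noteq> 0" using nx(2)[OF x ad(3) ad(3)] .
    then have "d * f = a" using ad by simp
    moreover have "d * f \<in> y" using i(4) s(2) ad(3) f by blast
    ultimately have "f \<in> mx ?x" unfolding mx_def using ad by blast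
    then show "f \<in> {f \<in> BV V. vge ?x 1 f}" using fB vge_simps(8)[OF x] by simp
  qed
  have "idl (BV V) {f \<in> BV V. vge ?x 1 f}" unfolding idl_def
  proof (intro conjI ballI)
    show "{f \<in> BV V. vge ?x 1 f} \<subseteq> BV V" "0 \<in> {f \<in> BV V. vge ?x 1 f}" using b vge_simps(1)[OF x] by auto
    fix a d assume d: "d \<in> {f \<in> BV V. vge ?x 1 f}"
    show "a + d \<in> {f \<in> BV V. vge ?x 1 f}" if "a \<in> {f \<in> BV V. vge ?x 1 f}"
      using that d b(3) vge_simps(2)[OF x] by auto
    show "a * d \<in> {f \<in> BV V. vge ?x 1 f}" if "a \<in> BV V"
      using that d b(4) vge_simps(3)[OF x, of 0 a 1 d] xV by (auto simp: BV_def)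
  qed
  moreover have "1 \<notin> {f \<in> BV V. vge ?x 1 f}" using mx_one[OF x] vge_simps(8)[OF x] by auto
  ultimately show "y = {f \<in> BV V. vge ?x 1 f}" using y sub b(2) unfolding maxidl_def by metis
qed

text \<open>Where \<open>u * u'\<close> is invertible, \<open>u\<close> is a coordinate on the
  fibres: dividing degree \<open>m\<close> by \<open>u^m\<close> gives Laurent polynomials over the
  base.\<close>

lemma trivial_on:
  assumes V: "V \<subseteq> CP" and u: "u \<noteq> 0" "u' \<noteq> 0" "lmon 1 u \<in> SS" "lmon (- 1) u' \<in> SS"
  shows "gm_trivial_on (coord (BV V) \<kappa>) (GA (PV V) \<kappa>) (lmon 0) (u * u')" "u * u' \<in> BV V"
proof -
  note P = PV[OF V] and s = lsubD[OF PV(1)[OF V]] and sb = sringD[OF sring_BV(1)[OF V]]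
  have uu: "lmul (lmon 1 u) (lmon (- 1) u') \<in> SS" using lsubD(6)[OF lsub_SV[OF subset_refl]] u by blast
  then have uA: "u * u' \<in> A" using SS0 by simp
  then show uB: "u * u' \<in> BV V" using sring_BV(2)[OF V] by blast
  define \<chi> where "\<chi> a = (\<lambda>m. a m * u powi (- m))" for a :: "int \<Rightarrow> 'k"
  have ch_lau: "\<chi> a \<in> lau" if "a \<in> lau" for a using that u by (simp add: \<chi>_def lau_def)
  have ch_mono: "\<chi> (lmon m a) = lmon m (a * u powi (- m))" for m a by (auto simp: \<chi>_def lmon_def)
  have pw: "lmon (int n) (u ^ n) \<in> SS" "lmon (- int n) (u' ^ n) \<in> SS" for n
    using lmon_pow[OF lsub_SV[OF subset_refl] u(3), of n] lmon_pow[OF lsub_SV[OF subset_refl] u(4), of n] by auto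
  interpret triv "BV V" \<kappa> "u * u'" "GA (PV V) \<kappa>" \<chi> "lmon 0"
  proof (rule triv.intro)
    show "sring (BV V)" by (rule sring_BV(1)[OF V])
    show "u * u' \<in> BV V" by fact
    show "u * u' \<noteq> 0" using u by simp
    show "khom \<kappa>" using rs.k .
    show "\<kappa> z \<in> BV V" for z using sring_BV(2)[OF V] by auto
    show "cring (GA (PV V) \<kappa>)" using domain_GA[OF P(1)] by (simp add: domain_def)
    show "\<chi> \<in> ring_hom (GA (PV V) \<kappa>) (GA lau \<kappa>)"
    proof (rule ring_hom_memI)
      fix a b assume ab: "a \<in> carrier (GA (PV V) \<kappa>)" "b \<in> carrier (GA (PV V) \<kappa>)"
      have l: "a \<in> lau" "b \<in> lau" using ab s(2) by auto
      show "\<chi> a \<in> carrier (GA lau \<kappa>)" using ch_lau l by simp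
      show "\<chi> (a \<oplus>\<^bsub>GA (PV V) \<kappa>\<^esub> b) = \<chi> a \<oplus>\<^bsub>GA lau \<kappa>\<^esub> \<chi> b" by (auto simp: \<chi>_def ladd_def distrib_right)
      have "\<chi> (lmul a b) = lmul (\<chi> a) (\<chi> b)"
      proof
        fix m
        have "lmul (\<chi> a) (\<chi> b) m = (\<Sum>i | a i \<noteq> 0. \<chi> a i * \<chi> b (m - i))"
          unfolding lmul_def by (rule sum.cong) (use u in \<open>auto simp: \<chi>_def\<close>)
        also have "\<dots> = (\<Sum>i | a i \<noteq> 0. a i * b (m - i) * u powi (- m))"
        proof (rule sum.cong[OF refl])
          fix i
          have "u powi (- i) * u powi (- (m - i)) = u powi (- m)" using u(1) by (simp flip: power_int_add)
          then show "\<chi> a i * \<chi> b (m - i) = a i * b (m - i) * u powi (- m)" unfolding \<chi>_def by (simp add: mult_ac)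
        qed
        also have "\<dots> = \<chi> (lmul a b) m" by (simp add: \<chi>_def lmul_def sum_distrib_right)
        finally show "\<chi> (lmul a b) m = lmul (\<chi> a) (\<chi> b) m" by simp
      qed
      then show "\<chi> (a \<otimes>\<^bsub>GA (PV V) \<kappa>\<^esub> b) = \<chi> a \<otimes>\<^bsub>GA lau \<kappa>\<^esub> \<chi> b" using l ch_lau by (simp add: GA_mult)
    next
      show "\<chi> \<one>\<^bsub>GA (PV V) \<kappa>\<^esub> = \<one>\<^bsub>GA lau \<kappa>\<^esub>" by (simp add: ch_mono)
    qed
    show "inj_on \<chi> (carrier (GA (PV V) \<kappa>))"
    proof (rule inj_onI)
      fix a b assume "\<chi> a = \<chi> b"
      then have "a m * u powi (- m) = b m * u powi (- m)" for m unfolding \<chi>_def by metis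
      then show "a = b" using u(1) by (auto simp: fun_eq_iff)
    qed
    show "lmon 0 b \<in> carrier (GA (PV V) \<kappa>)" if "b \<in> BV V" for b using P(3)[OF that] by simp
    show "\<chi> (lmon 0 b) = lmon 0 b" for b by (simp add: ch_mono)
    show "cst (GA (PV V) \<kappa>) z \<in> carrier (GA (PV V) \<kappa>)" for z using SV_A[OF subset_refl \<kappa>(1)] P(2) by auto
    show "\<chi> (cst (GA (PV V) \<kappa>) z) = lmon 0 (\<kappa> z)" for z by (simp add: ch_mono)
    fix a m
    show "\<chi> (wt (GA (PV V) \<kappa>) a m) = lmon m (\<chi> a m)" by (simp add: ch_mono) (simp add: \<chi>_def)
    assume a: "a \<in> carrier (GA (PV V) \<kappa>)"
    show "wt (GA (PV V) \<kappa>) a m \<in> carrier (GA (PV V) \<kappa>)" using P(5) a by (simp add: graded_def)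
    have am: "lmon m (a m) \<in> SV V" using P(4,5) a by (auto simp: graded_def)
    have SSV: "SS \<subseteq> SV V" using P(2,4) by blast
    \<comment> \<open>Multiplying by \<open>u^n\<close> or \<open>u'^n\<close> leads to degree 0,
      where the bounds are those of \<open>BV V\<close>; in positive degree this costs the factor
      \<open>(u * u')^n\<close>.\<close>
    show "\<exists>j::nat. (u * u') ^ j * \<chi> a m \<in> BV V"
    proof (cases "m \<le> 0")
      case True
      then obtain n where n: "m = - int n" by (metis minus_minus neg_0_le_iff_le nonneg_int_cases)
      have "lmul (lmon m (a m)) (lmon (int n) (u ^ n)) \<in> SV V"
        using lsubD(6)[OF lsub_SV[OF V] am] pw(1) SSV by blast
      then have "a m * u ^ n \<in> BV V" using n BV_SV[OF V] by simp
      then show ?thesis using n by (intro exI[of _ 0]) (simp add: \<chi>_def)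
    next
      case False
      then obtain n where n: "m = int n" by (metis linorder_le_cases nonneg_int_cases)
      have "lmul (lmon m (a m)) (lmon (- int n) (u' ^ n)) \<in> SV V"
        using lsubD(6)[OF lsub_SV[OF V] am] pw(2) SSV by blast
      then have "a m * u' ^ n \<in> BV V" using n BV_SV[OF V] by simp
      moreover have "(u * u') ^ n * \<chi> a m = a m * u' ^ n"
        using n u(1) by (simp add: \<chi>_def power_int_minus power_mult_distrib field_simps)
      ultimately show ?thesis by metis
    qed
  next
    fix b m assume b: "b \<in> BV V"
    show "\<exists>a\<in>carrier (GA (PV V) \<kappa>). \<exists>j::nat. \<chi> a = lmon m ((u * u') ^ j * b)"
    proof (cases "m \<ge> 0")
      case True
      then obtain n where n: "m = int n" by (metis nonneg_int_cases)
      have "lmul (lmon 0 b) (lmon (int n) (u ^ n)) \<in> PV V" using s(6) P(2,3) b pw(1) by blast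
      then show ?thesis using n u(1)
        by (intro bexI[of _ "lmon m (b * u ^ n)"] exI[of _ 0]) (auto simp: ch_mono power_int_minus mult.assoc)
    next
      case False
      then obtain n where n: "m = - int n" by (metis linorder_le_cases minus_minus neg_0_le_iff_le nonneg_int_cases)
      have "lmul (lmon 0 b) (lmon (- int n) (u' ^ n)) \<in> PV V" using s(6) P(2,3) b pw(2) by blast
      then show ?thesis using n u(1)
        by (intro bexI[of _ "lmon m (b * u' ^ n)"] exI[of _ n]) (auto simp: ch_mono power_mult_distrib mult_ac)
    qed
  qed
  show "gm_trivial_on (coord (BV V) \<kappa>) (GA (PV V) \<kappa>) (lmon 0) (u * u')" by (rule gm_trivial)
qed

text \<open>Without rounding, the bounds in degrees 1 and -1 are opposite, so elements attaining
  them multiply to a unit at \<open>x\<close>.\<close>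

lemma dl_integral:
  assumes "x \<in> CP" "D x \<in> \<int>" "D x + D (tx x) = of_int (ord_at C x h)"
  shows "dl x 1 + dl x (- 1) = 0"
proof -
  obtain d where d: "D x = of_int d" using assms(2) by (auto elim: Ints_cases)
  have "Dm x = - of_int d" using assms(3) d by (simp add: Dm)
  then show ?thesis using d by (simp add: dl_def) (simp flip: of_int_minus)
qed

lemma torsor:
  assumes V: "V \<subseteq> CP" "\<And>x. x \<in> V \<Longrightarrow> tx x \<in> V" and c: "c \<in> CP"
    and nd: "nondegenerate_over C \<tau> D h V"
  shows "S1_torsor (open_sub C V) \<tau> (over_open C (GA SS \<kappa>) V) rs.cj (lmon 0)"
  unfolding S1_torsor_def gm_torsor_def open_sub[OF V(1)] over_open[OF V(1)]
proof (intro conjI ballI)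
  note P = PV[OF V(1)] and s = lsubD[OF PV(1)[OF V(1)]] and sb = sringD[OF sring_BV(1)[OF V(1)]]
  show "real_structure (coord (BV V) \<kappa>) \<tau>"
    using cj_PV(1)[OF V] \<tau> by (auto simp: real_structure_def ring_hom_def)
  show "domain (GA (PV V) \<kappa>)" by (rule domain_GA[OF P(1)])
  have kP: "lmon 0 (\<kappa> z) \<in> PV V" for z by (rule P(3)[OF subsetD[OF sring_BV(2)[OF V(1)] \<kappa>(1)]])
  show act: "S1_action (GA (PV V) \<kappa>) rs.cj" by (rule rs.S1_action_GA[OF P(1,5) kP cj_PV(2)[OF V]])
  then show "gm_action (GA (PV V) \<kappa>)" by (simp add: S1_action_def)
  show "lmon 0 (\<tau> b) = rs.cj (lmon 0 b)" for b by (simp add: real_A)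
  show "calg_hom (coord (BV V) \<kappa>) (GA (PV V) \<kappa>) (lmon 0)"
    using P(3) by (auto simp: calg_hom_def ring_hom_def GA_mult)
  show "wt (GA (PV V) \<kappa>) (lmon 0 b) = lmonom (GA (PV V) \<kappa>) 0 (lmon 0 b)" for b
    by (auto simp: lmonom_def lmon_def fun_eq_iff)
  fix y assume "y \<in> closed_points (coord (BV V) \<kappa>)"
  then have y: "maxidl (BV V) y" using closed_points_coord[OF sring_BV(1)[OF V(1)]] by blast
  \<comment> \<open>At a point of \<open>V\<close>, elements attaining the bounds in degrees 1 and
    -1 have a product that does not vanish there. If zero is a maximal ideal, any nonzero elements
    of these degrees will do, and \<open>c\<close> provides some.\<close>
  have "\<exists>u u'. u \<noteq> 0 \<and> u' \<noteq> 0 \<and> lmon 1 u \<in> SS \<and> lmon (- 1) u' \<in> SS \<and> u * u' \<notin> y"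
  proof (cases "y = {0}")
    case True
    obtain u where u: "u \<noteq> 0" "lmon 1 u \<in> SS" using piece_elem[OF c] by metis
    obtain u' where u': "u' \<noteq> 0" "lmon (- 1) u' \<in> SS" using piece_elem[OF c] by metis
    show ?thesis using u u' True by (intro exI[of _ u] exI[of _ u']) simp
  next
    case False
    let ?x = "y \<inter> A"
    have xV: "?x \<in> V" and yx: "y = {f \<in> BV V. vge ?x 1 f}" using closed_points_BV[OF V(1) y False] by auto
    then have x: "?x \<in> CP" using V by blast
    obtain u where u: "u \<noteq> 0" "ord_at C ?x u = dl ?x 1" "lmon 1 u \<in> SS" using piece_elem[OF x] by metis
    obtain u' where u': "u' \<noteq> 0" "ord_at C ?x u' = dl ?x (- 1)" "lmon (- 1) u' \<in> SS" using piece_elem[OF x] by metis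
    have "ord_at C ?x (u * u') = 0"
      using ord_simps(1)[OF x u(1) u'(1)] u(2) u'(2) dl_integral[OF x] nd xV by (simp add: nondegenerate_over_def)
    then have "\<not> vge ?x 1 (u * u')" using u u' by (simp add: vge_def)
    then have "u * u' \<notin> y" using yx by blast
    then show ?thesis using u u' by blast
  qed
  then obtain u u' where u: "u \<noteq> 0" "u' \<noteq> 0" "lmon 1 u \<in> SS" "lmon (- 1) u' \<in> SS" "u * u' \<notin> y" by blast
  show "\<exists>f\<in>carrier (coord (BV V) \<kappa>) - y. gm_trivial_on (coord (BV V) \<kappa>) (GA (PV V) \<kappa>) (lmon 0) f"
    using trivial_on[OF V(1) u(1-4)] u(5) by (intro bexI[of _ "u * u'"]) auto
qed

text \<open>The maximal ideals of the ring of sections consist of the functions vanishing at a point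
  of \<open>U\<close>, and the local rings are unchanged.\<close>

lemma affine_openI:
  assumes U: "U \<subseteq> CP" "finite (CP - U)" "U \<noteq> {}"
  shows "affine_open C U"
  unfolding affine_open_def
proof
  \<comment> \<open>The functions vanishing on the complement; the factor \<open>A\<close> covers an
    empty complement, whose intersection is the whole type.\<close>
  let ?I = "A \<inter> \<Inter>(CP - U)"
  have fin: "(\<exists>a\<in>A. a \<notin> x \<and> (\<forall>y\<in>Y. a \<in> y))" if Y: "finite Y" "Y \<subseteq> CP - {x}" "x \<in> CP" for Y x
  proof -
    obtain b where b: "b \<in> A" "b \<notin> x" "\<And>y. y \<in> Y \<Longrightarrow> vge y 1 b" using pole_killer[OF Y(3,1,2), of "\<lambda>_. 1"] by blast
    have "b \<in> y" if "y \<in> Y" for y using vge_simps(10)[OF _ b(1), of y] b(3)[OF that] Y(2) that by blast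
    then show ?thesis using b by blast
  qed
  have "x \<in> U \<longleftrightarrow> \<not> ?I \<subseteq> x" if x: "x \<in> CP" for x
  proof
    assume xU: "x \<in> U"
    then obtain a where "a \<in> A" "a \<notin> x" "\<forall>y\<in>CP - U. a \<in> y" using fin[OF U(2) _ x] by blast
    then show "\<not> ?I \<subseteq> x" by blast
  next
    assume "\<not> ?I \<subseteq> x" then show "x \<in> U" using x by blast
  qed
  then have "U = {x \<in> CP. \<not> ?I \<subseteq> x}" using U(1) by blast
  then show "zariski_open C U" unfolding zariski_open_def by blast
  note s = sring_BV[OF U(1)] and sb = sringD[OF sring_BV(1)[OF U(1)]]
  let ?m = "\<lambda>x. {f \<in> BV U. vge x 1 f}"
  have m: "maxidl (BV U) (?m x)" if xU: "x \<in> U" for x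
  proof -
    have x: "x \<in> CP" using U xU by blast
    have B0: "vge x 0 f" if "f \<in> BV U" for f using that xU by (simp add: BV_def)
    have i: "idl (BV U) (?m x)" unfolding idl_def
    proof (intro conjI ballI)
      show "?m x \<subseteq> BV U" "0 \<in> ?m x" using sb vge_simps(1)[OF x] by auto
      fix a d assume d: "d \<in> ?m x"
      show "a + d \<in> ?m x" if "a \<in> ?m x" using that d sb(3) vge_simps(2)[OF x] by auto
      show "a * d \<in> ?m x" if "a \<in> BV U"
        using that d sb(4) vge_simps(3)[OF x B0[OF that], of 1 d] by auto
    qed
    have "1 \<notin> ?m x" using mx_one[OF x] vge_simps(8)[OF x] by auto
    moreover have "J = BV U" if J: "idl (BV U) J" "?m x \<subseteq> J" "J \<noteq> ?m x" for J
    proof -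
      note j = idlD[OF J(1)]
      \<comment> \<open>An element with nonzero value \<open>z\<close> differs from the constant
        \<open>z\<close> by an element of \<open>?m x\<close>, so \<open>J\<close> contains an
        invertible constant.\<close>
      obtain g where g: "g \<in> J" "\<not> vge x 1 g" using J j(1) by blast
      have gB: "g \<in> BV U" using g j(1) by blast
      obtain z where z: "vge x 1 (g - \<kappa> z)" using ev_spec[OF x B0[OF gB]] by blast
      have z0: "z \<noteq> 0" using z g(2) by auto
      have "\<kappa> z \<in> BV U" using s(2) by auto
      then have "g - \<kappa> z \<in> J" using J(2) z sb(6)[OF gB] by blast
      then have "\<kappa> z \<in> J" using idl_minus(2)[OF s(1) J(1) g(1), of "g - \<kappa> z"] by simp
      moreover have "\<kappa> (inverse z) \<in> BV U" using s(2) by auto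
      ultimately have "\<kappa> (inverse z) * \<kappa> z \<in> J" using j(4) by blast
      then have "1 \<in> J" using z0 by (simp flip: \<kappa>(3))
      then show ?thesis using j(1) j(4)[of _ 1] by auto
    qed
    ultimately show ?thesis unfolding maxidl_def using i sb(2) by blast
  qed
  have lr_m: "local_ring (coord (BV U) \<kappa>) (?m x) = lr x" if xU: "x \<in> U" for x
  proof -
    have x: "x \<in> CP" using U xU by blast
    have B0: "f \<in> lr x" if "f \<in> BV U" for f using that xU vge_simps(7)[OF x] by (simp add: BV_def)
    show ?thesis
    proof (rule subset_antisym; rule subsetI)
      fix f assume "f \<in> local_ring (coord (BV U) \<kappa>) (?m x)"
      then obtain a b where ab: "f = a / b" "a \<in> BV U" "b \<in> BV U" "b \<notin> ?m x" by (auto simp: local_ring_def)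
      then have "b \<notin> mx x" using vge_simps(8)[OF x] by blast
      then have "inverse b \<in> lr x" using lr_cases[OF x B0[OF ab(3)]] by blast
      then show "f \<in> lr x" using sringD(4)[OF sring_lr[OF x] B0[OF ab(2)]] ab(1) by (simp add: divide_inverse)
    next
      fix f assume "f \<in> lr x"
      then obtain a b where ab: "f = a / b" "a \<in> A" "b \<in> A - x" by (auto simp: local_ring_def)
      have "b \<notin> ?m x" using ab(3) vge_simps(10)[OF x] by blast
      then show "f \<in> local_ring (coord (BV U) \<kappa>) (?m x)" using ab s(2) by (auto simp: local_ring_def)
    qed
  qed
  have cp: "closed_points (open_sub C U) = ?m ` U"
  proof (rule subset_antisym; rule subsetI)
    fix y assume "y \<in> closed_points (open_sub C U)"
    then have y: "maxidl (BV U) y" unfolding open_sub[OF U(1)] using closed_points_coord[OF s(1)] by blast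
    obtain x where xU: "x \<in> U" using U(3) by blast
    have x: "x \<in> CP" using U(1) xU by blast
    \<comment> \<open>The set \<open>U\<close> has a point, and the ideal of that point is proper
      and strictly larger than zero.\<close>
    have "y \<noteq> {0}"
    proof
      assume "y = {0}"
      obtain a where a: "a \<in> x" "a \<noteq> 0" using CP_nonzero[OF x] by blast
      have aA: "a \<in> A" using CP_D(4)[OF x] a by blast
      then have "a \<in> ?m x" using a s(2) vge_simps(10)[OF x] by blast
      then have "?m x \<noteq> y" using a \<open>y = {0}\<close> by blast
      moreover have "y \<subseteq> ?m x" using \<open>y = {0}\<close> sb(1) vge_simps(1)[OF x] by blast
      ultimately show False using y m[OF xU] unfolding maxidl_def by blast
    qed
    then show "y \<in> ?m ` U" using closed_points_BV[OF U(1) y] by blast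
  next
    fix y assume "y \<in> ?m ` U"
    then show "y \<in> closed_points (open_sub C U)" unfolding open_sub[OF U(1)] using closed_points_coord[OF s(1)] m by blast
  qed
  show "lr ` U = local_ring (open_sub C U) ` closed_points (open_sub C U)"
    unfolding cp unfolding open_sub[OF U(1)] image_image using lr_m by simp
qed

text \<open>It is enough to remove the finitely many points other than \<open>c\<close> where
  \<open>D\<close>, its conjugate or the divisor of \<open>h\<close> is nonzero.\<close>

lemma good_nbhd:
  assumes c: "c \<in> CP" "tx c = c"
  obtains U where "real_affine_nbhd C \<tau> c U" "nondegenerate_over C \<tau> D h (U - {c})" "U \<subseteq> CP" "\<And>x. x \<in> U \<Longrightarrow> tx x \<in> U"
proof -
  define U where "U = {x \<in> CP. x = c \<or> (D x = 0 \<and> D (tx x) = 0 \<and> ord_at C x h = 0)}"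
  have "{x \<in> CP. D (tx x) \<noteq> 0} \<subseteq> tx ` {x \<in> CP. D x \<noteq> 0}" using tx by (force simp: image_iff)
  then have "finite {x \<in> CP. D (tx x) \<noteq> 0}" using Dfin finite_surj by blast
  moreover have "CP - U \<subseteq> {x \<in> CP. D x \<noteq> 0} \<union> {x \<in> CP. D (tx x) \<noteq> 0} \<union> {x \<in> CP. ord_at C x h \<noteq> 0}"
    by (auto simp: U_def)
  ultimately have fin: "finite (CP - U)" using Dfin finite_ord[OF h(1)] by (meson finite_UnI finite_subset)
  have UC: "U \<subseteq> CP" "c \<in> U" using c by (auto simp: U_def)
  have t: "tx x \<in> U" if "x \<in> U" for x using that tx ord_h_tx c by (auto simp: U_def)
  have "tx ` U = U" using t tx(2) UC by (auto simp: image_iff)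
  then have "real_affine_nbhd C \<tau> c U" unfolding real_affine_nbhd_def
    using affine_openI[OF UC(1) fin] UC by blast
  moreover have "nondegenerate_over C \<tau> D h (U - {c})" by (auto simp: nondegenerate_over_def U_def)
  ultimately show ?thesis using that UC t by blast
qed

lemma nbhd_D: assumes U: "real_affine_nbhd C \<tau> c U" shows "U \<subseteq> CP" "\<And>x. x \<in> U \<Longrightarrow> tx x \<in> U"
proof -
  have "zariski_open C U" and t: "tx ` U = U" using U by (auto simp: real_affine_nbhd_def affine_open_def)
  then show "U \<subseteq> CP" by (auto simp: zariski_open_def)
  show "tx x \<in> U" if "x \<in> U" for x using imageI[OF that, of tx] t by simp
qed

lemma trivial_even:
  assumes V: "V \<subseteq> CP" and Vt: "\<And>x. x \<in> V \<Longrightarrow> tx x \<in> V" and t: "trivial_S1_torsor (open_sub C V) \<tau> (over_open C (GA SS \<kappa>) V) rs.cj (lmon 0)"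
    and c: "c \<in> CP" "tx c = c"
  shows "even (ord_at C c h)"
proof -
  note P = PV[OF V] and s = lsubD[OF PV(1)[OF V]]
  let ?W = "gm_product (coord (BV V) \<kappa>)"
  obtain \<phi> where \<phi>: "S1_iso (GA (PV V) \<kappa>) rs.cj ?W (product_conj \<tau>) \<phi>"
    using t by (auto simp: trivial_S1_torsor_def open_sub[OF V] over_open[OF V])
  then have iso: "\<phi> \<in> ring_iso (GA (PV V) \<kappa>) ?W" and w: "\<And>a m. a \<in> PV V \<Longrightarrow> wt ?W (\<phi> a) m = \<phi> (lmon m (a m))"
    and cj: "\<And>a. a \<in> PV V \<Longrightarrow> \<phi> (rs.cj a) = product_conj \<tau> (\<phi> a)"
    by (auto simp: S1_iso_def gm_iso_def gm_hom_def)
  note e = ring_iso_memE[OF iso]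
  have sb: "sring (BV V)" by (rule sring_BV(1)[OF V])
  have mono: "lmonom (coord (BV V) \<kappa>) m a = lmon m a" for m a by (auto simp: lmonom_def lmon_def)
  have car: "lmon m 1 \<in> carrier ?W" for m using sringD(1,2)[OF sb] mono_lau[of m "1::'k"]
    by (auto simp: laurent_def lau_def) (auto simp: lmon_def)
  have mult: "f \<otimes>\<^bsub>?W\<^esub> g = lmul f g" if "f \<in> carrier ?W" "g \<in> carrier ?W" for f g
  proof -
    have "finite {i. f i \<noteq> 0}" using that by (simp add: laurent_def)
    then show ?thesis using that sringD(4)[OF sb] by (simp add: laurent_def lmul_def coord_finsum[OF sb])
  qed
  have one: "\<one>\<^bsub>?W\<^esub> = lmon 0 1" by (auto simp: laurent_def lmon_def)
  obtain E where E: "E \<in> PV V" "\<phi> E = lmon 1 1" using e(5) car[of 1] by (auto simp: bij_betw_def) (metis imageE)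
  have inj: "a = b" if "\<phi> a = \<phi> b" "a \<in> PV V" "b \<in> PV V" for a b using e(5) that by (auto simp: bij_betw_def inj_on_def)
  \<comment> \<open>\<open>E\<close> corresponds to the coordinate of the circle, whose weight 1
    forces \<open>E\<close> to be homogeneous of degree 1.\<close>
  have "\<phi> (lmon 1 (E 1)) = \<phi> E" using w[OF E(1), of 1] E(2) mono by simp
  then have E1: "E = lmon 1 (E 1)" using inj[of "lmon 1 (E 1)" E] E(1) P(5) by (auto simp: graded_def)
  have cjE: "rs.cj E = lmon (- 1) (h * \<tau> (E 1))" by (subst E1) (simp add: rs.cj_mono)
  have cjP: "rs.cj E \<in> PV V" by (rule cj_PV(2)[OF V Vt E(1)])
  have "product_conj \<tau> (lmon 1 1) = lmon (- 1) 1" by (auto simp: product_conj_def lmon_def \<tau>)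
  then have \<phi>cj: "\<phi> (rs.cj E) = lmon (- 1) 1" using cj[OF E(1)] E(2) by simp
  have "\<phi> (E \<otimes>\<^bsub>GA (PV V) \<kappa>\<^esub> rs.cj E) = lmon 1 1 \<otimes>\<^bsub>?W\<^esub> lmon (- 1) 1" using e(2)[of E "rs.cj E"] E cjP \<phi>cj by simp
  also have "\<dots> = \<phi> \<one>\<^bsub>GA (PV V) \<kappa>\<^esub>" using mult[OF car car] one e(4) by simp
  finally have "lmul E (rs.cj E) = lmon 0 1" using inj[of "lmul E (rs.cj E)" "lmon 0 1"] s E cjP by (simp add: GA_mult)
  then have "lmul (lmon 1 (E 1)) (lmon (- 1) (h * \<tau> (E 1))) = lmon 0 1" unfolding cjE using E1 by simp
  then have 1: "E 1 * (h * \<tau> (E 1)) = 1" using mono_simps(1)[of 0 1] by (metis lmul_mono_mono add.right_inverse mono_simps(1))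
  then have nz: "E 1 \<noteq> 0" "\<tau> (E 1) \<noteq> 0" by auto
  \<comment> \<open>At the real point \<open>c\<close> the orders of \<open>E 1\<close> and of its
    conjugate agree, so the order of \<open>h\<close> is minus twice this order.\<close>
  have "ord_at C c (E 1) + (ord_at C c h + ord_at C c (\<tau> (E 1))) = 0"
    using ord_simps(1)[OF c(1) nz(1), of "h * \<tau> (E 1)"] ord_simps(1)[OF c(1) h(1) nz(2)] 1 nz h ord_simps(4)[OF c(1)] by simp
  moreover have "ord_at C c (\<tau> (E 1)) = ord_at C c (E 1)" using ord_tx[OF c(1) nz(1)] c(2) by simp
  ultimately show ?thesis by presburger
qed

end

section \<open>Maximal ideals of algebras mapping to Laurent polynomials\<close>

lemma maximal_inverse:
  assumes R: "cring R" and y: "maximalideal y R" and e: "e \<in> carrier R" "e \<notin> y"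
  obtains r q where "r \<in> carrier R" "q \<in> y" "\<one>\<^bsub>R\<^esub> = q \<oplus>\<^bsub>R\<^esub> r \<otimes>\<^bsub>R\<^esub> e"
proof -
  interpret cring R by fact
  interpret y: maximalideal y R by fact
  have i: "ideal y R" "ideal (PIdl\<^bsub>R\<^esub> e) R" using y.is_ideal cgenideal_ideal[OF e(1)] by auto
  let ?J = "y <+>\<^bsub>R\<^esub> PIdl\<^bsub>R\<^esub> e"
  have J: "ideal ?J R" by (rule add_ideals[OF i])
  have 0: "\<zero>\<^bsub>R\<^esub> \<in> PIdl\<^bsub>R\<^esub> e" "e \<in> PIdl\<^bsub>R\<^esub> e"
    using additive_subgroup.zero_closed[OF ideal.axioms(1)[OF i(2)]] cgenideal_self[OF e(1)] by auto
  have yJ: "y \<subseteq> ?J"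
  proof
    fix a assume a: "a \<in> y"
    then have "a \<in> carrier R" using y.a_subset by blast
    then have "a = a \<oplus>\<^bsub>R\<^esub> \<zero>\<^bsub>R\<^esub>" by simp
    then show "a \<in> ?J" unfolding set_add_def' using a 0(1) by blast
  qed
  have z: "\<zero>\<^bsub>R\<^esub> \<in> y" using additive_subgroup.zero_closed[OF ideal.axioms(1)[OF i(1)]] .
  have "e = \<zero>\<^bsub>R\<^esub> \<oplus>\<^bsub>R\<^esub> e" using e by simp
  then have "e \<in> ?J" unfolding set_add_def' using z 0(2) by blast
  then have "?J \<noteq> y" using e(2) by blast
  moreover have "?J \<subseteq> carrier R" using J by (simp add: additive_subgroup.a_subset ideal.axioms(1))
  ultimately have "?J = carrier R" using y.I_maximal[OF J yJ] by blast
  then have "\<one>\<^bsub>R\<^esub> \<in> ?J" by simp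
  then obtain q s where "q \<in> y" "s \<in> PIdl\<^bsub>R\<^esub> e" "\<one>\<^bsub>R\<^esub> = q \<oplus>\<^bsub>R\<^esub> s" unfolding set_add_def' by blast
  then show ?thesis using that unfolding cgenideal_def by blast
qed

text \<open>The two alternatives are the affine line, where the images are exactly the polynomials,
  and the multiplicative group, where they are all Laurent polynomials.\<close>

locale lmap =
  fixes R :: "('a, 'm) ring_scheme" and \<phi> :: "'a \<Rightarrow> int \<Rightarrow> complex"
  assumes R: "cring R" and \<phi>: "\<phi> \<in> ring_hom R (GA lau (\<lambda>z. z))"
    and lp: "\<And>p. \<exists>a\<in>carrier R. \<phi> a = lp p"
    and img: "(\<forall>a\<in>carrier R. pos (\<phi> a)) \<or> (\<forall>q\<in>lau. \<exists>a\<in>carrier R. \<phi> a = q)"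
begin

sublocale R: cring R by (rule R)

lemma phi: 
  "a \<in> carrier R \<Longrightarrow> \<phi> a \<in> lau" "a \<in> carrier R \<Longrightarrow> b \<in> carrier R \<Longrightarrow> \<phi> (a \<otimes>\<^bsub>R\<^esub> b) = lmul (\<phi> a) (\<phi> b)"
  "a \<in> carrier R \<Longrightarrow> b \<in> carrier R \<Longrightarrow> \<phi> (a \<oplus>\<^bsub>R\<^esub> b) = ladd (\<phi> a) (\<phi> b)" "\<phi> \<one>\<^bsub>R\<^esub> = lmon 0 1"
  using ring_hom_memE[OF \<phi>] by (auto simp: GA_mult)

lemma phi_zero: "\<phi> \<zero>\<^bsub>R\<^esub> = (\<lambda>m. 0)"
proof -
  have "ladd (\<phi> \<zero>\<^bsub>R\<^esub>) (\<phi> \<zero>\<^bsub>R\<^esub>) = \<phi> \<zero>\<^bsub>R\<^esub>" using phi(3)[of "\<zero>\<^bsub>R\<^esub>" "\<zero>\<^bsub>R\<^esub>"] by simp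
  then have "\<phi> \<zero>\<^bsub>R\<^esub> m + \<phi> \<zero>\<^bsub>R\<^esub> m = \<phi> \<zero>\<^bsub>R\<^esub> m" for m unfolding ladd_def by metis
  then show ?thesis by (metis add_cancel_right_right ext)
qed

lemma phi_minus: assumes "a \<in> carrier R" "b \<in> carrier R" shows "\<phi> (a \<ominus>\<^bsub>R\<^esub> b) = (\<lambda>m. \<phi> a m - \<phi> b m)"
proof -
  have "ladd (\<phi> (\<ominus>\<^bsub>R\<^esub> b)) (\<phi> b) = (\<lambda>m. 0)" using phi(3)[of "\<ominus>\<^bsub>R\<^esub> b" b] assms phi_zero R.l_neg by simp
  then have "\<phi> (\<ominus>\<^bsub>R\<^esub> b) m = - \<phi> b m" for m unfolding ladd_def by (metis eq_neg_iff_add_eq_0)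
  then show ?thesis using phi(3)[of a "\<ominus>\<^bsub>R\<^esub> b"] assms by (simp add: a_minus_def ladd_def)
qed

text \<open>The parameter 0 is a point of the line but not of the multiplicative group.\<close>

definition ok :: "complex \<Rightarrow> bool" where "ok z \<longleftrightarrow> z \<noteq> 0 \<or> (\<forall>a\<in>carrier R. pos (\<phi> a))"

definition yz :: "complex \<Rightarrow> 'a set" where "yz z = {a \<in> carrier R. evl z (\<phi> a) = 0}"

lemma ev_hom:
  assumes "ok z" "a \<in> carrier R" "b \<in> carrier R"
  shows "evl z (\<phi> (a \<otimes>\<^bsub>R\<^esub> b)) = evl z (\<phi> a) * evl z (\<phi> b)" "evl z (\<phi> (a \<oplus>\<^bsub>R\<^esub> b)) = evl z (\<phi> a) + evl z (\<phi> b)"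
    "evl z (\<phi> (a \<ominus>\<^bsub>R\<^esub> b)) = evl z (\<phi> a) - evl z (\<phi> b)"
proof -
  show "evl z (\<phi> (a \<otimes>\<^bsub>R\<^esub> b)) = evl z (\<phi> a) * evl z (\<phi> b)"
    using assms evl_mult[OF phi(1)[OF assms(2)] phi(1)[OF assms(3)], of z] by (auto simp: phi(2) ok_def)
  have ad: "evl z (\<phi> (a \<oplus>\<^bsub>R\<^esub> b)) = evl z (\<phi> a) + evl z (\<phi> b)" if "a \<in> carrier R" "b \<in> carrier R" for a b
    using that by (simp add: phi(3) evl_add[OF phi(1) phi(1)])
  then show "evl z (\<phi> (a \<oplus>\<^bsub>R\<^esub> b)) = evl z (\<phi> a) + evl z (\<phi> b)" using assms by blast
  have "evl z (\<phi> ((a \<ominus>\<^bsub>R\<^esub> b) \<oplus>\<^bsub>R\<^esub> b)) = evl z (\<phi> (a \<ominus>\<^bsub>R\<^esub> b)) + evl z (\<phi> b)" using ad assms by simp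
  moreover have "(a \<ominus>\<^bsub>R\<^esub> b) \<oplus>\<^bsub>R\<^esub> b = a" using assms by (simp add: a_minus_def R.a_assoc R.l_neg)
  ultimately show "evl z (\<phi> (a \<ominus>\<^bsub>R\<^esub> b)) = evl z (\<phi> a) - evl z (\<phi> b)" by simp
qed

lemma const: obtains a where "a \<in> carrier R" "\<phi> a = lmon 0 w"
proof -
  have "lp [:w:] = lmon 0 w" by (simp add: lp_pCons ladd_def) (auto simp: lmul_def)
  then show ?thesis using that lp by metis
qed

lemma yz_ideal: assumes z: "ok z" shows "ideal (yz z) R"
proof (rule idealI)
  show "ring R" by (rule R.ring_axioms)
  show "subgroup (yz z) (add_monoid R)"
  proof (rule R.add.subgroupI)
    show "yz z \<noteq> {}" using phi_zero by (auto simp: yz_def)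
    show "yz z \<subseteq> carrier R" by (auto simp: yz_def)
    fix a assume a: "a \<in> yz z"
    then have "evl z (\<phi> (\<zero>\<^bsub>R\<^esub> \<ominus>\<^bsub>R\<^esub> a)) = 0" using ev_hom(3)[OF z, of "\<zero>\<^bsub>R\<^esub>" a] by (simp add: yz_def phi_zero)
    then show "\<ominus>\<^bsub>R\<^esub> a \<in> yz z" using a by (simp add: yz_def a_minus_def)
    fix b assume "b \<in> yz z"
    then show "a \<oplus>\<^bsub>R\<^esub> b \<in> yz z" using a ev_hom(2)[OF z] by (simp add: yz_def)
  qed
qed (use ev_hom(1)[OF z] in \<open>auto simp: yz_def\<close>)

text \<open>An element with nonzero value can be scaled to value 1 by a constant; it then differs
  from 1 by an element of \<open>yz z\<close>.\<close>

lemma yz_maximal: assumes z: "ok z" shows "maximalideal (yz z) R"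
proof (rule maximalidealI[OF yz_ideal[OF z]])
  show "carrier R \<noteq> yz z"
  proof
    assume "carrier R = yz z"
    then have "\<one>\<^bsub>R\<^esub> \<in> yz z" using R.one_closed by simp
    then show False by (simp add: yz_def phi(4))
  qed
  fix J assume J: "ideal J R" "yz z \<subseteq> J" "J \<subseteq> carrier R"
  interpret J: ideal J R by fact
  show "J = yz z \<or> J = carrier R"
  proof (rule disjCI)
    assume "J \<noteq> carrier R"
    then have n1: "\<one>\<^bsub>R\<^esub> \<notin> J" using J.one_imp_carrier by blast
    show "J = yz z"
    proof (rule ccontr)
      assume "J \<noteq> yz z"
      then obtain g where g: "g \<in> J" "g \<notin> yz z" using J(2) by blast
      have gR: "g \<in> carrier R" using g J(3) by blast
      let ?w = "evl z (\<phi> g)"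
      have w: "?w \<noteq> 0" using g gR by (simp add: yz_def)
      obtain b where b: "b \<in> carrier R" "\<phi> b = lmon 0 (1 / ?w)" using const by blast
      have bg: "b \<otimes>\<^bsub>R\<^esub> g \<in> J" using J.I_l_closed[OF g(1) b(1)] .
      have "evl z (\<phi> (\<one>\<^bsub>R\<^esub> \<ominus>\<^bsub>R\<^esub> b \<otimes>\<^bsub>R\<^esub> g)) = 0"
        using ev_hom(3)[OF z, of "\<one>\<^bsub>R\<^esub>" "b \<otimes>\<^bsub>R\<^esub> g"] ev_hom(1)[OF z b(1) gR] b gR w by (simp add: phi(4))
      then have "\<one>\<^bsub>R\<^esub> \<ominus>\<^bsub>R\<^esub> b \<otimes>\<^bsub>R\<^esub> g \<in> yz z" using b gR by (simp add: yz_def)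
      then have "(\<one>\<^bsub>R\<^esub> \<ominus>\<^bsub>R\<^esub> b \<otimes>\<^bsub>R\<^esub> g) \<oplus>\<^bsub>R\<^esub> b \<otimes>\<^bsub>R\<^esub> g \<in> J" using J(2) bg J.a_closed by blast
      moreover have "(\<one>\<^bsub>R\<^esub> \<ominus>\<^bsub>R\<^esub> b \<otimes>\<^bsub>R\<^esub> g) \<oplus>\<^bsub>R\<^esub> b \<otimes>\<^bsub>R\<^esub> g = \<one>\<^bsub>R\<^esub>"
        using b gR by (simp add: a_minus_def R.a_assoc R.l_neg)
      ultimately show False using n1 by simp
    qed
  qed
qed

text \<open>The polynomials that come from \<open>y\<close> include a nonzero one. One of least
  degree is not constant and has a root \<open>z\<close>; as \<open>y\<close> is prime and the
  cofactor has smaller degree, \<open>t - z\<close> comes from \<open>y\<close>, and then all of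
  \<open>y\<close> vanishes at \<open>z\<close>.\<close>

lemma maximal_yz:
  assumes y: "maximalideal y R" and ker: "\<And>a. a \<in> carrier R \<Longrightarrow> \<phi> a = (\<lambda>m. 0) \<Longrightarrow> a \<in> y"
  obtains z where "ok z" "y = yz z"
proof -
  interpret y: maximalideal y R by fact
  have yR: "a \<in> carrier R" if "a \<in> y" for a using that y.a_subset by blast
  have y1: "\<one>\<^bsub>R\<^esub> \<notin> y" using y.I_notcarr y.one_imp_carrier by blast
  have pr: "a \<in> y \<or> b \<in> y" if "a \<in> carrier R" "b \<in> carrier R" "a \<otimes>\<^bsub>R\<^esub> b \<in> y" for a b
    using primeideal.I_prime[OF R.maximalideal_prime[OF y]] that by blast
  have tr: "b \<in> y" if "a \<in> y" "b \<in> carrier R" "\<phi> a = \<phi> b" for a b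
  proof -
    have a: "a \<in> carrier R" using yR that by blast
    have "b \<ominus>\<^bsub>R\<^esub> a \<in> y" using a that by (intro ker) (auto simp: phi_minus)
    then have "(b \<ominus>\<^bsub>R\<^esub> a) \<oplus>\<^bsub>R\<^esub> a \<in> y" using that(1) y.a_closed by blast
    then show ?thesis using a that by (simp add: a_minus_def R.a_assoc R.l_neg)
  qed
  have nz: "w = 0" if "a \<in> y" "\<phi> a = lmon 0 w" for a w
  proof (rule ccontr)
    assume w: "w \<noteq> 0"
    obtain b where b: "b \<in> carrier R" "\<phi> b = lmon 0 (1 / w)" using const by blast
    have "b \<otimes>\<^bsub>R\<^esub> a \<in> y" using y.I_l_closed[OF that(1) b(1)] .
    moreover have "\<phi> (b \<otimes>\<^bsub>R\<^esub> a) = \<phi> \<one>\<^bsub>R\<^esub>" using b that yR w by (simp add: phi(2,4))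
    ultimately show False using tr y1 by blast
  qed
  define I where "I = {p. \<exists>a\<in>y. \<phi> a = lp p}"
  have shift: "\<exists>b p n. b \<in> carrier R \<and> \<phi> b = lmon (int n) 1 \<and> b \<otimes>\<^bsub>R\<^esub> a \<in> carrier R \<and> \<phi> (b \<otimes>\<^bsub>R\<^esub> a) = lp p
      \<and> (pos (\<phi> a) \<longrightarrow> n = 0)" if a: "a \<in> carrier R" for a
  proof -
    obtain n0 where n0: "pos (lmul (lmon (int n0) 1) (\<phi> a))" using shift_pos[OF phi(1)[OF a]] by blast
    \<comment> \<open>No shift for polynomials: a factor \<open>t\<close> would vanish at
      \<open>z = 0\<close>.\<close>
    define n where "n = (if pos (\<phi> a) then 0 else n0)"
    have n: "pos (lmul (lmon (int n) 1) (\<phi> a))" using n0 lmul_laws(3)[OF phi(1)[OF a] mono_lau mono_lau] by (simp add: n_def)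
    obtain b where b: "b \<in> carrier R" "\<phi> b = lmon (int n) 1" using lp[of "monom 1 n"] by (auto simp: lp_monom)
    obtain p where "lmul (lmon (int n) 1) (\<phi> a) = lp p" using pos_lp[OF _ n] phi(1)[OF a] by auto
    then show ?thesis using a b by (intro exI[of _ b] exI[of _ p] exI[of _ n]) (auto simp: phi(2) n_def)
  qed
  \<comment> \<open>Either \<open>t - 1\<close> comes from \<open>y\<close>, or it is invertible
    modulo \<open>y\<close>, and then the element \<open>q\<close> of \<open>y\<close> has value 1
    at 1.\<close>
  have "\<exists>p\<in>I. p \<noteq> 0"
  proof -
    obtain e where e: "e \<in> carrier R" "\<phi> e = lp [:-1, 1:]" using lp by blast
    show ?thesis
    proof (cases "e \<in> y")
      case True then show ?thesis using e unfolding I_def by (intro bexI[of _ "[:-1,1:]"]) auto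
    next
      case False
      obtain r q where rq: "r \<in> carrier R" "q \<in> y" "\<one>\<^bsub>R\<^esub> = q \<oplus>\<^bsub>R\<^esub> r \<otimes>\<^bsub>R\<^esub> e" using maximal_inverse[OF R y e(1) False] by blast
      have ok1: "ok 1" by (simp add: ok_def)
      have qR: "q \<in> carrier R" using yR rq by blast
      have "evl 1 (\<phi> \<one>\<^bsub>R\<^esub>) = evl 1 (\<phi> q) + evl 1 (\<phi> r) * evl 1 (\<phi> e)"
        using ev_hom(2)[OF ok1 qR, of "r \<otimes>\<^bsub>R\<^esub> e"] ev_hom(1)[OF ok1 rq(1) e(1)] rq(1) e(1) rq(3) by simp
      then have q1: "evl 1 (\<phi> q) = 1" by (simp add: phi(4) e(2) evl_lp)
      obtain b p n where b: "b \<in> carrier R" "\<phi> b = lmon (int n) 1" "\<phi> (b \<otimes>\<^bsub>R\<^esub> q) = lp p" using shift[OF qR] by blast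
      have "b \<otimes>\<^bsub>R\<^esub> q \<in> y" using y.I_l_closed[OF rq(2) b(1)] .
      then have "p \<in> I" using b(3) by (auto simp: I_def)
      moreover have "p \<noteq> 0"
      proof
        assume "p = 0"
        then have "evl 1 (\<phi> (b \<otimes>\<^bsub>R\<^esub> q)) = 0" using b(3) by simp
        then show False using ev_hom(1)[OF ok1 b(1) qR] q1 b(2) by simp
      qed
      ultimately show ?thesis by blast
    qed
  qed
  then obtain p where p: "p \<in> I" "p \<noteq> 0" and least: "\<And>q. q \<in> I \<Longrightarrow> q \<noteq> 0 \<Longrightarrow> Polynomial.degree p \<le> Polynomial.degree q"
    using arg_min_nat_lemma[of "\<lambda>p. p \<in> I \<and> p \<noteq> 0" _ Polynomial.degree] by (metis (no_types, lifting))
  obtain ap where ap: "ap \<in> y" "\<phi> ap = lp p" using p(1) by (auto simp: I_def)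
  have "\<not> constant (poly p)"
  proof
    assume "constant (poly p)"
    then have "Polynomial.degree p = 0" by (simp add: constant_degree)
    then obtain w where w: "p = [:w:]" by (metis degree_eq_zeroE)
    have "lp [:w:] = lmon 0 w" by (simp add: lp_pCons ladd_def) (auto simp: lmul_def)
    then show False using nz[OF ap(1)] ap(2) w p(2) by simp
  qed
  then obtain z where z: "poly p z = 0" using fundamental_theorem_of_algebra by blast
  then obtain q where q: "p = [:-z, 1:] * q" by (metis poly_eq_0_iff_dvd dvdE)
  have q0: "q \<noteq> 0" using q p(2) by auto
  have dq: "Polynomial.degree q < Polynomial.degree p" unfolding q using q0 by (subst degree_mult_eq) auto
  obtain a1 where a1: "a1 \<in> carrier R" "\<phi> a1 = lp [:-z, 1:]" using lp by blast
  obtain a2 where a2: "a2 \<in> carrier R" "\<phi> a2 = lp q" using lp by blast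
  have "a1 \<otimes>\<^bsub>R\<^esub> a2 \<in> y" using a1 a2 ap by (intro tr[OF ap(1)]) (auto simp: phi(2) q lp_mult simp del: mult_pCons_left)
  moreover have "a2 \<notin> y" using least[of q] dq q0 a2 by (force simp: I_def)
  ultimately have a1y: "a1 \<in> y" using pr a1 a2 by blast
  \<comment> \<open>If \<open>z = 0\<close> and the image is everything, then \<open>t\<close> comes
    from \<open>y\<close> and has an inverse in the image, so that \<open>y\<close> would contain a
    unit modulo the kernel.\<close>
  have okz: "ok z"
  proof (cases "z = 0")
    case True
    show ?thesis
    proof (rule ccontr)
      assume "\<not> ok z"
      then have "\<forall>q\<in>lau. \<exists>a\<in>carrier R. \<phi> a = q" using img by (auto simp: ok_def)
      from bspec[OF this mono_lau] obtain b where b: "b \<in> carrier R" "\<phi> b = lmon (- 1) 1" by blast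
      have "lp [:-z, 1:] = lmon 1 1" using True lp_monom[of 1 1] by (simp add: monom_altdef)
      then have "\<phi> (b \<otimes>\<^bsub>R\<^esub> a1) = lmon 0 1" using a1 b by (simp add: phi(2))
      from nz[OF y.I_l_closed[OF a1y b(1)] this] show False by simp
    qed
  qed (simp add: ok_def)
  \<comment> \<open>Modulo \<open>t - z\<close> a polynomial is its value at \<open>z\<close>, and
    \<open>y\<close> has no element mapping to a nonzero constant.\<close>
  have root: "poly p' z = 0" if p': "a \<in> y" "\<phi> a = lp p'" for a p'
  proof -
    have "[:-z, 1:] dvd p' - [:poly p' z:]" by (simp add: poly_eq_0_iff_dvd[symmetric])
    then obtain s where s: "p' - [:poly p' z:] = [:-z, 1:] * s" by (elim dvdE)
    obtain as where as: "as \<in> carrier R" "\<phi> as = lp s" using lp by blast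
    have 1: "a1 \<otimes>\<^bsub>R\<^esub> as \<in> y" using y.I_r_closed[OF a1y as(1)] .
    have aR: "a \<in> carrier R" using yR p' by blast
    have "a \<ominus>\<^bsub>R\<^esub> a1 \<otimes>\<^bsub>R\<^esub> as \<in> y" using p'(1) 1 by (simp add: a_minus_def)
    moreover have "\<phi> (a \<ominus>\<^bsub>R\<^esub> a1 \<otimes>\<^bsub>R\<^esub> as) = lmon 0 (poly p' z)"
    proof -
      have "\<phi> (a \<ominus>\<^bsub>R\<^esub> a1 \<otimes>\<^bsub>R\<^esub> as) = (\<lambda>m. lp p' m - lp ([:-z, 1:] * s) m)"
        using aR as a1 p' by (simp add: phi_minus phi(2) lp_mult del: mult_pCons_left)
      also have "\<dots> = lp (p' - [:-z, 1:] * s)" by (auto simp: lp_def fun_eq_iff)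
      also have "p' - [:-z, 1:] * s = [:poly p' z:]" using s by (simp add: algebra_simps)
      also have "lp [:poly p' z:] = lmon 0 (poly p' z)" by (simp add: lp_pCons ladd_def) (auto simp: lmul_def)
      finally show ?thesis .
    qed
    ultimately show ?thesis by (rule nz)
  qed
  have sub: "y \<subseteq> yz z"
  proof
    fix a assume a: "a \<in> y"
    then have aR: "a \<in> carrier R" using yR by blast
    obtain b p' n where b: "b \<in> carrier R" "\<phi> b = lmon (int n) 1" "\<phi> (b \<otimes>\<^bsub>R\<^esub> a) = lp p'" "pos (\<phi> a) \<longrightarrow> n = 0"
      using shift[OF aR] by blast
    have "evl z (\<phi> (b \<otimes>\<^bsub>R\<^esub> a)) = 0" using root[OF y.I_l_closed[OF a b(1)] b(3)] b(3) by (simp add: evl_lp)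
    then have "evl z (\<phi> b) * evl z (\<phi> a) = 0" using ev_hom(1)[OF okz b(1) aR] by simp
    moreover have "evl z (\<phi> b) \<noteq> 0" using b(2,4) okz aR by (auto simp: ok_def)
    ultimately show "a \<in> yz z" using aR by (simp add: yz_def)
  qed
  have "yz z = y"
  proof -
    have yc: "yz z \<subseteq> carrier R" by (auto simp: yz_def)
    have "yz z \<noteq> carrier R" using maximalideal.I_notcarr[OF yz_maximal[OF okz]] by blast
    then show ?thesis using y.I_maximal[OF yz_ideal[OF okz] sub yc] by blast
  qed
  then show ?thesis using that okz by blast
qed

end

lemma lmap_id: "lmap (GA lau (\<lambda>z. z)) (\<lambda>f. f)"
proof (rule lmap.intro)
  show "cring (GA lau (\<lambda>z::complex. z))" using domain_GA[OF lsub_lau] domain_def by blast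
  show "(\<lambda>f. f) \<in> ring_hom (GA lau (\<lambda>z::complex. z)) (GA lau (\<lambda>z. z))"
    by (rule ring_hom_memI) (auto simp: GA_mult)
qed auto

section \<open>Faces of the cone of monomials over a point\<close>

definition gidl :: "(int \<Rightarrow> 'k::field) set \<Rightarrow> (int \<Rightarrow> 'k) set \<Rightarrow> bool" where
  "gidl P I \<longleftrightarrow> I \<subseteq> P \<and> (\<lambda>m. 0) \<in> I \<and> (\<forall>f\<in>I. \<forall>g\<in>I. ladd f g \<in> I) \<and> (\<forall>f\<in>P. \<forall>g\<in>I. lmul f g \<in> I)"

lemma ideal_GA: assumes P: "lsub P" shows "ideal I (GA P k) \<longleftrightarrow> gidl P I"
proof
  interpret domain "GA P k" by (rule domain_GA[OF P])
  note s = lsubD[OF P]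
  { assume "ideal I (GA P k)"
    then interpret I: ideal I "GA P k" .
    have IP: "I \<subseteq> P" using I.a_subset by simp
    show "gidl P I" unfolding gidl_def
    proof (intro conjI ballI IP)
      show "(\<lambda>m. 0) \<in> I" using additive_subgroup.zero_closed[OF I.is_additive_subgroup] by simp
      fix f g assume g: "g \<in> I"
      show "ladd f g \<in> I" if "f \<in> I" using I.a_closed[OF that g] by simp
      show "lmul f g \<in> I" if "f \<in> P" using I.I_l_closed[of g f] g that s(2) by (simp add: GA_mult)
    qed }
  assume I: "gidl P I"
  show "ideal I (GA P k)"
  proof (rule idealI)
    show "ring (GA P k)" by (rule ring_axioms)
    show "subgroup I (add_monoid (GA P k))"
    proof (rule add.subgroupI)
      show "I \<subseteq> carrier (GA P k)" "I \<noteq> {}" using I by (auto simp: gidl_def)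
      fix a assume a: "a \<in> I"
      then have aP: "a \<in> P" using I by (auto simp: gidl_def)
      have "lmon 0 (- 1) = (\<lambda>m. - lmon 0 (1 :: 'a) m)" by (auto simp: lmon_def)
      then have "lmon 0 (- 1) \<in> P" using s(4)[OF s(3)] by simp
      then have "lmul (lmon 0 (- 1)) a \<in> I" using I a by (simp add: gidl_def)
      moreover have "lmul (lmon 0 (- 1)) a = (\<lambda>m. - a m)" by (auto simp: lmul_mono)
      ultimately show "\<ominus>\<^bsub>GA P k\<^esub> a \<in> I" using GA_a_inv[OF P aP] by metis
      fix b assume "b \<in> I" then show "a \<oplus>\<^bsub>GA P k\<^esub> b \<in> I" using a I by (simp add: gidl_def)
    qed
    fix a x assume ax: "a \<in> I" "x \<in> carrier (GA P k)"
    then have l: "a \<in> P" "x \<in> P" "a \<in> lau" "x \<in> lau" using I s(2) by (auto simp: gidl_def)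
    have "lmul x a \<in> I" using ax I by (simp add: gidl_def)
    then show "x \<otimes>\<^bsub>GA P k\<^esub> a \<in> I" "a \<otimes>\<^bsub>GA P k\<^esub> x \<in> I"
      using l lmul_laws(1)[OF l(3,4) mono_lau] by (simp_all add: GA_mult)
  qed
qed

locale dpdc = dpd C \<tau> D h for C :: "'k::field calg" and \<tau> D h +
  fixes c :: "'k set"
  assumes c: "c \<in> CP" "tx c = c"
begin

abbreviation "SA \<equiv> GA SS \<kappa>"
definition J :: "(int \<Rightarrow> 'k) set" where "J = fibre_ideal SA (lmon 0) c"

lemmas lS = lsub_SV[OF subset_refl]
lemmas sS = lsubD[OF lS]
lemmas vc = vge_simps[OF c(1)]

sublocale SA: domain SA by (rule domain_GA[OF lS])

lemma cA: "a \<in> c \<Longrightarrow> a \<in> A" using CP_D(4)[OF c(1)] by blast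

lemma J_ideal: "ideal J SA" "gidl SS J" "a \<in> c \<Longrightarrow> lmon 0 a \<in> J" "gidl SS I \<Longrightarrow> lmon 0 ` c \<subseteq> I \<Longrightarrow> J \<subseteq> I"
proof -
  have sub: "lmon 0 ` c \<subseteq> carrier SA" using cA SV_A[OF subset_refl] by auto
  show i: "ideal J SA" unfolding J_def fibre_ideal_def by (rule SA.genideal_ideal[OF sub])
  then show "gidl SS J" using ideal_GA[OF lS] by blast
  show "a \<in> c \<Longrightarrow> lmon 0 a \<in> J" unfolding J_def fibre_ideal_def using SA.genideal_self[OF sub] by blast
  show "gidl SS I \<Longrightarrow> lmon 0 ` c \<subseteq> I \<Longrightarrow> J \<subseteq> I"
    unfolding J_def fibre_ideal_def using SA.genideal_minimal ideal_GA[OF lS] by blast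
qed

lemma gidl_sum:
  assumes "gidl P I" "finite S" "\<And>i. i \<in> S \<Longrightarrow> F i \<in> I" shows "(\<lambda>m. \<Sum>i\<in>S. F i m) \<in> I"
  using assms(2,3)
proof (induction S rule: finite_induct)
  case (insert x S)
  then have "ladd (F x) (\<lambda>m. \<Sum>i\<in>S. F i m) \<in> I" using assms(1) by (auto simp: gidl_def)
  then show ?case using insert by (simp add: ladd_def)
qed (use assms(1) in \<open>auto simp: gidl_def\<close>)

text \<open>
  Locally at \<open>c\<close> the ideal of the fibre is generated by a uniformizer \<open>v\<close>; the difference is made
  up for by an element \<open>b\<close> that is invertible at \<open>c\<close> and cancels the poles of \<open>g / v\<close>.
\<close>

lemma J_mono:
  assumes g: "lmon m g \<in> SS" "vge c (dl c m + 1) g" shows "lmon m g \<in> J"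
proof (cases "g = 0")
  case True then show ?thesis using J_ideal(2) by (simp add: gidl_def)
next
  case False
  obtain v where v: "uniformizer C c v" "v \<in> c" "v \<noteq> 0" using uniformizer_ex[OF c(1)] by blast
  have ov: "ord_at C c v = 1" using ord_eqI[OF c(1) v(1) unit_at(1)[OF c(1)], of 1] by simp
  have "g / v \<noteq> 0" using False v by simp
  then obtain b where b: "b \<in> A" "b \<notin> c" "\<And>y. y \<in> CP \<Longrightarrow> y \<noteq> c \<Longrightarrow> vge y (dl y m) (b * (g / v))"
    using approx[OF c(1) _ finite_dl[of m]] by metis
  have "vge c (dl c m) (g / v)"
  proof -
    have "g / v * v = g" using v(3) by simp
    then show ?thesis using vge_mult_iff[OF c(1) v(3), of "dl c m + 1" "g / v"] ov g(2) by (metis add_diff_cancel_right')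
  qed
  then have "vge c (dl c m) (b * (g / v))" using vc(3)[OF vc(9)[OF b(1)], of "dl c m" "g / v"] by simp
  then have bS: "lmon m (b * (g / v)) \<in> SS" unfolding SV_mono[OF subset_refl] using b(3) by metis
  obtain r where r: "r \<in> A" "1 - r * b \<in> c" using maxidl_inverse[OF sring_A _ b(1,2)] c(1) CP by blast
  have "lmul (lmon 0 r) (lmon m (b * (g / v))) \<in> SS" using sS(6) SV_A[OF subset_refl r(1)] bS by blast
  then have rS: "lmon m (r * (b * (g / v))) \<in> SS" by simp
  have JD: "ladd f e \<in> J" "lmul p f \<in> J" if "f \<in> J" "e \<in> J" "p \<in> SS" for f e p
    using J_ideal(2) that by (auto simp: gidl_def)
  have cm: "lmul f e = lmul e f" if "f \<in> SS" "e \<in> SS" for f e using lmul_laws(1)[OF sS(2)[OF that(1)] sS(2)[OF that(2)] mono_lau] .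
  have cS: "lmon 0 a \<in> SS" if "a \<in> c" for a using SV_A[OF subset_refl] cA that by blast
  have "lmul (lmon m (r * (b * (g / v)))) (lmon 0 v) \<in> J" by (rule JD(2)[OF J_ideal(3)[OF v(2)] J_ideal(3)[OF v(2)] rS])
  moreover have "lmul (lmon m g) (lmon 0 (1 - r * b)) \<in> J" by (rule JD(2)[OF J_ideal(3)[OF r(2)] J_ideal(3)[OF r(2)] g(1)])
  ultimately have "ladd (lmul (lmon m (r * (b * (g / v)))) (lmon 0 v)) (lmul (lmon m g) (lmon 0 (1 - r * b))) \<in> J"
    by (rule JD(1)[OF _ _ g(1)])
  moreover have "r * (b * (g / v)) * v + g * (1 - r * b) = g" using v(3) by (simp add: field_simps)
  ultimately show ?thesis by simp
qed

lemma J_super: assumes f: "f \<in> SS" "\<And>m. vge c (dl c m + 1) (f m)" shows "f \<in> J"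
proof -
  have fl: "f \<in> lau" using f sS by blast
  have fin: "finite {m. f m \<noteq> 0}" using fl by (simp add: lau_def)
  have "lmon m (f m) \<in> J" for m
    using J_mono[OF _ f(2)] graded_SV[OF subset_refl] f(1) by (simp add: graded_def)
  then have "(\<lambda>n. \<Sum>m | f m \<noteq> 0. lmon m (f m) n) \<in> J" by (intro gidl_sum[OF J_ideal(2) fin])
  then show ?thesis using lau_expand[OF fl] by simp
qed

text \<open>A maximal ideal containing \<open>J\<close> contracts to a proper ideal that contains
  \<open>c\<close>, hence to \<open>c\<close>.\<close>

lemma fibre_points_iff: "y \<in> fibre_points C SA (lmon 0) c \<longleftrightarrow> maximalideal y SA \<and> J \<subseteq> y"
proof
  assume y: "y \<in> fibre_points C SA (lmon 0) c"
  then have m: "maximalideal y SA" and e: "{a \<in> A. lmon 0 a \<in> y} = c"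
    by (auto simp: fibre_points_def closed_points_def spec_map_def)
  interpret y: maximalideal y SA by (rule m)
  have "gidl SS y" using y.is_ideal ideal_GA[OF lS] by blast
  then have "J \<subseteq> y" using J_ideal(4) e by blast
  then show "maximalideal y SA \<and> J \<subseteq> y" using m by blast
next
  assume y: "maximalideal y SA \<and> J \<subseteq> y"
  interpret y: maximalideal y SA using y by blast
  have g: "gidl SS y" using y.is_ideal ideal_GA[OF lS] by blast
  let ?x = "{a \<in> A. lmon 0 a \<in> y}"
  have cx: "c \<subseteq> ?x" using J_ideal(3) y cA by blast
  have "idl A ?x" unfolding idl_def
  proof (intro conjI ballI)
    show "?x \<subseteq> A" by blast
    show "0 \<in> ?x" using g A_simps by (simp add: gidl_def)
    fix a b assume b: "b \<in> ?x"
    show "a + b \<in> ?x" if a: "a \<in> ?x"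
    proof -
      have "ladd (lmon 0 a) (lmon 0 b) \<in> y" using g a b unfolding gidl_def by blast
      then show ?thesis using a b A_simps by simp
    qed
    show "a * b \<in> ?x" if a: "a \<in> A"
    proof -
      have "lmul (lmon 0 a) (lmon 0 b) \<in> y" using g SV_A[OF subset_refl a] b unfolding gidl_def by blast
      then show ?thesis using a b A_simps by simp
    qed
  qed
  moreover have "1 \<notin> ?x"
  proof
    assume "1 \<in> ?x"
    then have "\<one>\<^bsub>SA\<^esub> \<in> y" by simp
    then show False using y.one_imp_carrier y.I_notcarr by blast
  qed
  ultimately have "?x = c" using c(1) cx A_simps(2) unfolding CP maxidl_def by blast
  then show "y \<in> fibre_points C SA (lmon 0) c"
    using y by (simp add: fibre_points_def closed_points_def spec_map_def)
qed

lemma translate_eq: assumes a: "a \<in> SS" shows "translate SA t a = (\<lambda>m. \<kappa> (t powi m) * a m)" "translate SA t a \<in> SS"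
proof -
  have fin: "finite {m. a m \<noteq> 0}" using sS(2)[OF a] by (simp add: lau_def)
  have mem: "lmul (lmon 0 (\<kappa> (t powi m))) (lmon m (a m)) \<in> SS" for m
    using sS(6)[OF SV_A[OF subset_refl \<kappa>(1)]] graded_SV[OF subset_refl] a by (simp add: graded_def del: lmul_mono_mono)
  have "translate SA t a = finsum SA (\<lambda>m. lmon m (\<kappa> (t powi m) * a m)) {m. a m \<noteq> 0}"
    by (simp add: translate_def mono_eq0 GA_mult)
  also have "\<dots> = (\<lambda>n. \<Sum>m | a m \<noteq> 0. lmon m (\<kappa> (t powi m) * a m) n)" by (rule GA_finsum[OF lS fin]) (use mem in simp)
  also have "\<dots> = (\<lambda>n. \<kappa> (t powi n) * a n)"
  proof
    fix n
    have "(\<Sum>m | a m \<noteq> 0. lmon m (\<kappa> (t powi m) * a m) n) = (\<Sum>m | a m \<noteq> 0. if n = m then \<kappa> (t powi m) * a m else 0)"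
      by (simp add: lmon_def)
    also have "\<dots> = \<kappa> (t powi n) * a n" using fin by (simp add: sum.delta)
    finally show "(\<Sum>m | a m \<noteq> 0. lmon m (\<kappa> (t powi m) * a m) n) = \<kappa> (t powi n) * a n" .
  qed
  finally show e: "translate SA t a = (\<lambda>m. \<kappa> (t powi m) * a m)" .
  have "(\<lambda>n. \<Sum>m | a m \<noteq> 0. lmon m (\<kappa> (t powi m) * a m) n) \<in> SS" by (rule lsub_sum[OF lS fin]) (use mem in simp)
  then show "translate SA t a \<in> SS" unfolding e using \<open>(\<lambda>n. \<Sum>m | a m \<noteq> 0. lmon m (\<kappa> (t powi m) * a m) n) = _\<close> by simp
qed

end

text \<open>
  The elements of degree \<open>q k\<close> with \<open>k \<in> K\<close> of least order at \<open>c\<close> are the multiples of \<open>x^k\<close>, and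
  the ideal of the other elements is prime, with a quotient of functions on a line or on the
  multiplicative group.
\<close>

locale face = dpdc C \<tau> D h c for C :: "'k::field calg" and \<tau> D h c +
  fixes q :: int and x :: 'k and K :: "int set"
  assumes q: "q \<noteq> 0" and x: "x \<noteq> 0" and K: "K = UNIV \<or> K = {0..}"
    and low: "\<And>k. k \<in> K \<Longrightarrow> dl c (q * k) = k * ord_at C c x"
    and mixed: "\<And>i j k. i + j = q * k \<Longrightarrow> k \<in> K \<Longrightarrow> i \<notin> (*) q ` K \<or> j \<notin> (*) q ` K \<Longrightarrow> dl c (q * k) + 1 \<le> dl c i + dl c j"
begin

text \<open>Leading coefficients along the face, measured against the powers of \<open>x\<close>; by
  the assumption \<open>low\<close> these quotients are regular at \<open>c\<close>.\<close>

definition \<psi> :: "(int \<Rightarrow> 'k) \<Rightarrow> int \<Rightarrow> complex" where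
  "\<psi> f = (\<lambda>k. if k \<in> K then ev c (f (q * k) * x powi (- k)) else 0)"

lemma K_simps: "0 \<in> K" "i \<in> K \<Longrightarrow> j \<in> K \<Longrightarrow> i + j \<in> K" using K by auto

lemma vx: "vge c n (g * x powi (- k)) \<longleftrightarrow> vge c (n + k * ord_at C c x) g"
  using vge_mult_iff[OF c(1), of "x powi (- k)" n g] x ord_simps(3)[OF c(1) x, of "- k"] by simp

lemma v0: "f \<in> SS \<Longrightarrow> k \<in> K \<Longrightarrow> vge c 0 (f (q * k) * x powi (- k))"
  unfolding vx using SV_D(2)[of f CP c "q * k"] c(1) low by simp

lemma psi_lau: assumes f: "f \<in> SS" shows "\<psi> f \<in> lau"
proof -
  have "{k. \<psi> f k \<noteq> 0} \<subseteq> (\<lambda>k. q * k) -` {m. f m \<noteq> 0}" using ev_simps(2)[OF c(1)] by (auto simp: \<psi>_def)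
  moreover have "finite ((\<lambda>k. q * k) -` {m. f m \<noteq> 0})"
    by (rule finite_vimageI) (use sS(2)[OF f] q in \<open>auto simp: lau_def inj_on_def\<close>)
  ultimately show ?thesis by (auto simp: lau_def intro: finite_subset)
qed

lemma psi_add: assumes "f \<in> SS" "g \<in> SS" shows "\<psi> (ladd f g) = ladd (\<psi> f) (\<psi> g)"
proof
  fix k
  show "\<psi> (ladd f g) k = ladd (\<psi> f) (\<psi> g) k"
    using ev_simps(4)[OF c(1) v0[OF assms(1)] v0[OF assms(2)], of k k] by (simp add: \<psi>_def ladd_def distrib_right)
qed

text \<open>By the assumption \<open>mixed\<close>, a product of components exceeds the bound in a
  degree of the face unless both factors have degrees on the face; there the powers of
  \<open>x\<close> simply multiply.\<close>

lemma psi_mult: assumes f: "f \<in> SS" and g: "g \<in> SS" shows "\<psi> (lmul f g) = lmul (\<psi> f) (\<psi> g)"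
proof
  fix k
  let ?I = "{i. f i \<noteq> 0}" and ?J = "{j. f (q * j) \<noteq> 0}"
  have finI: "finite ?I" using sS(2)[OF f] by (simp add: lau_def)
  have "finite ((\<lambda>j. q * j) -` ?I)" by (rule finite_vimageI) (use finI q in \<open>auto simp: inj_on_def\<close>)
  then have finJ: "finite ?J" by (simp add: vimage_def)
  have R: "lmul (\<psi> f) (\<psi> g) k = (\<Sum>j\<in>?J. \<psi> f j * \<psi> g (k - j))"
    by (rule lmul_super[OF finJ]) (use ev_simps(2)[OF c(1)] in \<open>auto simp: \<psi>_def\<close>)
  show "\<psi> (lmul f g) k = lmul (\<psi> f) (\<psi> g) k"
  proof (cases "k \<in> K")
    case False
    have "\<psi> f j * \<psi> g (k - j) = 0" for j
      using False K_simps(2)[of j "k - j"] by (auto simp: \<psi>_def)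
    then have "lmul (\<psi> f) (\<psi> g) k = 0" unfolding R by (rule sum.neutral[OF ballI])
    then show ?thesis using False by (simp add: \<psi>_def)
  next
    case True
    let ?T = "\<lambda>i. f i * g (q * k - i) * x powi (- k)"
    have vT: "vge c (dl c i + dl c (q * k - i) - dl c (q * k)) (?T i)" for i
    proof -
      have "vge c (dl c i + dl c (q * k - i)) (f i * g (q * k - i))"
        by (rule vc(3)) (use SV_D(2)[OF f c(1)] SV_D(2)[OF g c(1)] in auto)
      then show ?thesis unfolding vx low[OF True] by simp
    qed
    have v0T: "vge c 0 (?T i)" for i
      by (rule vc(4)[OF vT[of i]]) (use dl_add[OF c(1), of i "q * k - i"] in simp)
    have e0: "ev c (?T i) = 0" if "i \<notin> (*) q ` K \<or> q * k - i \<notin> (*) q ` K" for i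
    proof -
      have "vge c 1 (?T i)" by (rule vc(4)[OF vT[of i]]) (use mixed[of i "q * k - i" k] True that in simp)
      then show ?thesis using ev_simps(6)[OF c(1) v0T] by simp
    qed
    have "\<psi> (lmul f g) k = ev c (\<Sum>i\<in>?I. ?T i)" using True by (simp add: \<psi>_def lmul_def sum_distrib_right)
    also have "\<dots> = (\<Sum>i\<in>?I. ev c (?T i))" by (rule ev_sum[OF c(1) finI v0T])
    also have "\<dots> = (\<Sum>i\<in>(\<lambda>j. q * j) ` ?J. ev c (?T i))"
    proof (rule sum.mono_neutral_right[OF finI])
      show "\<forall>i\<in>?I - (\<lambda>j. q * j) ` ?J. ev c (?T i) = 0"
      proof
        fix i assume i: "i \<in> ?I - (\<lambda>j. q * j) ` ?J"
        have "i \<notin> (*) q ` K"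
        proof
          assume "i \<in> (*) q ` K"
          then obtain j where "i = q * j" by blast
          then show False using i by auto
        qed
        then show "ev c (?T i) = 0" using e0 by blast
      qed
    qed auto
    also have "\<dots> = (\<Sum>j\<in>?J. ev c (?T (q * j)))" by (subst sum.reindex) (use q in \<open>auto simp: inj_on_def\<close>)
    also have "\<dots> = (\<Sum>j\<in>?J. \<psi> f j * \<psi> g (k - j))"
    proof (rule sum.cong[OF refl])
      fix j
      show "ev c (?T (q * j)) = \<psi> f j * \<psi> g (k - j)"
      proof (cases "j \<in> K \<and> k - j \<in> K")
        case jk: True
        have "x powi (- j) * x powi (- (k - j)) = x powi (- k)" using x by (simp flip: power_int_add)
        then have "?T (q * j) = f (q * j) * g (q * k - q * j) * (x powi (- j) * x powi (- (k - j)))" by simp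
        also have "\<dots> = (f (q * j) * x powi (- j)) * (g (q * (k - j)) * x powi (- (k - j)))"
          by (simp only: mult_ac right_diff_distrib)
        finally have e: "?T (q * j) = (f (q * j) * x powi (- j)) * (g (q * (k - j)) * x powi (- (k - j)))" .
        have "ev c (?T (q * j)) = ev c (f (q * j) * x powi (- j)) * ev c (g (q * (k - j)) * x powi (- (k - j)))"
          unfolding e by (rule ev_simps(5)[OF c(1) v0[OF f] v0[OF g]]) (use jk in auto)
        then show ?thesis using jk by (simp add: \<psi>_def)
      next
        case False
        have "q * j \<notin> (*) q ` K \<or> q * k - q * j \<notin> (*) q ` K" using False q by (auto simp flip: right_diff_distrib)
        then show ?thesis using e0[of "q * j"] False by (auto simp: \<psi>_def)
      qed
    qed
    finally show ?thesis unfolding R .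
  qed
qed

lemma psi_mono: "\<psi> (lmon (q * k) g) = (if k \<in> K then lmon k (ev c (g * x powi (- k))) else (\<lambda>m. 0))"
  using q ev_simps(2)[OF c(1)] by (auto simp: \<psi>_def lmon_def fun_eq_iff)

lemma psi_mono0: "m \<notin> (*) q ` K \<Longrightarrow> \<psi> (lmon m g) = (\<lambda>m. 0)"
  using ev_simps(2)[OF c(1)] by (auto simp: \<psi>_def lmon_def fun_eq_iff)

lemma psi_const: "\<psi> (lmon 0 (\<kappa> z)) = lmon 0 z"
  using psi_mono[of 0 "\<kappa> z"] K_simps(1) ev_simps(1)[OF c(1)] by simp

lemma psi_hom: "\<psi> \<in> ring_hom SA (GA lau (\<lambda>z. z))"
proof (rule ring_hom_memI)
  show "\<psi> \<one>\<^bsub>SA\<^esub> = \<one>\<^bsub>GA lau (\<lambda>z. z)\<^esub>" using psi_const[of 1] by simp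
qed (use psi_lau psi_add psi_mult sS(2) in \<open>auto simp: GA_mult\<close>)

lemma psi_zero_iff: assumes f: "f \<in> SS" shows "\<psi> f = (\<lambda>m. 0) \<longleftrightarrow> (\<forall>k\<in>K. vge c (dl c (q * k) + 1) (f (q * k)))"
proof -
  have "\<psi> f k = 0 \<longleftrightarrow> vge c (dl c (q * k) + 1) (f (q * k))" if k: "k \<in> K" for k
    using ev_simps(6)[OF c(1) v0[OF f k]] k unfolding vx low[OF k] by (simp add: \<psi>_def add.commute)
  moreover have "\<psi> f k = 0" if "k \<notin> K" for k using that by (simp add: \<psi>_def)
  ultimately show ?thesis by (auto simp: fun_eq_iff)
qed

lemma J_psi: assumes "f \<in> J" shows "\<psi> f = (\<lambda>m. 0)"
proof -
  let ?I = "{f \<in> SS. \<psi> f = (\<lambda>m. 0)}"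
  have "gidl SS ?I" unfolding gidl_def
  proof (intro conjI ballI)
    show "?I \<subseteq> SS" "(\<lambda>m. 0) \<in> ?I" using sS(7) psi_const[of 0] by auto
    have z: "lmul p (\<lambda>m. 0) = (\<lambda>m. 0)" for p :: "int \<Rightarrow> complex" by (simp add: lmul_def)
    fix f g assume g: "g \<in> ?I"
    show "ladd f g \<in> ?I" if "f \<in> ?I" using that g sS(5) psi_add[of f g] by (simp add: ladd_def)
    show "lmul f g \<in> ?I" if "f \<in> SS" using that g sS(6) psi_mult[of f g] by (simp add: z)
  qed
  moreover have "lmon 0 ` c \<subseteq> ?I"
  proof
    fix f assume "f \<in> lmon 0 ` c"
    then obtain a where a: "f = lmon 0 a" "a \<in> c" by blast
    then have "vge c 1 a" using vc(10)[OF cA] by blast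
    then have "ev c a = 0" using ev_simps(6)[OF c(1) vc(9)[OF cA[OF a(2)]]] by simp
    then have "\<psi> (lmon 0 a) = (\<lambda>m. 0)" using psi_mono[of 0 a] by (simp split: if_splits)
    then show "f \<in> ?I" using a SV_A[OF subset_refl cA] by simp
  qed
  ultimately have "J \<subseteq> ?I" by (rule J_ideal(4))
  then show ?thesis using assms by blast
qed

text \<open>An element attaining the bound has a nonzero leading coefficient, which a constant
  factor turns into \<open>z\<close>.\<close>

lemma psi_img_mono: assumes k: "k \<in> K" obtains g where "lmon (q * k) g \<in> SS" "\<psi> (lmon (q * k) g) = lmon k z"
proof -
  obtain g where g: "g \<noteq> 0" "ord_at C c g = dl c (q * k)" "lmon (q * k) g \<in> SS" using piece_elem[OF c(1)] by metis
  let ?e = "ev c (g * x powi (- k))"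
  have v: "vge c 0 (g * x powi (- k))" using v0[OF g(3) k] by simp
  have "\<not> vge c 1 (g * x powi (- k))" unfolding vx using g low[OF k] by (simp add: vge_def)
  then have e0: "?e \<noteq> 0" using ev_simps(6)[OF c(1) v] by simp
  have "lmul (lmon 0 (\<kappa> (z / ?e))) (lmon (q * k) g) \<in> SS" using sS(6)[OF SV_A[OF subset_refl \<kappa>(1)] g(3)] .
  then have 1: "lmon (q * k) (\<kappa> (z / ?e) * g) \<in> SS" by simp
  have "ev c (\<kappa> (z / ?e) * g * x powi (- k)) = z / ?e * ?e"
    using ev_simps(5)[OF c(1) vc(9)[OF \<kappa>(1)] v, of "z / ?e"] ev_simps(1)[OF c(1)] by (simp add: mult.assoc)
  then have "\<psi> (lmon (q * k) (\<kappa> (z / ?e) * g)) = lmon k z" using psi_mono[of k] k e0 by simp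
  then show ?thesis using that 1 by blast
qed

lemma psi_sum:
  assumes "finite S" "\<And>i. i \<in> S \<Longrightarrow> F i \<in> SS" shows "\<psi> (\<lambda>m. \<Sum>i\<in>S. F i m) = (\<lambda>m. \<Sum>i\<in>S. \<psi> (F i) m)"
  using assms
proof (induction S rule: finite_induct)
  case empty then show ?case using psi_const[of 0] by simp
next
  case (insert a S)
  have "(\<lambda>m. \<Sum>i\<in>insert a S. F i m) = ladd (F a) (\<lambda>m. \<Sum>i\<in>S. F i m)" using insert by (simp add: ladd_def)
  moreover have "(\<lambda>m. \<Sum>i\<in>S. F i m) \<in> SS" using lsub_sum[OF lS insert(1)] insert.prems by blast
  ultimately show ?case using psi_add[of "F a"] insert by (simp add: ladd_def)
qed

lemma psi_img: assumes p: "p \<in> lau" "\<And>k. k \<notin> K \<Longrightarrow> p k = 0" obtains f where "f \<in> SS" "\<psi> f = p"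
proof -
  have "\<exists>g. k \<in> K \<longrightarrow> lmon (q * k) g \<in> SS \<and> \<psi> (lmon (q * k) g) = lmon k (p k)" for k using psi_img_mono[of k "p k"] by metis
  then obtain g where g: "\<And>k. k \<in> K \<Longrightarrow> lmon (q * k) (g k) \<in> SS \<and> \<psi> (lmon (q * k) (g k)) = lmon k (p k)" by metis
  let ?S = "{k. p k \<noteq> 0}"
  have fin: "finite ?S" using p by (simp add: lau_def)
  have KS: "k \<in> K" if "k \<in> ?S" for k using p(2) that by blast
  let ?f = "\<lambda>m. \<Sum>k\<in>?S. lmon (q * k) (g k) m"
  have "?f \<in> SS" by (rule lsub_sum[OF lS fin]) (use g KS in blast)
  moreover have "\<psi> ?f = (\<lambda>m. \<Sum>k\<in>?S. \<psi> (lmon (q * k) (g k)) m)" by (rule psi_sum[OF fin]) (use g KS in blast)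
  moreover have "\<dots> = (\<lambda>m. \<Sum>k\<in>?S. lmon k (p k) m)" using g KS by (intro ext sum.cong) auto
  ultimately show ?thesis using that lau_expand[OF p(1)] by metis
qed

lemma psi_pos: assumes "K = {0..}" shows "pos (\<psi> f)"
proof -
  have "m \<notin> K" if "m < 0" for m using assms that by simp
  then show ?thesis by (simp add: pos_def \<psi>_def)
qed

text \<open>The component is an affine line for \<open>K = {0..}\<close> and a multiplicative group
  for \<open>K = UNIV\<close>.\<close>

sublocale L: lmap SA \<psi>
proof (rule lmap.intro)
  show "cring SA" by (rule SA.is_cring)
  show "\<psi> \<in> ring_hom SA (GA lau (\<lambda>z. z))" by (rule psi_hom)
  have *: "\<exists>a\<in>carrier SA. \<psi> a = p" if "p \<in> lau" "\<And>k. k \<notin> K \<Longrightarrow> p k = 0" for p using psi_img[OF that] by (metis GA_simps(1))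
  show "\<exists>a\<in>carrier SA. \<psi> a = lp p" for p
    by (rule *) (use K lp_pos[of p] in \<open>auto simp: pos_def\<close>)
  show "(\<forall>a\<in>carrier SA. pos (\<psi> a)) \<or> (\<forall>q\<in>lau. \<exists>a\<in>carrier SA. \<psi> a = q)"
    using K psi_pos * by blast
qed

lemma ok_iff: "L.ok z \<longleftrightarrow> z \<noteq> 0 \<or> K = {0..}"
proof -
  have "\<not> (\<forall>a\<in>SS. pos (\<psi> a))" if U: "K = UNIV"
  proof
    assume a: "\<forall>a\<in>SS. pos (\<psi> a)"
    obtain g where "lmon (q * - 1) g \<in> SS" "\<psi> (lmon (q * - 1) g) = lmon (- 1) 1" using psi_img_mono[of "- 1" 1] U by auto
    then have "pos (lmon (- 1) 1)" using a by metis
    then show False unfolding pos_def by (auto dest: spec[of _ "- 1"])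
  qed
  then show ?thesis using K psi_pos unfolding L.ok_def by auto
qed

definition \<Psi>K where "\<Psi>K = {f \<in> SS. \<psi> f = (\<lambda>m. 0)}"

lemma yz_contains: "\<Psi>K \<subseteq> L.yz z" by (auto simp: \<Psi>K_def L.yz_def)

lemma points: assumes "maximalideal y SA" "\<Psi>K \<subseteq> y" obtains z where "L.ok z" "y = L.yz z"
proof (rule L.maximal_yz[OF assms(1)])
  fix a assume "a \<in> carrier SA" "\<psi> a = (\<lambda>m. 0)"
  then have "a \<in> \<Psi>K" by (simp add: \<Psi>K_def)
  then show "a \<in> y" by (rule subsetD[OF assms(2)])
qed (rule that)

lemma J_\<Psi>K: "J \<subseteq> \<Psi>K" using J_psi J_ideal(2) by (auto simp: \<Psi>K_def gidl_def)

lemma yz_fibre: assumes "L.ok z" shows "L.yz z \<in> fibre_points C SA (lmon 0) c"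
  unfolding fibre_points_iff by (rule conjI[OF L.yz_maximal[OF assms] subset_trans[OF J_\<Psi>K yz_contains]])

lemma psi_translate: assumes a: "a \<in> SS" and t: "t \<noteq> 0" shows "\<psi> (translate SA t a) k = t powi (q * k) * \<psi> a k"
proof (cases "k \<in> K")
  case True
  have "ev c (\<kappa> (t powi (q * k)) * a (q * k) * x powi (- k)) = t powi (q * k) * ev c (a (q * k) * x powi (- k))"
    using ev_simps(5)[OF c(1) vc(9)[OF \<kappa>(1)] v0[OF a True], of "t powi (q * k)"] ev_simps(1)[OF c(1)] by (simp add: mult.assoc)
  then show ?thesis using True by (simp add: \<psi>_def translate_eq[OF a])
qed (simp add: \<psi>_def)

lemma evl_translate: assumes a: "a \<in> SS" and t: "t \<noteq> 0" shows "evl z (\<psi> (translate SA t a)) = evl (t powi q * z) (\<psi> a)"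
proof -
  have "{k. \<psi> (translate SA t a) k \<noteq> 0} = {k. \<psi> a k \<noteq> 0}" using t by (auto simp: psi_translate[OF a t])
  then have "evl z (\<psi> (translate SA t a)) = (\<Sum>k | \<psi> a k \<noteq> 0. \<psi> (translate SA t a) k * z powi k)"
    unfolding evl_def by simp
  also have "\<dots> = evl (t powi q * z) (\<psi> a)" unfolding evl_def
    by (rule sum.cong[OF refl]) (simp add: psi_translate[OF a t] power_int_mult_distrib power_int_mult)
  finally show ?thesis .
qed

lemma yz_translate: assumes t: "t \<noteq> 0" shows "spec_map SA (translate SA t) (L.yz z) = L.yz (t powi q * z)"
  using evl_translate[OF _ t] translate_eq(2) by (auto simp: spec_map_def L.yz_def)

text \<open>The group acts on the coordinate of the face through \<open>t^q\<close>; for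
  \<open>q = 2\<close> this is the source of the stabilizer of order 2.\<close>

lemma orbit_yz: "orbit_of SA (L.yz z) = {L.yz (t powi q * z) | t. t \<noteq> 0}"
  unfolding orbit_of_def using yz_translate by auto

lemma evl_inj: assumes "\<And>w. w \<noteq> 0 \<Longrightarrow> a \<in> L.yz w" shows "a \<in> \<Psi>K"
proof -
  have a: "a \<in> SS" using assms[of 1] by (simp add: L.yz_def)
  have "evl w (\<psi> a) = 0" if "w \<noteq> 0" for w using assms[OF that] by (simp add: L.yz_def)
  then show ?thesis using evl_all_zero[OF psi_lau[OF a]] a by (simp add: \<Psi>K_def)
qed

end

section \<open>Conjugation on points, and the points of the multiplicative group\<close>

lemma sum_uminus: "(\<Sum>m | P (- m). f m) = (\<Sum>m | P m. f (- m))" for f :: "int \<Rightarrow> 'b::comm_monoid_add"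
proof -
  have "{m. P (- m)} = uminus ` {m. P m}" by (auto simp: image_iff) (metis minus_minus)
  then show ?thesis by (simp add: sum.reindex inj_on_def)
qed

text \<open>On points the twisted conjugation is \<open>z \<mapsto> l / cnj z\<close>. For
  \<open>l = 1\<close> it fixes the unit circle, for \<open>l = - 1\<close> it has no fixed
  point.\<close>

lemma evl_conj:
  assumes z: "z \<noteq> 0" and l: "l = 1 \<or> l = - 1"
  shows "evl z (dpd_conj cnj l p) = cnj (evl (l / cnj z) p)"
proof -
  have l0: "l \<noteq> 0" "cnj l = l" using l by auto
  have "{m. dpd_conj cnj l p m \<noteq> 0} = {m. p (- m) \<noteq> 0}" using l0 by (auto simp: dpd_conj_def)
  then have "evl z (dpd_conj cnj l p) = (\<Sum>m | p (- m) \<noteq> 0. l powi (- m) * cnj (p (- m)) * z powi m)"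
    unfolding evl_def by (simp add: dpd_conj_def)
  also have "\<dots> = (\<Sum>m | p m \<noteq> 0. l powi m * cnj (p m) * z powi (- m))"
    using sum_uminus[of "\<lambda>m. l powi (- m) * cnj (p (- m)) * z powi m" "\<lambda>m. p m \<noteq> 0"] by simp
  also have "\<dots> = (\<Sum>m | p m \<noteq> 0. cnj (p m * (l / cnj z) powi m))"
  proof (rule sum.cong[OF refl])
    fix m
    have "cnj (w powi m) = cnj w powi m" for w by (simp add: power_int_def)
    then show "l powi m * cnj (p m) * z powi (- m) = cnj (p m * (l / cnj z) powi m)"
      using l0 by (simp add: power_int_divide_distrib power_int_minus field_simps)
  qed
  also have "\<dots> = cnj (evl (l / cnj z) p)" by (simp add: evl_def)
  finally show ?thesis .
qed

lemma evl_cnj: "evl z (\<lambda>m. cnj (p m)) = cnj (evl (cnj z) p)"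
proof -
  have "cnj (w powi m) = cnj w powi m" for w and m :: int by (simp add: power_int_def)
  then show ?thesis by (simp add: evl_def)
qed

lemma evl_0: assumes "p \<in> lau" "pos p" shows "evl 0 p = p 0"
proof -
  have "finite {m. p m \<noteq> 0}" using assms by (simp add: lau_def)
  then have fin: "finite (insert 0 {m. p m \<noteq> 0})" by simp
  have "evl 0 p = (\<Sum>m\<in>insert 0 {m. p m \<noteq> 0}. p m * 0 powi m)" by (rule evl_super[OF fin]) auto
  also have "\<dots> = (\<Sum>m\<in>insert 0 {m. p m \<noteq> 0}. if m = 0 then p 0 else 0)" by (rule sum.cong) auto
  also have "\<dots> = p 0" using fin by (simp add: sum.delta)
  finally show ?thesis .
qed

lemma cp_iff: "y \<in> closed_points R \<longleftrightarrow> maximalideal y R" by (simp add: closed_points_def)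

lemma zcl_iff: "y \<in> zclosure R Z \<longleftrightarrow> maximalideal y R \<and> \<Inter>Z \<subseteq> y" by (simp add: zclosure_def closed_points_def)

abbreviation "WW \<equiv> GA lau (\<lambda>z::complex. z)"

interpretation WL: lmap WW "\<lambda>f. f" by (rule lmap_id)

lemma W_ok: "WL.ok z \<longleftrightarrow> z \<noteq> 0"
proof -
  have "\<not> pos (lmon (- 1) (1::complex))" unfolding pos_def by (auto intro!: exI[of _ "- 1"])
  then show ?thesis unfolding WL.ok_def using mono_lau by (metis GA_simps(1))
qed

lemma W_points: "closed_points WW = {WL.yz z | z. z \<noteq> 0}"
proof (rule subset_antisym; rule subsetI)
  fix y assume "y \<in> closed_points WW"
  then have y: "maximalideal y WW" by (simp add: cp_iff)
  interpret y: maximalideal y WW by fact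
  obtain z where "WL.ok z" "y = WL.yz z"
  proof (rule WL.maximal_yz[OF y])
    fix a :: "int \<Rightarrow> complex" assume "a = (\<lambda>m. 0)"
    then show "a \<in> y" using additive_subgroup.zero_closed[OF y.is_additive_subgroup] by simp
  qed
  then show "y \<in> {WL.yz z | z. z \<noteq> 0}" using W_ok by blast
next
  fix y assume "y \<in> {WL.yz z | z. z \<noteq> 0}"
  then show "y \<in> closed_points WW" using WL.yz_maximal W_ok by (auto simp: cp_iff)
qed

lemma W_yz: "WL.yz z = {f \<in> lau. evl z f = 0}" by (simp add: WL.yz_def)

lemma W_pow: "lmon m a [^]\<^bsub>WW\<^esub> n = lmon (int n * m) (a ^ n)"
proof (induction n)
  case 0 then show ?case by simp
next
  case (Suc n) then show ?case by (simp add: GA_mult algebra_simps)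
qed

context dpdc begin

lemma cjS: "f \<in> SS \<Longrightarrow> rs.cj f \<in> SS" by (rule cj_SS)

lemma gidl_SS: assumes "gidl SS I" shows "I \<subseteq> SS" "(\<lambda>m. 0) \<in> I" "f \<in> I \<Longrightarrow> g \<in> I \<Longrightarrow> ladd f g \<in> I" "f \<in> SS \<Longrightarrow> g \<in> I \<Longrightarrow> lmul f g \<in> I"
  using assms by (auto simp: gidl_def)

lemma prime_max_SA: "maximalideal y SA \<Longrightarrow> f \<in> SS \<Longrightarrow> g \<in> SS \<Longrightarrow> lmul f g \<in> y \<Longrightarrow> f \<in> y \<or> g \<in> y"
  using primeideal.I_prime[OF SA.maximalideal_prime, of y f g] sS(2) by (simp add: GA_mult)

lemma max_gidl: "maximalideal y SA \<Longrightarrow> gidl SS y" using maximalideal.axioms(1) ideal_GA[OF lS] by blast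

end

section \<open>Components as closures of orbits\<close>

context face begin

text \<open>The quotient embeds into the domain of Laurent polynomials.\<close>

lemma \<Psi>K_prime: "primeideal \<Psi>K SA"
proof (rule primeidealI)
  have z: "lmul p (\<lambda>m. 0) = (\<lambda>m. 0)" for p :: "int \<Rightarrow> complex" by (simp add: lmul_def)
  have "gidl SS \<Psi>K" unfolding gidl_def
  proof (intro conjI ballI)
    show "\<Psi>K \<subseteq> SS" "(\<lambda>m. 0) \<in> \<Psi>K" using sS(7) psi_const[of 0] by (auto simp: \<Psi>K_def)
    fix f g assume g: "g \<in> \<Psi>K"
    show "ladd f g \<in> \<Psi>K" if "f \<in> \<Psi>K" using that g sS(5) psi_add[of f g] by (simp add: ladd_def \<Psi>K_def)
    show "lmul f g \<in> \<Psi>K" if "f \<in> SS" using that g sS(6) psi_mult[of f g] by (simp add: z \<Psi>K_def)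
  qed
  then show "ideal \<Psi>K SA" using ideal_GA[OF lS] by blast
  show "cring SA" by (rule SA.is_cring)
  have "lmon 0 1 \<notin> \<Psi>K" using psi_const[of 1] mono_eq0[of 0 "1::complex"] by (simp add: \<Psi>K_def)
  then show "carrier SA \<noteq> \<Psi>K" using sS(3) by auto
  fix a b assume ab: "a \<in> carrier SA" "b \<in> carrier SA" "a \<otimes>\<^bsub>SA\<^esub> b \<in> \<Psi>K"
  then have "lmul (\<psi> a) (\<psi> b) = (\<lambda>m. 0)" using psi_mult sS(2) by (simp add: GA_mult \<Psi>K_def)
  then show "a \<in> \<Psi>K \<or> b \<in> \<Psi>K" using lmul_laws(7)[OF psi_lau psi_lau mono_lau] ab by (simp add: \<Psi>K_def)
qed

lemma \<Psi>K_gidl: "gidl SS \<Psi>K" using \<Psi>K_prime ideal_GA[OF lS] primeideal.axioms(1) by blast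

lemma \<Psi>K_one: "lmon 0 1 \<notin> \<Psi>K" using psi_const[of 1] mono_eq0[of 0 "1::complex"] by (simp add: \<Psi>K_def)

lemma \<Psi>K_pow: assumes "f \<in> SS" "f [^]\<^bsub>SA\<^esub> (n::nat) \<in> \<Psi>K" shows "f \<in> \<Psi>K"
  using assms(2)
proof (induction n)
  case 0 then show ?case using \<Psi>K_one by simp
next
  case (Suc n)
  have "f [^]\<^bsub>SA\<^esub> n \<in> carrier SA" using SA.nat_pow_closed[of f n] assms(1) by simp
  then show ?case using primeideal.I_prime[OF \<Psi>K_prime, of "f [^]\<^bsub>SA\<^esub> n" f] Suc assms(1) by auto
qed

lemma psi_onto: assumes "K = UNIV" shows "\<psi> ` SS = lau"
proof (rule subset_antisym; rule subsetI)
  fix p assume "p \<in> \<psi> ` SS" then show "p \<in> lau" using psi_lau by blast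
next
  fix p :: "int \<Rightarrow> complex" assume p: "p \<in> lau"
  obtain f where "f \<in> SS" "\<psi> f = p" by (rule psi_img[OF p]) (use assms in auto)
  then show "p \<in> \<psi> ` SS" by blast
qed

text \<open>A Laurent polynomial vanishing at all nonzero points is zero, so the ideal of the orbit
  is \<open>\<Psi>K\<close>; its closure adds exactly the point \<open>z = 0\<close>.\<close>

lemma zcl:
  assumes "K = {0..}"
  shows "zclosure SA {L.yz z | z. z \<noteq> 0} = range L.yz" "\<Inter>(zclosure SA {L.yz z | z. z \<noteq> 0}) = \<Psi>K"
proof -
  have ok: "L.ok z" for z using ok_iff assms by simp
  have i: "\<Inter>{L.yz z | z. z \<noteq> 0} = \<Psi>K"
  proof (rule subset_antisym)
    show "\<Psi>K \<subseteq> \<Inter>{L.yz z | z. z \<noteq> 0}" using yz_contains by blast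
    show "\<Inter>{L.yz z | z. z \<noteq> 0} \<subseteq> \<Psi>K" using evl_inj by blast
  qed
  show 1: "zclosure SA {L.yz z | z. z \<noteq> 0} = range L.yz"
  proof (rule subset_antisym; rule subsetI)
    fix y assume "y \<in> zclosure SA {L.yz z | z. z \<noteq> 0}"
    then have "maximalideal y SA" "\<Psi>K \<subseteq> y" unfolding zcl_iff i by auto
    then obtain z where "y = L.yz z" by (rule points)
    then show "y \<in> range L.yz" by blast
  next
    fix y assume "y \<in> range L.yz"
    then show "y \<in> zclosure SA {L.yz z | z. z \<noteq> 0}"
      unfolding zcl_iff i using L.yz_maximal[OF ok] yz_contains by blast
  qed
  show "\<Inter>(zclosure SA {L.yz z | z. z \<noteq> 0}) = \<Psi>K"
    unfolding 1
  proof (rule subset_antisym)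
    have "{L.yz z | z. z \<noteq> 0} \<subseteq> range L.yz" by blast
    from Inter_anti_mono[OF this] show "\<Inter>(range L.yz) \<subseteq> \<Psi>K" unfolding i .
    show "\<Psi>K \<subseteq> \<Inter>(range L.yz)" by (rule Inter_greatest) (use yz_contains in blast)
  qed
qed

lemma affine_line_face:
  assumes "K = {0..}" shows "is_affine_line SA (zclosure SA {L.yz z | z. z \<noteq> 0})"
proof -
  \<comment> \<open>The polynomial formed by the leading coefficients of \<open>f\<close>;
    injectivity of \<open>lp\<close> makes the description definite.\<close>
  define un where "un f = (THE p. lp p = \<psi> f)" for f
  have un: "lp (un f) = \<psi> f" if f: "f \<in> SS" for f
  proof -
    obtain p where p: "\<psi> f = lp p" using pos_lp[OF psi_lau[OF f] psi_pos[OF assms]] by blast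
    show ?thesis unfolding un_def by (rule theI2[of _ p]) (use p lp_inj in auto)
  qed
  have eq: "un f = p" if "f \<in> SS" "\<psi> f = lp p" for f p using un[OF that(1)] that(2) lp_inj by metis
  have line: "carrier affine_line = UNIV" "monoid.mult affine_line = (*)" "one affine_line = 1" "ring.zero affine_line = 0"
    "add affine_line = (+)" "cst affine_line = (\<lambda>z. [:z:])" by (simp_all add: affine_line_def)
  have const: "lp [:w:] = lmon 0 w" for w by (simp add: lp_pCons ladd_def) (auto simp: lmul_def)
  obtain \<Phi> where \<Phi>: "\<Phi> \<in> ring_iso (SA Quot \<Psi>K) affine_line" "\<And>a. a \<in> carrier SA \<Longrightarrow> \<Phi> (\<Psi>K +>\<^bsub>SA\<^esub> a) = un a"
  proof (rule quot_iso[of SA affine_line un \<Psi>K])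
    show "cring SA" by (rule SA.is_cring)
    show "cring affine_line" unfolding affine_line_def by (rule cring_coord) simp
    show "un \<in> ring_hom SA affine_line"
    proof (rule ring_hom_memI)
      fix f g assume "f \<in> carrier SA" "g \<in> carrier SA"
      then have fg: "f \<in> SS" "g \<in> SS" by simp_all
      show "un (f \<otimes>\<^bsub>SA\<^esub> g) = un f \<otimes>\<^bsub>affine_line\<^esub> un g" unfolding line
        by (rule eq) (use fg sS in \<open>auto simp: GA_mult psi_mult lp_mult un\<close>)
      show "un (f \<oplus>\<^bsub>SA\<^esub> g) = un f \<oplus>\<^bsub>affine_line\<^esub> un g" unfolding line
        by (rule eq) (use fg sS in \<open>auto simp: psi_add lp_add un\<close>)
    next
      show "un \<one>\<^bsub>SA\<^esub> = \<one>\<^bsub>affine_line\<^esub>" unfolding line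
        by (rule eq) (use sS(3) psi_const[of 1] const[of 1] in \<open>auto simp: one_pCons\<close>)
    qed (simp add: line)
    show "un ` carrier SA = carrier affine_line" unfolding line
    proof (intro subset_antisym subset_UNIV subsetI)
      fix p
      obtain f where "f \<in> SS" "\<psi> f = lp p"
        by (rule psi_img[of "lp p"]) (use assms lp_pos[of p] in \<open>auto simp: pos_def\<close>)
      then show "p \<in> un ` carrier SA" using eq[of f p] by (auto simp: image_iff)
    qed
    have "un f = 0 \<longleftrightarrow> \<psi> f = (\<lambda>m. 0)" if "f \<in> SS" for f using un[OF that] eq[OF that, of 0] by auto
    then show "\<Psi>K = {a \<in> carrier SA. un a = \<zero>\<^bsub>affine_line\<^esub>}" unfolding line \<Psi>K_def by auto
  qed blast
  have "calg_iso (gm_quot SA \<Psi>K) affine_line \<Phi>"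
    unfolding calg_iso_def calg_hom_def
  proof (intro conjI allI)
    show 1: "\<Phi> \<in> ring_iso (gm_quot SA \<Psi>K) affine_line" using \<Phi>(1) unfolding ring_iso_def ring_hom_def gm_quot_simps .
    then show "\<Phi> \<in> ring_hom (gm_quot SA \<Psi>K) affine_line" by (simp add: ring_iso_def)
    fix z
    have kS: "lmon 0 (\<kappa> z) \<in> SS" by (rule SV_A[OF subset_refl \<kappa>(1)])
    have "un (lmon 0 (\<kappa> z)) = [:z:]" by (rule eq[OF kS]) (simp add: psi_const const)
    then show "\<Phi> (cst (gm_quot SA \<Psi>K) z) = cst affine_line z" unfolding gm_quot_simps line
      using \<Phi>(2)[of "lmon 0 (\<kappa> z)"] kS by simp
  qed
  then show ?thesis unfolding is_affine_line_def zcl(2)[OF assms] by blast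
qed

text \<open>The power \<open>k\<close> of the face coordinate has weight \<open>q * k\<close>; the
  reindexing makes exponents in the image equal to weights.\<close>

lemma psi_flip_hom:
  assumes qq: "q = 1 \<or> q = - 1"
  shows "gm_hom SA WW (\<lambda>f m. \<psi> f (q * m))"
proof -
  have fl: "(\<lambda>m. p (q * m)) \<in> lau" if "p \<in> lau" for p :: "int \<Rightarrow> complex"
  proof -
    have "finite ((\<lambda>m. q * m) -` {m. p m \<noteq> 0})" by (rule finite_vimageI) (use that q in \<open>auto simp: lau_def inj_on_def\<close>)
    then show ?thesis by (simp add: lau_def vimage_def)
  qed
  have fm: "(\<lambda>m. lmul p r (q * m)) = lmul (\<lambda>m. p (q * m)) (\<lambda>m. r (q * m))" for p r :: "int \<Rightarrow> complex"
  proof (cases "q = 1")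
    case False
    then have q1: "q = - 1" using qq by blast
    show ?thesis
    proof
      fix m
      have e: "r (- i - m) = r (- m - i)" for i by (rule arg_cong[of _ _ r]) simp
      have "lmul (\<lambda>m. p (- m)) (\<lambda>m. r (- m)) m = (\<Sum>i | p (- i) \<noteq> 0. p (- i) * r (i - m))" by (simp add: lmul_def)
      also have "\<dots> = lmul p r (- m)" using sum_uminus[of "\<lambda>i. p (- i) * r (i - m)" "\<lambda>i. p i \<noteq> 0"]
        by (simp add: lmul_def e)
      finally show "lmul p r (q * m) = lmul (\<lambda>m. p (q * m)) (\<lambda>m. r (q * m)) m" using q1 by simp
    qed
  qed simp
  show ?thesis unfolding gm_hom_def calg_hom_def
  proof (intro conjI allI ballI)
    show "(\<lambda>f m. \<psi> f (q * m)) \<in> ring_hom SA WW"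
    proof (rule ring_hom_memI)
      fix f g assume "f \<in> carrier SA" "g \<in> carrier SA"
      then have fg: "f \<in> SS" "g \<in> SS" by simp_all
      show "(\<lambda>m. \<psi> f (q * m)) \<in> carrier WW" using fl psi_lau fg by simp
      show "(\<lambda>m. \<psi> (f \<otimes>\<^bsub>SA\<^esub> g) (q * m)) = (\<lambda>m. \<psi> f (q * m)) \<otimes>\<^bsub>WW\<^esub> (\<lambda>m. \<psi> g (q * m))"
        using fg sS(2) fl psi_lau by (simp add: GA_mult psi_mult fm)
      show "(\<lambda>m. \<psi> (f \<oplus>\<^bsub>SA\<^esub> g) (q * m)) = (\<lambda>m. \<psi> f (q * m)) \<oplus>\<^bsub>WW\<^esub> (\<lambda>m. \<psi> g (q * m))"
        using fg by (simp add: psi_add) (simp add: ladd_def)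
    next
      show "(\<lambda>m. \<psi> \<one>\<^bsub>SA\<^esub> (q * m)) = \<one>\<^bsub>WW\<^esub>" using psi_const[of 1] q by (auto simp: lmon_def)
    qed
    show "(\<lambda>m. \<psi> (cst SA z) (q * m)) = cst WW z" for z using psi_const[of z] q by (auto simp: lmon_def)
    fix a m assume a: "a \<in> carrier SA"
    have qm: "q * (q * m) = m" using qq by auto
    have "\<psi> a (q * m) = (if q * m \<in> K then ev c (a m * x powi (- (q * m))) else 0)" unfolding \<psi>_def qm ..
    then have "\<psi> (lmon m (a m)) = lmon (q * m) (\<psi> a (q * m))"
      using psi_mono[of "q * m" "a m", unfolded qm] by simp
    then show "wt WW (\<lambda>m. \<psi> a (q * m)) m = (\<lambda>n. \<psi> (wt SA a m) (q * n))" using q by (auto simp: lmon_def fun_eq_iff)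
  qed
qed

text \<open>The orbit is the line without \<open>z = 0\<close>, and inverting one element of degree
  \<open>q\<close> whose image is the face coordinate makes the comorphism surjective.\<close>

lemma principal_face:
  assumes qq: "q = 1 \<or> q = - 1" and KK: "K = {0..}"
  shows "principal_orbit SA {L.yz z | z. z \<noteq> 0}"
proof -
  have ok: "L.ok z" for z using ok_iff KK by simp
  let ?\<theta> = "\<lambda>f m. \<psi> f (q * m)"
  have ev: "evl z (?\<theta> f) = evl (z powi q) (\<psi> f)" if "z \<noteq> 0" for z f
  proof (cases "q = 1")
    case False
    then have q1: "q = - 1" using qq by blast
    have "evl z (?\<theta> f) = (\<Sum>m | \<psi> f (- m) \<noteq> 0. \<psi> f (- m) * z powi m)" by (simp add: evl_def q1)
    also have "\<dots> = (\<Sum>m | \<psi> f m \<noteq> 0. \<psi> f m * z powi (- m))"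
      using sum_uminus[of "\<lambda>m. \<psi> f (- m) * z powi m" "\<lambda>m. \<psi> f m \<noteq> 0"] by simp
    also have "\<dots> = evl (z powi q) (\<psi> f)" by (simp add: evl_def q1 power_int_minus power_int_inverse)
    finally show ?thesis .
  qed simp
  have sm: "spec_map SA ?\<theta> (WL.yz z) = L.yz (z powi q)" if z: "z \<noteq> 0" for z
  proof -
    have "?\<theta> f \<in> lau" if "f \<in> SS" for f
      using psi_flip_hom[OF qq] that by (auto simp: gm_hom_def calg_hom_def dest: ring_hom_memE(1))
    then show ?thesis unfolding spec_map_def W_yz L.yz_def using ev[OF z] by auto
  qed
  have "orbit_of SA (L.yz 1) = {L.yz z | z. z \<noteq> 0}"
  proof -
    have "z \<noteq> 0 \<Longrightarrow> \<exists>t. t \<noteq> 0 \<and> z = t powi q" for z :: complex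
      using qq by (auto intro: exI[of _ z] exI[of _ "inverse z"] simp: power_int_minus)
    then show ?thesis unfolding orbit_yz using q by auto
  qed
  then have "gm_orbit SA {L.yz z | z. z \<noteq> 0}" unfolding gm_orbit_def
    by (intro bexI[of _ "L.yz 1"]) (simp_all only: cp_iff L.yz_maximal[OF ok])
  moreover have "gm_hom SA WW ?\<theta>" by (rule psi_flip_hom[OF qq])
  moreover have "immersion SA WW ?\<theta>" unfolding immersion_def
  proof
    fix y assume "y \<in> closed_points WW"
    then obtain z where z: "z \<noteq> 0" "y = WL.yz z" unfolding W_points by blast
    obtain g where g: "lmon (q * 1) g \<in> SS" "\<psi> (lmon (q * 1) g) = lmon 1 1" using psi_img_mono[of 1 1] KK by auto
    let ?g = "lmon (q * 1) g"
    \<comment> \<open>The image of \<open>?g\<close> is a unit, and its powers clear the negative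
      exponents of \<open>b\<close> in the face coordinate.\<close>
    have \<theta>g: "?\<theta> ?g = lmon q 1" unfolding g(2) using qq by (auto simp: lmon_def fun_eq_iff)
    show "\<exists>g\<in>carrier SA - spec_map SA ?\<theta> y. \<forall>b\<in>carrier WW. \<exists>a\<in>carrier SA. \<exists>n::nat. ?\<theta> g [^]\<^bsub>WW\<^esub> n \<otimes>\<^bsub>WW\<^esub> b = ?\<theta> a"
    proof (rule bexI[of _ ?g], intro ballI)
      have "evl (z powi q) (\<psi> ?g) \<noteq> 0" unfolding g(2) using z by simp
      then show "?g \<in> carrier SA - spec_map SA ?\<theta> y" using g(1) z by (simp add: sm L.yz_def)
      fix b assume "b \<in> carrier WW"
      then have b: "b \<in> lau" by simp
      let ?b = "\<lambda>m. b (q * m)"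
      have bl: "?b \<in> lau"
      proof -
        have "finite ((\<lambda>m. q * m) -` {m. b m \<noteq> 0})" by (rule finite_vimageI) (use b q in \<open>auto simp: lau_def inj_on_def\<close>)
        then show ?thesis by (simp add: lau_def vimage_def)
      qed
      obtain n where n: "pos (lmul (lmon (int n) 1) ?b)" using shift_pos[OF bl] by blast
      obtain a where a: "a \<in> SS" "\<psi> a = lmul (lmon (int n) 1) ?b"
        by (rule psi_img[of "lmul (lmon (int n) 1) ?b"]) (use bl n KK in \<open>auto simp: pos_def\<close>)
      have "?\<theta> ?g [^]\<^bsub>WW\<^esub> n \<otimes>\<^bsub>WW\<^esub> b = lmul (lmon (int n * q) 1) b" unfolding \<theta>g W_pow by (simp add: GA_mult)
      also have "\<dots> = ?\<theta> a" unfolding a(2) using qq by (auto simp: lmul_mono fun_eq_iff algebra_simps)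
      finally show "\<exists>a\<in>carrier SA. \<exists>n::nat. ?\<theta> ?g [^]\<^bsub>WW\<^esub> n \<otimes>\<^bsub>WW\<^esub> b = ?\<theta> a" using a(1) by auto
    qed
  qed
  moreover have "spec_map SA ?\<theta> ` closed_points WW = {L.yz z | z. z \<noteq> 0}"
  proof (rule subset_antisym; rule subsetI)
    fix y assume "y \<in> spec_map SA ?\<theta> ` closed_points WW"
    then obtain z where "z \<noteq> 0" "y = L.yz (z powi q)" unfolding W_points using sm by auto
    then show "y \<in> {L.yz z | z. z \<noteq> 0}" using power_int_not_zero[of z q] by blast
  next
    fix y assume "y \<in> {L.yz z | z. z \<noteq> 0}"
    then obtain z where z: "z \<noteq> 0" "y = L.yz z" by blast
    have "(z powi q) powi q = z" using qq by (auto simp: power_int_minus)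
    then have "y = spec_map SA ?\<theta> (WL.yz (z powi q))" using sm[of "z powi q"] z by simp
    then show "y \<in> spec_map SA ?\<theta> ` closed_points WW" unfolding W_points using z power_int_not_zero[of z q] by blast
  qed
  ultimately show ?thesis unfolding principal_orbit_def circle_GA(1) by blast
qed

end

section \<open>Multiple fibres\<close>

context dpdc begin

abbreviation "n \<equiv> ord_at C c h"

text \<open>With \<open>D c = n / 2\<close> and \<open>n\<close> odd, the bound
  \<open>- i * n / 2\<close> is rounded up by one half exactly in odd degrees.\<close>

lemma dl_half:
  assumes "of_int n = 2 * D c" "odd n" shows "2 * dl c i = - i * n + (if odd i then 1 else 0)"
proof -
  have D: "D c = of_int n / 2" using assms(1) by simp
  have Dm: "Dm c = - (of_int n / 2)" using D c(2) by (simp add: Dm)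
  have dl: "dl c i = \<lceil>of_int (- i * n) / (2::rat)\<rceil>" unfolding dl_def Dm D by simp
  show ?thesis
  proof (cases "odd i")
    case True
    then have "odd (- i * n)" using assms(2) by simp
    then obtain j where j: "- i * n = 2 * j + 1" by (elim oddE)
    have "dl c i = j + 1" unfolding dl j by (rule ceiling_unique) auto
    then show ?thesis using True j by simp
  next
    case False
    then obtain j where j: "- i * n = 2 * j" by (metis dvd_mult2 dvd_minus_iff evenE)
    have "dl c i = j" unfolding dl j by simp
    then show ?thesis using False j by simp
  qed
qed

lemma multiple_fibre:
  assumes nD: "of_int n = 2 * D c" and nodd: "odd n"
  shows "multiple_divisor SA J 2" "exceptional_S1_orbit SA rs.cj (fibre_points C SA (lmon 0) c)"
    "\<exists>\<phi>. S1_iso (gm_quot SA (radical_ideal SA J)) (quot_conj SA (radical_ideal SA J) rs.cj) circle_mu2 circle_conj \<phi>"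
proof -
  note half = dl_half[OF nD nodd]
  have oh: "ord_at C c (inverse h) = - n" using ord_simps(2)[OF c(1) h(1)] .
  \<comment> \<open>In degree 2 the bound is \<open>- n\<close>, the order of
    \<open>inverse h\<close>. Conjugation sends \<open>inverse h\<close> in degree 2 to
    \<open>h\<close> in degree -2, its inverse, so the standard real structure of the circle appears
    without rescaling.\<close>
  interpret F: face C \<tau> D h c 2 "inverse h" UNIV
  proof unfold_locales
    show "inverse h \<noteq> 0" using h by simp
    show "dl c (2 * k) = k * ord_at C c (inverse h)" for k using half[of "2 * k"] oh by simp
    fix i j k :: int assume ij: "i + j = 2 * k" "i \<notin> range ((*) 2) \<or> j \<notin> range ((*) 2)"
    have "odd m" if "m \<notin> range ((*) 2)" for m :: int using that by (auto elim!: evenE)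
    then have "odd i \<or> odd j" using ij(2) by blast
    then have "odd i" "odd j" using ij(1) by presburger+
    \<comment> \<open>Both degrees are odd, and the two halves gained by rounding make a
      whole.\<close>
    then have "2 * (dl c i + dl c j) = - (i + j) * n + 2" using half[of i] half[of j] by (simp add: algebra_simps)
    then show "dl c (2 * k) + 1 \<le> dl c i + dl c j" using half[of "2 * k"] ij(1) by simp
  qed auto
  let ?R = F.\<Psi>K
  note R = gidl_SS[OF F.\<Psi>K_gidl] and Jg = gidl_SS[OF J_ideal(2)]
  have Rv: "vge c (dl c i + (if odd i then 0 else 1)) (f i)" if f: "f \<in> ?R" for f i
  proof (cases "odd i")
    case True then show ?thesis using SV_D(2)[OF _ c(1)] R(1) f by auto
  next
    case False
    then obtain k where "i = 2 * k" by (auto elim: evenE)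
    then show ?thesis using F.psi_zero_iff[of f] f by (auto simp: F.\<Psi>K_def)
  qed
  \<comment> \<open>Two odd degrees gain 1 from rounding, and a factor of even degree gains 1 from
    membership in \<open>?R\<close>; so every product exceeds the bound.\<close>
  have RR: "lmul f g \<in> J" if f: "f \<in> ?R" and g: "g \<in> ?R" for f g
  proof (rule J_super)
    show "lmul f g \<in> SS" using sS(6) R(1) f g by blast
    show "vge c (dl c m + 1) (lmul f g m)" for m unfolding lmul_def
    proof (rule vc(11))
      fix i
      let ?e = "\<lambda>i::int. if odd i then 0 else 1 :: int"
      have "dl c m + 1 \<le> (dl c i + ?e i) + (dl c (m - i) + ?e (m - i))"
        using half[of m] half[of i] half[of "m - i"] by (auto simp: algebra_simps split: if_splits)
      then show "vge c (dl c m + 1) (f i * g (m - i))" by (rule vc(4)[OF vc(3)[OF Rv[OF f] Rv[OF g]]])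
    qed
  qed
  have rad: "radical_ideal SA J = ?R"
  proof (rule subset_antisym; rule subsetI)
    fix f assume "f \<in> radical_ideal SA J"
    then obtain k :: nat where f: "f \<in> SS" "f [^]\<^bsub>SA\<^esub> k \<in> J" by (auto simp: radical_ideal_def)
    then show "f \<in> ?R" using F.\<Psi>K_pow F.J_\<Psi>K by blast
  next
    fix f assume f: "f \<in> ?R"
    then have fS: "f \<in> SS" using R(1) by blast
    have "f [^]\<^bsub>SA\<^esub> (2::nat) = lmul f f" using fS sS(2) SA.l_one[of f] by (simp add: numeral_2_eq_2 GA_mult)
    then have "f [^]\<^bsub>SA\<^esub> (2::nat) \<in> J" using RR[OF f f] by simp
    then show "f \<in> radical_ideal SA J" using fS unfolding radical_ideal_def by auto
  qed
  have idR: "ideal ?R SA" using F.\<Psi>K_prime by (rule primeideal.axioms(1))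
  let ?I1 = "ideal_prod SA ?R (carrier SA)"
  let ?I2 = "ideal_prod SA ?R ?I1"
  have i1: "ideal ?I1 SA" by (rule SA.ideal_prod_is_ideal[OF idR SA.oneideal])
  have i2: "ideal ?I2 SA" by (rule SA.ideal_prod_is_ideal[OF idR i1])
  have g2: "gidl SS ?I2" using i2 ideal_GA[OF lS] by blast
  note I2 = gidl_SS[OF g2]
  have pow: "ideal_power SA ?R 2 = ?I2" by (simp add: ideal_power_def numeral_2_eq_2)
  have I1R: "?I1 \<subseteq> ?R" using SA.ideal_prod_inter[OF idR SA.oneideal] by blast
  have I2J: "?I2 \<subseteq> J"
  proof
    fix a assume "a \<in> ?I2"
    then show "a \<in> J"
    proof induction
      case (prod i j)
      have "i \<in> lau" using sS(2) R(1) prod(1) by blast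
      moreover have "j \<in> ?R" using I1R prod(2) by blast
      ultimately show ?case using RR[OF prod(1)] by (simp add: GA_mult)
    next
      case (sum s1 s2) then show ?case using Jg(3) by simp
    qed
  qed
  have bR: "lmon 0 b \<notin> ?R" if b: "b \<in> A" "b \<notin> c" for b
  proof
    assume "lmon 0 b \<in> ?R"
    then have "vge c 1 b" using Rv[of "lmon 0 b" 0] by simp
    then show False using vc(10)[OF b(1)] b(2) by blast
  qed
  show "multiple_divisor SA J 2" unfolding multiple_divisor_def rad pow locally_equal_def
  proof (intro conjI ballI)
    show "primeideal ?R SA" by (rule F.\<Psi>K_prime)
    fix a assume a: "a \<in> ?I2"
    show "\<exists>s\<in>carrier SA - ?R. s \<otimes>\<^bsub>SA\<^esub> a \<in> J"
    proof (intro bexI[of _ "lmon 0 1"])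
      have "a \<in> SS" using I2(1) a by blast
      then show "lmon 0 1 \<otimes>\<^bsub>SA\<^esub> a \<in> J" using a I2J SA.l_one[of a] by auto
      show "lmon 0 1 \<in> carrier SA - ?R" using sS(3) F.\<Psi>K_one by simp
    qed
  next
    fix a assume a: "a \<in> J"
    \<comment> \<open>The elements that some function not vanishing at \<open>c\<close> multiplies
      into the square of \<open>?R\<close>. They form an ideal, so it suffices to treat the
      generators of \<open>J\<close>.\<close>
    let ?T = "{j \<in> SS. \<exists>b\<in>A - c. lmul (lmon 0 b) j \<in> ?I2}"
    have "gidl SS ?T" unfolding gidl_def
    proof (intro conjI ballI)
      have one: "1 \<in> A - c" using A_simps(2) CP_D(2)[OF c(1)] by simp
      have "lmul (lmon 0 1) (\<lambda>m. 0) \<in> ?I2" by (rule I2(4)[OF sS(3) I2(2)])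
      then show "?T \<subseteq> SS" "(\<lambda>m. 0) \<in> ?T" using sS(7) one by auto
      fix f g assume "g \<in> ?T"
      then obtain b where b: "g \<in> SS" "b \<in> A - c" "lmul (lmon 0 b) g \<in> ?I2" by blast
      have bS: "lmon 0 b \<in> SS" using SV_A[OF subset_refl] b by blast
      { assume "f \<in> ?T"
        then obtain d where d: "f \<in> SS" "d \<in> A - c" "lmul (lmon 0 d) f \<in> ?I2" by blast
        have dS: "lmon 0 d \<in> SS" using SV_A[OF subset_refl] d by blast
        have "lmul (lmon 0 (d * b)) (ladd f g) = ladd (lmul (lmon 0 b) (lmul (lmon 0 d) f)) (lmul (lmon 0 d) (lmul (lmon 0 b) g))"
          by (auto simp: fun_eq_iff lmul_mono ladd_def algebra_simps)
        also have "\<dots> \<in> ?I2" by (rule I2(3)[OF I2(4)[OF bS d(3)] I2(4)[OF dS b(3)]])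
        finally show "ladd f g \<in> ?T" using nx(1)[OF c(1) d(2) b(2)] sS(5)[OF d(1) b(1)] by blast }
      { assume f: "f \<in> SS"
        have l: "f \<in> lau" "g \<in> lau" using sS(2) f b by auto
        have "lmul (lmon 0 b) (lmul f g) = lmul f (lmul (lmon 0 b) g)"
          using lmul_laws(2)[OF mono_lau l, of 0 b] lmul_laws(2)[OF l(1) mono_lau l(2), of 0 b] lmul_laws(1)[OF l(1) mono_lau mono_lau, of 0 b] by simp
        also have "\<dots> \<in> ?I2" by (rule I2(4)[OF f b(3)])
        finally show "lmul f g \<in> ?T" using b(2) sS(6)[OF f b(1)] by blast }
    qed
    moreover have "lmon 0 ` c \<subseteq> ?T"
    proof
      fix f assume "f \<in> lmon 0 ` c"
      then obtain r where r: "f = lmon 0 r" "r \<in> c" by blast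
      \<comment> \<open>Elements attaining the bounds in degrees 1 and -1 lie in \<open>?R\<close>.
        Rounding adds 1 in total, so their product is a local equation of \<open>c\<close>.\<close>
      obtain e where e: "e \<noteq> 0" "ord_at C c e = dl c 1" "lmon 1 e \<in> SS" using piece_elem[OF c(1)] by metis
      obtain e' where e': "e' \<noteq> 0" "ord_at C c e' = dl c (- 1)" "lmon (- 1) e' \<in> SS" using piece_elem[OF c(1)] by metis
      have n1: "m \<notin> range ((*) 2)" if "odd m" for m :: int using that by auto
      have eR: "lmon 1 e \<in> ?R" "lmon (- 1) e' \<in> ?R"
        using F.psi_mono0[OF n1] e(3) e'(3) by (auto simp: F.\<Psi>K_def)
      have "lmon (- 1) e' \<otimes>\<^bsub>SA\<^esub> \<one>\<^bsub>SA\<^esub> \<in> ?I1" by (rule ideal_prod.prod[OF eR(2)]) (simp add: sS(3))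
      then have "lmon (- 1) e' \<in> ?I1" by (simp add: GA_mult)
      then have "lmon 1 e \<otimes>\<^bsub>SA\<^esub> lmon (- 1) e' \<in> ?I2" by (rule ideal_prod.prod[OF eR(1)])
      then have ee: "lmon 0 (e * e') \<in> ?I2" by (simp add: GA_mult)
      have "2 * (dl c 1 + dl c (- 1)) = 2" using half[of 1] half[of "- 1"] by simp
      then have oe: "ord_at C c (e * e') = 1" using ord_simps(1)[OF c(1) e(1) e'(1)] e e' by simp
      have e0: "e * e' \<noteq> 0" using e e' by simp
      have "vge c 1 (r / (e * e') * (e * e'))" using vc(10)[OF cA[OF r(2)]] r(2) e0 by simp
      then have "vge c 0 (r / (e * e'))" using vge_mult_iff[OF c(1) e0, of 1 "r / (e * e')", unfolded oe diff_self] by blast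
      then have "r / (e * e') \<in> lr c" using vc(7) by simp
      then obtain s b where sb: "r / (e * e') = s / b" "s \<in> A" "b \<in> A - c" by (auto simp: local_ring_def)
      have b0: "b \<noteq> 0" using nx(2)[OF c(1) sb(3) sb(3)] .
      have br: "b * r = s * (e * e')" using sb(1) b0 e0 by (simp add: field_simps)
      have "lmul (lmon 0 s) (lmon 0 (e * e')) \<in> ?I2" by (rule I2(4)[OF SV_A[OF subset_refl sb(2)] ee])
      then have "lmul (lmon 0 b) f \<in> ?I2" using br r(1) by simp
      then show "f \<in> ?T" using sb(3) SV_A[OF subset_refl cA[OF r(2)]] r(1) by blast
    qed
    ultimately have "J \<subseteq> ?T" by (rule J_ideal(4))
    then obtain b where b: "b \<in> A - c" "lmul (lmon 0 b) a \<in> ?I2" using a by blast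
    show "\<exists>s\<in>carrier SA - ?R. s \<otimes>\<^bsub>SA\<^esub> a \<in> ?I2"
      using b bR[of b] SV_A[OF subset_refl, of b] by (intro bexI[of _ "lmon 0 b"]) (auto simp: GA_mult)
  qed
  have cj: "F.\<psi> (rs.cj f) = dpd_conj cnj 1 (F.\<psi> f)" if f: "f \<in> SS" for f
  proof
    fix k
    have "rs.cj f (2 * k) * inverse h powi (- k) = \<tau> (f (2 * (- k)) * inverse h powi k)"
    proof -
      have "h powi (- (2 * k)) * inverse h powi (- k) = inverse h powi k"
        using h(1) by (simp add: power_int_inverse power_int_minus flip: power_int_add)
          (simp add: power_int_minus[symmetric] power_int_add[symmetric])
      then show ?thesis using h by (simp add: dpd_conj_def \<tau> \<tau>_powi \<tau>_inverse mult_ac)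
    qed
    moreover have "vge c 0 (f (2 * (- k)) * inverse h powi k)" using F.v0[OF f, of "- k"] by simp
    ultimately show "F.\<psi> (rs.cj f) k = dpd_conj cnj 1 (F.\<psi> f) k"
      using ev_tx[OF c(1), of "f (2 * (- k)) * inverse h powi k"] c(2) by (simp add: F.\<psi>_def dpd_conj_def)
  qed
  have mu: "carrier circle_mu2 = lau" "monoid.mult circle_mu2 = monoid.mult WW" "one circle_mu2 = one WW"
    "ring.zero circle_mu2 = ring.zero WW" "add circle_mu2 = add WW" "cst circle_mu2 = cst WW"
    "wt circle_mu2 = (\<lambda>f m. if even m then lmon (m div 2) (f (m div 2)) else (\<lambda>_. 0))"
    by (simp_all add: circle_mu2_def point_eq mk_gmalg_def mk_calg_def gmalg.defs calg.defs ring.defs GA_def cong: if_cong)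
  have "cring circle_mu2"
  proof (rule ring_iso_domain(1)[of "\<lambda>f. f" WW])
    show "(\<lambda>f. f) \<in> ring_iso WW circle_mu2" by (rule ring_iso_memI) (auto simp: mu bij_betw_def)
    show "cring WW" by (rule WL.R)
  qed (simp add: mu)
  moreover have "F.\<psi> \<in> ring_hom SA circle_mu2" using F.psi_hom unfolding ring_hom_def mu by simp
  ultimately obtain \<Phi> where \<Phi>: "gm_iso (gm_quot SA ?R) circle_mu2 \<Phi>" "\<And>a. a \<in> carrier SA \<Longrightarrow> \<Phi> (?R +>\<^bsub>SA\<^esub> a) = F.\<psi> a"
    "carrier (gm_quot SA ?R) = {?R +>\<^bsub>SA\<^esub> a | a. a \<in> carrier SA}"
    "\<And>\<sigma> a. (\<And>a b. a \<in> carrier SA \<Longrightarrow> b \<in> carrier SA \<Longrightarrow> F.\<psi> a = F.\<psi> b \<Longrightarrow> \<sigma> a \<in> carrier SA \<and> F.\<psi> (\<sigma> a) = F.\<psi> (\<sigma> b)) \<Longrightarrow>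
       a \<in> carrier SA \<Longrightarrow> quot_conj SA ?R \<sigma> (?R +>\<^bsub>SA\<^esub> a) = ?R +>\<^bsub>SA\<^esub> \<sigma> a"
  proof (rule gm_quot_iso[OF SA.is_cring])
    show "F.\<psi> ` carrier SA = carrier circle_mu2" using F.psi_onto by (simp add: mu)
    show "?R = {a \<in> carrier SA. F.\<psi> a = \<zero>\<^bsub>circle_mu2\<^esub>}" by (simp add: F.\<Psi>K_def mu)
    show "cst SA z \<in> carrier SA" for z using SV_A[OF subset_refl \<kappa>(1)] by simp
    show "F.\<psi> (cst SA z) = cst circle_mu2 z" for z by (simp add: mu F.psi_const)
    show "wt SA a m \<in> carrier SA" if "a \<in> carrier SA" for a m using that graded_SV[OF subset_refl] by (simp add: graded_def)
    show "F.\<psi> (wt SA a m) = wt circle_mu2 (F.\<psi> a) m" for a m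
    proof (cases "even m")
      case True
      then obtain k where k: "m = 2 * k" by (elim evenE)
      show ?thesis using F.psi_mono[of k "a m"] k by (simp add: mu F.\<psi>_def)
    next
      case False
      then have "m \<notin> (*) 2 ` UNIV" by auto
      then show ?thesis using F.psi_mono0[of m "a m"] False by (simp add: mu)
    qed
  qed blast
  have "S1_iso (gm_quot SA ?R) (quot_conj SA ?R rs.cj) circle_mu2 circle_conj \<Phi>"
    unfolding S1_iso_def
  proof (intro conjI ballI \<Phi>(1))
    fix Y assume "Y \<in> carrier (gm_quot SA ?R)"
    then obtain a where a: "a \<in> SS" "Y = ?R +>\<^bsub>SA\<^esub> a" unfolding \<Phi>(3) by auto
    have "quot_conj SA ?R rs.cj Y = ?R +>\<^bsub>SA\<^esub> rs.cj a" unfolding a(2)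
      by (rule \<Phi>(4)) (use a(1) cjS cj in auto)
    then show "\<Phi> (quot_conj SA ?R rs.cj Y) = circle_conj (\<Phi> Y)"
      using \<Phi>(2)[of a] \<Phi>(2)[of "rs.cj a"] a cjS cj by (simp add: circle_conj_eq)
  qed
  then show "\<exists>\<phi>. S1_iso (gm_quot SA (radical_ideal SA J)) (quot_conj SA (radical_ideal SA J) rs.cj) circle_mu2 circle_conj \<phi>"
    unfolding rad by blast
  have okz: "F.L.ok z \<longleftrightarrow> z \<noteq> 0" for z using F.ok_iff by auto
  have fib: "fibre_points C SA (lmon 0) c = {F.L.yz z | z. z \<noteq> 0}"
  proof (rule subset_antisym; rule subsetI)
    fix y assume "y \<in> fibre_points C SA (lmon 0) c"
    then have y: "maximalideal y SA" "J \<subseteq> y" unfolding fibre_points_iff by auto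
    have "?R \<subseteq> y"
    proof
      fix f assume f: "f \<in> ?R"
      then have "lmul f f \<in> y" using RR y(2) by blast
      then show "f \<in> y" using prime_max_SA[OF y(1)] R(1) f by blast
    qed
    then obtain z where "F.L.ok z" "y = F.L.yz z" by (rule F.points[OF y(1)])
    then show "y \<in> {F.L.yz z | z. z \<noteq> 0}" using okz by blast
  next
    fix y assume "y \<in> {F.L.yz z | z. z \<noteq> 0}"
    then show "y \<in> fibre_points C SA (lmon 0) c" using F.yz_fibre okz by blast
  qed
  \<comment> \<open>Every nonzero complex number is a square, so a single orbit fills the component
    although the group acts through \<open>t^2\<close>.\<close>
  have "orbit_of SA (F.L.yz 1) = {F.L.yz z | z. z \<noteq> 0}"
  proof -
    have "\<exists>t. t \<noteq> 0 \<and> z = t powi 2" if "z \<noteq> 0" for z :: complex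
      using that by (intro exI[of _ "csqrt z"]) simp
    then show ?thesis unfolding F.orbit_yz by auto
  qed
  moreover have "F.L.ok 1" unfolding okz by simp
  ultimately have "gm_orbit SA (fibre_points C SA (lmon 0) c)" unfolding gm_orbit_def fib
    by (intro bexI[of _ "F.L.yz 1"]) (simp_all only: cp_iff F.L.yz_maximal)
  \<comment> \<open>An equivariant \<open>\<theta>\<close> kills the odd degrees, so its values are
    even functions on the multiplicative group; no immersion can then separate the points 1 and
    -1.\<close>
  moreover have "\<not> principal_orbit SA (fibre_points C SA (lmon 0) c)"
  proof
    assume "principal_orbit SA (fibre_points C SA (lmon 0) c)"
    then obtain \<theta> where \<theta>: "gm_hom SA WW \<theta>" "immersion SA WW \<theta>" "spec_map SA \<theta> ` closed_points WW = {F.L.yz z | z. z \<noteq> 0}"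
      unfolding principal_orbit_def circle_GA(1) fib by blast
    have \<theta>l: "\<theta> a \<in> lau" if "a \<in> SS" for a using \<theta>(1) that by (auto simp: gm_hom_def calg_hom_def dest: ring_hom_memE(1))
    have \<theta>w: "lmon m (\<theta> a m) = \<theta> (lmon m (a m))" if "a \<in> SS" for a m using \<theta>(1) that by (simp add: gm_hom_def)
    have Rz: "\<theta> a = (\<lambda>m. 0)" if a: "a \<in> ?R" for a
    proof (rule evl_all_zero)
      show "\<theta> a \<in> lau" using \<theta>l R(1) a by blast
      fix z :: complex assume z: "z \<noteq> 0"
      have "WL.yz z \<in> closed_points WW" unfolding W_points using z by blast
      then have "spec_map SA \<theta> (WL.yz z) \<in> {F.L.yz z | z. z \<noteq> 0}" using \<theta>(3) by blast
      then have "a \<in> spec_map SA \<theta> (WL.yz z)" using F.yz_contains a by blast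
      then show "evl z (\<theta> a) = 0" by (simp add: spec_map_def W_yz)
    qed
    have odd0: "\<theta> a m = 0" if a: "a \<in> SS" "odd m" for a m
    proof -
      have "m \<notin> (*) 2 ` UNIV" using a(2) by auto
      then have "lmon m (a m) \<in> ?R" using graded_SV[OF subset_refl] a(1) F.psi_mono0[of m "a m"] by (auto simp: F.\<Psi>K_def graded_def)
      then have "lmon m (\<theta> a m) = (\<lambda>m. 0)" using Rz \<theta>w[OF a(1)] by simp
      then show ?thesis by (simp add: mono_eq0)
    qed
    have even: "evl (- 1) (\<theta> a) = evl 1 (\<theta> a)" if a: "a \<in> SS" for a
    proof -
      have "\<theta> a m * (- 1) powi m = \<theta> a m * 1 powi m" for m using odd0[OF a, of m] by (cases "even m") auto
      then show ?thesis by (simp only: evl_def)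
    qed
    have "WL.yz 1 \<in> closed_points WW" unfolding W_points by auto
    then obtain g where g: "g \<in> carrier SA - spec_map SA \<theta> (WL.yz 1)"
      "\<forall>b\<in>carrier WW. \<exists>a\<in>carrier SA. \<exists>n::nat. \<theta> g [^]\<^bsub>WW\<^esub> n \<otimes>\<^bsub>WW\<^esub> b = \<theta> a" using \<theta>(2) unfolding immersion_def by blast
    have gS: "g \<in> SS" using g by simp
    have g1: "evl 1 (\<theta> g) \<noteq> 0" using g(1) \<theta>l[OF gS] by (simp add: spec_map_def W_yz)
    obtain a k where a: "a \<in> SS" "\<theta> g [^]\<^bsub>WW\<^esub> (k::nat) \<otimes>\<^bsub>WW\<^esub> lmon 1 1 = \<theta> a" using g(2) mono_lau by (metis GA_simps(1))
    have pl: "\<theta> g [^]\<^bsub>WW\<^esub> k \<in> lau" for k :: nat using WL.R.nat_pow_closed[of "\<theta> g" k] \<theta>l[OF gS] by simp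
    have pw: "evl z (\<theta> g [^]\<^bsub>WW\<^esub> k) = evl z (\<theta> g) ^ k" if "z \<noteq> 0" for z and k :: nat
    proof (induction k)
      case (Suc k) then show ?case using evl_mult[OF pl \<theta>l[OF gS]] that pl by (simp add: GA_mult)
    qed simp
    have "evl z (\<theta> a) = evl z (\<theta> g) ^ k * z" if "z \<noteq> 0" for z
      using evl_mult[OF pl mono_lau, of z k 1 1] that pl pw[OF that] by (simp add: GA_mult flip: a(2))
    \<comment> \<open>Evenness of \<open>\<theta> a\<close> and \<open>\<theta> g\<close> makes the
      power of the value of \<open>\<theta> g\<close> at 1 equal to its own negative.\<close>
    from this[of 1] this[of "- 1"] even[OF a(1)] even[OF gS] have "evl 1 (\<theta> g) ^ k = 0" by simp
    then show False using g1 by simp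
  qed
  moreover have "spec_map SA rs.cj ` fibre_points C SA (lmon 0) c = fibre_points C SA (lmon 0) c"
  proof -
    have s: "spec_map SA rs.cj (F.L.yz z) = F.L.yz (1 / cnj z)" if z: "z \<noteq> 0" for z
      using evl_conj[OF z, of 1] cj cjS by (auto simp: spec_map_def F.L.yz_def)
    show ?thesis unfolding fib
    proof (rule subset_antisym; rule subsetI)
      fix y assume "y \<in> spec_map SA rs.cj ` {F.L.yz z | z. z \<noteq> 0}"
      then obtain z where z: "z \<noteq> 0" "y = F.L.yz (1 / cnj z)" using s by auto
      then have "1 / cnj z \<noteq> 0" by simp
      then show "y \<in> {F.L.yz z | z. z \<noteq> 0}" using z(2) by blast
    next
      fix y assume "y \<in> {F.L.yz z | z. z \<noteq> 0}"
      then obtain z where z: "z \<noteq> 0" "y = F.L.yz z" by blast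
      have "1 / cnj z \<noteq> 0" using z by simp
      moreover have "y = spec_map SA rs.cj (F.L.yz (1 / cnj z))" using s[OF calculation] z by simp
      ultimately show "y \<in> spec_map SA rs.cj ` {F.L.yz z | z. z \<noteq> 0}" by blast
    qed
  qed
  ultimately show "exceptional_S1_orbit SA rs.cj (fibre_points C SA (lmon 0) c)"
    unfolding exceptional_S1_orbit_def exceptional_orbit_def by blast
qed

end

section \<open>Crossing fibres\<close>

context dpdc begin

text \<open>For integral \<open>D c\<close> nothing is rounded, and the bound is linear on either
  side of 0, with slopes differing by \<open>n - 2 * d\<close>.\<close>

lemma dl_integer:
  assumes "D c = of_int d" shows "dl c m = - m * d + (n - 2 * d) * max 0 (- m)"
proof (cases "m \<ge> 0")
  case True
  have "- (of_int m * of_int d) = (of_int (- m * d) :: rat)" by simp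
  then have "dl c m = - m * d" using True assms unfolding dl_def by (simp only: if_True ceiling_of_int)
  then show ?thesis using True by simp
next
  case False
  have "Dm c = of_int (d - n)" using assms c(2) by (simp add: Dm)
  then have "of_int m * Dm c = (of_int (m * (d - n)) :: rat)" by simp
  then have "dl c m = m * (d - n)" using False unfolding dl_def by (simp only: if_False ceiling_of_int)
  then show ?thesis using False by (simp add: algebra_simps)
qed

lemma crossing_fibre:
  assumes dD: "D c = of_int d" and nd: "n = 2 * d + 1"
  shows "radical_ideal SA J = J"
    "\<exists>Op Om p. principal_orbit SA Op \<and> principal_orbit SA Om \<and> Op \<noteq> Om \<and>
           spec_map SA rs.cj ` Op = Om \<and> spec_map SA rs.cj ` Om = Op \<and>
           fibre_points C SA (lmon 0) c = zclosure SA Op \<union> zclosure SA Om \<and>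
           is_affine_line SA (zclosure SA Op) \<and> is_affine_line SA (zclosure SA Om) \<and>
           zclosure SA Op \<inter> zclosure SA Om = {p} \<and>
           transversal_at SA (\<Inter>(zclosure SA Op)) (\<Inter>(zclosure SA Om)) p \<and>
           p \<in> closed_points SA \<and> orbit_of SA p = {p} \<and> spec_map SA rs.cj p = p"
proof -
  have dl: "dl c m = - m * d + max 0 (- m)" for m using dl_integer[OF dD, of m] nd by simp
  obtain u where u: "u \<noteq> 0" "ord_at C c u = - d" using ord_ex[OF c(1)] by metis
  \<comment> \<open>The conjugate of \<open>u\<close> in degree 1 is \<open>?v\<close> in degree -1;
    with this choice conjugation exchanges the coordinates of the two faces without a
    scalar.\<close>
  let ?v = "h * \<tau> u"
  have tu: "\<tau> u \<noteq> 0" using u by simp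
  have ov: "ord_at C c ?v = d + 1"
    using ord_simps(1)[OF c(1) h(1) tu] ord_tx[OF c(1) u(1)] c(2) u(2) nd by simp
  interpret P: face C \<tau> D h c 1 u "{0..}"
  proof unfold_locales
    show "u \<noteq> 0" by fact
    show "dl c (1 * k) = k * ord_at C c u" if "k \<in> {0..}" for k using dl[of k] that u by simp
    fix i j k :: int assume ij: "i + j = 1 * k" "k \<in> {0..}" "i \<notin> (*) 1 ` {0..} \<or> j \<notin> (*) 1 ` {0..}"
    \<comment> \<open>Off this face one degree is negative, and the break of the bound at 0 costs at
      least 1.\<close>
    have "max 0 (- i) + max 0 (- j) \<ge> 1" using ij by auto
    moreover have "(i + j) * d = k * d" using ij(1) by simp
    then have "- i * d + - j * d = - k * d" by (simp add: distrib_right)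
    ultimately show "dl c (1 * k) + 1 \<le> dl c i + dl c j" using dl[of i] dl[of j] dl[of k] ij(2) by simp
  qed auto
  interpret N: face C \<tau> D h c "- 1" "?v" "{0..}"
  proof unfold_locales
    show "?v \<noteq> 0" using h u by simp
    show "dl c (- 1 * k) = k * ord_at C c ?v" if "k \<in> {0..}" for k using dl[of "- k"] that ov by (simp add: algebra_simps)
    fix i j k :: int assume ij: "i + j = - 1 * k" "k \<in> {0..}" "i \<notin> (*) (- 1) ` {0..} \<or> j \<notin> (*) (- 1) ` {0..}"
    have im: "m \<in> (*) (- 1) ` {0..}" if "m \<le> 0" for m :: int using that by (auto intro!: image_eqI[of _ _ "- m"])
    have "i > 0 \<or> j > 0" using ij(3) im by force
    \<comment> \<open>A positive degree has to be compensated by one below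
      \<open>- k\<close>.\<close>
    then have "max 0 (- i) + max 0 (- j) \<ge> k + 1" using ij(1,2) by auto
    moreover have "(i + j) * d = - k * d" using ij(1) by simp
    then have "- i * d + - j * d = k * d" by (simp add: distrib_right)
    ultimately show "dl c (- 1 * k) + 1 \<le> dl c i + dl c j" using dl[of i] dl[of j] dl[of "- k"] ij(2) by simp
  qed auto
  have okP: "P.L.ok z" and okN: "N.L.ok z" for z using P.ok_iff N.ok_iff by simp_all
  \<comment> \<open>The two faces together cover all degrees, so zero leading coefficients on both
    mean that every bound is exceeded.\<close>
  have JPN: "P.\<Psi>K \<inter> N.\<Psi>K = J"
  proof (rule subset_antisym; rule subsetI)
    fix f assume "f \<in> P.\<Psi>K \<inter> N.\<Psi>K"
    then have f: "f \<in> SS" "P.\<psi> f = (\<lambda>m. 0)" "N.\<psi> f = (\<lambda>m. 0)" by (auto simp: P.\<Psi>K_def N.\<Psi>K_def)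
    show "f \<in> J"
    proof (rule J_super[OF f(1)])
      fix m
      show "vge c (dl c m + 1) (f m)"
      proof (cases "m \<ge> 0")
        case True then show ?thesis using P.psi_zero_iff[OF f(1)] f(2) by auto
      next
        case False
        then have "- m \<in> {0..}" by simp
        then have "vge c (dl c (- 1 * (- m)) + 1) (f (- 1 * (- m)))" using N.psi_zero_iff[OF f(1)] f(3) by blast
        then show ?thesis by simp
      qed
    qed
  qed (use P.J_\<Psi>K N.J_\<Psi>K in auto)
  note gP = gidl_SS[OF P.\<Psi>K_gidl] and gN = gidl_SS[OF N.\<Psi>K_gidl]
  show "radical_ideal SA J = J"
  proof (rule subset_antisym; rule subsetI)
    fix f assume "f \<in> radical_ideal SA J"
    then obtain k :: nat where f: "f \<in> SS" "f [^]\<^bsub>SA\<^esub> k \<in> J" by (auto simp: radical_ideal_def)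
    have k: "f [^]\<^bsub>SA\<^esub> k \<in> P.\<Psi>K" "f [^]\<^bsub>SA\<^esub> k \<in> N.\<Psi>K" using f(2) JPN by auto
    show "f \<in> J" unfolding JPN[symmetric] using P.\<Psi>K_pow[OF f(1) k(1)] N.\<Psi>K_pow[OF f(1) k(2)] by blast
  next
    fix f assume f: "f \<in> J"
    then have fS: "f \<in> SS" using J_ideal(2) by (auto simp: gidl_def)
    then have "f [^]\<^bsub>SA\<^esub> (1::nat) = f" using SA.nat_pow_eone[of f] by simp
    then show "f \<in> radical_ideal SA J" unfolding radical_ideal_def using f fS by (auto intro!: exI[of _ "1::nat"])
  qed
  have cjP: "P.\<psi> (rs.cj f) = (\<lambda>k. cnj (N.\<psi> f k))" if f: "f \<in> SS" for f
  proof
    fix k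
    show "P.\<psi> (rs.cj f) k = cnj (N.\<psi> f k)"
    proof (cases "k \<in> {0..}")
      case True
      let ?g = "f (- 1 * k) * ?v powi (- k)"
      have "rs.cj f (1 * k) * u powi (- k) = \<tau> ?g"
        by (simp add: dpd_conj_def \<tau> \<tau>_powi power_int_mult_distrib h mult_ac)
      moreover have "vge c 0 ?g" by (rule N.v0[OF f True])
      ultimately show ?thesis using ev_tx[OF c(1), of ?g] c(2) True by (simp add: P.\<psi>_def N.\<psi>_def)
    qed (auto simp: P.\<psi>_def N.\<psi>_def)
  qed
  have cjN: "N.\<psi> (rs.cj f) = (\<lambda>k. cnj (P.\<psi> f k))" if f: "f \<in> SS" for f
  proof -
    have "P.\<psi> f = (\<lambda>k. cnj (N.\<psi> (rs.cj f) k))" using cjP[OF cjS[OF f]] by (simp add: rs.cj_cj)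
    then show ?thesis by simp
  qed
  have smP: "spec_map SA rs.cj (P.L.yz z) = N.L.yz (cnj z)" for z
    using cjP cjS evl_cnj by (auto simp: spec_map_def P.L.yz_def N.L.yz_def)
  have smN: "spec_map SA rs.cj (N.L.yz z) = P.L.yz (cnj z)" for z
    using cjN cjS evl_cnj by (auto simp: spec_map_def P.L.yz_def N.L.yz_def)
  define Op where "Op = {P.L.yz z | z. z \<noteq> 0}"
  define Om where "Om = {N.L.yz z | z. z \<noteq> 0}"
  define p where "p = P.L.yz 0"
  have zP: "zclosure SA Op = range P.L.yz" "\<Inter>(zclosure SA Op) = P.\<Psi>K" unfolding Op_def using P.zcl by auto
  have zN: "zclosure SA Om = range N.L.yz" "\<Inter>(zclosure SA Om) = N.\<Psi>K" unfolding Om_def using N.zcl by auto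
  \<comment> \<open>A function of degree 1 that restricts to the coordinate of the first line
    vanishes on the second, so the lines can meet only where that coordinate is 0.\<close>
  obtain g where "lmon (1 * 1) g \<in> SS" "P.\<psi> (lmon (1 * 1) g) = lmon 1 1" using P.psi_img_mono[of 1 1] by auto
  then have g: "lmon 1 g \<in> SS" "P.\<psi> (lmon 1 g) = lmon 1 1" by simp_all
  have "1 \<notin> (*) (- 1) ` {0::int..}" by auto
  then have gN0: "lmon 1 g \<in> N.\<Psi>K" using N.psi_mono0[of 1 g] g(1) by (simp add: N.\<Psi>K_def)
  have meet: "z = 0" if "P.L.yz z = N.L.yz w" for z w
  proof -
    have "lmon 1 g \<in> P.L.yz z" unfolding that using gN0 N.yz_contains by blast
    then show ?thesis using g by (simp add: P.L.yz_def)
  qed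
  \<comment> \<open>At \<open>z = 0\<close> only degree 0 survives, and it belongs to both
    faces.\<close>
  have P0: "P.L.yz 0 = {f \<in> SS. ev c (f 0) = 0}"
    using evl_0[OF P.psi_lau P.psi_pos] by (auto simp: P.L.yz_def P.\<psi>_def)
  have N0: "N.L.yz 0 = {f \<in> SS. ev c (f 0) = 0}"
    using evl_0[OF N.psi_lau N.psi_pos] by (auto simp: N.L.yz_def N.\<psi>_def)
  have PN0: "N.L.yz 0 = P.L.yz 0" using P0 N0 by simp
  have pmax: "maximalideal p SA" unfolding p_def by (rule P.L.yz_maximal[OF okP])
  note pg = gidl_SS[OF max_gidl[OF pmax]]
  have "principal_orbit SA Op" unfolding Op_def by (rule P.principal_face) auto
  moreover have "principal_orbit SA Om" unfolding Om_def by (rule N.principal_face) auto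
  moreover have "Op \<noteq> Om"
  proof
    assume "Op = Om"
    then have "P.L.yz 1 \<in> Om" unfolding Op_def by auto
    then obtain w where "P.L.yz 1 = N.L.yz w" unfolding Om_def by blast
    then show False using meet by force
  qed
  moreover have "spec_map SA rs.cj ` Op = Om"
  proof (rule subset_antisym; rule subsetI)
    fix y assume "y \<in> spec_map SA rs.cj ` Op"
    then obtain z where z: "z \<noteq> 0" "y = N.L.yz (cnj z)" unfolding Op_def using smP by auto
    then show "y \<in> Om" unfolding Om_def by (intro CollectI exI[of _ "cnj z"]) simp
  next
    fix y assume "y \<in> Om"
    then obtain z where z: "z \<noteq> 0" "y = N.L.yz z" unfolding Om_def by blast
    then have "P.L.yz (cnj z) \<in> Op" unfolding Op_def by (intro CollectI exI[of _ "cnj z"]) simp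
    then show "y \<in> spec_map SA rs.cj ` Op" by (rule rev_image_eqI) (simp add: smP z)
  qed
  moreover have "spec_map SA rs.cj ` Om = Op"
  proof (rule subset_antisym; rule subsetI)
    fix y assume "y \<in> spec_map SA rs.cj ` Om"
    then obtain z where z: "z \<noteq> 0" "y = P.L.yz (cnj z)" unfolding Om_def using smN by auto
    then show "y \<in> Op" unfolding Op_def by (intro CollectI exI[of _ "cnj z"]) simp
  next
    fix y assume "y \<in> Op"
    then obtain z where z: "z \<noteq> 0" "y = P.L.yz z" unfolding Op_def by blast
    then have "N.L.yz (cnj z) \<in> Om" unfolding Om_def by (intro CollectI exI[of _ "cnj z"]) simp
    then show "y \<in> spec_map SA rs.cj ` Om" by (rule rev_image_eqI) (simp add: smN z)
  qed
  moreover have "fibre_points C SA (lmon 0) c = zclosure SA Op \<union> zclosure SA Om"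
    unfolding zP(1) zN(1)
  proof (rule subset_antisym; rule subsetI)
    fix y assume "y \<in> fibre_points C SA (lmon 0) c"
    then have y: "maximalideal y SA" "J \<subseteq> y" unfolding fibre_points_iff by auto
    \<comment> \<open>A prime ideal that contains the intersection of two ideals contains one of
      them.\<close>
    have "P.\<Psi>K \<subseteq> y \<or> N.\<Psi>K \<subseteq> y"
    proof (rule ccontr)
      assume "\<not> ?thesis"
      then obtain f e where fe: "f \<in> P.\<Psi>K" "f \<notin> y" "e \<in> N.\<Psi>K" "e \<notin> y" by blast
      have S: "f \<in> SS" "e \<in> SS" using gP(1) gN(1) fe by auto
      have "lmul e f \<in> P.\<Psi>K" by (rule gP(4)[OF S(2) fe(1)])
      moreover have "lmul f e \<in> N.\<Psi>K" by (rule gN(4)[OF S(1) fe(3)])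
      moreover have "lmul e f = lmul f e" by (rule lmul_laws(1)[OF sS(2)[OF S(2)] sS(2)[OF S(1)] mono_lau])
      ultimately have "lmul f e \<in> y" using y(2) JPN by auto
      then show False using prime_max_SA[OF y(1) S] fe by blast
    qed
    then show "y \<in> range P.L.yz \<union> range N.L.yz"
    proof
      assume "P.\<Psi>K \<subseteq> y" then obtain z where "y = P.L.yz z" by (rule P.points[OF y(1)])
      then show ?thesis by blast
    next
      assume "N.\<Psi>K \<subseteq> y" then obtain z where "y = N.L.yz z" by (rule N.points[OF y(1)])
      then show ?thesis by blast
    qed
  next
    fix y assume "y \<in> range P.L.yz \<union> range N.L.yz"
    then show "y \<in> fibre_points C SA (lmon 0) c" using P.yz_fibre[OF okP] N.yz_fibre[OF okN] by blast
  qed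
  moreover have "is_affine_line SA (zclosure SA Op)" unfolding Op_def by (rule P.affine_line_face) simp
  moreover have "is_affine_line SA (zclosure SA Om)" unfolding Om_def by (rule N.affine_line_face) simp
  moreover have "zclosure SA Op \<inter> zclosure SA Om = {p}" unfolding zP(1) zN(1)
  proof (rule subset_antisym; rule subsetI)
    fix y assume "y \<in> range P.L.yz \<inter> range N.L.yz"
    then obtain z w where "y = P.L.yz z" "y = N.L.yz w" by blast
    then show "y \<in> {p}" using meet[of z w] by (simp add: p_def)
  next
    fix y assume "y \<in> {p}"
    then have "y = P.L.yz 0" "y = N.L.yz 0" by (simp_all add: p_def PN0)
    then show "y \<in> range P.L.yz \<inter> range N.L.yz" by blast
  qed
  moreover have "transversal_at SA (\<Inter>(zclosure SA Op)) (\<Inter>(zclosure SA Om)) p"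
    unfolding transversal_at_def zP(2) zN(2) locally_equal_def
  proof (intro conjI ballI)
    show Pp: "P.\<Psi>K \<subseteq> p" unfolding p_def by (rule P.yz_contains)
    show Np: "N.\<Psi>K \<subseteq> p" unfolding p_def PN0[symmetric] by (rule N.yz_contains)
    have one: "lmon 0 1 \<in> carrier SA - p" using sS(3) ev_simps(3)[OF c(1)] by (simp add: p_def P0)
    have l1: "lmon 0 1 \<otimes>\<^bsub>SA\<^esub> a = a" if "a \<in> SS" for a using SA.l_one[of a] that by simp
    { fix a assume "a \<in> P.\<Psi>K <+>\<^bsub>SA\<^esub> N.\<Psi>K"
      then obtain f e where fe: "f \<in> P.\<Psi>K" "e \<in> N.\<Psi>K" "a = ladd f e" unfolding set_add_def' by auto
      then have "a \<in> p" using pg(3) Pp Np by blast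
      moreover from this have "a \<in> SS" using pg(1) by blast
      ultimately show "\<exists>s\<in>carrier SA - p. s \<otimes>\<^bsub>SA\<^esub> a \<in> p" using one l1 by (intro bexI[of _ "lmon 0 1"]) auto }
    fix a assume a: "a \<in> p"
    then have aS: "a \<in> SS" and a0: "ev c (a 0) = 0" by (auto simp: p_def P0)
    \<comment> \<open>Split \<open>a\<close> by the sign of the degree. The positive part has no
      component on the negative face; the rest meets the positive face only in degree 0, where its
      value at \<open>c\<close> vanishes.\<close>
    define f1 where "f1 m = (if m \<le> 0 then a m else 0)" for m
    define f2 where "f2 m = (if m \<le> 0 then 0 else a m)" for m
    have fin: "finite {m. a m \<noteq> 0}" using sS(2)[OF aS] by (simp add: lau_def)
    have "{m. f1 m \<noteq> 0} \<subseteq> {m. a m \<noteq> 0}" "{m. f2 m \<noteq> 0} \<subseteq> {m. a m \<noteq> 0}" by (auto simp: f1_def f2_def)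
    then have "f1 \<in> lau" "f2 \<in> lau" using fin finite_subset by (auto simp: lau_def)
    then have S: "f1 \<in> SS" "f2 \<in> SS" using SV_D(2)[OF aS] vge_simps(1) by (auto simp: SV_def f1_def f2_def)
    have e0: "ev c 0 = 0" by (rule ev_simps(2)[OF c(1)])
    have "P.\<psi> f1 k = 0" for k
      using a0 e0 by (cases "k = 0") (auto simp: P.\<psi>_def f1_def)
    then have 1: "f1 \<in> P.\<Psi>K" using S by (auto simp: P.\<Psi>K_def)
    have "N.\<psi> f2 k = 0" for k using e0 by (auto simp: N.\<psi>_def f2_def)
    then have 2: "f2 \<in> N.\<Psi>K" using S by (auto simp: N.\<Psi>K_def)
    have "a = f1 \<oplus>\<^bsub>SA\<^esub> f2" by (auto simp: ladd_def f1_def f2_def)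
    then have "a \<in> P.\<Psi>K <+>\<^bsub>SA\<^esub> N.\<Psi>K" unfolding set_add_def' using 1 2 by blast
    then show "\<exists>s\<in>carrier SA - p. s \<otimes>\<^bsub>SA\<^esub> a \<in> P.\<Psi>K <+>\<^bsub>SA\<^esub> N.\<Psi>K"
      using one l1[OF aS] by (intro bexI[of _ "lmon 0 1"]) auto
  qed
  moreover have "p \<in> closed_points SA" unfolding cp_iff by (rule pmax)
  moreover have "orbit_of SA p = {p}" unfolding p_def P.orbit_yz by (auto intro: exI[of _ 1])
  moreover have "spec_map SA rs.cj p = p" unfolding p_def smP by (simp add: PN0)
  ultimately show "\<exists>Op Om p. principal_orbit SA Op \<and> principal_orbit SA Om \<and> Op \<noteq> Om \<and>
           spec_map SA rs.cj ` Op = Om \<and> spec_map SA rs.cj ` Om = Op \<and>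
           fibre_points C SA (lmon 0) c = zclosure SA Op \<union> zclosure SA Om \<and>
           is_affine_line SA (zclosure SA Op) \<and> is_affine_line SA (zclosure SA Om) \<and>
           zclosure SA Op \<inter> zclosure SA Om = {p} \<and>
           transversal_at SA (\<Inter>(zclosure SA Op)) (\<Inter>(zclosure SA Om)) p \<and>
           p \<in> closed_points SA \<and> orbit_of SA p = {p} \<and> spec_map SA rs.cj p = p"
    by (intro exI[of _ Op] exI[of _ Om] exI[of _ p] conjI)
qed

end

section \<open>Torsor fibres\<close>

lemma rstruct_cnj: "l = 1 \<or> l = - 1 \<Longrightarrow> rstruct cnj (\<lambda>z. z) l"
  by unfold_locales (auto simp: khom_def)

text \<open>Over a point one trivialization suffices: \<open>\<Phi>\<close> itself is one, with
  \<open>f = 1\<close>. The action is transported from the model.\<close>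

lemma S1_torsor_point:
  fixes F :: "('a, 'm) gmalg_scheme"
  assumes iso: "S1_iso F \<sigma>F WW (dpd_conj cnj l) \<Phi>" and l: "l = 1 \<or> l = - 1" and F: "domain F"
    and cF: "\<And>z. cst F z \<in> carrier F" and wF: "\<And>x m. x \<in> carrier F \<Longrightarrow> wt F x m \<in> carrier F"
    and sF: "\<And>x. x \<in> carrier F \<Longrightarrow> \<sigma>F x \<in> carrier F"
  shows "S1_torsor point cnj F \<sigma>F (cst F)"
proof -
  interpret F: domain F by fact
  interpret r: rstruct cnj "\<lambda>z. z" l using l by (rule rstruct_cnj)
  note lD = lsubD[OF lsub_lau]
  have "S1_action WW r.cj" by (rule r.S1_action_GA[OF lsub_lau _ mono_lau r.cj_lau]) (simp_all add: graded_def)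
  then have act: "S1_action F \<sigma>F" by (rule S1_action_transport[OF iso _ F.is_cring cF wF sF])
  then have g: "gm_action F" "real_structure F \<sigma>F" by (auto simp: S1_action_def)
  have i: "\<Phi> \<in> ring_iso F WW" "\<And>z. \<Phi> (cst F z) = lmon 0 z" "\<And>x m. x \<in> carrier F \<Longrightarrow> \<Phi> (wt F x m) = lmon m (\<Phi> x m)"
    using iso by (auto simp: S1_iso_def gm_iso_def gm_hom_def calg_hom_def)
  note e = ring_iso_memE[OF i(1)]
  have triv: "gm_trivial_on point F (cst F) 1" unfolding point_eq
  proof (rule triv.gm_trivial, rule triv.intro)
    show "sring (UNIV :: complex set)" by (simp add: sring_def)
    show "\<Phi> \<in> ring_hom F WW" using i(1) by (simp add: ring_iso_def)
    show "inj_on \<Phi> (carrier F)" using e(5) by (simp add: bij_betw_def)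
    fix m and b :: complex
    have "lmon m b \<in> \<Phi> ` carrier F" using e(5) by (simp add: bij_betw_def)
    then show "\<exists>a\<in>carrier F. \<exists>j::nat. \<Phi> a = lmon m (1 ^ j * b)" by auto
  qed (auto simp: khom_def i cF wF F.is_cring)
  show ?thesis unfolding S1_torsor_def gm_torsor_def
  proof (intro conjI ballI)
    show "real_structure point cnj" by (auto simp: real_structure_def point_eq ring_hom_def)
    show "cst F (cnj b) = \<sigma>F (cst F b)" for b using g(2) by (simp add: real_structure_def)
    show "calg_hom point F (cst F)" "wt F (cst F b) = lmonom F 0 (cst F b)" for b using g(1) by (auto simp: gm_action_def)
    fix y assume "y \<in> closed_points point"
    then have "1 \<notin> y" using maxidl_one by (auto simp: point_eq closed_points_coord sring_def)
    then show "\<exists>f\<in>carrier point - y. gm_trivial_on point F (cst F) f" using triv by (auto simp: point_eq)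
  qed (use act g F in auto)
qed

lemma trivial_S1_torsor_point:
  assumes "S1_iso F \<sigma>F WW (dpd_conj cnj 1) \<Phi>" shows "trivial_S1_torsor point cnj F \<sigma>F (cst F)"
  unfolding trivial_S1_torsor_def circle_GA(1) circle_conj_eq(1)[unfolded circle_conj_def]
proof (intro exI conjI ballI)
  show "\<Phi> (cst F b) = lmonom point 0 b" for b
    using assms by (simp add: S1_iso_def gm_iso_def gm_hom_def calg_hom_def point_eq)
qed (rule assms)

text \<open>The element \<open>E\<close> corresponding to the coordinate satisfies
  \<open>E * \<sigma>F E = - 1\<close>, whereas a trivialization would turn this product into
  \<open>a * cnj a\<close>.\<close>

lemma nontrivial_S1_torsor_point:
  assumes iso: "S1_iso F \<sigma>F WW (dpd_conj cnj (- 1)) \<Phi>" and F: "cring F"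
    and cF: "\<And>z. cst F z \<in> carrier F" and wF: "\<And>x m. x \<in> carrier F \<Longrightarrow> wt F x m \<in> carrier F"
    and sF: "\<And>x. x \<in> carrier F \<Longrightarrow> \<sigma>F x \<in> carrier F"
  shows "\<not> trivial_S1_torsor point cnj F \<sigma>F (cst F)"
proof
  interpret F: cring F by fact
  interpret r: rstruct cnj "\<lambda>z. z" "- 1" by (rule rstruct_cnj) simp
  interpret r1: rstruct cnj "\<lambda>z. z" 1 by (rule rstruct_cnj) simp
  assume "trivial_S1_torsor point cnj F \<sigma>F (cst F)"
  then obtain \<phi> where \<phi>: "S1_iso F \<sigma>F WW (dpd_conj cnj 1) \<phi>"
    unfolding trivial_S1_torsor_def circle_GA(1) circle_conj_eq(1)[unfolded circle_conj_def] by blast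
  have i: "\<Phi> \<in> ring_iso F WW" "\<And>z. \<Phi> (cst F z) = lmon 0 z" "\<And>x m. x \<in> carrier F \<Longrightarrow> \<Phi> (wt F x m) = lmon m (\<Phi> x m)"
    "\<And>x. x \<in> carrier F \<Longrightarrow> \<Phi> (\<sigma>F x) = dpd_conj cnj (- 1) (\<Phi> x)"
    using iso by (auto simp: S1_iso_def gm_iso_def gm_hom_def calg_hom_def)
  have j: "\<phi> \<in> ring_iso F WW" "\<And>z. \<phi> (cst F z) = lmon 0 z" "\<And>x m. x \<in> carrier F \<Longrightarrow> \<phi> (wt F x m) = lmon m (\<phi> x m)"
    "\<And>x. x \<in> carrier F \<Longrightarrow> \<phi> (\<sigma>F x) = dpd_conj cnj 1 (\<phi> x)"
    using \<phi> by (auto simp: S1_iso_def gm_iso_def gm_hom_def calg_hom_def)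
  note e = ring_iso_memE[OF i(1)] and e' = ring_iso_memE[OF j(1)]
  have "lmon 1 1 \<in> \<Phi> ` carrier F" using e(5) by (simp add: bij_betw_def)
  then obtain E where E: "E \<in> carrier F" "\<Phi> E = lmon 1 1" by auto
  have inj: "x = y" if "x \<in> carrier F" "y \<in> carrier F" "\<Phi> x = \<Phi> y" for x y
    using e(5) that by (auto simp: bij_betw_def inj_on_def)
  have "wt F E 1 = E" by (rule inj) (simp_all add: E wF i(3))
  then obtain a where a: "\<phi> E = lmon 1 a" using j(3)[OF E(1), of 1] by metis
  have "E \<otimes>\<^bsub>F\<^esub> \<sigma>F E = cst F (- 1)"
    by (rule inj) (simp_all add: E sF cF e(2) i(2,4) GA_mult r.cj_mono)
  then have "\<phi> E \<otimes>\<^bsub>WW\<^esub> \<phi> (\<sigma>F E) = lmon 0 (- 1)" using e'(2)[OF E(1) sF[OF E(1)]] j(2) by simp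
  then have "lmon 0 (a * cnj a) = lmon 0 (- 1 :: complex)" using j(4)[OF E(1)] by (simp add: a GA_mult r1.cj_mono)
  then have "a * cnj a = - 1" by (metis mono_simps(1))
  then have "complex_of_real ((cmod a)\<^sup>2) = of_real (- 1)" by (simp only: complex_norm_square of_real_minus of_real_1)
  then have "(cmod a)\<^sup>2 = - 1" by (simp only: of_real_eq_iff)
  then show False using zero_le_power2[of "cmod a"] by linarith
qed

context curve begin

lemma ev_powi:
  assumes y: "y \<in> CP" and f: "f \<noteq> 0" "ord_at C y f = 0" shows "ev y (f powi k) = ev y f powi k"
proof -
  have v: "vge y 0 (f powi j)" for j using f ord_simps(3)[OF y f(1), of j] by (simp add: vge_def)
  have nat: "ev y (f ^ j) = ev y f ^ j" for j
  proof (induction j)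
    case (Suc j) then show ?case using ev_simps(5)[OF y, of f "f ^ j"] v[of 1] v[of "int j"] by simp
  qed (simp add: ev_simps(3)[OF y])
  show ?thesis
  proof (cases k)
    case (nonneg j) then show ?thesis using nat by simp
  next
    case (neg j)
    have "ev y (f powi k) * ev y (f ^ Suc j) = ev y (f powi k * f ^ Suc j)"
      using ev_simps(5)[OF y v[of k] v[of "int (Suc j)"]] by (simp only: power_int_of_nat)
    also have "f powi k * f ^ Suc j = 1" using neg f(1) by (simp add: power_int_minus del: of_nat_Suc power_Suc)
    finally have "ev y (f powi k) * ev y f ^ Suc j = 1" using ev_simps(3)[OF y] by (simp only: nat)
    then have "ev y (f powi k) = inverse (ev y f ^ Suc j)" by (metis inverse_unique mult.commute)
    then show ?thesis using neg by (simp add: power_int_minus del: of_nat_Suc)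
  qed
qed

end

context dpdc begin

text \<open>For \<open>u\<close> of order \<open>- d\<close> at \<open>c\<close>, the function
  \<open>h * u * \<tau> u\<close> has a nonzero real value at \<open>c\<close>. Rescaling
  \<open>u\<close> by a constant multiplies it by a positive number, so it can be made 1 or -1; this
  sign \<open>l\<close> decides the form of the circle.\<close>

lemma torsor_fibre:
  assumes dD: "D c = of_int d" and nd: "n = 2 * d"
  obtains \<Phi> l where "l = 1 \<or> l = - 1" "S1_iso (gm_quot SA J) (quot_conj SA J rs.cj) WW (dpd_conj cnj l) \<Phi>"
    "domain (gm_quot SA J)" "\<And>z. cst (gm_quot SA J) z \<in> carrier (gm_quot SA J)"
    "\<And>Y m. Y \<in> carrier (gm_quot SA J) \<Longrightarrow> wt (gm_quot SA J) Y m \<in> carrier (gm_quot SA J)"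
    "\<And>Y. Y \<in> carrier (gm_quot SA J) \<Longrightarrow> quot_conj SA J rs.cj Y \<in> carrier (gm_quot SA J)"
    "(\<exists>y\<in>fibre_points C SA (lmon 0) c. spec_map SA rs.cj y = y) \<longleftrightarrow> l = 1"
proof -
  have dl: "dl c m = - m * d" for m using dl_integer[OF dD] nd by simp
  obtain u0 where u0: "u0 \<noteq> 0" "ord_at C c u0 = - d" using ord_ex[OF c(1)] by metis
  have tu0: "\<tau> u0 \<noteq> 0" "ord_at C c (\<tau> u0) = - d" using u0 ord_tx[OF c(1) u0(1)] c(2) by simp_all
  let ?r = "h * (u0 * \<tau> u0)"
  have r: "?r \<noteq> 0" "ord_at C c ?r = 0" "\<tau> ?r = ?r"
    using h u0 tu0 ord_simps(1)[OF c(1) h(1), of "u0 * \<tau> u0"] ord_simps(1)[OF c(1) u0(1) tu0(1)] nd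
    by (simp_all add: \<tau> mult.commute)
  have vr: "vge c 0 ?r" "\<not> vge c 1 ?r" using r by (simp_all add: vge_def)
  \<comment> \<open>\<open>?r\<close> is fixed by \<open>\<tau>\<close> and \<open>c\<close> is
    real, so the value is fixed by conjugation.\<close>
  have "ev c ?r \<in> \<real>" using ev_tx[OF c(1), of ?r] vr(1) c(2) r(3) by (simp add: Reals_cnj_iff)
  then obtain s where s: "ev c ?r = complex_of_real s" by (rule Reals_cases)
  have s0: "s \<noteq> 0" using s ev_simps(6)[OF c(1) vr(1)] vr(2) by auto
  \<comment> \<open>Rescaling \<open>u0\<close> by \<open>\<rho>\<close> divides the value
    \<open>s\<close> by |s|.\<close>
  define \<rho> where "\<rho> = complex_of_real (1 / sqrt \<bar>s\<bar>)"
  have \<rho>: "\<rho> \<noteq> 0" "cnj \<rho> = \<rho>" using s0 by (simp_all add: \<rho>_def)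
  define u where "u = \<kappa> \<rho> * u0"
  have u: "u \<noteq> 0" "ord_at C c u = - d"
    using u0 \<rho>(1) \<kappa>_eq0 ord_simps(1)[OF c(1) _ u0(1), of "\<kappa> \<rho>"] ord_simps(5)[OF c(1) \<rho>(1)] by (simp_all add: u_def)
  have tu: "\<tau> u \<noteq> 0" "ord_at C c (\<tau> u) = - d" using u ord_tx[OF c(1) u(1)] c(2) by simp_all
  let ?g = "h * (u * \<tau> u)"
  have g: "?g \<noteq> 0" "ord_at C c ?g = 0"
    using h(1) u tu ord_simps(1)[OF c(1) h(1), of "u * \<tau> u"] ord_simps(1)[OF c(1) u(1) tu(1)] nd by simp_all
  define l where "l = ev c ?g"
  have "?g = \<kappa> (\<rho> * \<rho>) * ?r" by (simp add: u_def \<tau> \<rho>(2) mult_ac)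
  then have "l = \<rho> * \<rho> * of_real s" unfolding l_def using ev_simps(5)[OF c(1) vc(9)[OF \<kappa>(1)] vr(1), of "\<rho> * \<rho>"]
    by (simp only: ev_simps(1)[OF c(1)] s)
  also have "\<dots> = of_real (s / \<bar>s\<bar>)" using s0 by (simp add: \<rho>_def flip: of_real_mult)
  finally have l: "l = 1 \<or> l = - 1" using s0 by (cases "s > 0") (auto simp: abs_if)
  interpret F: face C \<tau> D h c 1 u UNIV
  proof unfold_locales
    show "dl c (1 * k) = k * ord_at C c u" for k using dl[of k] u by simp
  qed (use u in auto)
  have K: "F.\<Psi>K = J"
  proof (rule subset_antisym[OF _ F.J_\<Psi>K]; rule subsetI)
    fix f assume "f \<in> F.\<Psi>K"
    then have f: "f \<in> SS" "F.\<psi> f = (\<lambda>m. 0)" by (auto simp: F.\<Psi>K_def)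
    show "f \<in> J" by (rule J_super[OF f(1)]) (use F.psi_zero_iff[OF f(1)] f(2) in auto)
  qed
  have cj: "F.\<psi> (rs.cj f) = dpd_conj cnj l (F.\<psi> f)" if f: "f \<in> SS" for f
  proof
    fix k
    let ?f = "f (1 * (- k)) * u powi (- (- k))"
    have vf: "vge c 0 ?f" by (rule F.v0[OF f]) simp
    have vt: "vge c 0 (\<tau> ?f)" using vge_tx[OF c(1), of 0 ?f] vf c(2) by simp
    \<comment> \<open>Passing from powers of \<open>\<tau> u\<close> back to powers of
      \<open>u\<close> leaves the factor \<open>?g powi (- k)\<close>, whose value at
      \<open>c\<close> is the twist.\<close>
    have "rs.cj f (1 * k) * u powi (- k) = ?g powi (- k) * \<tau> ?f"
      using tu(1) by (simp add: dpd_conj_def \<tau> \<tau>_powi power_int_mult_distrib mult_ac power_int_minus)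
    moreover have "vge c 0 (?g powi (- k))" using g ord_simps(3)[OF c(1) g(1), of "- k"] by (simp add: vge_def)
    ultimately have "F.\<psi> (rs.cj f) k = l powi (- k) * ev c (\<tau> ?f)"
      using ev_simps(5)[OF c(1) _ vt] ev_powi[OF c(1) g, of "- k"] by (simp add: F.\<psi>_def l_def)
    moreover have "ev c (\<tau> ?f) = cnj (F.\<psi> f (- k))" using ev_tx[OF c(1), of ?f] vf c(2) by (simp add: F.\<psi>_def)
    ultimately show "F.\<psi> (rs.cj f) k = dpd_conj cnj l (F.\<psi> f) k" by (simp add: dpd_conj_def)
  qed
  have cS: "cst SA z \<in> carrier SA" for z using SV_A[OF subset_refl \<kappa>(1)] by simp
  have wS: "wt SA a m \<in> carrier SA" if "a \<in> carrier SA" for a m using that graded_SV[OF subset_refl] by (simp add: graded_def)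
  obtain \<Phi> where \<Phi>: "gm_iso (gm_quot SA J) WW \<Phi>" "\<And>a. a \<in> carrier SA \<Longrightarrow> \<Phi> (J +>\<^bsub>SA\<^esub> a) = F.\<psi> a"
    "carrier (gm_quot SA J) = {J +>\<^bsub>SA\<^esub> a | a. a \<in> carrier SA}"
    "\<And>a m. a \<in> carrier SA \<Longrightarrow> wt (gm_quot SA J) (J +>\<^bsub>SA\<^esub> a) m = J +>\<^bsub>SA\<^esub> wt SA a m"
    "\<And>\<sigma> a. (\<And>a b. a \<in> carrier SA \<Longrightarrow> b \<in> carrier SA \<Longrightarrow> F.\<psi> a = F.\<psi> b \<Longrightarrow> \<sigma> a \<in> carrier SA \<and> F.\<psi> (\<sigma> a) = F.\<psi> (\<sigma> b)) \<Longrightarrow>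
       a \<in> carrier SA \<Longrightarrow> quot_conj SA J \<sigma> (J +>\<^bsub>SA\<^esub> a) = J +>\<^bsub>SA\<^esub> \<sigma> a"
  proof (rule gm_quot_iso[OF SA.is_cring WL.R])
    show "F.\<psi> \<in> ring_hom SA WW" by (rule F.psi_hom)
    show "F.\<psi> ` carrier SA = carrier WW" using F.psi_onto by simp
    show "J = {a \<in> carrier SA. F.\<psi> a = \<zero>\<^bsub>WW\<^esub>}" unfolding K[symmetric] by (simp add: F.\<Psi>K_def)
    show "F.\<psi> (cst SA z) = cst WW z" for z by (simp add: F.psi_const)
    show "F.\<psi> (wt SA a m) = wt WW (F.\<psi> a) m" for a m using F.psi_mono[of m "a m"] by (simp add: F.\<psi>_def)
  qed (rule cS wS | assumption | blast)+
  have qc: "quot_conj SA J rs.cj (J +>\<^bsub>SA\<^esub> a) = J +>\<^bsub>SA\<^esub> rs.cj a" if "a \<in> SS" for a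
    by (rule \<Phi>(5)) (use that cjS cj in auto)
  have fib: "y \<in> fibre_points C SA (lmon 0) c \<longleftrightarrow> (\<exists>z. z \<noteq> 0 \<and> y = F.L.yz z)" for y
  proof
    assume "y \<in> fibre_points C SA (lmon 0) c"
    then have y: "maximalideal y SA" "F.\<Psi>K \<subseteq> y" unfolding fibre_points_iff K by auto
    obtain z where "F.L.ok z" "y = F.L.yz z" by (rule F.points[OF y])
    then show "\<exists>z. z \<noteq> 0 \<and> y = F.L.yz z" using F.ok_iff by auto
  next
    assume "\<exists>z. z \<noteq> 0 \<and> y = F.L.yz z"
    then show "y \<in> fibre_points C SA (lmon 0) c" using F.yz_fibre F.ok_iff by auto
  qed
  have sm: "spec_map SA rs.cj (F.L.yz z) = F.L.yz (l / cnj z)" if z: "z \<noteq> 0" for z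
    using evl_conj[OF z l] cj cjS by (auto simp: spec_map_def F.L.yz_def)
  have rp: "(\<exists>y\<in>fibre_points C SA (lmon 0) c. spec_map SA rs.cj y = y) \<longleftrightarrow> l = 1"
  proof
    assume "l = 1"
    then have "spec_map SA rs.cj (F.L.yz 1) = F.L.yz 1" using sm[of 1] by simp
    moreover have "F.L.yz 1 \<in> fibre_points C SA (lmon 0) c" unfolding fib by (intro exI[of _ 1]) simp
    ultimately show "\<exists>y\<in>fibre_points C SA (lmon 0) c. spec_map SA rs.cj y = y" by (rule rev_bexI[rotated])
  next
    assume "\<exists>y\<in>fibre_points C SA (lmon 0) c. spec_map SA rs.cj y = y"
    then obtain z where z: "z \<noteq> 0" "F.L.yz (l / cnj z) = F.L.yz z" using fib sm by auto
    \<comment> \<open>The function \<open>t - z\<close> separates the points of the fibre, so a real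
      point has \<open>l = z * cnj z\<close>, which rules out the value -1.\<close>
    have "ladd (lmon 0 (- z)) (lmon 1 1) \<in> F.\<psi> ` SS" unfolding F.psi_onto[OF refl]
      using lsubD(5)[OF lsub_lau mono_lau mono_lau] by blast
    then obtain e where e: "e \<in> SS" "F.\<psi> e = ladd (lmon 0 (- z)) (lmon 1 1)" by auto
    have ee: "evl w (F.\<psi> e) = w - z" for w unfolding e(2) using evl_add[OF mono_lau mono_lau, of w 0 "- z" 1 1] by simp
    have "e \<in> F.L.yz z" using e(1) ee by (simp add: F.L.yz_def)
    then have "e \<in> F.L.yz (l / cnj z)" using z(2) by simp
    then have "l / cnj z = z" using ee by (simp add: F.L.yz_def)
    then have "l = z * cnj z" using z(1) by (simp add: field_simps)
    then have "l = of_real ((cmod z)\<^sup>2)" by (simp only: complex_norm_square)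
    moreover have "(cmod z)\<^sup>2 \<noteq> - 1" using zero_le_power2[of "cmod z"] by linarith
    then have "complex_of_real ((cmod z)\<^sup>2) \<noteq> of_real (- 1)" by (simp only: of_real_eq_iff not_False_eq_True)
    ultimately show "l = 1" using l by auto
  qed
  have pJ: "primeideal J SA" using F.\<Psi>K_prime K by simp
  have dF: "domain (gm_quot SA J)"
  proof (rule ring_iso_domain(2)[of "\<lambda>Y. Y" "SA Quot J"])
    show "domain (SA Quot J)" by (rule primeideal.quotient_is_domain[OF pJ])
    show "(\<lambda>Y. Y) \<in> ring_iso (SA Quot J) (gm_quot SA J)"
      by (rule ring_iso_memI) (simp_all add: bij_betw_def SA.ring_axioms
        monoid.m_closed[OF ring.axioms(2)[OF ideal.quotient_is_ring[OF J_ideal(1)]]])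
  qed simp
  show ?thesis
  proof (rule that[OF l _ dF _ _ _ rp])
    show "cst (gm_quot SA J) z \<in> carrier (gm_quot SA J)" for z unfolding \<Phi>(3) using cS by auto
    show "wt (gm_quot SA J) Y m \<in> carrier (gm_quot SA J)" if Y: "Y \<in> carrier (gm_quot SA J)" for Y m
    proof -
      obtain a where a: "a \<in> carrier SA" "Y = J +>\<^bsub>SA\<^esub> a" using Y unfolding \<Phi>(3) by blast
      show ?thesis unfolding a(2) \<Phi>(4)[OF a(1)] unfolding \<Phi>(3) by (intro CollectI exI conjI, rule refl) (rule wS[OF a(1)])
    qed
    show "quot_conj SA J rs.cj Y \<in> carrier (gm_quot SA J)" if Y: "Y \<in> carrier (gm_quot SA J)" for Y
    proof -
      obtain a where "a \<in> carrier SA" and a: "Y = J +>\<^bsub>SA\<^esub> a" using Y unfolding \<Phi>(3) by blast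
      then have aS: "a \<in> SS" by simp
      have "rs.cj a \<in> carrier SA" using cjS[OF aS] by simp
      then show ?thesis unfolding a qc[OF aS] \<Phi>(3) by (intro CollectI exI conjI) (rule refl)
    qed
    show "S1_iso (gm_quot SA J) (quot_conj SA J rs.cj) WW (dpd_conj cnj l) \<Phi>" unfolding S1_iso_def
    proof (intro conjI ballI \<Phi>(1))
      fix Y assume "Y \<in> carrier (gm_quot SA J)"
      then obtain a where "a \<in> carrier SA" and a: "Y = J +>\<^bsub>SA\<^esub> a" unfolding \<Phi>(3) by blast
      then have aS: "a \<in> SS" by simp
      show "\<Phi> (quot_conj SA J rs.cj Y) = dpd_conj cnj l (\<Phi> Y)"
        unfolding a qc[OF aS] using \<Phi>(2)[of a] \<Phi>(2)[of "rs.cj a"] aS cjS[OF aS] cj[OF aS] by simp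
    qed
  qed
qed

end

section \<open>The three cases\<close>

lemma regular_pair_integer:
  assumes reg: "regular_pair r s" and s: "s = r - of_int k \<or> s = of_int k - r"
  shows "r \<in> \<int>"
proof -
  obtain p q where r: "quotient_of r = (p, q)" by (cases "quotient_of r")
  obtain p' q' where s': "quotient_of s = (p', q')" by (cases "quotient_of s")
  have q: "q > 0" "q' > 0" using quotient_of_denom_pos[OF r] quotient_of_denom_pos[OF s'] .
  have eq: "r = of_int p / of_int q" "s = of_int p' / of_int q'" using quotient_of_div[OF r] quotient_of_div[OF s'] .
  have one: "\<bar>p * q' - p' * q\<bar> = 1" using reg r s' by (simp add: regular_pair_def)
  have "(of_int (p' * q) :: rat) = of_int ((p - k * q) * q') \<or> (of_int (p' * q) :: rat) = of_int ((k * q - p) * q')"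
    using s q unfolding eq by (auto simp: field_simps)
  then have "q' dvd p' * q" unfolding of_int_eq_iff by auto
  then have "q' dvd p * q' - p' * q" by simp
  then have "q' dvd 1" using one by (metis dvd_abs_iff)
  then have "s = of_int p'" using q(2) eq(2) by simp
  then have "r = of_int (p' + k) \<or> r = of_int (k - p')" using s by auto
  then show ?thesis using Ints_of_int by metis
qed

text \<open>Two elements cannot span a space with three independent functionals. The pair
  \<open>k3\<close>, \<open>l3\<close> makes the first two vectors parallel; the pair
  \<open>k1\<close>, \<open>l1\<close> kills the second but not the first, so the second vector is
  zero.\<close>

lemma minors_contradiction:
  fixes x1 :: "'a::field"
  assumes a1: "k1 * x1 + l1 * y1 \<noteq> 0" "k1 * x2 + l1 * y2 = 0" and a2: "k2 * x2 + l2 * y2 \<noteq> 0"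
    and a3: "k3 * x3 + l3 * y3 \<noteq> 0" "k3 * x1 + l3 * y1 = 0" "k3 * x2 + l3 * y2 = 0"
  shows False
proof -
  have "k3 * (x1 * y2 - x2 * y1) = (k3 * x1 + l3 * y1) * y2 - (k3 * x2 + l3 * y2) * y1"
    "l3 * (x1 * y2 - x2 * y1) = (k3 * x2 + l3 * y2) * x1 - (k3 * x1 + l3 * y1) * x2" by (simp_all add: algebra_simps)
  then have m: "x1 * y2 = x2 * y1" using a3 by auto
  have "(k1 * x1 + l1 * y1) * x2 = x1 * (k1 * x2 + l1 * y2) + l1 * (x2 * y1 - x1 * y2)"
    "(k1 * x1 + l1 * y1) * y2 = y1 * (k1 * x2 + l1 * y2) + k1 * (x1 * y2 - x2 * y1)" by (simp_all add: algebra_simps)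
  then have "(k1 * x1 + l1 * y1) * x2 = 0" "(k1 * x1 + l1 * y1) * y2 = 0"
    by (simp_all only: a1(2) m diff_self mult_zero_right add_0)
  then have "x2 = 0" "y2 = 0" using a1(1) by (metis mult_eq_0_iff)+
  then show False using a2 by simp
qed

context dpdc begin

text \<open>Division by \<open>w\<close> moves the common order to 0, where the error term has value
  0.\<close>

lemma ev_linear:
  assumes v: "vge c q a" "vge c q a1" "vge c q a2" and r: "vge c (q + 1) (a - (\<kappa> k * a1 + \<kappa> l * a2))"
    and w: "w \<noteq> 0" "ord_at C c w = q"
  shows "ev c (a / w) = k * ev c (a1 / w) + l * ev c (a2 / w)"
proof -
  have iw: "inverse w \<noteq> 0" "ord_at C c (inverse w) = - q" using w ord_simps(2)[OF c(1) w(1)] by simp_all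
  have dv: "vge c m (f / w) \<longleftrightarrow> vge c (m + q) f" for m f
    using vge_mult_iff[OF c(1) iw(1), of m f] iw(2) by (simp add: divide_inverse)
  have v': "vge c 0 (a / w)" "vge c 0 (a1 / w)" "vge c 0 (a2 / w)" using v by (simp_all add: dv)
  have vk: "vge c 0 (\<kappa> z)" for z by (rule vc(9)[OF \<kappa>(1)])
  let ?b = "\<kappa> k * a1 + \<kappa> l * a2"
  have s: "ev c (\<kappa> z * f) = z * ev c f" "vge c 0 (\<kappa> z * f)" if "vge c 0 f" for z f
    using ev_simps(5)[OF c(1) vk that] ev_simps(1)[OF c(1)] vc(3)[OF vk that] by simp_all
  have "a / w = (a - ?b) / w + (\<kappa> k * (a1 / w) + \<kappa> l * (a2 / w))" by (simp add: diff_divide_distrib add_divide_distrib)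
  moreover have r': "vge c 1 ((a - ?b) / w)" using r by (simp add: dv add.commute)
  then have r0: "vge c 0 ((a - ?b) / w)" by (rule vc(4)) simp
  then have "ev c ((a - ?b) / w) = 0" using r' ev_simps(6)[OF c(1)] by blast
  ultimately show ?thesis
    using ev_simps(4)[OF c(1) r0 vc(2)[OF s(2)[OF v'(2), of k] s(2)[OF v'(3), of l]]]
      ev_simps(4)[OF c(1) s(2)[OF v'(2), of k] s(2)[OF v'(3), of l]] s(1)[OF v'(2), of k] s(1)[OF v'(3), of l] by simp
qed

text \<open>
  If \<open>n \<ge> 2 * d + 2\<close>, then the leading coefficients in degrees \<open>1\<close>, \<open>0\<close> and \<open>-1\<close> are three
  independent functionals on the cotangent space at the fixed point.
\<close>

lemma smooth_crossing:
  assumes dD: "D c = of_int d" and nd: "2 * d < n"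
    and smooth: "\<And>y. maximalideal y SA \<Longrightarrow> cotangent_dim SA y 2"
  shows "n = 2 * d + 1"
proof (rule ccontr)
  assume "n \<noteq> 2 * d + 1"
  define N where "N = n - 2 * d"
  have N: "N \<ge> 2" using \<open>n \<noteq> 2 * d + 1\<close> nd by (simp add: N_def)
  have dl: "dl c m = - m * d + N * max 0 (- m)" for m unfolding N_def by (rule dl_integer[OF dD])
  have dl2: "dl c i + dl c j - dl c (i + j) = N * (max 0 (- i) + max 0 (- j) - max 0 (- (i + j)))" for i j
    unfolding dl by (simp add: algebra_simps)
  \<comment> \<open>The slopes of the bound differ by \<open>N \<ge> 2\<close>, so multiplying
    degrees of opposite sign costs at least 2.\<close>
  have gap: "dl c i + dl c j \<ge> dl c (i + j) + 2 * (max 0 (- i) + max 0 (- j) - max 0 (- (i + j)))" for i j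
  proof -
    have "max 0 (- i) + max 0 (- j) - max 0 (- (i + j)) \<ge> 0" by (auto simp: max_def)
    from mult_right_mono[OF N this] show ?thesis using dl2[of i j] by linarith
  qed
  obtain u where u: "u \<noteq> 0" "ord_at C c u = - d" using ord_ex[OF c(1)] by metis
  interpret P: face C \<tau> D h c 1 u "{0..}"
  proof unfold_locales
    show "dl c (1 * k) = k * ord_at C c u" if "k \<in> {0..}" for k using dl[of k] that u by simp
    fix i j k :: int assume ij: "i + j = 1 * k" "k \<in> {0..}" "i \<notin> (*) 1 ` {0..} \<or> j \<notin> (*) 1 ` {0..}"
    then have "max 0 (- i) + max 0 (- j) - max 0 (- (i + j)) \<ge> 1" by auto
    then show "dl c (1 * k) + 1 \<le> dl c i + dl c j" using gap[of i j] ij(1) by simp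
  qed (use u in auto)
  define p where "p = P.L.yz 0"
  have p: "f \<in> p \<longleftrightarrow> f \<in> SS \<and> ev c (f 0) = 0" for f
    using evl_0[OF P.psi_lau P.psi_pos] by (auto simp: p_def P.L.yz_def P.\<psi>_def)
  have pmax: "maximalideal p SA" unfolding p_def by (rule P.L.yz_maximal) (simp add: P.ok_iff)
  \<comment> \<open>The least order at \<open>c\<close> in degree \<open>m\<close> of an element of
    \<open>p\<close>; in degree 0 such an element vanishes at \<open>c\<close>.\<close>
  define q where "q m = dl c m + (if m = 0 then 1 else 0)" for m
  have pq: "vge c (q m) (f m)" if "f \<in> p" for f m
    using that p[of f] SV_D(2)[of f CP c m] c(1) ev_simps(6)[OF c(1), of "f 0"] by (auto simp: q_def)
  let ?M = "{- 1, 0, 1} :: int set"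
  have prod: "vge c (q m + 1) (f m)" if f: "f \<in> ideal_prod SA p p" and m: "m \<in> ?M" for f m
    using f
  proof induction
    case (prod f g)
    have "f \<in> lau" using prod(1) p sS(2) by blast
    moreover have "vge c (q m + 1) (lmul f g m)" unfolding lmul_def
    proof (rule vc(11))
      fix i
      \<comment> \<open>In the degrees -1, 0 and 1 a product of two elements of \<open>p\<close>
        exceeds \<open>q\<close> by 1: a factor of degree 0 gains 1 by vanishing at
        \<open>c\<close>, and factors of opposite sign gain 2.\<close>
      have "2 * (max 0 (- i) + max 0 (- (m - i)) - max 0 (- m)) + (if i = 0 then 1 else 0) + (if m - i = 0 then 1 else 0)
          \<ge> (if m = 0 then 2 else 1)"
        using m by (auto simp: max_def)
      then have "q m + 1 \<le> q i + q (m - i)" using gap[of i "m - i"] by (auto simp: q_def split: if_splits)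
      then show "vge c (q m + 1) (f i * g (m - i))" by (rule vc(4)[OF vc(3)[OF pq[OF prod(1)] pq[OF prod(2)]]])
    qed
    ultimately show ?case by (simp add: GA_mult)
  next
    case (sum f g) then show ?case using vc(2) by (simp add: ladd_def)
  qed
  have "\<exists>w. w \<noteq> 0 \<and> ord_at C c w = q m \<and> lmon m w \<in> p" if "m \<in> ?M" for m
  proof (cases "m = 0")
    case True
    obtain w where w: "w \<noteq> 0" "ord_at C c w = 1" "\<And>y. y \<in> CP \<Longrightarrow> y \<noteq> c \<Longrightarrow> vge y 0 w"
      using ord_approx[OF c(1), of "\<lambda>_. 0" 1] by auto
    have v: "vge c 1 w" using w by (simp add: vge_def)
    then have v0: "vge c 0 w" by (rule vc(4)) simp
    then have "lmon 0 w \<in> SS" unfolding SV_mono[OF subset_refl] using w(3) by (metis dl0)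
    moreover have "ev c w = 0" using ev_simps(6)[OF c(1) v0] v by blast
    ultimately show ?thesis using w True p by (intro exI[of _ w]) (simp add: q_def)
  next
    case False
    obtain w where "w \<noteq> 0" "ord_at C c w = dl c m" "lmon m w \<in> SS" using piece_elem[OF c(1)] by metis
    then show ?thesis using False p ev_simps(2)[OF c(1)] by (intro exI[of _ w]) (simp add: q_def)
  qed
  \<comment> \<open>The monomial \<open>lmon m (w m)\<close> has leading coefficient 1 in degree
    \<open>m\<close> and 0 in the other two degrees, so the functionals \<open>?e\<close> are
    independent.\<close>
  then obtain w where w: "\<And>m. m \<in> ?M \<Longrightarrow> w m \<noteq> 0 \<and> ord_at C c (w m) = q m \<and> lmon m (w m) \<in> p" by metis
  obtain v :: "nat \<Rightarrow> int \<Rightarrow> 'k" where v: "(\<forall>i<2. v i \<in> p) \<and>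
      (\<forall>a\<in>p. \<exists>!k. (\<forall>i\<ge>2. k i = 0) \<and> a \<ominus>\<^bsub>SA\<^esub> finsum SA (\<lambda>i. cst SA (k i) \<otimes>\<^bsub>SA\<^esub> v i) {..<2} \<in> ideal_prod SA p p)"
    using smooth[OF pmax] unfolding cotangent_dim_def by (elim exE) (rule that)
  have vp: "v i \<in> p" if "i < 2" for i using v that by simp
  have vS: "v i \<in> SS" if "i < 2" for i using vp[OF that] p by blast
  let ?e = "\<lambda>m f. ev c (f m / w m)"
  \<comment> \<open>The functionals \<open>?e\<close> vanish on the square of \<open>p\<close>,
    modulo which two vectors span.\<close>
  have span: "\<exists>k l. \<forall>m\<in>?M. ?e m a = k * ?e m (v 0) + l * ?e m (v 1)" if a: "a \<in> p" for a
  proof -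
    obtain k where k: "a \<ominus>\<^bsub>SA\<^esub> finsum SA (\<lambda>i. cst SA (k i) \<otimes>\<^bsub>SA\<^esub> v i) {..<2} \<in> ideal_prod SA p p"
      using bspec[OF conjunct2[OF v] a] by (elim ex1E conjE) (rule that)
    have aS: "a \<in> SS" using a p by blast
    have t: "cst SA (k i) \<otimes>\<^bsub>SA\<^esub> v i = (\<lambda>m. \<kappa> (k i) * v i m)" "(\<lambda>m. \<kappa> (k i) * v i m) \<in> SS" if "i < 2" for i
    proof -
      have 1: "lmul (lmon 0 (\<kappa> (k i))) (v i) = (\<lambda>m. \<kappa> (k i) * v i m)" by (rule ext) (simp add: lmul_mono)
      then show "cst SA (k i) \<otimes>\<^bsub>SA\<^esub> v i = (\<lambda>m. \<kappa> (k i) * v i m)" by (simp add: GA_mult)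
      have "lmul (lmon 0 (\<kappa> (k i))) (v i) \<in> SS" by (rule sS(6)[OF SV_A[OF subset_refl \<kappa>(1)] vS[OF that]])
      then show "(\<lambda>m. \<kappa> (k i) * v i m) \<in> SS" unfolding 1 .
    qed
    have "finsum SA (\<lambda>i. cst SA (k i) \<otimes>\<^bsub>SA\<^esub> v i) {..<2} = finsum SA (\<lambda>i m. \<kappa> (k i) * v i m) {..<2}"
      by (rule SA.finsum_cong') (use t in auto)
    also have "\<dots> = (\<lambda>m. \<Sum>i<2. \<kappa> (k i) * v i m)" by (rule GA_finsum[OF lS]) (use t in auto)
    finally have fs: "finsum SA (\<lambda>i. cst SA (k i) \<otimes>\<^bsub>SA\<^esub> v i) {..<2} = (\<lambda>m. \<Sum>i<2. \<kappa> (k i) * v i m)" .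
    moreover have "(\<lambda>m. \<Sum>i<2. \<kappa> (k i) * v i m) \<in> SS" by (rule lsub_sum[OF lS]) (use t in auto)
    ultimately have d: "(\<lambda>m. a m - (\<kappa> (k 0) * v 0 m + \<kappa> (k 1) * v 1 m)) \<in> ideal_prod SA p p"
      using k unfolding fs a_minus_def by (simp add: GA_a_inv[OF lS] ladd_def numeral_2_eq_2 algebra_simps)
    have "?e m a = k 0 * ?e m (v 0) + k 1 * ?e m (v 1)" if m: "m \<in> ?M" for m
      by (rule ev_linear[OF pq[OF a] pq[OF vp] pq[OF vp] prod[OF d m]]) (use w[OF m] in auto)
    then show ?thesis by blast
  qed
  have dual: "\<exists>k l. k * ?e m (v 0) + l * ?e m (v 1) \<noteq> 0 \<and> (\<forall>j\<in>?M - {m}. k * ?e j (v 0) + l * ?e j (v 1) = 0)" if m: "m \<in> ?M" for m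
  proof -
    obtain k l where kl: "\<And>j. j \<in> ?M \<Longrightarrow> ?e j (lmon m (w m)) = k * ?e j (v 0) + l * ?e j (v 1)" using span w[OF m] by meson
    have "?e m (lmon m (w m)) = 1" using w[OF m] ev_simps(3)[OF c(1)] by simp
    then have "k * ?e m (v 0) + l * ?e m (v 1) \<noteq> 0" using kl[OF m] by simp
    moreover have "k * ?e j (v 0) + l * ?e j (v 1) = 0" if j: "j \<in> ?M - {m}" for j
    proof -
      have "?e j (lmon m (w m)) = 0" using j ev_simps(2)[OF c(1)] by simp
      then show ?thesis using kl[of j] j by simp
    qed
    ultimately show ?thesis by blast
  qed
  obtain k1 l1 where 1: "k1 * ?e (- 1) (v 0) + l1 * ?e (- 1) (v 1) \<noteq> 0" "\<forall>j\<in>?M - {- 1}. k1 * ?e j (v 0) + l1 * ?e j (v 1) = 0"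
    using dual[of "- 1"] by blast
  obtain k2 l2 where 2: "k2 * ?e 0 (v 0) + l2 * ?e 0 (v 1) \<noteq> 0" using dual[of 0] by blast
  obtain k3 l3 where 3: "k3 * ?e 1 (v 0) + l3 * ?e 1 (v 1) \<noteq> 0" "\<forall>j\<in>?M - {1}. k3 * ?e j (v 0) + l3 * ?e j (v 1) = 0"
    using dual[of 1] by blast
  show False
  proof (rule minors_contradiction[OF 1(1) _ 2 3(1)])
    show "k1 * ?e 0 (v 0) + l1 * ?e 0 (v 1) = 0" by (rule bspec[OF 1(2)]) simp
    show "k3 * ?e (- 1) (v 0) + l3 * ?e (- 1) (v 1) = 0" by (rule bspec[OF 3(2)]) simp
    show "k3 * ?e 0 (v 0) + l3 * ?e 0 (v 1) = 0" by (rule bspec[OF 3(2)]) simp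
  qed
qed

end

theorem theorem20:
  fixes C :: "'k::field calg" and \<tau> :: "'k \<Rightarrow> 'k"
    and D :: "'k set \<Rightarrow> rat" and h :: 'k and c :: "'k set"
    and S :: "(int \<Rightarrow> 'k) gmalg" and \<sigma> :: "(int \<Rightarrow> 'k) \<Rightarrow> int \<Rightarrow> 'k" and \<pi> :: "'k \<Rightarrow> int \<Rightarrow> 'k"
    and J :: "(int \<Rightarrow> 'k) set" and F :: "(int \<Rightarrow> 'k) set gmalg"
    and \<sigma>F :: "(int \<Rightarrow> 'k) set \<Rightarrow> (int \<Rightarrow> 'k) set"
  assumes curve: "smooth_real_affine_curve C \<tau>"
    and dpd: "real_dpd_pair C \<tau> D h"
    and regular: "regular_dpd_pair C \<tau> D h"
    and surface: "S = dpd_surface C \<tau> D h" "\<sigma> = dpd_conj \<tau> h" "\<pi> = dpd_quotient C"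
    and smooth: "smooth_affine_variety S 2"
    and effective: "effective_action S"
    and real_point: "c \<in> closed_points C" "spec_map C \<tau> c = c"
    and fibre: "J = fibre_ideal S \<pi> c" "F = gm_quot S J" "\<sigma>F = quot_conj S J \<sigma>"
  shows
    "(torsor_case C D h c \<or> multiple_case C D h c \<or> crossing_case C D h c) \<and>
     \<not> (torsor_case C D h c \<and> multiple_case C D h c) \<and>
     \<not> (torsor_case C D h c \<and> crossing_case C D h c) \<and>
     \<not> (multiple_case C D h c \<and> crossing_case C D h c)
   \<and>
     (torsor_case C D h c \<longrightarrow>
        (\<exists>U. real_affine_nbhd C \<tau> c U \<and>
             S1_torsor (open_sub C U) \<tau> (over_open C S U) \<sigma> \<pi>) \<and>
        S1_torsor point cnj F \<sigma>F (cst F) \<and>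
        ((\<exists>y\<in>fibre_points C S \<pi> c. spec_map S \<sigma> y = y) \<longrightarrow>
           trivial_S1_torsor point cnj F \<sigma>F (cst F) \<and>
           (\<exists>\<phi>. S1_iso F \<sigma>F circle circle_conj \<phi>)) \<and>
        (\<not> (\<exists>y\<in>fibre_points C S \<pi> c. spec_map S \<sigma> y = y) \<longrightarrow>
           \<not> trivial_S1_torsor point cnj F \<sigma>F (cst F) \<and>
           (\<exists>\<phi>. S1_iso F \<sigma>F circle circle_hat_conj \<phi>)))
   \<and>
     (multiple_case C D h c \<longrightarrow>
        multiple_divisor S J 2 \<and>
        exceptional_S1_orbit S \<sigma> (fibre_points C S \<pi> c) \<and>
        (\<exists>\<phi>. S1_iso (gm_quot S (radical_ideal S J)) (quot_conj S (radical_ideal S J) \<sigma>)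
               circle_mu2 circle_conj \<phi>))
   \<and>
     (crossing_case C D h c \<longrightarrow>
        radical_ideal S J = J \<and>
        (\<exists>Op Om p. principal_orbit S Op \<and> principal_orbit S Om \<and> Op \<noteq> Om \<and>
           spec_map S \<sigma> ` Op = Om \<and> spec_map S \<sigma> ` Om = Op \<and>
           fibre_points C S \<pi> c = zclosure S Op \<union> zclosure S Om \<and>
           is_affine_line S (zclosure S Op) \<and> is_affine_line S (zclosure S Om) \<and>
           zclosure S Op \<inter> zclosure S Om = {p} \<and>
           transversal_at S (\<Inter>(zclosure S Op)) (\<Inter>(zclosure S Om)) p \<and>
           p \<in> closed_points S \<and> orbit_of S p = {p} \<and> spec_map S \<sigma> p = p))
   \<and>
     (multiple_case C D h c \<or> crossing_case C D h c \<longrightarrow>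
        (\<exists>U0. real_affine_nbhd C \<tau> c U0 \<and> nondegenerate_over C \<tau> D h (U0 - {c})) \<and>
        (\<forall>U. real_affine_nbhd C \<tau> c U \<and> nondegenerate_over C \<tau> D h (U - {c}) \<longrightarrow>
           S1_torsor (open_sub C (U - {c})) \<tau> (over_open C S (U - {c})) \<sigma> \<pi>) \<and>
        (\<forall>U. real_affine_nbhd C \<tau> c U \<longrightarrow>
           \<not> trivial_S1_torsor (open_sub C (U - {c})) \<tau> (over_open C S (U - {c})) \<sigma> \<pi>))"
proof -
  interpret X: dpdc C \<tau> D h c by unfold_locales (use curve dpd real_point in auto)
  have e: "S = X.SA" "\<sigma> = X.rs.cj" "\<pi> = lmon 0" using surface X.surface X.quotient by simp_all
  have e4: "J = X.J" unfolding fibre(1) e X.J_def ..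
  note eqs = fibre(2,3)[unfolded e e4]
  have le: "D c + D c \<le> of_int X.n" using X.Dle[OF real_point(1)] real_point(2) by simp
  have tri: "torsor_case C D h c \<or> multiple_case C D h c \<or> crossing_case C D h c"
  proof (cases "D c + D c = of_int X.n")
    case True
    then show ?thesis unfolding torsor_case_def multiple_case_def by (metis Ints_of_int mult_2)
  next
    case False
    \<comment> \<open>At a real point both numbers of the regular pair are built from
      \<open>D c\<close> itself, up to sign and the integer order of \<open>h\<close>.\<close>
    then have "D c \<in> \<int>" using regular real_point le regular_pair_integer[of "D c" _ X.n]
      by (force simp: regular_dpd_pair_def)
    then obtain d where d: "D c = of_int d" by (rule Ints_cases)
    have "of_int (2 * d) < (of_int X.n :: rat)" using le False d by simp
    then have "2 * d < X.n" by (simp only: of_int_less_iff)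
    moreover have "cotangent_dim X.SA y 2" if "maximalideal y X.SA" for y
      using smooth that unfolding e smooth_affine_variety_def by (simp add: closed_points_def)
    ultimately have "X.n = 2 * d + 1" by (rule X.smooth_crossing[OF d])
    then show ?thesis using d by (simp add: crossing_case_def)
  qed
  have excl: "\<not> (torsor_case C D h c \<and> multiple_case C D h c)" "\<not> (torsor_case C D h c \<and> crossing_case C D h c)"
    "\<not> (multiple_case C D h c \<and> crossing_case C D h c)"
    by (auto simp: torsor_case_def multiple_case_def crossing_case_def)
  obtain U0 where U0: "real_affine_nbhd C \<tau> c U0" "nondegenerate_over C \<tau> D h (U0 - {c})" "U0 \<subseteq> closed_points C"
    "\<And>y. y \<in> U0 \<Longrightarrow> spec_map C \<tau> y \<in> U0" using X.good_nbhd[OF real_point] by blast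
  have odd: "odd X.n" if "multiple_case C D h c \<or> crossing_case C D h c"
    using that
  proof
    assume m: "multiple_case C D h c"
    show ?thesis
    proof
      \<comment> \<open>An even order would make \<open>D c\<close> an integer.\<close>
      assume "even X.n"
      then obtain k where "X.n = 2 * k" by (elim evenE)
      then have "D c = of_int k" using m by (simp add: multiple_case_def)
      then show False using m by (simp add: multiple_case_def)
    qed
  next
    assume "crossing_case C D h c"
    then obtain d where "D c = of_int d" "of_int X.n = (2 * of_int d + 1 :: rat)"
      by (auto simp: crossing_case_def elim: Ints_cases)
    then have "of_int X.n = (of_int (2 * d + 1) :: rat)" by simp
    then have "X.n = 2 * d + 1" by (simp only: of_int_eq_iff)
    then show ?thesis by simp
  qed
  have a: "(\<exists>U. real_affine_nbhd C \<tau> c U \<and> S1_torsor (open_sub C U) \<tau> (over_open C S U) \<sigma> \<pi>) \<and>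
        S1_torsor point cnj F \<sigma>F (cst F) \<and>
        ((\<exists>y\<in>fibre_points C S \<pi> c. spec_map S \<sigma> y = y) \<longrightarrow>
           trivial_S1_torsor point cnj F \<sigma>F (cst F) \<and>
           (\<exists>\<phi>. S1_iso F \<sigma>F circle circle_conj \<phi>)) \<and>
        (\<not> (\<exists>y\<in>fibre_points C S \<pi> c. spec_map S \<sigma> y = y) \<longrightarrow>
           \<not> trivial_S1_torsor point cnj F \<sigma>F (cst F) \<and>
           (\<exists>\<phi>. S1_iso F \<sigma>F circle circle_hat_conj \<phi>))"
    if t: "torsor_case C D h c"
  proof -
    obtain d where d: "D c = of_int d" "of_int X.n = (2 * of_int d :: rat)" using t by (auto simp: torsor_case_def elim: Ints_cases)
    then have "of_int X.n = (of_int (2 * d) :: rat)" by simp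
    then have nd: "X.n = 2 * d" by (simp only: of_int_eq_iff)
    \<comment> \<open>In this case the condition holds at \<open>c\<close> too, so the point need
      not be removed.\<close>
    have "nondegenerate_over C \<tau> D h U0"
      using U0(2) d real_point(2) unfolding nondegenerate_over_def by (metis Diff_iff Ints_of_int mult_2 singletonD)
    then have tor: "S1_torsor (open_sub C U0) \<tau> (over_open C S U0) \<sigma> \<pi>"
      unfolding e using X.torsor[OF U0(3,4) real_point(1)] by blast
    obtain l \<Phi> where l: "l = 1 \<or> l = - 1" and \<Phi>': "S1_iso (gm_quot X.SA X.J) (quot_conj X.SA X.J X.rs.cj) WW (dpd_conj cnj l) \<Phi>"
      "domain (gm_quot X.SA X.J)" "\<And>z. cst (gm_quot X.SA X.J) z \<in> carrier (gm_quot X.SA X.J)"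
      "\<And>Y m. Y \<in> carrier (gm_quot X.SA X.J) \<Longrightarrow> wt (gm_quot X.SA X.J) Y m \<in> carrier (gm_quot X.SA X.J)"
      "\<And>Y. Y \<in> carrier (gm_quot X.SA X.J) \<Longrightarrow> quot_conj X.SA X.J X.rs.cj Y \<in> carrier (gm_quot X.SA X.J)"
      and rp': "(\<exists>y\<in>fibre_points C X.SA (lmon 0) c. spec_map X.SA X.rs.cj y = y) \<longleftrightarrow> l = 1"
      by (rule X.torsor_fibre[OF d(1) nd]) (rule that)
    note \<Phi> = \<Phi>'[folded eqs(1,2)] and rp = rp'[folded e]
    have "cring F" using \<Phi>(2) by (simp add: domain_def)
    note nt = nontrivial_S1_torsor_point[OF _ this \<Phi>(3-5)]
    show ?thesis
    proof (intro conjI impI exI)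
      show "S1_torsor point cnj F \<sigma>F (cst F)" by (rule S1_torsor_point[OF \<Phi>(1) l \<Phi>(2-5)])
      { assume "\<exists>y\<in>fibre_points C S \<pi> c. spec_map S \<sigma> y = y"
        then have i: "S1_iso F \<sigma>F WW (dpd_conj cnj 1) \<Phi>" using \<Phi>(1) rp by simp
        then show "trivial_S1_torsor point cnj F \<sigma>F (cst F)" by (rule trivial_S1_torsor_point)
        show "S1_iso F \<sigma>F circle circle_conj \<Phi>" using i by (simp only: circle_GA circle_conj_eq) }
      { assume "\<not> (\<exists>y\<in>fibre_points C S \<pi> c. spec_map S \<sigma> y = y)"
        then have i: "S1_iso F \<sigma>F WW (dpd_conj cnj (- 1)) \<Phi>" using \<Phi>(1) rp l by auto
        then show "\<not> trivial_S1_torsor point cnj F \<sigma>F (cst F)" by (rule nt)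
        show "S1_iso F \<sigma>F circle circle_hat_conj \<Phi>" using i by (simp only: circle_GA circle_conj_eq) }
    qed (rule U0(1) tor)+
  qed
  have b: "multiple_divisor S J 2 \<and> exceptional_S1_orbit S \<sigma> (fibre_points C S \<pi> c) \<and>
        (\<exists>\<phi>. S1_iso (gm_quot S (radical_ideal S J)) (quot_conj S (radical_ideal S J) \<sigma>) circle_mu2 circle_conj \<phi>)"
    if m: "multiple_case C D h c"
  proof -
    have "of_int X.n = 2 * D c" using m by (simp add: multiple_case_def)
    from X.multiple_fibre[OF this odd] m show ?thesis unfolding e e4 by blast
  qed
  have c: "radical_ideal S J = J \<and>
        (\<exists>Op Om p. principal_orbit S Op \<and> principal_orbit S Om \<and> Op \<noteq> Om \<and>
           spec_map S \<sigma> ` Op = Om \<and> spec_map S \<sigma> ` Om = Op \<and>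
           fibre_points C S \<pi> c = zclosure S Op \<union> zclosure S Om \<and>
           is_affine_line S (zclosure S Op) \<and> is_affine_line S (zclosure S Om) \<and>
           zclosure S Op \<inter> zclosure S Om = {p} \<and>
           transversal_at S (\<Inter>(zclosure S Op)) (\<Inter>(zclosure S Om)) p \<and>
           p \<in> closed_points S \<and> orbit_of S p = {p} \<and> spec_map S \<sigma> p = p)"
    if m: "crossing_case C D h c"
  proof -
    obtain d where d: "D c = of_int d" "of_int X.n = (2 * of_int d + 1 :: rat)"
      using m by (auto simp: crossing_case_def elim: Ints_cases)
    then have "of_int X.n = (of_int (2 * d + 1) :: rat)" by simp
    then have "X.n = 2 * d + 1" by (simp only: of_int_eq_iff)
    note cr = X.crossing_fibre[OF d(1) this]
    show ?thesis unfolding e e4 by (rule conjI[OF cr])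
  qed
  have f: "(\<exists>U0. real_affine_nbhd C \<tau> c U0 \<and> nondegenerate_over C \<tau> D h (U0 - {c})) \<and>
        (\<forall>U. real_affine_nbhd C \<tau> c U \<and> nondegenerate_over C \<tau> D h (U - {c}) \<longrightarrow>
           S1_torsor (open_sub C (U - {c})) \<tau> (over_open C S (U - {c})) \<sigma> \<pi>) \<and>
        (\<forall>U. real_affine_nbhd C \<tau> c U \<longrightarrow>
           \<not> trivial_S1_torsor (open_sub C (U - {c})) \<tau> (over_open C S (U - {c})) \<sigma> \<pi>)"
    if m: "multiple_case C D h c \<or> crossing_case C D h c"
  proof (intro conjI allI impI)
    show "\<exists>U0. real_affine_nbhd C \<tau> c U0 \<and> nondegenerate_over C \<tau> D h (U0 - {c})" using U0(1,2) by blast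
    have UV: "U - {c} \<subseteq> closed_points C" "y \<in> U - {c} \<Longrightarrow> spec_map C \<tau> y \<in> U - {c}"
      if U: "real_affine_nbhd C \<tau> c U" for U y
    proof -
      show "U - {c} \<subseteq> closed_points C" using X.nbhd_D(1)[OF U] by blast
      assume y: "y \<in> U - {c}"
      then have "y \<in> closed_points C" using X.nbhd_D(1)[OF U] by blast
      \<comment> \<open>The real structure is an involution on points and fixes
        \<open>c\<close>.\<close>
      then have "spec_map C \<tau> y \<noteq> c" using X.tx(2)[of y] real_point(2) y by auto
      then show "spec_map C \<tau> y \<in> U - {c}" using X.nbhd_D(2)[OF U] y by blast
    qed
    fix U
    { assume "real_affine_nbhd C \<tau> c U \<and> nondegenerate_over C \<tau> D h (U - {c})"
      then show "S1_torsor (open_sub C (U - {c})) \<tau> (over_open C S (U - {c})) \<sigma> \<pi>"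
        unfolding e using X.torsor[OF UV real_point(1)] by blast }
    assume U: "real_affine_nbhd C \<tau> c U"
    show "\<not> trivial_S1_torsor (open_sub C (U - {c})) \<tau> (over_open C S (U - {c})) \<sigma> \<pi>"
      unfolding e using X.trivial_even[OF UV[OF U] _ real_point] odd[OF m] by blast
  qed
  show ?thesis
    by (rule conjI[OF tri conjI[OF excl(1) conjI[OF excl(2) conjI[OF excl(3)
      conjI[OF impI[OF a] conjI[OF impI[OF b] conjI[OF impI[OF c] impI[OF f]]]]]]]])
qed

end
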